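(* Let $c>0$ and let $\epsilon:[1,\infty)\to\mathbb{R}$ be a function satisfying $|\epsilon(t)|\le\frac{c}{\log t}$ for $t>1$. Then $$\liminf_{t\to\infty}\left|\zeta(\tfrac12+\epsilon(t)+it)\right|=0\qquad\text{and}\qquad\limsup_{t\to\infty}\left|\zeta(\tfrac12+\epsilon(t)+it)\right|=\infty.$$
   Context: $\zeta$ is the Riemann zeta-function. *)

theory Defs
  imports "HOL-Complex_Analysis.Complex_Analysis"
begin

text \<open>
  The Riemann zeta function: the unique analytic continuation to the punctured plane of the
  Dirichlet series, which converges for \<^term>\<open>Re s > 1\<close>. The clause \<^term>\<open>f 1 = 0\<close> only fixes
  the junk value at the pole, as the description would not be unique without it.
\<close>

definition zeta :: "complex \<Rightarrow> complex" where
  "zeta = (THE f. f holomorphic_on (- {1}) \<and>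
                  (\<forall>s. Re s > 1 \<longrightarrow> (\<lambda>n. 1 / of_nat (Suc n) powr s) sums f s) \<and>
                  f 1 = 0)"

end

theory Submission
  imports Defs "HOL-Computational_Algebra.Squarefree" "HOL-Real_Asymp.Real_Asymp"
begin

text \<open>
  The proof produces, at heights T = exp L with L arbitrarily large, ordinates t for which zeta is
  very small, respectively very large, simultaneously at all points of real part within w / L
  of 1/2. Since the given deviation is bounded by c / ln t, the curve passes through such points.

  Fix a finite set PP of primes and split zeta into the Euler product over PP and the sieved
  function in whose Dirichlet series only the integers coprime to PP occur. The logarithm of the
  Euler product is, up to a bounded error, the trigonometric sum V over the primes of PP, so that its
  size can be prescribed by prescribing the signs of the cosines. The resonator is a product over PP
  the square of whose modulus, used as a weight on the interval from T to 2 T, favours one sign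
  (lemma \<open>resonator_bias\<close>). By unique factorization its frequencies do not interfere with those of the sieved
  function: weighted mean values of the latter are the unweighted ones times the mass of the weight
  (lemma \<open>twisted_mean_value\<close>). So the mean squares of the sieved function stay bounded by a power of L,
  and there is a point t0 at which V is a fixed proportion of its maximum, with the required sign, while
  all the local mean squares are at most a power of L (lemma \<open>exists_biased_point\<close>).

  To obtain such mean squares also slightly to the left of the critical line, the sieved function is
  compared with two sums of length sqrt T, related by the functional equation. The remainder is
  estimated at distance eta on both sides, where the Dirichlet series is accurate, and interpolated by
  Cauchy's formula (lemmas \<open>tail_mean_square\<close>, \<open>defect_lines\<close>, \<open>near_bound\<close>). As a result the sieved
  function is at most a power of L on the whole window around t0 and to the right of it
  (lemma \<open>wide_bound\<close>).

  For the lower limit this suffices: the Euler product is the exponential of minus a large multiple of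
  ln L, and the sieved function is at most a power of L. For the upper limit a lower bound for the
  sieved function is needed, across the whole window at once because the deviation is arbitrary. If it were tiny
  somewhere on each horizontal segment of the window for t between t0 and t0 + len, then
  interpolation at these points by Blaschke products and the upper bound would force it to be small at
  2 + i t0, where it is at least 1/6 (lemma \<open>small_on_segments_imp_small\<close>). Along a suitable sequence of
  dyadic blocks of primes (lemma \<open>many_primes_in_dyadic_block\<close>) the gain from the Euler product dominates.

  The analytic continuation, the functional equation, the approximation by partial sums and the
  mean value theorem for Dirichlet polynomials are developed from Euler-Maclaurin summation.
\<close>

section \<open>Euler-Maclaurin continuation of the zeta function\<close>

text \<open>
  The error of the trapezoidal rule for n to the power -s on the interval from n to n + 1, times s - 1; the factor clears the denominator of the antiderivative, so the term is entire in s.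
\<close>
definition em_term :: "nat \<Rightarrow> complex \<Rightarrow> complex" where
  "em_term n s = (s - 1) / 2 * (of_nat n powr (-s) + of_nat (Suc n) powr (-s))
     + (of_nat (Suc n) powr (1 - s) - of_nat n powr (1 - s))"

lemma norm_real_powr: "x > 0 \<Longrightarrow> norm (complex_of_real x powr s) = x powr Re s"
  by (simp add: norm_powr_real_powr powr_def)

lemma norm_nat_powr: "n > 0 \<Longrightarrow> norm (of_nat n powr s :: complex) = real n powr Re s"
  using norm_real_powr[of "real n" s] by simp

text \<open>
  The error of the rule on the interval from n to n + z vanishes to second order at z = 0, and its second derivative is of size n to the power -Re s - 2. The gain of two powers of n is what continues the series to Re s > -1.
\<close>
lemma norm_em_term_le:
  assumes n: "n > 0" and s: "Re s \<ge> -2"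
  shows "norm (em_term n s) \<le> norm (s - 1) * norm s * norm (s + 1) * real n powr (- Re s - 2)"
proof -
  define S where "S = closed_segment (0::complex) 1"
  define B where "B = norm (s - 1) * norm s * norm (s + 1) * real n powr (- Re s - 2)"
  define \<psi> where "\<psi> = (\<lambda>z::complex. (s - 1) / 2 * z * (of_nat n powr (-s) + (of_nat n + z) powr (-s))
     + ((of_nat n + z) powr (1 - s) - of_nat n powr (1 - s)))"
  define \<psi>1 where "\<psi>1 = (\<lambda>z::complex. (s - 1) / 2 * (of_nat n powr (-s) - (of_nat n + z) powr (-s)
     - s * z * (of_nat n + z) powr (-s - 1)))"
  define \<psi>2 where "\<psi>2 = (\<lambda>z::complex. (s - 1) / 2 * s * (s + 1) * z * (of_nat n + z) powr (-s - 2))"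
  have S: "\<exists>x. z = of_real x \<and> 0 \<le> x \<and> x \<le> 1" if "z \<in> S" for z
  proof -
    from that obtain u where "0 \<le> u" "u \<le> 1" "z = (1 - u) *\<^sub>R 0 + u *\<^sub>R 1"
      unfolding S_def closed_segment_def by blast
    then show ?thesis by (intro exI[of _ u]) (simp add: scaleR_conv_of_real)
  qed
  have nz: "of_nat n + z \<notin> \<real>\<^sub>\<le>\<^sub>0" "of_nat n + z \<noteq> 0" if "z \<in> S" for z
  proof -
    from S[OF that] obtain x where x: "z = of_real x" "0 \<le> x" by blast
    then have "Re (of_nat n + z) > 0" using n by simp
    then show "of_nat n + z \<notin> \<real>\<^sub>\<le>\<^sub>0"
      by (auto simp: complex_nonpos_Reals_iff)
    then show "of_nat n + z \<noteq> 0" by auto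
  qed
  have d1: "(\<psi> has_field_derivative \<psi>1 z) (at z within S)" if "z \<in> S" for z
    unfolding \<psi>_def \<psi>1_def using nz[OF that]
    by (auto intro!: derivative_eq_intros simp: field_simps)
  have d2: "(\<psi>1 has_field_derivative \<psi>2 z) (at z within S)" if "z \<in> S" for z
  proof -
    define w where "w = of_nat n + z"
    have "(\<psi>1 has_field_derivative (s - 1) / 2 * (0 - (-s) * w powr (-s - 1)
        - (s * w powr (-s - 1) + s * z * ((-s - 1) * w powr (-s - 1 - 1))))) (at z within S)"
      unfolding \<psi>1_def w_def using nz[OF that] by (auto intro!: derivative_eq_intros)
    moreover have "-s - 1 - 1 = -s - 2" by simp
    moreover have "a * (0 - (-s) * W - (s * W + s * z * ((-s - 1) * V))) = a * s * (s + 1) * z * V" for a W V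
      by algebra
    ultimately show ?thesis unfolding \<psi>2_def w_def[symmetric] by (simp only: times_divide_eq_left)
  qed
  have b2: "norm (\<psi>2 z) \<le> B" if "z \<in> S" for z
  proof -
    from S[OF that] obtain x where x: "z = of_real x" "0 \<le> x" "x \<le> 1" by blast
    have "norm ((of_nat n + z) powr (-s-2)) = (real n + x) powr (- Re s - 2)"
      using norm_real_powr[of "real n + x" "-s-2"] x n by simp
    also have "\<dots> \<le> real n powr (- Re s - 2)"
      using n s x by (intro powr_mono2') auto
    finally have *: "norm ((of_nat n + z) powr (-s-2)) \<le> real n powr (- Re s - 2)" .
    have "norm (\<psi>2 z) = norm (s - 1) * norm s * norm (s + 1) * (x / 2 * norm ((of_nat n + z) powr (-s-2)))"
      unfolding \<psi>2_def norm_mult norm_divide using x by simp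
    also have "\<dots> \<le> norm (s - 1) * norm s * norm (s + 1) * (1 * real n powr (- Re s - 2))"
      using * x by (intro mult_left_mono mult_mono) auto
    finally show ?thesis by (simp add: B_def)
  qed
  have cS: "convex S" by (simp add: S_def)
  have 0: "0 \<in> S" and 1: "1 \<in> S" by (auto simp: S_def)
  have b1: "norm (\<psi>1 z) \<le> B" if "z \<in> S" for z
  proof -
    have "norm (\<psi>1 z - \<psi>1 0) \<le> B * norm (z - 0)"
      by (rule field_differentiable_bound[OF cS d2 b2]) (use that 0 in auto)
    moreover have "\<psi>1 0 = 0" by (simp add: \<psi>1_def)
    moreover have "norm z \<le> 1" using S[OF that] by auto
    moreover have "B \<ge> 0" by (simp add: B_def)
    ultimately show ?thesis by (smt (verit) diff_zero mult_left_le)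
  qed
  have "norm (\<psi> 1 - \<psi> 0) \<le> B * norm (1 - 0 :: complex)"
    by (rule field_differentiable_bound[OF cS d1 b1]) (use 0 1 in auto)
  moreover have "\<psi> 0 = 0" by (simp add: \<psi>_def)
  moreover have "\<psi> 1 = em_term n s" by (simp add: \<psi>_def em_term_def add.commute)
  ultimately show ?thesis by (simp add: B_def)
qed

lemma em_term_holomorphic [holomorphic_intros]: "n > 0 \<Longrightarrow> em_term n holomorphic_on A"
  unfolding em_term_def by (auto intro!: holomorphic_intros)

text \<open>
  This is (s - 1) zeta(s), which is regular at 1; the identification with the zeta function follows below.
\<close>
definition zpre :: "complex \<Rightarrow> complex" where
  "zpre s = 1 + (s - 1) / 2 + (\<Sum>n. em_term (Suc n) s)"

lemma summable_em_term:
  assumes "Re s > -1"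
  shows "summable (\<lambda>n. em_term (Suc n) s)"
proof (rule summable_comparison_test')
  show "summable (\<lambda>n. norm (s - 1) * norm s * norm (s + 1) * real (Suc n) powr (- Re s - 2))"
    using assms by (intro summable_mult) (subst summable_Suc_iff, simp add: summable_real_powr_iff)
  show "norm (em_term (Suc n) s) \<le> norm (s - 1) * norm s * norm (s + 1) * real (Suc n) powr (- Re s - 2)" 
    if "n \<ge> 0" for n using norm_em_term_le[of "Suc n" s] assms by simp
qed

lemma zpre_holomorphic: "zpre holomorphic_on {s. Re s > -1}"
proof -
  let ?S = "{s::complex. Re s > -1}"
  have op: "open ?S" by (simp add: open_halfspace_Re_gt)
  have "(\<lambda>s. \<Sum>n. em_term (Suc n) s) holomorphic_on ?S"
  proof (rule holomorphic_uniform_sequence[OF op, where f = "\<lambda>N s. \<Sum>n<N. em_term (Suc n) s"])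
    show "(\<lambda>s. \<Sum>n<N. em_term (Suc n) s) holomorphic_on ?S" for N
      by (intro holomorphic_intros) auto
    fix z :: complex assume z: "z \<in> ?S"
    define d where "d = (Re z + 1) / 2"
    have d: "d > 0" using z by (simp add: d_def)
    have re: "Re s \<ge> -1 + d" if "s \<in> cball z d" for s
      using that abs_Re_le_cmod[of "z - s"] by (auto simp: dist_norm d_def abs_if split: if_splits)
    define C where "C = (norm z + d + 1) * (norm z + d + 1) * (norm z + d + 1)"
    have "uniform_limit (cball z d) (\<lambda>N s. \<Sum>n<N. em_term (Suc n) s) (\<lambda>s. \<Sum>n. em_term (Suc n) s) sequentially"
    proof (rule Weierstrass_m_test)
      show "summable (\<lambda>n. C * real (Suc n) powr (- 1 - d))"
        using d by (intro summable_mult) (subst summable_Suc_iff, simp add: summable_real_powr_iff)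
      fix n s assume s: "s \<in> cball z d"
      have ns: "norm s \<le> norm z + d"
        using s norm_triangle_ineq2[of s z] by (auto simp: dist_norm norm_minus_commute)
      have "norm (em_term (Suc n) s) \<le> norm (s - 1) * norm s * norm (s + 1) * real (Suc n) powr (- Re s - 2)"
        using norm_em_term_le[of "Suc n" s] re[OF s] d by simp
      also have "\<dots> \<le> C * real (Suc n) powr (- 1 - d)"
        unfolding C_def
      proof (intro mult_mono powr_mono)
        show "norm (s - 1) \<le> norm z + d + 1" using norm_triangle_ineq4[of s 1] ns by simp
        show "norm (s + 1) \<le> norm z + d + 1" using norm_triangle_ineq[of s 1] ns by simp
      qed (use re[OF s] d ns in auto)
      finally show "norm (em_term (Suc n) s) \<le> C * real (Suc n) powr (- 1 - d)" .
    qed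
    moreover have "cball z d \<subseteq> ?S" using re d by force
    ultimately show "\<exists>d>0. cball z d \<subseteq> ?S \<and> uniform_limit (cball z d)
        (\<lambda>N s. \<Sum>n<N. em_term (Suc n) s) (\<lambda>s. \<Sum>n. em_term (Suc n) s) sequentially"
      using d by blast
  qed
  then show ?thesis unfolding zpre_def by (intro holomorphic_intros) auto
qed

lemma sum_em_term:
  "(\<Sum>n<N. em_term (Suc n) s) = (s - 1) * ((\<Sum>n<N. of_nat (Suc n) powr (-s)) + (of_nat (Suc N) powr (-s) - 1) / 2)
     + of_nat (Suc N) powr (1 - s) - 1"
proof (induction N)
  case (Suc N)
  show ?case unfolding sum.lessThan_Suc Suc.IH unfolding em_term_def
    by (simp add: field_simps del: of_nat_Suc)
qed simp

text \<open>
  Euler-Maclaurin with the sum stopped at N: the tail of the trapezoidal errors is dominated by the telescoping bound of their sizes.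
\<close>
lemma zpre_approx:
  assumes s: "Re s > 0" and N: "N \<ge> 1"
  shows "norm (zpre s - ((s - 1) * (\<Sum>n=1..N. of_nat n powr (-s)) + of_nat N powr (1 - s)))
     \<le> norm (s - 1) * (real N powr (- Re s) / 2 + 2 * norm s * norm (s + 1) * real N powr (- Re s - 1))"
proof -
  obtain M where M: "N = Suc M" using N by (cases N) auto
  have sm: "summable (\<lambda>n. em_term (Suc n) s)" by (rule summable_em_term) (use s in auto)
  have "(\<Sum>n. em_term (Suc n) s) = (\<Sum>n. em_term (Suc (n + M)) s) + (\<Sum>n<M. em_term (Suc n) s)"
    using suminf_split_initial_segment[OF sm, of M] by simp
  also have "(\<Sum>n<M. em_term (Suc n) s) = (s - 1) * ((\<Sum>n=1..N. of_nat n powr (-s)) - (of_nat N powr (-s) + 1) / 2)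
     + of_nat N powr (1 - s) - 1"
  proof -
    have "(\<Sum>n=1..N. of_nat n powr (-s)) = (\<Sum>n<M. of_nat (Suc n) powr (-s)) + of_nat N powr (-s)"
      unfolding M by (simp add: sum.atLeast1_atMost_eq)
    then show ?thesis unfolding sum_em_term M by (simp add: field_simps)
  qed
  finally have eq: "zpre s - ((s - 1) * (\<Sum>n=1..N. of_nat n powr (-s)) + of_nat N powr (1 - s)) =
      (\<Sum>n. em_term (Suc (n + M)) s) - (s - 1) * (of_nat N powr (-s) / 2)"
    unfolding zpre_def by (simp only:) (simp add: algebra_simps add_divide_distrib diff_divide_distrib)
  define C where "C = norm (s - 1) * norm s * norm (s + 1) * real N powr (- Re s)"
  have bd: "norm (em_term (Suc (n + M)) s) \<le> C * (1 / (real (n + N))\<^sup>2)" for n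
  proof -
    have "norm (em_term (Suc (n + M)) s) \<le> norm (s - 1) * norm s * norm (s + 1) * real (n + N) powr (- Re s - 2)"
      using norm_em_term_le[of "Suc (n + M)" s] s M by simp
    also have "real (n + N) powr (- Re s - 2) = real (n + N) powr (- Re s) * (1 / (real (n + N))\<^sup>2)"
      using N by (simp add: powr_diff)
    also have "\<dots> \<le> real N powr (- Re s) * (1 / (real (n + N))\<^sup>2)"
      using s N by (intro mult_right_mono powr_mono2') auto
    finally show ?thesis unfolding C_def
      by (smt (verit) ab_semigroup_mult_class.mult_ac(1) mult_left_mono mult_nonneg_nonneg norm_ge_zero)
  qed
  have tel: "(\<lambda>n. 1 / real (n + N) - 1 / real (Suc n + N)) sums (1 / real (0 + N) - 0)"
    by (rule telescope_sums') (use LIMSEQ_ignore_initial_segment[OF lim_1_over_n, of N] in simp)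
  have bd2: "1 / (real (n + N))\<^sup>2 \<le> 2 * (1 / real (n + N) - 1 / real (Suc n + N))" for n
  proof -
    define x where "x = real (n + N)"
    have x: "x \<ge> 1" using N by (simp add: x_def)
    have "1 / x\<^sup>2 \<le> 2 / (x * (x + 1))"
    proof -
      have "x * (x + 1) \<le> 2 * x\<^sup>2" using x by (simp add: power2_eq_square algebra_simps)
      then show ?thesis using x by (simp add: divide_simps)
    qed
    also have "\<dots> = 2 * (1 / x - 1 / (x + 1))" using x by (simp add: divide_simps)
    finally show ?thesis by (simp add: x_def add.commute add.left_commute)
  qed
  have C0: "C \<ge> 0" by (simp add: C_def)
  have "norm (\<Sum>n. em_term (Suc (n + M)) s) \<le> (\<Sum>n. C * (2 * (1 / real (n + N) - 1 / real (Suc n + N))))"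
  proof (rule norm_suminf_le)
    show "norm (em_term (Suc (n + M)) s) \<le> C * (2 * (1 / real (n + N) - 1 / real (Suc n + N)))" for n
      using bd[of n] mult_left_mono[OF bd2[of n] C0] by linarith
    show "summable (\<lambda>n. C * (2 * (1 / real (n + N) - 1 / real (Suc n + N))))"
      by (intro summable_mult sums_summable[OF tel])
  qed
  also have "\<dots> = C * (2 * (1 / real N))"
    using sums_unique[OF sums_mult[OF sums_mult[OF tel, of 2], of C]] by simp
  also have "\<dots> = norm (s - 1) * (2 * norm s * norm (s + 1) * real N powr (- Re s - 1))"
    using N by (simp add: C_def powr_diff)
  finally have 1: "norm (\<Sum>n. em_term (Suc (n + M)) s) \<le> \<dots>" .
  have 2: "norm ((s - 1) * (of_nat N powr (-s) / 2)) = norm (s - 1) * (real N powr (- Re s) / 2)"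
    using N by (simp add: norm_mult norm_nat_powr norm_divide)
  show ?thesis unfolding eq
    using norm_triangle_ineq4[of "\<Sum>n. em_term (Suc (n + M)) s" "(s - 1) * (of_nat N powr (-s) / 2)"] 1 2
    by (simp add: algebra_simps)
qed

text \<open>
  Letting N tend to infinity in the finite Euler-Maclaurin identity, the boundary terms vanish for Re s > 1.
\<close>
lemma zpre_dirichlet:
  assumes s: "Re s > 1"
  shows "(\<lambda>n. 1 / of_nat (Suc n) powr s) sums (zpre s / (s - 1))"
proof -
  have s1: "s \<noteq> 1" using s by auto
  have 1: "(\<lambda>N. (s - 1) * ((\<Sum>n<N. of_nat (Suc n) powr (-s)) + (of_nat (Suc N) powr (-s) - 1) / 2)
     + of_nat (Suc N) powr (1 - s) - 1) \<longlonglongrightarrow> (\<Sum>n. em_term (Suc n) s)"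
    using summable_LIMSEQ[OF summable_em_term[of s]] s by (simp add: sum_em_term del: of_nat_Suc)
  have t: "(\<lambda>N. of_nat (Suc N) powr a :: complex) \<longlonglongrightarrow> 0" if "Re a < 0" for a
  proof -
    have "(\<lambda>N. real (Suc N) powr Re a) \<longlonglongrightarrow> 0"
      using that by (intro tendsto_neg_powr filterlim_compose[OF filterlim_real_sequentially filterlim_Suc]) auto
    then have "(\<lambda>N. norm (of_nat (Suc N) powr a :: complex)) \<longlonglongrightarrow> 0"
      by (subst norm_nat_powr) auto
    then show ?thesis by (rule tendsto_norm_zero_cancel)
  qed
  have "(\<lambda>N. (((s - 1) * ((\<Sum>n<N. of_nat (Suc n) powr (-s)) + (of_nat (Suc N) powr (-s) - 1) / 2)
     + of_nat (Suc N) powr (1 - s) - 1) - of_nat (Suc N) powr (1 - s) + 1) / (s - 1)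
      - (of_nat (Suc N) powr (-s) - 1) / 2) 
     \<longlonglongrightarrow> ((\<Sum>n. em_term (Suc n) s) - 0 + 1) / (s - 1) - (0 - 1) / 2"
    using s s1 by (intro tendsto_intros 1 t) auto
  also have "(\<lambda>N. (((s - 1) * ((\<Sum>n<N. of_nat (Suc n) powr (-s)) + (of_nat (Suc N) powr (-s) - 1) / 2)
     + of_nat (Suc N) powr (1 - s) - 1) - of_nat (Suc N) powr (1 - s) + 1) / (s - 1)
      - (of_nat (Suc N) powr (-s) - 1) / 2) = (\<lambda>N. \<Sum>n<N. of_nat (Suc n) powr (-s))"
  proof
    fix N
    define S p q where "S = (\<Sum>n<N. of_nat (Suc n) powr (-s))" "p = of_nat (Suc N) powr (-s)" "q = of_nat (Suc N) powr (1 - s)"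
    have "((s - 1) * (S + (p - 1) / 2) + q - 1) - q + 1 = (s - 1) * (S + (p - 1) / 2)" by simp
    then have "(((s - 1) * (S + (p - 1) / 2) + q - 1) - q + 1) / (s - 1) - (p - 1) / 2 = S" using s1 by simp
    then show "(((s - 1) * ((\<Sum>n<N. of_nat (Suc n) powr (-s)) + (of_nat (Suc N) powr (-s) - 1) / 2)
       + of_nat (Suc N) powr (1 - s) - 1) - of_nat (Suc N) powr (1 - s) + 1) / (s - 1)
        - (of_nat (Suc N) powr (-s) - 1) / 2 = (\<Sum>n<N. of_nat (Suc n) powr (-s))"
      unfolding S_p_q_def .
  qed
  also have "((\<Sum>n. em_term (Suc n) s) - 0 + 1) / (s - 1) - (0 - 1) / 2 = zpre s / (s - 1)"
    using s1 by (simp add: zpre_def divide_simps) (simp add: algebra_simps)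
  finally show ?thesis by (simp add: sums_def powr_minus inverse_eq_divide)
qed

section \<open>The functional equation at negative real points\<close>

lemma nn_integral_Gamma:
  assumes q: "q > 0" and a: "a > (0::real)"
  shows "(\<integral>\<^sup>+x. ennreal (x powr (q - 1) * exp (- a * x)) * indicator {0<..} x \<partial>lborel) = ennreal (Gamma q * a powr (-q))"
proof -
  let ?f = "\<lambda>x. ennreal (x powr (q - 1) * exp (- x)) * indicator {0<..} x"
  have "ennreal (Gamma q) = (\<integral>\<^sup>+x. ?f x \<partial>lborel)"
    unfolding Gamma_conv_nn_integral_real[OF q]
    by (intro nn_integral_cong) (auto simp: indicator_def exp_minus field_simps)
  also have "\<dots> = ennreal \<bar>a\<bar> * (\<integral>\<^sup>+x. ?f (0 + a * x) \<partial>lborel)"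
    by (rule nn_integral_real_affine) (use a in auto)
  also have "(\<lambda>x. ?f (0 + a * x)) = (\<lambda>x. ennreal (a powr (q - 1)) * (ennreal (x powr (q - 1) * exp (- a * x)) * indicator {0<..} x))"
    using a by (auto simp: fun_eq_iff indicator_def powr_mult zero_less_mult_iff ennreal_mult'[symmetric] mult_ac)
  also have "(\<integral>\<^sup>+x. ennreal (a powr (q - 1)) * (ennreal (x powr (q - 1) * exp (- a * x)) * indicator {0<..} x) \<partial>lborel)
      = ennreal (a powr (q - 1)) * (\<integral>\<^sup>+x. ennreal (x powr (q - 1) * exp (- a * x)) * indicator {0<..} x \<partial>lborel)"
    by (rule nn_integral_cmult) auto
  finally have "ennreal (a powr (-q)) * ennreal (Gamma q) =
     (ennreal (a powr (-q)) * (ennreal \<bar>a\<bar> * ennreal (a powr (q - 1)))) * (\<integral>\<^sup>+x. ennreal (x powr (q - 1) * exp (- a * x)) * indicator {0<..} x \<partial>lborel)"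
    by (simp add: mult.assoc)
  also have "(ennreal (a powr (-q)) * (ennreal \<bar>a\<bar> * ennreal (a powr (q - 1)))) = ennreal (a powr (-q) * (a * a powr (q - 1)))"
    using a by (simp add: ennreal_mult')
  also have "a powr (-q) * (a * a powr (q - 1)) = 1"
    using a by (simp add: powr_diff powr_minus field_simps)
  finally show ?thesis using q by (simp add: ennreal_mult'[symmetric] mult.commute)
qed

lemma Digamma_reflection:
  assumes "z \<notin> \<int>"
  shows "Digamma (1 - z) - Digamma z = of_real pi * cot (of_real pi * z :: complex)"
proof -
  have nz: "z \<notin> \<int>\<^sub>\<le>\<^sub>0" "1 - z \<notin> \<int>\<^sub>\<le>\<^sub>0" using assms nonpos_Ints_Int by (force, metis Ints_1 Ints_diff diff_diff_eq2 diff_add_cancel add_diff_cancel_left' nonpos_Ints_Int)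
  have sn: "sin (of_real pi * z) \<noteq> 0"
    using assms by (metis sin_eq_0 mult.commute mult_cancel_right of_real_eq_0_iff pi_neq_zero Ints_of_int of_real_of_int_eq of_real_mult)
  have d1: "((\<lambda>z. Gamma z * Gamma (1 - z)) has_field_derivative
      Gamma z * Gamma (1 - z) * (Digamma z - Digamma (1 - z))) (at z)"
    using nz by (auto intro!: derivative_eq_intros simp: algebra_simps)
  have d2: "((\<lambda>z. of_real pi / sin (of_real pi * z)) has_field_derivative
      (- of_real pi * (of_real pi * cos (of_real pi * z)) / (sin (of_real pi * z))\<^sup>2)) (at z)"
    using sn by (auto intro!: derivative_eq_intros simp: power2_eq_square)
  have "(\<lambda>z. Gamma z * Gamma (1 - z)) = (\<lambda>z. of_real pi / sin (of_real pi * z :: complex))"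
    by (simp add: Gamma_reflection_complex)
  with d1 d2 have "Gamma z * Gamma (1 - z) * (Digamma z - Digamma (1 - z)) =
      - of_real pi * (of_real pi * cos (of_real pi * z)) / (sin (of_real pi * z))\<^sup>2"
    using DERIV_unique by metis
  then have "of_real pi / sin (of_real pi * z) * (Digamma z - Digamma (1 - z)) =
      of_real pi / sin (of_real pi * z) * (- of_real pi * cot (of_real pi * z))"
    unfolding Gamma_reflection_complex by (simp add: cot_def power2_eq_square)
  moreover have "of_real pi / sin (of_real pi * z) \<noteq> 0" using sn by simp
  ultimately have "Digamma z - Digamma (1 - z) = - of_real pi * cot (of_real pi * z)"
    using mult_left_cancel by blast
  then show ?thesis by (metis minus_diff_eq minus_mult_left minus_minus)
qed

lemma cot_partial_fractions:
  assumes z: "z \<notin> \<int>"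
  shows "(\<lambda>n. 2 * z / (z\<^sup>2 - (of_nat (Suc n))\<^sup>2)) sums (of_real pi * cot (of_real pi * z) - 1 / z :: complex)"
proof -
  have z0: "z \<noteq> 0" "1 - z \<noteq> 0" using z by auto
  have "(\<lambda>m. (of_real (ln (real m)) - (\<Sum>n<m. inverse (1 - z + of_nat n))) - (of_real (ln (real m)) - (\<Sum>n<m. inverse (z + of_nat n))))
     \<longlonglongrightarrow> Digamma (1 - z) - Digamma z"
    by (intro tendsto_diff Digamma_LIMSEQ z0)
  then have 1: "(\<lambda>m. (\<Sum>n<m. inverse (z + of_nat n)) - (\<Sum>n<m. inverse (1 - z + of_nat n))) \<longlonglongrightarrow> of_real pi * cot (of_real pi * z)"
    unfolding Digamma_reflection[OF z] by simp
  have 2: "(\<lambda>m. inverse (z + of_nat m)) \<longlonglongrightarrow> 0"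
    by (intro tendsto_inverse_0 filterlim_compose[OF tendsto_inverse_0] tendsto_add_filterlim_at_infinity[OF tendsto_const] tendsto_of_nat)
  have eq: "(\<Sum>n<m. 2 * z / (z\<^sup>2 - (of_nat (Suc n))\<^sup>2)) =
      ((\<Sum>n<m. inverse (z + of_nat n)) - (\<Sum>n<m. inverse (1 - z + of_nat n))) + inverse (z + of_nat m) - 1 / z" for m
  proof (induction m)
    case 0
    then show ?case by (simp add: inverse_eq_divide)
  next
    case (Suc m)
    have a: "z + of_nat (Suc m) \<noteq> 0"
      using z by (metis Ints_minus Ints_of_nat add_eq_0_iff2)
    have b: "1 - z + of_nat m \<noteq> 0"
      using z by (metis Ints_of_nat Ints_add Ints_1 add_diff_eq add.commute eq_iff_diff_eq_0)
    have "2 * z / (z\<^sup>2 - (of_nat (Suc m))\<^sup>2) = inverse (z + of_nat (Suc m)) - inverse (1 - z + of_nat m)"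
    proof -
      have "z\<^sup>2 - (of_nat (Suc m))\<^sup>2 = - ((z + of_nat (Suc m)) * (1 - z + of_nat m))"
        by (simp add: power2_eq_square algebra_simps)
      moreover have "inverse (z + of_nat (Suc m)) - inverse (1 - z + of_nat m) =
          ((1 - z + of_nat m) - (z + of_nat (Suc m))) / ((z + of_nat (Suc m)) * (1 - z + of_nat m))"
        using a b by (simp add: divide_simps del: of_nat_Suc)
      moreover have "(1 - z + of_nat m) - (z + of_nat (Suc m)) = - (2 * z)" by simp
      ultimately show ?thesis by simp
    qed
    then show ?case unfolding sum.lessThan_Suc Suc.IH by simp
  qed
  show ?thesis unfolding sums_def eq using tendsto_diff[OF tendsto_add[OF 1 2] tendsto_const[of "1/z"]] by simp
qed

text \<open>
  The kernel 1/(exp x - 1) - 1/x + 1/2 is the sum of the trapezoidal errors of the exponential. Its expansion in simple rational functions of x is the cotangent expansion on the imaginary axis, and it turns a Mellin transform over the kernel into a Dirichlet series again.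
\<close>
lemma bose_partial_fractions:
  assumes x: "x > (0::real)"
  shows "(\<lambda>k. 2 * x / (x\<^sup>2 + (2 * pi * real (Suc k))\<^sup>2)) sums (1 / (exp x - 1) - 1 / x + 1 / 2)"
proof -
  define y where "y = x / (2 * pi)"
  have y: "y > 0" using x by (simp add: y_def)
  define z where "z = \<i> * of_real y"
  have z: "z \<notin> \<int>" using y by (auto simp: z_def complex_is_Int_iff)
  have e: "exp x \<noteq> 1" using x by simp
  have "cot (of_real pi * z) = - \<i> * of_real (1 + 2 / (exp x - 1))"
  proof -
    have pz: "of_real pi * z = \<i> * of_real (x / 2)" by (simp add: z_def y_def)
    define E where "E = complex_of_real (exp (x/2))"
    have E: "E \<noteq> 0" "E * E = of_real (exp x)" "E * E \<noteq> 1"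
      using e by (auto simp: E_def of_real_mult[symmetric] mult_exp_exp simp del: of_real_mult) 
    have "exp (\<i> * (of_real pi * z)) = 1 / E" "exp (- (\<i> * (of_real pi * z))) = E"
      unfolding pz E_def exp_of_real[symmetric] by (auto simp: exp_minus inverse_eq_divide simp flip: mult.assoc of_real_divide)
    then have sc: "sin (of_real pi * z) = \<i> * (E - 1 / E) / 2" "cos (of_real pi * z) = (1 / E + E) / 2"
      unfolding sin_exp_eq' cos_exp_eq by (simp_all only: mult_minus_left)
    have half: "(a / 2) / (b / 2) = a / b" for a b :: complex by simp
    have "cot (of_real pi * z) = (1 / E + E) / (\<i> * (E - 1 / E))"
      unfolding cot_def sc by (rule half)
    also have "\<i> * (E - 1 / E) = - (\<i> * (1 / E - E))" by (simp add: algebra_simps)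
    also have "a / - (\<i> * d) = \<i> * (a / d)" for a d :: complex
      by (cases "d = 0") (simp_all add: divide_simps)
    then have "(1 / E + E) / - (\<i> * (1 / E - E)) = \<i> * ((1 / E + E) / (1 / E - E))" .
    finally have "cot (of_real pi * z) = \<i> * ((1 / E + E) / (1 / E - E))" .
    also have "(1 / E + E) / (1 / E - E) = (1 + E * E) / (1 - E * E)"
      using E by (simp add: divide_simps)
    also have "\<dots> = - (1 + 2 / (E * E - 1))" using E(3) by (simp add: divide_simps) (simp add: algebra_simps)
    finally show ?thesis unfolding E(2) by (simp add: algebra_simps)
  qed
  moreover have "1 / z = - \<i> * of_real (1 / y)" using y by (simp add: z_def divide_simps)
  moreover have "2 * z / (z\<^sup>2 - (of_nat (Suc n))\<^sup>2) = - \<i> * of_real (2 * y / (y\<^sup>2 + (real (Suc n))\<^sup>2))" for n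
  proof -
    have "z\<^sup>2 - (of_nat (Suc n))\<^sup>2 = - of_real (y\<^sup>2 + (real (Suc n))\<^sup>2)"
      by (simp add: z_def power_mult_distrib)
    then show ?thesis by (simp add: z_def del: of_real_add of_real_power of_nat_Suc)
  qed
  ultimately have "(\<lambda>n. - \<i> * of_real (2 * y / (y\<^sup>2 + (real (Suc n))\<^sup>2))) sums
      (of_real pi * (- \<i> * of_real (1 + 2 / (exp x - 1))) - (- \<i> * of_real (1 / y)))"
    using cot_partial_fractions[OF z] by (simp only:)
  from sums_mult[OF this, of \<i>]
  have "(\<lambda>n. complex_of_real (2 * y / (y\<^sup>2 + (real (Suc n))\<^sup>2))) sums
      of_real (pi * (1 + 2 / (exp x - 1)) - 1 / y)" by (simp add: algebra_simps del: of_nat_Suc)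
  then have "(\<lambda>n. 2 * y / (y\<^sup>2 + (real (Suc n))\<^sup>2)) sums (pi * (1 + 2 / (exp x - 1)) - 1 / y)"
    by (simp only: sums_of_real_iff)
  from sums_mult[OF this, of "1 / (2 * pi)"]
  have "(\<lambda>n. 1 / (2 * pi) * (2 * y / (y\<^sup>2 + (real (Suc n))\<^sup>2))) sums (1 / (2 * pi) * (pi * (1 + 2 / (exp x - 1)) - 1 / y))" .
  moreover have "1 / (2 * pi) * (pi * (1 + 2 / (exp x - 1)) - 1 / y) = 1 / (exp x - 1) - 1 / x + 1 / 2"
    using x e by (simp add: y_def divide_simps) (simp add: algebra_simps)
  moreover have "1 / (2 * pi) * (2 * y / (y\<^sup>2 + (real (Suc n))\<^sup>2)) = 2 * x / (x\<^sup>2 + (2 * pi * real (Suc n))\<^sup>2)" for n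
  proof -
    have "x\<^sup>2 + (2 * pi * real (Suc n))\<^sup>2 = (2 * pi)\<^sup>2 * (y\<^sup>2 + (real (Suc n))\<^sup>2)"
      using x by (simp add: y_def power_mult_distrib power_divide distrib_left del: of_nat_Suc)
    moreover have "2 * x = (2 * pi)\<^sup>2 * (1 / (2 * pi) * (2 * y))" using x by (simp add: y_def power2_eq_square)
    ultimately show ?thesis by simp
  qed
  ultimately show ?thesis by (simp only:)
qed

text \<open>
  Write the reciprocal of the square sum as an integral of exponentials. The inner integral is then Gaussian, the outer one a Gamma integral, and the reflection formula evaluates the product of the two Gamma values.
\<close>
lemma nn_integral_mellin_quadratic:
  assumes r: "0 < r" "r < 1" and b: "b > 0"
  shows "(\<integral>\<^sup>+x. ennreal (x powr (-r) / (x\<^sup>2 + b\<^sup>2)) * indicator {0<..} x \<partial>lborel) =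
     ennreal (b powr (-r-1) * (pi / (2 * cos (pi * r / 2))))"
proof -
  define q where "q = (1 - r) / 2"
  have q: "q > 0" "1 - q > 0" using r by (auto simp: q_def)
  have gauss: "(\<integral>\<^sup>+x. ennreal (x powr (-r) * exp (- u * x\<^sup>2)) * indicator {0<..} x \<partial>lborel) = ennreal (Gamma q / 2 * u powr (-q))"
    if u: "u > 0" for u
  proof -
    have int: "(\<lambda>x. x powr (q - 1) * exp (- u * x)) absolutely_integrable_on {0<..} \<and>
       integral {0<..} (\<lambda>x. x powr (q - 1) * exp (- u * x)) = Gamma q * u powr (-q)"
    proof -
      have hi: "((\<lambda>x. indicator {0<..} x * (x powr (q - 1) * exp (- u * x))) has_integral Gamma q * u powr (-q)) UNIV"
        using nn_integral_Gamma[OF q(1) u] q u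
        by (intro nn_integral_has_integral) (auto simp: ennreal_indicator[symmetric] ennreal_mult'[symmetric] mult_ac simp del: ennreal_indicator)
      then have hi': "((\<lambda>x. x powr (q - 1) * exp (- u * x)) has_integral Gamma q * u powr (-q)) {0<..}"
        by (subst has_integral_restrict_UNIV[symmetric]) (erule has_integral_eq[rotated], simp add: indicator_def)
      then show ?thesis
        by (auto intro!: nonnegative_absolutely_integrable_1)
    qed
    have "g ` {0<..} = {0<..}" if "g = (\<lambda>x::real. x\<^sup>2)" for g
      unfolding that
    proof (intro equalityI subsetI)
      fix y :: real assume "y \<in> {0<..}"
      then show "y \<in> (\<lambda>x. x\<^sup>2) ` {0<..}" by (intro image_eqI[of _ _ "sqrt y"]) auto
    qed auto
    then have im: "(\<lambda>x::real. x\<^sup>2) ` {0<..} = {0<..}" by blast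
    have inj: "inj_on (\<lambda>x::real. x\<^sup>2) {0<..}" by (auto simp: inj_on_def power2_eq_iff)
    have dg: "((\<lambda>x::real. x\<^sup>2) has_field_derivative 2 * x) (at x within {0<..})" for x
      by (auto intro!: derivative_eq_intros)
    have "(\<lambda>x. \<bar>2 * x\<bar> * ((x\<^sup>2) powr (q - 1) * exp (- u * x\<^sup>2))) absolutely_integrable_on {0<..} \<and>
       integral {0<..} (\<lambda>x. \<bar>2 * x\<bar> * ((x\<^sup>2) powr (q - 1) * exp (- u * x\<^sup>2))) = Gamma q * u powr (-q)"
      using has_absolute_integral_change_of_variables_1'[of "{0<..}" "\<lambda>x::real. x\<^sup>2" "\<lambda>x. 2 * x"
         "\<lambda>x. x powr (q - 1) * exp (- u * x)" "Gamma q * u powr (-q)", OF _ dg inj] int unfolding im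
      by simp
    then have "((\<lambda>x. \<bar>2 * x\<bar> * ((x\<^sup>2) powr (q - 1) * exp (- u * x\<^sup>2))) has_integral Gamma q * u powr (-q)) {0<..}"
      by (auto simp: absolutely_integrable_on_def has_integral_integrable_integral)
    from has_integral_mult_right[OF this, of "1/2"]
    have hi: "((\<lambda>x. 1 / 2 * (\<bar>2 * x\<bar> * ((x\<^sup>2) powr (q - 1) * exp (- u * x\<^sup>2)))) has_integral 1 / 2 * (Gamma q * u powr (-q))) {0<..}" .
    have "1 / 2 * (\<bar>2 * x\<bar> * ((x\<^sup>2) powr (q - 1) * exp (- u * x\<^sup>2))) = x powr (-r) * exp (- u * x\<^sup>2)" if x: "x \<in> {0<..}" for x
    proof -
      have "(x\<^sup>2) powr (q - 1) = x powr (2 * (q - 1))"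
        using x by (simp add: powr_powr flip: powr_numeral)
      moreover have "1 + 2 * (q - 1) = -r" by (simp add: q_def field_simps)
      then have "x * x powr (2 * (q - 1)) = x powr (-r)" using x powr_mult_base[of x "2 * (q - 1)"] by simp
      ultimately show ?thesis
        using x by (simp add: abs_mult mult.assoc[symmetric])
    qed
    from has_integral_eq[OF this hi]
    have "((\<lambda>x. x powr (-r) * exp (- u * x\<^sup>2)) has_integral Gamma q / 2 * u powr (-q)) {0<..}" by simp
    from nn_integral_has_integral_lebesgue'[OF _ this] show ?thesis by simp
  qed
  have "(\<integral>\<^sup>+x. ennreal (x powr (-r) / (x\<^sup>2 + b\<^sup>2)) * indicator {0<..} x \<partial>lborel)
     = (\<integral>\<^sup>+x. (\<integral>\<^sup>+u. ennreal (x powr (-r) * exp (- (x\<^sup>2 + b\<^sup>2) * u)) * indicator {0<..} u * indicator {0<..} x \<partial>lborel) \<partial>lborel)"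
  proof (intro nn_integral_cong)
    fix x :: real
    have p: "x\<^sup>2 + b\<^sup>2 > 0" using b by (simp add: add_nonneg_pos)
    have "(\<integral>\<^sup>+u. ennreal (x powr (-r) * exp (- (x\<^sup>2 + b\<^sup>2) * u)) * indicator {0<..} u * indicator {0<..} x \<partial>lborel)
      = (\<integral>\<^sup>+u. (ennreal (x powr (-r)) * indicator {0<..} x) * (ennreal (u powr (1 - 1) * exp (- (x\<^sup>2 + b\<^sup>2) * u)) * indicator {0<..} u) \<partial>lborel)"
      by (intro nn_integral_cong) (auto simp: indicator_def ennreal_mult')
    also have "\<dots> = (ennreal (x powr (-r)) * indicator {0<..} x) * (\<integral>\<^sup>+u. (ennreal (u powr (1 - 1) * exp (- (x\<^sup>2 + b\<^sup>2) * u)) * indicator {0<..} u) \<partial>lborel)"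
      by (rule nn_integral_cmult) auto
    also have "\<dots> = ennreal (x powr (-r) / (x\<^sup>2 + b\<^sup>2)) * indicator {0<..} x"
      using nn_integral_Gamma[OF _ p, of 1] p
      by (simp add: powr_minus ennreal_mult'[symmetric] divide_inverse mult.commute mult.left_commute) (simp add: ennreal_mult' mult_ac)
    finally show "ennreal (x powr (-r) / (x\<^sup>2 + b\<^sup>2)) * indicator {0<..} x = (\<integral>\<^sup>+u. ennreal (x powr (-r) * exp (- (x\<^sup>2 + b\<^sup>2) * u)) * indicator {0<..} u * indicator {0<..} x \<partial>lborel)" ..
  qed
  also have "\<dots> = (\<integral>\<^sup>+u. (\<integral>\<^sup>+x. ennreal (x powr (-r) * exp (- (x\<^sup>2 + b\<^sup>2) * u)) * indicator {0<..} u * indicator {0<..} x \<partial>lborel) \<partial>lborel)"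
    by (rule lborel_pair.Fubini') measurable
  also have "\<dots> = (\<integral>\<^sup>+u. ennreal (Gamma q / 2) * (ennreal (u powr ((1 - q) - 1) * exp (- b\<^sup>2 * u)) * indicator {0<..} u) \<partial>lborel)"
  proof (intro nn_integral_cong)
    fix u :: real
    show "(\<integral>\<^sup>+x. ennreal (x powr (-r) * exp (- (x\<^sup>2 + b\<^sup>2) * u)) * indicator {0<..} u * indicator {0<..} x \<partial>lborel)
       = ennreal (Gamma q / 2) * (ennreal (u powr ((1 - q) - 1) * exp (- b\<^sup>2 * u)) * indicator {0<..} u)"
    proof (cases "u > 0")
      case True
      have "(\<integral>\<^sup>+x. ennreal (x powr (-r) * exp (- (x\<^sup>2 + b\<^sup>2) * u)) * indicator {0<..} u * indicator {0<..} x \<partial>lborel)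
         = (\<integral>\<^sup>+x. ennreal (exp (- b\<^sup>2 * u)) * (ennreal (x powr (-r) * exp (- u * x\<^sup>2)) * indicator {0<..} x) \<partial>lborel)"
        using True by (intro nn_integral_cong) (auto simp: indicator_def ennreal_mult'[symmetric] mult_exp_exp algebra_simps exp_add[symmetric])
      also have "\<dots> = ennreal (exp (- b\<^sup>2 * u)) * ennreal (Gamma q / 2 * u powr (-q))"
        by (subst nn_integral_cmult) (auto simp: gauss[OF True, simplified])
      finally show ?thesis using True q by (simp add: ennreal_mult'[symmetric] mult_ac)
    qed auto
  qed
  also have "\<dots> = ennreal (Gamma q / 2) * ennreal (Gamma (1 - q) * (b\<^sup>2) powr (-(1 - q)))"
    using nn_integral_Gamma[OF q(2), of "b\<^sup>2"] b by (subst nn_integral_cmult) auto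
  also have "\<dots> = ennreal (Gamma q / 2 * (Gamma (1 - q) * (b\<^sup>2) powr (-(1 - q))))"
    by (rule ennreal_mult'[symmetric]) (use q in simp)
  also have "(b\<^sup>2) powr (-(1 - q)) = b powr (2 * (-(1 - q)))"
    using b by (simp add: powr_powr flip: powr_numeral)
  also have "2 * (-(1 - q)) = -r - 1" by (simp add: q_def)
  also have "Gamma q / 2 * (Gamma (1 - q) * b powr (-r - 1)) = b powr (-r - 1) * (Gamma q * Gamma (1 - q) / 2)"
    by simp
  also have "Gamma q * Gamma (1 - q) = pi / sin (pi * q)"
  proof -
    have q1: "1 - complex_of_real q = complex_of_real (1 - q)" by simp
    have q2: "complex_of_real pi * complex_of_real q = complex_of_real (pi * q)" by simp
    have "complex_of_real (Gamma q * Gamma (1 - q)) = of_real (pi / sin (pi * q))"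
      using Gamma_reflection_complex[of "of_real q"] unfolding q1 q2 Gamma_complex_of_real sin_of_real
      by (simp only: of_real_mult of_real_divide)
    then show ?thesis by (simp only: of_real_eq_iff)
  qed
  also have "sin (pi * q) = cos (pi * r / 2)"
    using sin_diff[of "pi/2" "pi * r / 2"] by (simp add: q_def algebra_simps diff_divide_distrib)
  finally show ?thesis by (simp add: mult.commute)
qed

text \<open>
  The trapezoidal error is the integral of the second derivative against the Peano kernel u (1 - u) / 2. In this form it is a positive combination of values of the second derivative, which are Gamma integrals of exponentials.
\<close>
lemma em_term_kernel_integral:
  assumes r: "0 < r" "r < 1"
  defines "E \<equiv> (\<lambda>n. (- r - 1) / 2 * (real n powr r + real (Suc n) powr r) + (real (Suc n) powr (1 + r) - real n powr (1 + r)))"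
  shows "((\<lambda>u. u * (1 - u) * (real n + u) powr (r - 2)) has_integral (2 / (r * (1 - r\<^sup>2)) * E n)) {0..1}"
proof -
  define F where "F = (\<lambda>u. - ((real n + u) powr (r + 1)) / (r + 1) + (2 * real n + 1) * (real n + u) powr r / r
     + real n * (real n + 1) * ((real n + u) powr (r - 1) / (1 - r)))"
  have nz: "r + 1 \<noteq> 0" "r \<noteq> 0" "1 - r \<noteq> 0" "1 - r\<^sup>2 \<noteq> 0" using r by (auto simp: power2_eq_1_iff)
  have cont: "continuous_on {0..1} F"
  proof (cases "n = 0")
    case True
    have c: "continuous_on {0..1} (\<lambda>u::real. u powr a)" if "a > 0" for a
      using that by (intro continuous_on_powr') (auto intro!: continuous_intros)
    have "F = (\<lambda>u. - (u powr (r + 1)) / (r + 1) + u powr r / r)"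
      unfolding F_def True by simp
    then show ?thesis using r nz by (auto intro!: continuous_intros c)
  next
    case False
    then show ?thesis unfolding F_def using r nz by (auto intro!: continuous_intros)
  qed
  have der: "(F has_vector_derivative (u * (1 - u) * (real n + u) powr (r - 2))) (at u)" if u: "u \<in> {0<..<1}" for u
  proof -
    define v where "v = real n + u"
    have v: "v > 0" using u by (simp add: v_def)
    have "(F has_real_derivative (- ((r + 1) * v powr (r + 1 - 1)) / (r + 1) + (2 * real n + 1) * (r * v powr (r - 1)) / r
     + real n * (real n + 1) * ((r - 1) * v powr (r - 1 - 1) / (1 - r)))) (at u)"
      unfolding F_def v_def using v nz unfolding v_def by (auto intro!: derivative_eq_intros)
    moreover have e1: "- ((r + 1) * v powr (r + 1 - 1)) / (r + 1) = - (v\<^sup>2 * v powr (r - 2))"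
      using nz v by (simp add: powr_diff)
    have e2: "(2 * real n + 1) * (r * v powr (r - 1)) / r = (2 * real n + 1) * (v * v powr (r - 2))"
      using nz v by (simp add: powr_diff power2_eq_square)
    have e3: "(r - 1) * v powr (r - 1 - 1) / (1 - r) = - (v powr (r - 2))"
      using nz by (simp add: divide_simps algebra_simps)
    have e4: "- (v\<^sup>2 * W) + (2 * real n + 1) * (v * W) + real n * (real n + 1) * (- W) = u * (1 - u) * W" for W
      unfolding v_def by (simp add: power2_eq_square algebra_simps)
    ultimately have "(F has_real_derivative (u * (1 - u) * v powr (r - 2))) (at u)"
      unfolding e1 e2 e3 e4 by simp
    then show ?thesis unfolding has_real_derivative_iff_has_vector_derivative v_def .
  qed
  have "((\<lambda>u. u * (1 - u) * (real n + u) powr (r - 2)) has_integral (F 1 - F 0)) {0..1}"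
    by (rule fundamental_theorem_of_calculus_interior[OF _ cont der]) auto
  moreover have "F 1 - F 0 = 2 / (r * (1 - r\<^sup>2)) * E n"
  proof -
    define m a b where "m = real n + 1" "a = m powr r" "b = real n powr r"
    have m0: "m > 0" by (simp add: m_a_b_def(1))
    have m: "m powr (r + 1) = m * a" "m powr (r - 1) = a / m"
      using m0 by (simp_all add: m_a_b_def(2) powr_add powr_diff)
    have b: "real n powr (r + 1) = real n * b" "real n * (real n + 1) * (real n powr (r - 1) / (1 - r)) = (real n + 1) * b / (1 - r)"
      by (cases "n = 0"; simp add: m_a_b_def(3) powr_add powr_diff)+
    have F1: "F 1 = - (m * a) / (r + 1) + (2 * m - 1) * a / r + (m - 1) * a / (1 - r)"
    proof -
      have n: "real n = m - 1" by (simp add: m_a_b_def(1))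
      have "F 1 = - (m powr (r + 1)) / (r + 1) + (2 * (m - 1) + 1) * m powr r / r + (m - 1) * m * (m powr (r - 1) / (1 - r))"
        unfolding F_def n by simp
      also have "(m - 1) * m * (m powr (r - 1) / (1 - r)) = (m - 1) * a / (1 - r)" unfolding m using m0 by simp
      finally show ?thesis unfolding m m_a_b_def(2)[symmetric] by simp
    qed
    have F0: "F 0 = - (real n * b) / (r + 1) + (2 * real n + 1) * b / r + (real n + 1) * b / (1 - r)"
      unfolding F_def using b by (simp add: m_a_b_def)
    have r2: "1 - r\<^sup>2 = (1 - r) * (r + 1)" by (simp add: power2_eq_square algebra_simps)
    have E: "E n = (- r - 1) / 2 * (b + a) + (m * a - real n * b)"
      unfolding E_def using m b by (simp add: m_a_b_def add.commute)
    have eq1: "- (x * a) / (r + 1) + (2 * x - 1) * a / r + (x - 1) * a / (1 - r) = 2 / (r * (1 - r\<^sup>2)) * ((- r - 1) / 2 * a + x * a)" for x a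
      unfolding r2 using nz by (simp add: divide_simps) algebra
    have eq2: "- (x * a) / (r + 1) + (2 * x + 1) * a / r + (x + 1) * a / (1 - r) = 2 / (r * (1 - r\<^sup>2)) * ((r + 1) / 2 * a + x * a)" for x a
      unfolding r2 using nz by (simp add: divide_simps) algebra
    show ?thesis unfolding F1 F0 E eq1 eq2 right_diff_distrib[symmetric]
      by (intro arg_cong2[where f = "(*)"] refl) (simp add: field_simps)
  qed
  ultimately show ?thesis by simp
qed

lemma trapezoid_exp_integral:
  assumes x: "x > (0::real)"
  shows "((\<lambda>u. u * (1 - u) * exp (- x * u)) has_integral ((x * (1 + exp (-x)) - 2 * (1 - exp (-x))) / x ^ 3)) {0..1}"
proof -
  define F where "F = (\<lambda>u. exp (- x * u) * (u\<^sup>2 / x + (2 / x\<^sup>2 - 1 / x) * u + (2 / x ^ 3 - 1 / x\<^sup>2)))"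
  have "(F has_vector_derivative (u * (1 - u) * exp (- x * u))) (at u within {0..1})" for u
  proof -
    have "(F has_real_derivative (- x * exp (- x * u) * (u\<^sup>2 / x + (2 / x\<^sup>2 - 1 / x) * u + (2 / x ^ 3 - 1 / x\<^sup>2))
        + exp (- x * u) * (2 * u / x + (2 / x\<^sup>2 - 1 / x)))) (at u within {0..1})"
      unfolding F_def using x by (auto intro!: derivative_eq_intros simp: mult.commute)
    moreover have "- x * e * (u\<^sup>2 / x + (2 / x\<^sup>2 - 1 / x) * u + (2 / x ^ 3 - 1 / x\<^sup>2))
        + e * (2 * u / x + (2 / x\<^sup>2 - 1 / x)) = u * (1 - u) * e" for e
      using x by (simp add: field_simps power2_eq_square power3_eq_cube)
    ultimately show ?thesis unfolding has_real_derivative_iff_has_vector_derivative by simp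
  qed
  then have "((\<lambda>u. u * (1 - u) * exp (- x * u)) has_integral (F 1 - F 0)) {0..1}"
    by (intro fundamental_theorem_of_calculus) auto
  moreover have "F 1 - F 0 = (x * (1 + exp (-x)) - 2 * (1 - exp (-x))) / x ^ 3"
    unfolding F_def using x by (simp add: field_simps power2_eq_square power3_eq_cube)
  ultimately show ?thesis by simp
qed

text \<open>
  Both sides are the Mellin transform of the Bose kernel. Expanding it in exponentials gives the trapezoidal errors, hence the zeta function at -r; expanding it in partial fractions gives the Dirichlet series at 1 + r. All integrands are nonnegative, so the two interchanges of sum and integral need no further justification.
\<close>
lemma real_functional_equation:
  assumes r: "0 < r" "r < 1"
  defines "E \<equiv> (\<lambda>n. (- r - 1) / 2 * (real n powr r + real (Suc n) powr r) + (real (Suc n) powr (1 + r) - real n powr (1 + r)))"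
  assumes sE: "summable E"
  shows "suminf E * (2 / (r * (1 - r\<^sup>2))) * Gamma (2 - r) =
     4 * (2 * pi) powr (- r - 1) * (pi / (2 * cos (pi * r / 2))) * (\<Sum>k. real (Suc k) powr (- r - 1))"
proof -
  define c where "c = (2 / (r * (1 - r\<^sup>2)))"
  define J where "J = pi / (2 * cos (pi * r / 2))"
  have r2: "r\<^sup>2 < 1" using r by (simp add: power_less_one_iff)
  have c0: "c > 0" using r r2 by (simp add: c_def)
  have cospos: "cos (pi * r / 2) > 0" using r by (intro cos_gt_zero) (auto simp: field_simps)
  have J0: "J > 0" using cospos by (simp add: J_def)
  have G0: "Gamma (2 - r) > 0" using r by (intro Gamma_real_pos) auto
  have hi: "((\<lambda>u. u * (1 - u) * (real n + u) powr (r - 2)) has_integral (c * E n)) {0..1}" for n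
    using em_term_kernel_integral[OF r, of n] unfolding c_def E_def .
  have E0: "E n \<ge> 0" for n
  proof -
    have "c * E n \<ge> 0" by (rule has_integral_nonneg[OF hi]) auto
    then show ?thesis using c0 by (simp add: zero_le_mult_iff)
  qed
  define h where "h = (\<lambda>x::real. (x * (1 + exp (-x)) - 2 * (1 - exp (-x))) / x ^ 3)"
  have h0: "h x \<ge> 0" if "x > 0" for x
    unfolding h_def by (rule has_integral_nonneg[OF trapezoid_exp_integral[OF that]]) auto
  have I1: "ennreal (Gamma (2 - r) * (c * E n)) = (\<integral>\<^sup>+x. ennreal (x powr (1 - r) * exp (- real n * x) * h x) * indicator {0<..} x \<partial>lborel)" for n
  proof -
    have "ennreal (Gamma (2 - r) * (c * E n)) = ennreal (Gamma (2 - r)) * (\<integral>\<^sup>+u. ennreal (u * (1 - u) * (real n + u) powr (r - 2)) * indicator {0..1} u \<partial>lborel)"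
      using nn_integral_has_integral_lebesgue'[OF _ hi[of n]] G0 by (simp add: ennreal_mult')
    also have "\<dots> = (\<integral>\<^sup>+u. ennreal (Gamma (2 - r)) * (ennreal (u * (1 - u) * (real n + u) powr (r - 2)) * indicator {0..1} u) \<partial>lborel)"
      by (rule nn_integral_cmult[symmetric]) measurable
    also have "\<dots> = (\<integral>\<^sup>+u. (\<integral>\<^sup>+x. ennreal (u * (1 - u)) * indicator {0..1} u * (ennreal (x powr (2 - r - 1) * exp (- (real n + u) * x)) * indicator {0<..} x) \<partial>lborel) \<partial>lborel)"
    proof (intro nn_integral_cong)
      fix u :: real
      have "(\<integral>\<^sup>+x. ennreal (u * (1 - u)) * indicator {0..1} u * (ennreal (x powr (2 - r - 1) * exp (- (real n + u) * x)) * indicator {0<..} x) \<partial>lborel)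
        = ennreal (u * (1 - u)) * indicator {0..1} u * (\<integral>\<^sup>+x. (ennreal (x powr (2 - r - 1) * exp (- (real n + u) * x)) * indicator {0<..} x) \<partial>lborel)"
        by (rule nn_integral_cmult) measurable
      also have "\<dots> = ennreal (Gamma (2 - r)) * (ennreal (u * (1 - u) * (real n + u) powr (r - 2)) * indicator {0..1} u)"
      proof (cases "0 < u \<and> u \<le> 1")
        case True
        have "ennreal (u * (1 - u)) * indicator {0..1} u * (\<integral>\<^sup>+x. (ennreal (x powr (2 - r - 1) * exp (- (real n + u) * x)) * indicator {0<..} x) \<partial>lborel)
           = ennreal (u * (1 - u)) * ennreal (Gamma (2 - r) * (real n + u) powr (- (2 - r)))"
          using nn_integral_Gamma[of "2 - r" "real n + u"] r True by simp
        also have "\<dots> = ennreal (u * (1 - u) * (Gamma (2 - r) * (real n + u) powr (- (2 - r))))"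
          by (rule ennreal_mult'[symmetric]) (use True in auto)
        also have "u * (1 - u) * (Gamma (2 - r) * (real n + u) powr (- (2 - r))) = Gamma (2 - r) * (u * (1 - u) * (real n + u) powr (r - 2))"
          by simp
        also have "ennreal \<dots> = ennreal (Gamma (2 - r)) * ennreal (u * (1 - u) * (real n + u) powr (r - 2))"
          by (rule ennreal_mult') (use G0 in auto)
        finally show ?thesis using True by simp
      qed (auto simp: indicator_def)
      finally show "ennreal (Gamma (2 - r)) * (ennreal (u * (1 - u) * (real n + u) powr (r - 2)) * indicator {0..1} u) =
        (\<integral>\<^sup>+x. ennreal (u * (1 - u)) * indicator {0..1} u * (ennreal (x powr (2 - r - 1) * exp (- (real n + u) * x)) * indicator {0<..} x) \<partial>lborel)" ..
    qed
    also have "\<dots> = (\<integral>\<^sup>+x. (\<integral>\<^sup>+u. ennreal (u * (1 - u)) * indicator {0..1} u * (ennreal (x powr (2 - r - 1) * exp (- (real n + u) * x)) * indicator {0<..} x) \<partial>lborel) \<partial>lborel)"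
      by (rule lborel_pair.Fubini') measurable
    also have "\<dots> = (\<integral>\<^sup>+x. ennreal (x powr (1 - r) * exp (- real n * x) * h x) * indicator {0<..} x \<partial>lborel)"
    proof (intro nn_integral_cong)
      fix x :: real
      show "(\<integral>\<^sup>+u. ennreal (u * (1 - u)) * indicator {0..1} u * (ennreal (x powr (2 - r - 1) * exp (- (real n + u) * x)) * indicator {0<..} x) \<partial>lborel)
         = ennreal (x powr (1 - r) * exp (- real n * x) * h x) * indicator {0<..} x"
      proof (cases "x > 0")
        case True
        have "(\<integral>\<^sup>+u. ennreal (u * (1 - u)) * indicator {0..1} u * (ennreal (x powr (2 - r - 1) * exp (- (real n + u) * x)) * indicator {0<..} x) \<partial>lborel)
          = (\<integral>\<^sup>+u. ennreal (x powr (1 - r) * exp (- real n * x)) * (ennreal (u * (1 - u) * exp (- x * u)) * indicator {0..1} u) \<partial>lborel)"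
        proof (intro nn_integral_cong)
          fix u :: real
          have e: "exp (- (real n + u) * x) = exp (- real n * x) * exp (- x * u)"
            by (simp add: exp_add[symmetric] algebra_simps)
          show "ennreal (u * (1 - u)) * indicator {0..1} u * (ennreal (x powr (2 - r - 1) * exp (- (real n + u) * x)) * indicator {0<..} x)
             = ennreal (x powr (1 - r) * exp (- real n * x)) * (ennreal (u * (1 - u) * exp (- x * u)) * indicator {0..1} u)"
          proof (cases "u \<in> {0..1}")
            case u: True
            have "ennreal (u * (1 - u)) * ennreal (x powr (2 - r - 1) * exp (- (real n + u) * x)) = ennreal (u * (1 - u) * (x powr (2 - r - 1) * exp (- (real n + u) * x)))"
              by (rule ennreal_mult'[symmetric]) (use u in auto)
            also have "u * (1 - u) * (x powr (2 - r - 1) * exp (- (real n + u) * x)) = (x powr (1 - r) * exp (- real n * x)) * (u * (1 - u) * exp (- x * u))"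
              unfolding e by simp
            also have "ennreal \<dots> = ennreal (x powr (1 - r) * exp (- real n * x)) * ennreal (u * (1 - u) * exp (- x * u))"
              by (rule ennreal_mult') auto
            finally show ?thesis using True u by simp
          qed auto
        qed
        also have "\<dots> = ennreal (x powr (1 - r) * exp (- real n * x)) * (\<integral>\<^sup>+u. (ennreal (u * (1 - u) * exp (- x * u)) * indicator {0..1} u) \<partial>lborel)"
          by (rule nn_integral_cmult) measurable
        also have "(\<integral>\<^sup>+u. (ennreal (u * (1 - u) * exp (- x * u)) * indicator {0..1} u) \<partial>lborel) = ennreal (h x)"
          using nn_integral_has_integral_lebesgue'[OF _ trapezoid_exp_integral[OF True]] unfolding h_def by simp
        finally show ?thesis using True h0[OF True] by (simp add: ennreal_mult')
      qed auto
    qed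
    finally show ?thesis .
  qed
  have I2: "ennreal (4 * (2 * pi * real (Suc k)) powr (- r - 1) * J) = (\<integral>\<^sup>+x. ennreal (4 * (x powr (-r) / (x\<^sup>2 + (2 * pi * real (Suc k))\<^sup>2))) * indicator {0<..} x \<partial>lborel)" for k
  proof -
    have "(\<integral>\<^sup>+x. ennreal (4 * (x powr (-r) / (x\<^sup>2 + (2 * pi * real (Suc k))\<^sup>2))) * indicator {0<..} x \<partial>lborel) =
       (\<integral>\<^sup>+x. ennreal 4 * (ennreal (x powr (-r) / (x\<^sup>2 + (2 * pi * real (Suc k))\<^sup>2)) * indicator {0<..} x) \<partial>lborel)"
      by (intro nn_integral_cong, subst ennreal_mult', simp, simp only: mult.assoc)
    also have "\<dots> = ennreal 4 * ennreal ((2 * pi * real (Suc k)) powr (- r - 1) * J)"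
    proof -
      have "2 * pi * real (Suc k) > 0" by simp
      from nn_integral_mellin_quadratic[OF r this]
      have m: "(\<integral>\<^sup>+x. ennreal (x powr (-r) / (x\<^sup>2 + (2 * pi * real (Suc k))\<^sup>2)) * indicator {0<..} x \<partial>lborel) = ennreal ((2 * pi * real (Suc k)) powr (- r - 1) * J)"
        unfolding J_def .
      show ?thesis unfolding m[symmetric] by (rule nn_integral_cmult) measurable
    qed
    also have "\<dots> = ennreal (4 * ((2 * pi * real (Suc k)) powr (- r - 1) * J))"
      by (rule ennreal_mult'[symmetric]) simp
    finally show ?thesis by (simp add: mult.assoc)
  qed
  have pt: "(\<Sum>n. ennreal (x powr (1 - r) * exp (- real n * x) * h x) * indicator {0<..} x)
      = (\<Sum>k. ennreal (4 * (x powr (-r) / (x\<^sup>2 + (2 * pi * real (Suc k))\<^sup>2))) * indicator {0<..} x)" for x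
  proof (cases "x > 0")
    case True
    have e: "exp (-x) < 1" using True by simp
    have "(\<lambda>n. exp (-x) ^ n) sums (1 / (1 - exp (-x)))" using e by (intro geometric_sums) auto
    from sums_mult[OF this, of "x powr (1 - r) * h x"]
    have s1: "(\<lambda>n. x powr (1 - r) * exp (- real n * x) * h x) sums (x powr (1 - r) * h x / (1 - exp (-x)))"
      by (simp add: exp_of_nat_mult[symmetric] mult_ac)
    from sums_mult[OF bose_partial_fractions[OF True], of "2 * x powr (-r) / x"]
    have s2: "(\<lambda>k. 4 * (x powr (-r) / (x\<^sup>2 + (2 * pi * real (Suc k))\<^sup>2))) sums (2 * x powr (-r) / x * (1 / (exp x - 1) - 1 / x + 1 / 2))"
      using True by (simp del: of_nat_Suc)
    have ev: "x powr (1 - r) * h x / (1 - exp (-x)) = 2 * x powr (-r) / x * (1 / (exp x - 1) - 1 / x + 1 / 2)"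
    proof -
      define X where "X = exp x"
      have X: "X > 1" using True by (simp add: X_def)
      have ex: "exp (-x) = 1 / X" by (simp add: X_def exp_minus inverse_eq_divide)
      have p: "x powr (1 - r) = x * x powr (-r)" using True by (simp add: powr_mult_base)
      define A where "A = x powr (-r)"
      have a: "1 - 1 / X = (X - 1) / X" "x * (1 + 1 / X) - 2 * (1 - 1 / X) = (x * (X + 1) - 2 * (X - 1)) / X"
        using X by (simp_all add: field_simps)
      have b: "1 / (X - 1) - 1 / x + 1 / 2 = (x * (X + 1) - 2 * (X - 1)) / (2 * x * (X - 1))"
        using X True by (simp add: field_simps)
      have "x powr (1 - r) * h x / (1 - exp (-x)) = x * A * ((x * (X + 1) - 2 * (X - 1)) / X / x ^ 3) / ((X - 1) / X)"
        unfolding h_def ex p A_def[symmetric] unfolding a(2) unfolding a(1) ..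
      also have "\<dots> = 2 * A / x * ((x * (X + 1) - 2 * (X - 1)) / (2 * x * (X - 1)))"
        using True X by (simp add: power3_eq_cube)
      finally show ?thesis unfolding b[symmetric] unfolding A_def X_def .
    qed
    have s2': "(\<lambda>k. 4 * (x powr (-r) / (x\<^sup>2 + (2 * pi * real (Suc k))\<^sup>2))) sums (x powr (1 - r) * h x / (1 - exp (-x)))"
      unfolding ev by (rule s2)
    have "(\<Sum>n. ennreal (x powr (1 - r) * exp (- real n * x) * h x)) = ennreal (x powr (1 - r) * h x / (1 - exp (-x)))"
      by (rule suminf_ennreal_eq[OF _ s1]) (use h0[OF True] in auto)
    moreover have "(\<Sum>k. ennreal (4 * (x powr (-r) / (x\<^sup>2 + (2 * pi * real (Suc k))\<^sup>2)))) = ennreal (x powr (1 - r) * h x / (1 - exp (-x)))"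
      by (rule suminf_ennreal_eq[OF _ s2']) simp
    moreover have "indicator {0<..} x = (1::ennreal)" using True by simp
    ultimately show ?thesis by (simp only: mult_1_right)
  qed simp
  have [measurable]: "h \<in> borel_measurable borel" unfolding h_def by measurable
  have eqs: "(\<Sum>n. ennreal (Gamma (2 - r) * (c * E n))) = (\<Sum>k. ennreal (4 * (2 * pi * real (Suc k)) powr (- r - 1) * J))"
  proof -
    have "(\<Sum>n. ennreal (Gamma (2 - r) * (c * E n))) = (\<integral>\<^sup>+x. (\<Sum>n. ennreal (x powr (1 - r) * exp (- real n * x) * h x) * indicator {0<..} x) \<partial>lborel)"
      unfolding I1 by (rule nn_integral_suminf[symmetric]) measurable
    also have "\<dots> = (\<Sum>k. ennreal (4 * (2 * pi * real (Suc k)) powr (- r - 1) * J))"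
      unfolding pt I2 by (rule nn_integral_suminf) measurable
    finally show ?thesis .
  qed
  have s3: "summable (\<lambda>n. Gamma (2 - r) * (c * E n))" by (intro summable_mult sE)
  have sk: "summable (\<lambda>k. real (Suc k) powr (- r - 1))"
    using r by (subst summable_Suc_iff) (simp add: summable_real_powr_iff)
  have eqk: "4 * (2 * pi * real (Suc k)) powr (- r - 1) * J = 4 * (2 * pi) powr (- r - 1) * J * real (Suc k) powr (- r - 1)" for k
  proof -
    have "(2 * pi * real (Suc k)) powr (- r - 1) = (2 * pi) powr (- r - 1) * real (Suc k) powr (- r - 1)"
      by (rule powr_mult)
    then show ?thesis by (simp only: mult_ac)
  qed
  have s4: "summable (\<lambda>k. 4 * (2 * pi * real (Suc k)) powr (- r - 1) * J)"
    unfolding eqk by (intro summable_mult sk)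
  have n3: "Gamma (2 - r) * (c * E n) \<ge> 0" for n using G0 c0 E0[of n] by simp
  have n4: "4 * (2 * pi * real (Suc k)) powr (- r - 1) * J \<ge> 0" for k
    by (intro mult_nonneg_nonneg) (use J0 in auto)
  have "ennreal (\<Sum>n. Gamma (2 - r) * (c * E n)) = ennreal (\<Sum>k. 4 * (2 * pi * real (Suc k)) powr (- r - 1) * J)"
    unfolding suminf_ennreal2[OF n3 s3, symmetric] suminf_ennreal2[OF n4 s4, symmetric] by (rule eqs)
  then have "(\<Sum>n. Gamma (2 - r) * (c * E n)) = (\<Sum>k. 4 * (2 * pi * real (Suc k)) powr (- r - 1) * J)"
    by (rule ennreal_inj[OF suminf_nonneg[OF s3 n3] suminf_nonneg[OF s4 n4], THEN iffD1])
  also have "\<dots> = 4 * (2 * pi) powr (- r - 1) * J * (\<Sum>k. real (Suc k) powr (- r - 1))"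
    unfolding eqk by (rule suminf_mult[OF sk])
  finally have "(\<Sum>n. Gamma (2 - r) * (c * E n)) = 4 * (2 * pi) powr (- r - 1) * J * (\<Sum>k. real (Suc k) powr (- r - 1))" .
  moreover have "(\<Sum>n. Gamma (2 - r) * (c * E n)) = Gamma (2 - r) * (c * suminf E)"
    unfolding suminf_mult[OF summable_mult[OF sE, of c], of "Gamma (2 - r)"] suminf_mult[OF sE, of c] ..
  ultimately have "Gamma (2 - r) * (c * suminf E) = 4 * (2 * pi) powr (- r - 1) * J * (\<Sum>k. real (Suc k) powr (- r - 1))"
    by (rule subst[rotated])
  then show ?thesis unfolding J_def c_def by (simp only: mult_ac)
qed

section \<open>The functional equation of the zeta function\<close>

lemma Gamma_reflection_real:
  "Gamma q * Gamma (1 - q) = pi / sin (pi * q :: real)"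
proof -
  have q1: "1 - complex_of_real q = complex_of_real (1 - q)" by simp
  have q2: "complex_of_real pi * complex_of_real q = complex_of_real (pi * q)" by simp
  have "complex_of_real (Gamma q * Gamma (1 - q)) = of_real (pi / sin (pi * q))"
    using Gamma_reflection_complex[of "of_real q"] unfolding q1 q2 Gamma_complex_of_real sin_of_real
    by (simp only: of_real_mult of_real_divide)
  then show ?thesis by (simp only: of_real_eq_iff)
qed

lemma Re_pos_notin_nonpos_Ints: "Re z > 0 \<Longrightarrow> z \<notin> \<int>\<^sub>\<le>\<^sub>0"
  by (auto elim!: nonpos_Ints_cases)

lemma functional_equation_on_reals:
  assumes r: "0 < r" "r < 1"
  shows "of_real (-r) * zpre (of_real (-r)) =
    2 * of_real (2 * pi) powr (of_real (-r) - 1) * sin (of_real pi * of_real (-r) / 2) * Gamma (2 - of_real (-r)) * zpre (1 - of_real (-r))"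
proof -
  define E where "E = (\<lambda>n. (- r - 1) / 2 * (real n powr r + real (Suc n) powr r) + (real (Suc n) powr (1 + r) - real n powr (1 + r)))"
  have em: "em_term (Suc n) (of_real (-r)) = of_real (E (Suc n))" for n
    unfolding em_term_def E_def
    by (simp add: powr_of_real[symmetric] del: of_nat_Suc)
  have "summable (\<lambda>n. complex_of_real (E (Suc n)))"
    using summable_em_term[of "of_real (-r)"] r unfolding em by simp
  then have sE1: "summable (\<lambda>n. E (Suc n))" by (simp only: summable_of_real_iff)
  then have sE: "summable E" by (simp only: summable_Suc_iff)
  define Z where "Z = (\<Sum>k. real (Suc k) powr (- r - 1))"
  have "suminf E = E 0 + (\<Sum>n. E (Suc n))" using suminf_split_head[OF sE] by simp
  moreover have "E 0 = (1 - r) / 2" using r by (simp add: E_def field_simps)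
  ultimately have zm: "zpre (of_real (-r)) = of_real (suminf E)"
  proof -
    assume a: "suminf E = E 0 + (\<Sum>n. E (Suc n))" "E 0 = (1 - r) / 2"
    show ?thesis unfolding zpre_def em suminf_of_real[OF sE1, symmetric] a by (simp add: field_simps)
  qed
  have zp: "zpre (1 - of_real (-r)) = of_real (r * Z)"
  proof -
    have "(\<lambda>n. 1 / of_nat (Suc n) powr (1 - of_real (-r))) sums (zpre (1 - of_real (-r)) / (1 - of_real (-r) - 1))"
      by (rule zpre_dirichlet) (use r in simp)
    moreover have "1 / of_nat (Suc n) powr (1 - of_real (-r)) = complex_of_real (real (Suc n) powr (- r - 1))" for n
    proof -
      have e: "- (1 - of_real (-r)) = complex_of_real (- r - 1)" by simp
      have "complex_of_real (real (Suc n) powr (- r - 1)) = of_nat (Suc n) powr (- (1 - of_real (-r)))"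
        unfolding e using powr_of_real[of "real (Suc n)" "- r - 1"] by (simp only: of_real_of_nat_eq)
      then show ?thesis by (simp only: powr_minus inverse_eq_divide)
    qed
    ultimately have s: "(\<lambda>n. complex_of_real (real (Suc n) powr (- r - 1))) sums (zpre (1 - of_real (-r)) / of_real r)"
      by simp
    have "summable (\<lambda>k. real (Suc k) powr (- r - 1))"
      using r by (subst summable_Suc_iff) (simp add: summable_real_powr_iff)
    then have "(\<lambda>k. complex_of_real (real (Suc k) powr (- r - 1))) sums of_real Z"
      unfolding Z_def sums_of_real_iff by (rule summable_sums)
    from sums_unique2[OF s this] r show ?thesis by (simp add: field_simps)
  qed
  define J where "J = pi / (2 * cos (pi * r / 2))"
  have cospos: "cos (pi * r / 2) > 0" using r by (intro cos_gt_zero) (auto simp: field_simps)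
  have G0: "Gamma (2 - r) > 0" using r by (intro Gamma_real_pos) auto
  have sinpos: "sin (pi * r) > 0" using r by (intro sin_gt_zero) (auto simp: field_simps)
  have r2: "r * (1 - r\<^sup>2) > 0" using r by (auto simp: power_less_one_iff)
  have fe: "suminf E * (2 / (r * (1 - r\<^sup>2))) * Gamma (2 - r) = 4 * (2 * pi) powr (- r - 1) * J * Z"
    using real_functional_equation[OF r, of, folded E_def, OF sE] unfolding Z_def J_def .
  have gg: "Gamma (2 + r) * Gamma (2 - r) = r * (1 - r\<^sup>2) * (pi / sin (pi * r))"
  proof -
    have np: "x \<notin> \<int>\<^sub>\<le>\<^sub>0" if "x > 0" for x :: real using that by (auto elim!: nonpos_Ints_cases)
    have "Gamma (2 + r) = Gamma (1 + r + 1)" by (simp add: add.commute)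
    also have "\<dots> = (1 + r) * Gamma (r + 1)" using Gamma_plus1[OF np, of "1 + r"] r by (simp add: add.commute)
    also have "Gamma (r + 1) = r * Gamma r" using Gamma_plus1[OF np, of r] r by simp
    finally have "Gamma (2 + r) = (1 + r) * (r * Gamma r)" .
    moreover have "Gamma (2 - r) = (1 - r) * Gamma (1 - r)"
      using Gamma_plus1[OF np, of "1 - r"] r by simp
    ultimately have "Gamma (2 + r) * Gamma (2 - r) = r * (1 - r\<^sup>2) * (Gamma r * Gamma (1 - r))"
      by (simp only:) (simp add: power2_eq_square algebra_simps)
    then show ?thesis unfolding Gamma_reflection_real .
  qed
  have "suminf E = 2 * (2 * pi) powr (- r - 1) * sin (pi * r / 2) * Gamma (2 + r) * Z"
  proof -
    have s2: "sin (pi * r) = 2 * sin (pi * r / 2) * cos (pi * r / 2)"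
      using sin_double[of "pi * r / 2"] by simp
    have "sin (pi * r / 2) \<noteq> 0" "cos (pi * r / 2) \<noteq> 0" using sinpos unfolding s2 by auto
    then have "sin (pi * r / 2) * (Gamma (2 + r) * Gamma (2 - r)) = r * (1 - r\<^sup>2) * J"
      unfolding gg s2 J_def by (simp add: field_simps)
    moreover have "R * J / R = J" if "R > 0" for R using that by simp
    ultimately have J: "J = sin (pi * r / 2) * (Gamma (2 + r) * Gamma (2 - r)) / (r * (1 - r\<^sup>2))"
      using r2 by (simp only:)
    have "(suminf E * 2) * (Gamma (2 - r) / (r * (1 - r\<^sup>2))) = (4 * (2 * pi) powr (- r - 1) * (sin (pi * r / 2) * Gamma (2 + r)) * Z) * (Gamma (2 - r) / (r * (1 - r\<^sup>2)))"
      using fe unfolding J by simp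
    then have "suminf E * 2 = 4 * (2 * pi) powr (- r - 1) * (sin (pi * r / 2) * Gamma (2 + r)) * Z"
      using G0 r2 by (subst (asm) mult_right_cancel) auto
    then show ?thesis by simp
  qed
  moreover have "of_real (2 * pi) powr (of_real (-r) - 1) = complex_of_real ((2 * pi) powr (- r - 1))"
    using powr_of_real[of "2 * pi" "- r - 1"] by simp
  moreover have "sin (of_real pi * of_real (-r) / 2) = complex_of_real (- sin (pi * r / 2))"
    using sin_of_real[of "- (pi * r / 2)", where 'a = complex] by simp
  moreover have "Gamma (2 - of_real (-r)) = complex_of_real (Gamma (2 + r))"
    using Gamma_complex_of_real[of "2 + r"] by simp
  ultimately show ?thesis unfolding zm zp by simp
qed

text \<open>
  Both sides are holomorphic in a strip and agree on a real interval, so the identity theorem applies.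
\<close>
lemma zpre_functional:
  assumes s: "-1 < Re s" "Re s < 2"
  shows "s * zpre s = 2 * of_real (2 * pi) powr (s - 1) * sin (of_real pi * s / 2) * Gamma (2 - s) * zpre (1 - s)"
proof -
  define S where "S = {s::complex. -1 < Re s \<and> Re s < 2}"
  define F where "F = (\<lambda>s. s * zpre s - 2 * of_real (2 * pi) powr (s - 1) * sin (of_real pi * s / 2) * Gamma (2 - s) * zpre (1 - s))"
  have S: "S = {s. -1 < Re s} \<inter> {s. Re s < 2}" by (auto simp: S_def)
  have "open S" unfolding S by (intro open_Int open_halfspace_Re_gt open_halfspace_Re_lt)
  moreover have "connected S" unfolding S
    by (intro convex_connected convex_Int convex_halfspace_Re_gt convex_halfspace_Re_lt)
  moreover have "F holomorphic_on S"
  proof -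
    have 1: "zpre holomorphic_on S" by (rule holomorphic_on_subset[OF zpre_holomorphic]) (auto simp: S_def)
    have 2: "(zpre \<circ> (\<lambda>s. 1 - s)) holomorphic_on S"
      by (rule holomorphic_on_compose_gen[OF _ zpre_holomorphic]) (auto intro!: holomorphic_intros simp: S_def)
    have 3: "2 - z \<notin> \<int>\<^sub>\<le>\<^sub>0" if "z \<in> S" for z
      using that by (intro Re_pos_notin_nonpos_Ints) (simp add: S_def)
    show ?thesis unfolding F_def using 2 unfolding o_def
      by (intro holomorphic_intros 1) (use 3 in auto)
  qed
  moreover have "of_real ` {-1<..<0} \<subseteq> S" by (auto simp: S_def)
  moreover have "of_real (-1/2) \<in> S" by (auto simp: S_def)
  moreover have "complex_of_real (-1/2) islimpt of_real ` {-1<..<0}"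
  proof -
    have "\<exists>x'\<in>complex_of_real ` {-1<..<0}. x' \<noteq> of_real (-1/2) \<and> dist x' (of_real (-1/2)) < e" if "e > 0" for e
    proof (intro bexI[of _ "of_real (-1/2 + min (1/4) (e/2))"] conjI)
      show "complex_of_real (-1/2 + min (1/4) (e/2)) \<noteq> of_real (-1/2)"
        unfolding of_real_eq_iff using that by simp
      show "dist (complex_of_real (-1/2 + min (1/4) (e/2))) (of_real (-1/2)) < e"
        unfolding dist_of_real using that by (simp add: dist_real_def)
      show "complex_of_real (-1/2 + min (1/4) (e/2)) \<in> of_real ` {-1<..<0}"
        by (rule imageI) (use that in auto)
    qed
    then show ?thesis unfolding islimpt_approachable by blast
  qed
  moreover have "F z = 0" if "z \<in> of_real ` {-1<..<0}" for z
  proof -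
    from that obtain x where x: "z = of_real x" "-1 < x" "x < 0" by auto
    then show ?thesis using functional_equation_on_reals[of "-x"] unfolding F_def by simp
  qed
  moreover have "s \<in> S" using s by (simp add: S_def)
  ultimately have "F s = 0" 
    by - (rule analytic_continuation[where f = F and S = S and U = "of_real ` {-1<..<0}" and \<xi> = "of_real (-1/2)"], assumption+)
  then show ?thesis by (simp add: F_def)
qed

text \<open>
  Existence of the continuation: the Euler-Maclaurin series covers Re s > -1 and the functional equation defines the function further to the left. Uniqueness is the identity theorem on the connected punctured plane.
\<close>
lemma zeta_characterization:
  "zeta holomorphic_on (- {1}) \<and> (\<forall>s. Re s > -1 \<and> s \<noteq> 1 \<longrightarrow> zeta s = zpre s / (s - 1))"
proof -
  define A where "A = (\<lambda>s. 2 * of_real (2 * pi) powr (s - 1) * sin (of_real pi * s / 2) * Gamma (2 - s) * zpre (1 - s) / (s * (s - 1)))"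
  define Z where "Z = (\<lambda>s. if s = 1 then 0 else if Re s > -1 then zpre s / (s - 1) else A s)"
  have Z1: "Z s = zpre s / (s - 1)" if "Re s > -1" "s \<noteq> 1" for s using that by (simp add: Z_def)
  have ZA: "Z s = A s" if "Re s < 0" for s
  proof (cases "Re s > -1")
    case True
    have "s \<noteq> 0" using that by auto
    have "A s = s * zpre s / (s * (s - 1))"
      unfolding A_def using zpre_functional[of s] True that by simp
    also have "\<dots> = zpre s / (s - 1)" using \<open>s \<noteq> 0\<close> by simp
    finally have "A s = zpre s / (s - 1)" .
    moreover have "s \<noteq> 1" using that by auto
    ultimately show ?thesis using Z1[of s] True by simp
  qed (use that in \<open>auto simp: Z_def\<close>)
  have "Z holomorphic_on ({s. Re s > -1} - {1})"
  proof (rule holomorphic_transform)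
    have "zpre holomorphic_on ({s. Re s > -1} - {1})" by (rule holomorphic_on_subset[OF zpre_holomorphic]) auto
    then show "(\<lambda>s. zpre s / (s - 1)) holomorphic_on ({s. Re s > -1} - {1})"
      by (intro holomorphic_intros) auto
  qed (use Z1 in auto)
  moreover have "Z holomorphic_on {s. Re s < 0}"
  proof (rule holomorphic_transform)
    have 2: "(zpre \<circ> (\<lambda>s. 1 - s)) holomorphic_on {s. Re s < 0}"
      by (rule holomorphic_on_compose_gen[OF _ zpre_holomorphic]) (auto intro!: holomorphic_intros)
    have 3: "2 - z \<notin> \<int>\<^sub>\<le>\<^sub>0" if "Re z < 0" for z
      using that by (intro Re_pos_notin_nonpos_Ints) simp
    show "A holomorphic_on {s. Re s < 0}" unfolding A_def using 2 unfolding o_def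
      by (intro holomorphic_intros) (use 3 in auto)
  qed (use ZA in auto)
  ultimately have "Z holomorphic_on (({s. Re s > -1} - {1}) \<union> {s. Re s < 0})"
    by (intro holomorphic_on_Un open_Diff open_halfspace_Re_gt open_halfspace_Re_lt) auto
  also have "({s. Re s > -1} - {1}) \<union> {s. Re s < 0} = - {1::complex}" by auto
  finally have Zh: "Z holomorphic_on (- {1})" .
  have Zd: "\<forall>s. Re s > 1 \<longrightarrow> (\<lambda>n. 1 / of_nat (Suc n) powr s) sums Z s"
    using zpre_dirichlet Z1 by (metis add.inverse_neutral less_trans neg_less_0_iff_less one_complex.simps(1) order_less_irrefl zero_less_one)
  have "zeta = Z" unfolding zeta_def
  proof (rule the_equality)
    show "Z holomorphic_on - {1} \<and> (\<forall>s. Re s > 1 \<longrightarrow> (\<lambda>n. 1 / of_nat (Suc n) powr s) sums Z s) \<and> Z 1 = 0"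
      using Zh Zd by (simp add: Z_def)
  next
    fix f assume f: "f holomorphic_on - {1} \<and> (\<forall>s. Re s > 1 \<longrightarrow> (\<lambda>n. 1 / of_nat (Suc n) powr s) sums f s) \<and> f 1 = 0"
    show "f = Z"
    proof
      fix s
      show "f s = Z s"
      proof (cases "s = 1")
        case True
        then show ?thesis using f by (simp add: Z_def)
      next
        case False
        show ?thesis
        proof (rule analytic_continuation_open[of "{s. Re s > 1}" "- {1}" f Z])
          show "open {s. Re s > 1}" by (rule open_halfspace_Re_gt)
          show "{s::complex. Re s > 1} \<noteq> {}" by (auto intro!: exI[of _ 2])
          show "connected (- {1::complex})" by (rule connected_punctured_universe) simp
          show "f z = Z z" if "z \<in> {s. Re s > 1}" for z
            using sums_unique2 f Zd that by blast
        qed (use f Zh False in auto)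
      qed
    qed
  qed
  then show ?thesis using Zh Z1 by auto
qed

lemma zeta_holomorphic: "zeta holomorphic_on (- {1})"
  and zeta_eq_zpre: "Re s > -1 \<Longrightarrow> s \<noteq> 1 \<Longrightarrow> zeta s = zpre s / (s - 1)"
  using zeta_characterization by auto

lemma zeta_dirichlet: "Re s > 1 \<Longrightarrow> (\<lambda>n. 1 / of_nat (Suc n) powr s) sums zeta s"
  using zpre_dirichlet[of s] zeta_eq_zpre[of s] by (cases "s = 1") auto

text \<open>
  The factor in zeta s = chi s * zeta (1 - s).
\<close>
definition chi :: "complex \<Rightarrow> complex" where
  "chi s = 2 * of_real (2 * pi) powr (s - 1) * sin (of_real pi * s / 2) * Gamma (1 - s)"

lemma zeta_functional:
  assumes s: "0 < Re s" "Re s < 1"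
  shows "zeta s = chi s * zeta (1 - s)"
proof -
  have nz: "s \<noteq> 0" "s \<noteq> 1" "s - 1 \<noteq> 0" using s by auto
  have "2 - s = (1 - s) + 1" by simp
  moreover have "1 - s \<notin> \<int>\<^sub>\<le>\<^sub>0" using s by (intro Re_pos_notin_nonpos_Ints) simp
  ultimately have g: "Gamma (2 - s) = (1 - s) * Gamma (1 - s)" using Gamma_plus1[of "1 - s"] by simp
  have z1: "zeta (1 - s) = zpre (1 - s) / (- s)" using zeta_eq_zpre[of "1 - s"] s nz by simp
  have "zeta s = s * zpre s / (s * (s - 1))" using zeta_eq_zpre[of s] s nz by simp
  also have "s * zpre s = 2 * of_real (2 * pi) powr (s - 1) * sin (of_real pi * s / 2) * ((1 - s) * Gamma (1 - s)) * zpre (1 - s)"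
    using zpre_functional[of s] s unfolding g by simp
  also have "\<dots> = (s * (s - 1)) * (chi s * zeta (1 - s))"
    unfolding chi_def z1 using nz by (simp add: field_simps)
  finally show ?thesis using nz by simp
qed

lemma chi_holomorphic: "chi holomorphic_on {s. Re s < 1}"
proof -
  have "1 - z \<notin> \<int>\<^sub>\<le>\<^sub>0" if "Re z < 1" for z
    using that by (intro Re_pos_notin_nonpos_Ints) simp
  then show ?thesis unfolding chi_def by (intro holomorphic_intros) auto
qed

lemma zeta_cnj:
  assumes s: "Re s > -1" "s \<noteq> 1"
  shows "zeta (cnj s) = cnj (zeta s)"
proof -
  have em: "em_term n (cnj s) = cnj (em_term n s)" for n
    unfolding em_term_def by (simp add: cnj_powr del: of_nat_Suc)
  have z: "zpre (cnj s) = cnj (zpre s)"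
    unfolding zpre_def em using bounded_linear.suminf[OF bounded_linear_cnj summable_em_term[OF s(1)]] by simp
  have "cnj s \<noteq> 1" using s(2) by (metis complex_cnj_cnj complex_cnj_one)
  then show ?thesis using zeta_eq_zpre[of s] zeta_eq_zpre[of "cnj s"] s z by simp
qed

section \<open>Size of the factor in the functional equation\<close>

text \<open>
  The partial sums of the Digamma series are compared with the logarithm; only the real part on vertical lines in a bounded strip matters for the size of Gamma.
\<close>
lemma Re_Digamma_approx:
  assumes x: "1/4 \<le> x" "x \<le> 3/4" and t: "t \<ge> 1"
  shows "\<bar>Re (Digamma (Complex x t)) - ln t\<bar> \<le> 5"
proof -
  define \<phi> where "\<phi> = (\<lambda>u::real. u / (u\<^sup>2 + t\<^sup>2))"
  define F where "F = (\<lambda>u::real. ln (u\<^sup>2 + t\<^sup>2) / 2)"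
  have pos: "u\<^sup>2 + t\<^sup>2 > 0" for u using t by (intro add_nonneg_pos) auto
  have dF: "(F has_real_derivative \<phi> u) (at u)" for u
  proof -
    have "((\<lambda>u. ln (u\<^sup>2 + t\<^sup>2)) has_real_derivative (2 * u) / (u\<^sup>2 + t\<^sup>2)) (at u)"
      using pos[of u] by (auto intro!: derivative_eq_intros)
    from DERIV_cdivide[OF this, of 2]
    have "(F has_real_derivative (2 * u) / (u\<^sup>2 + t\<^sup>2) / 2) (at u)" unfolding F_def .
    moreover have "2 * a / b / 2 = a / b" for a b :: real by simp
    ultimately show ?thesis unfolding \<phi>_def by (simp only:)
  qed
  have d\<phi>: "(\<phi> has_real_derivative ((t\<^sup>2 - u\<^sup>2) / (u\<^sup>2 + t\<^sup>2)\<^sup>2)) (at u)" for u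
  proof -
    have "(\<phi> has_real_derivative (((u\<^sup>2 + t\<^sup>2) - u * (2 * u)) / ((u\<^sup>2 + t\<^sup>2) * (u\<^sup>2 + t\<^sup>2)))) (at u)"
      unfolding \<phi>_def using pos[of u] by (auto intro!: derivative_eq_intros)
    moreover have "(u\<^sup>2 + t\<^sup>2) - u * (2 * u) = t\<^sup>2 - u\<^sup>2" by (simp add: power2_eq_square)
    ultimately show ?thesis by (simp add: power2_eq_square)
  qed
  have b\<phi>: "\<bar>(t\<^sup>2 - u\<^sup>2) / (u\<^sup>2 + t\<^sup>2)\<^sup>2\<bar> \<le> 1 / ((real n)\<^sup>2 + 1)" if "u \<ge> real n" for u n
  proof -
    have "\<bar>t\<^sup>2 - u\<^sup>2\<bar> \<le> u\<^sup>2 + t\<^sup>2" by (simp add: abs_if)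
    then have "\<bar>(t\<^sup>2 - u\<^sup>2) / (u\<^sup>2 + t\<^sup>2)\<^sup>2\<bar> \<le> (u\<^sup>2 + t\<^sup>2) / (u\<^sup>2 + t\<^sup>2)\<^sup>2"
      unfolding abs_divide by (intro divide_mono) (use pos[of u] in auto)
    also have "\<dots> = 1 / (u\<^sup>2 + t\<^sup>2)" using pos[of u] by (simp add: power2_eq_square)
    also have "\<dots> \<le> 1 / ((real n)\<^sup>2 + 1)"
    proof (intro divide_left_mono add_mono)
      show "(real n)\<^sup>2 \<le> u\<^sup>2" using that by (intro power_mono) auto
      show "1 \<le> t\<^sup>2" using t by simp
      show "0 < (u\<^sup>2 + t\<^sup>2) * ((real n)\<^sup>2 + 1)" using pos[of u] by (intro mult_pos_pos) (auto intro!: add_nonneg_pos)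
    qed auto
    finally show ?thesis .
  qed
  have step: "\<bar>F (x + real (Suc n)) - F (x + real n) - \<phi> (x + real n)\<bar> \<le> 1 / ((real n)\<^sup>2 + 1)" for n
  proof -
    have "\<exists>z>x + real n. z < x + real n + 1 \<and> F (x + real n + 1) - F (x + real n) = (x + real n + 1 - (x + real n)) * \<phi> z"
      by (rule MVT2) (use dF in auto)
    then obtain z where z: "z > x + real n" "z < x + real n + 1" "F (x + real n + 1) - F (x + real n) = \<phi> z" by auto
    have "\<exists>y>x + real n. y < z \<and> \<phi> z - \<phi> (x + real n) = (z - (x + real n)) * ((t\<^sup>2 - y\<^sup>2) / (y\<^sup>2 + t\<^sup>2)\<^sup>2)"
      by (rule MVT2) (use d\<phi> z in auto)
    then obtain y where y: "y > x + real n" "y < z" "\<phi> z - \<phi> (x + real n) = (z - (x + real n)) * ((t\<^sup>2 - y\<^sup>2) / (y\<^sup>2 + t\<^sup>2)\<^sup>2)" by auto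
    have "\<bar>\<phi> z - \<phi> (x + real n)\<bar> \<le> 1 * (1 / ((real n)\<^sup>2 + 1))"
      unfolding y(3) abs_mult using y z x by (intro mult_mono b\<phi>) auto
    then show ?thesis using z(3) by (simp add: add_ac)
  qed
  have sum1: "(\<Sum>n<m. 1 / ((real n)\<^sup>2 + 1)) \<le> 4 - 4 / (real m + 1)" for m
  proof (induction m)
    case (Suc m)
    have "1 / ((real m)\<^sup>2 + 1) \<le> 4 / ((real m + 1) * (real m + 2))"
    proof -
      have "(real m + 1) * (real m + 2) \<le> 4 * ((real m)\<^sup>2 + 1)"
      proof -
        have "4 * ((real m)\<^sup>2 + 1) - (real m + 1) * (real m + 2) = 3 * (real m - 1/2)\<^sup>2 + 5/4"
          by (simp add: power2_eq_square algebra_simps)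
        moreover have "3 * (real m - 1/2)\<^sup>2 \<ge> 0" by simp
        ultimately show ?thesis by linarith
      qed
      moreover have "1 / A \<le> 4 / B" if "B \<le> 4 * A" "A > 0" "B > 0" for A B :: real
        using that by (simp add: divide_simps)
      moreover have "(real m)\<^sup>2 + 1 > 0" by (intro add_nonneg_pos) auto
      ultimately show ?thesis by simp
    qed
    also have "\<dots> = 4 / (real m + 1) - 4 / (real (Suc m) + 1)" by (simp add: divide_simps)
    finally show ?case using Suc by simp
  qed simp
  have close: "\<bar>F (x + real m) - F x - (\<Sum>n<m. \<phi> (x + real n))\<bar> \<le> 4" for m
  proof -
    have "F (x + real m) - F x = (\<Sum>n<m. F (x + real (Suc n)) - F (x + real n))"
      by (subst sum_lessThan_telescope) simp
    then have "\<bar>F (x + real m) - F x - (\<Sum>n<m. \<phi> (x + real n))\<bar> = \<bar>\<Sum>n<m. F (x + real (Suc n)) - F (x + real n) - \<phi> (x + real n)\<bar>"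
      by (simp add: sum_subtractf)
    also have "\<dots> \<le> (\<Sum>n<m. 1 / ((real n)\<^sup>2 + 1))"
      by (rule order_trans[OF sum_abs sum_mono[OF step]])
    also have "\<dots> \<le> 4" using sum1[of m] by (smt (verit) divide_nonneg_nonneg of_nat_0_le_iff)
    finally show ?thesis .
  qed
  have "Complex x t \<noteq> 0" using t by (simp add: complex_eq_iff)
  from tendsto_Re[OF Digamma_LIMSEQ[OF this]]
  have lim1: "(\<lambda>m. ln (real m) - (\<Sum>n<m. \<phi> (x + real n))) \<longlonglongrightarrow> Re (Digamma (Complex x t))"
    by (simp add: \<phi>_def)
  have "(\<lambda>m. ln (real m) - F (x + real m)) \<longlonglongrightarrow> 0"
    unfolding F_def by real_asymp
  from tendsto_add[OF this tendsto_const[of "F x"]]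
  have lim2: "(\<lambda>m. ln (real m) - F (x + real m) + F x) \<longlonglongrightarrow> F x" by simp
  have "(\<lambda>m. \<bar>(ln (real m) - (\<Sum>n<m. \<phi> (x + real n))) - (ln (real m) - F (x + real m) + F x)\<bar>) \<longlonglongrightarrow> \<bar>Re (Digamma (Complex x t)) - F x\<bar>"
    by (intro tendsto_rabs tendsto_diff lim1 lim2)
  then have "\<bar>Re (Digamma (Complex x t)) - F x\<bar> \<le> 4"
    by (rule LIMSEQ_le_const2) (use close in \<open>auto intro!: exI[of _ 0] simp: abs_if algebra_simps split: if_splits\<close>)
  moreover have "\<bar>F x - ln t\<bar> \<le> 1"
  proof -
    have lt: "ln t = ln (t\<^sup>2) / 2" using t by (simp add: ln_realpow)
    have "ln (t\<^sup>2) \<le> ln (x\<^sup>2 + t\<^sup>2)" using t pos[of x] by (subst ln_le_cancel_iff) auto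
    moreover have "ln (x\<^sup>2 + t\<^sup>2) \<le> ln (2 * t\<^sup>2)"
    proof -
      have "x\<^sup>2 \<le> 1" using x by (intro power_le_one) auto
      moreover have "1 \<le> t\<^sup>2" using t by simp
      ultimately have "x\<^sup>2 + t\<^sup>2 \<le> 2 * t\<^sup>2" by linarith
      then show ?thesis using t pos[of x] by (subst ln_le_cancel_iff) auto
    qed
    moreover have "ln (2 * t\<^sup>2) = ln 2 + ln (t\<^sup>2)" using t by (simp add: ln_mult)
    moreover have "ln 2 \<le> (1::real)" using ln_2_less_1 by simp
    ultimately show ?thesis unfolding F_def lt by (simp add: abs_if)
  qed
  ultimately show ?thesis by linarith
qed

text \<open>
  The value on the line of real part 1/2 is known exactly by reflection, and the logarithmic derivative of the modulus in the horizontal direction is the real part of the Digamma function. Integrating from that line gives the exponent.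
\<close>
lemma norm_Gamma_le:
  assumes x: "1/4 \<le> x" "x \<le> 3/4" and t: "t \<ge> 1"
  shows "norm (Gamma (Complex x t)) \<le> 36 * t powr (x - 1/2) * exp (- pi * t / 2)"
proof -
  define l where "l = (\<lambda>y. Re (ln_Gamma (Complex y t)))"
  have nG: "norm (Gamma (Complex y t)) = exp (l y)" for y
  proof -
    have "Complex y t \<notin> \<int>\<^sub>\<le>\<^sub>0" using t by (auto elim!: nonpos_Ints_cases simp: complex_eq_iff)
    then show ?thesis unfolding Gamma_complex_altdef l_def by simp
  qed
  have dl: "(l has_real_derivative Re (Digamma (Complex y t))) (at y)" for y
  proof -
    have "Complex y t \<notin> \<real>\<^sub>\<le>\<^sub>0" using t by (auto simp: complex_nonpos_Reals_iff)
    then have "(ln_Gamma has_field_derivative Digamma (Complex y t)) (at (Complex y t))"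
      by (rule has_field_derivative_ln_Gamma_complex)
    then have "(ln_Gamma has_derivative (\<lambda>h. Digamma (Complex y t) * h)) (at (Complex y t))"
      by (simp add: has_field_derivative_def)
    moreover have "((\<lambda>y. Complex y t) has_derivative (\<lambda>h. Complex h 0)) (at y)"
    proof -
      have "((\<lambda>y. of_real y + \<i> * of_real t) has_derivative (\<lambda>h. of_real h)) (at y)"
        by (auto intro!: derivative_eq_intros)
      then show ?thesis by (simp add: complex_eq_iff Complex_eq)
    qed
    ultimately have "(ln_Gamma \<circ> (\<lambda>y. Complex y t) has_derivative (\<lambda>h. Digamma (Complex y t) * h) \<circ> (\<lambda>h. Complex h 0)) (at y)"
      by (intro diff_chain_at) auto
    from has_derivative_Re[OF this]
    have "(l has_derivative (\<lambda>h. Re (Digamma (Complex y t)) * h)) (at y)"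
      unfolding o_def l_def by simp
    then show ?thesis by (simp add: has_field_derivative_def)
  qed
  have half: "norm (Gamma (Complex (1/2) t)) \<le> 4 * exp (- pi * t / 2)"
  proof -
    define z where "z = Complex (1/2) t"
    have cz: "1 - z = cnj z" by (simp add: z_def complex_eq_iff)
    have "(norm (Gamma z))\<^sup>2 = norm (Gamma z * Gamma (1 - z))"
      unfolding cz cnj_Gamma[symmetric] by (simp add: norm_mult power2_eq_square)
    also have "\<dots> = pi / norm (sin (of_real pi * z))"
      unfolding Gamma_reflection_complex by (simp add: norm_divide)
    also have "\<dots> \<le> pi / (exp (pi * t) / 2)"
    proof (intro divide_left_mono)
      have e: "exp (2 * (pi * t)) = (exp (pi * t))\<^sup>2" by (simp add: exp_double)
      have "(norm (sin (of_real pi * z)))\<^sup>2 = (exp (2 * (pi * t)) + inverse (exp (2 * (pi * t))) + 2) / 4"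
        unfolding norm_sin_squared by (simp add: z_def)
      also have "\<dots> \<ge> (exp (pi * t) / 2)\<^sup>2"
        unfolding e by (simp add: power_divide)
      finally show "exp (pi * t) / 2 \<le> norm (sin (of_real pi * z))"
        by (rule power2_le_imp_le) auto
      then have "norm (sin (of_real pi * z)) > 0" by (smt (verit) exp_gt_zero half_gt_zero)
      then show "0 < norm (sin (complex_of_real pi * z)) * (exp (pi * t) / 2)" by simp
    qed auto
    also have "\<dots> \<le> (4 * exp (- pi * t / 2))\<^sup>2"
    proof -
      have "(exp (- pi * t / 2))\<^sup>2 = exp (- (pi * t))" by (simp add: exp_double[symmetric])
      moreover have "pi / (exp (pi * t) / 2) = 2 * pi * exp (- (pi * t))" by (simp add: exp_minus field_simps)
      moreover have "2 * pi \<le> 16" using pi_less_4 by simp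
      ultimately show ?thesis by (simp add: power_mult_distrib)
    qed
    finally show ?thesis unfolding z_def by (rule power2_le_imp_le) simp
  qed
  have "l x \<le> l (1/2) + (x - 1/2) * ln t + 2"
  proof (cases x "1/2 :: real" rule: linorder_cases)
    case less
    have "\<exists>y>x. y < 1/2 \<and> l (1/2) - l x = (1/2 - x) * Re (Digamma (Complex y t))"
      by (rule MVT2[OF less]) (use dl in auto)
    then obtain y where y: "y > x" "y < 1/2" "l (1/2) - l x = (1/2 - x) * Re (Digamma (Complex y t))" by auto
    have "Re (Digamma (Complex y t)) \<ge> ln t - 5" using Re_Digamma_approx[of y t] x y t by (simp add: abs_le_iff)
    then have "l (1/2) - l x \<ge> (1/2 - x) * (ln t - 5)" unfolding y(3) using less by (intro mult_left_mono) auto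
    then show ?thesis using x by (simp add: algebra_simps)
  next
    case greater
    have "\<exists>y>1/2. y < x \<and> l x - l (1/2) = (x - 1/2) * Re (Digamma (Complex y t))"
      by (rule MVT2[OF greater]) (use dl in auto)
    then obtain y where y: "y > 1/2" "y < x" "l x - l (1/2) = (x - 1/2) * Re (Digamma (Complex y t))" by auto
    have "Re (Digamma (Complex y t)) \<le> ln t + 5" using Re_Digamma_approx[of y t] x y t by (simp add: abs_le_iff)
    then have "l x - l (1/2) \<le> (x - 1/2) * (ln t + 5)" unfolding y(3) using greater by (intro mult_left_mono) auto
    then show ?thesis using x by (simp add: algebra_simps)
  next
    case equal
    then show ?thesis by (simp only:) simp
  qed
  then have "exp (l x) \<le> exp (l (1/2)) * t powr (x - 1/2) * exp 2"
    using t by (simp add: powr_def exp_add[symmetric] algebra_simps)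
  also have "\<dots> \<le> (4 * exp (- pi * t / 2)) * t powr (x - 1/2) * 9"
  proof (intro mult_mono)
    have "exp 2 = exp 1 * (exp 1 :: real)" by (simp add: exp_add[symmetric])
    also have "\<dots> \<le> 3 * 3" by (intro mult_mono) (use exp_le in auto)
    finally show "exp 2 \<le> (9::real)" by simp
  qed (use half nG in auto)
  finally show ?thesis unfolding nG by (simp add: mult_ac)
qed

text \<open>
  The exponential decay of Gamma cancels the growth of the sine, which leaves the power of the ordinate.
\<close>
lemma norm_chi_le:
  assumes s: "1/4 \<le> Re s" "Re s \<le> 3/4" and t: "\<bar>Im s\<bar> \<ge> 1"
  shows "norm (chi s) \<le> 72 * \<bar>Im s\<bar> powr (1/2 - Re s)"
proof -
  define t where "t = \<bar>Im s\<bar>"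
  have G: "norm (Gamma (1 - s)) = norm (Gamma (Complex (1 - Re s) t))"
  proof (cases "Im s \<ge> 0")
    case True
    then have "1 - s = cnj (Complex (1 - Re s) t)" by (simp add: complex_eq_iff t_def)
    then show ?thesis by (simp flip: cnj_Gamma)
  next
    case False
    then have "1 - s = Complex (1 - Re s) t" by (simp add: complex_eq_iff t_def)
    then show ?thesis by simp
  qed
  have g: "norm (Gamma (1 - s)) \<le> 36 * t powr (1/2 - Re s) * exp (- pi * t / 2)"
    unfolding G using norm_Gamma_le[of "1 - Re s" t] s t by (simp add: t_def)
  have sn: "norm (sin (of_real pi * s / 2)) \<le> exp (pi * t / 2)"
  proof (rule power2_le_imp_le)
    define u where "u = pi * Im s"
    have "(norm (sin (of_real pi * s / 2)))\<^sup>2 = (exp u + inverse (exp u) - 2 * cos (pi * Re s)) / 4"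
      unfolding norm_sin_squared by (simp add: u_def)
    also have "\<dots> \<le> (exp \<bar>u\<bar> + exp \<bar>u\<bar> + 2 * exp \<bar>u\<bar>) / 4"
    proof (intro divide_right_mono add_mono)
      have "inverse (exp u) \<le> exp \<bar>u\<bar>" unfolding exp_minus[symmetric] by simp
      moreover have "exp u \<le> exp \<bar>u\<bar>" by simp
      moreover have "- cos (pi * Re s) \<le> exp \<bar>u\<bar>" by (smt (verit) cos_ge_minus_one one_le_exp_iff abs_ge_zero)
      ultimately show "exp u + inverse (exp u) - 2 * cos (pi * Re s) \<le> exp \<bar>u\<bar> + exp \<bar>u\<bar> + 2 * exp \<bar>u\<bar>" by linarith
    qed auto
    also have "\<dots> = (exp (pi * t / 2))\<^sup>2" by (simp add: exp_double[symmetric] u_def t_def abs_mult)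
    finally show "(norm (sin (of_real pi * s / 2)))\<^sup>2 \<le> (exp (pi * t / 2))\<^sup>2" .
  qed simp
  have p: "norm (of_real (2 * pi) powr (s - 1)) \<le> 1"
  proof -
    have "2 * pi \<ge> 1" using pi_gt3 by simp
    moreover have "norm (of_real (2 * pi) powr (s - 1)) = (2 * pi) powr (Re s - 1)"
      using norm_real_powr[of "2 * pi" "s - 1"] by simp
    ultimately show ?thesis using s powr_mono[of "Re s - 1" 0 "2 * pi"] by simp
  qed
  have "norm (chi s) \<le> 2 * 1 * exp (pi * t / 2) * (36 * t powr (1/2 - Re s) * exp (- pi * t / 2))"
    unfolding chi_def norm_mult by (intro mult_mono p sn g) auto
  also have "\<dots> = 72 * t powr (1/2 - Re s) * (exp (pi * t / 2) * exp (- pi * t / 2))" by simp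
  also have "exp (pi * t / 2) * exp (- pi * t / 2) = 1" by (simp add: exp_add[symmetric])
  finally show ?thesis by (simp add: t_def)
qed

section \<open>Approximation of zeta by partial sums\<close>

text \<open>
  While n exceeds twice the modulus of s, the quotient of consecutive terms stays away from 1, so each term is a multiple of a difference of consecutive terms by a slowly varying factor. Summation by parts then bounds the block by its end terms.
\<close>
lemma dirichlet_block_bound:
  fixes s :: complex
  assumes s: "1/2 \<le> Re s" "Re s \<le> 3/4" and a: "2 * norm s \<le> real a" "a \<le> N" and s1: "norm s \<ge> 1"
  shows "norm (\<Sum>n=a+1..N. of_nat n powr (-s)) \<le> 152 * real N powr (1 - Re s) / norm s"
proof -
  have a2: "a \<ge> 2" using a s1 by linarith
  define u where "u = (\<lambda>n. (of_nat n :: complex) powr (-s))"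
  define w where "w = (\<lambda>n. s * of_real (ln (1 + 1 / real n)))"
  define r where "r = (\<lambda>n. 1 / (1 - exp (- w n)))"
  have lnl: "ln (1 + 1 / real n) \<ge> 1 / (real n + 1)" if "n > 0" for n
  proof -
    have "- ln (1 + 1 / real n) = ln (1 - 1 / (real n + 1))"
      using that by (simp add: ln_div[symmetric] field_simps flip: ln_inverse)
    also have "\<dots> \<le> - (1 / (real n + 1))"
      using ln_le_minus_one[of "1 - 1 / (real n + 1)"] that by simp
    finally show ?thesis by simp
  qed
  have lnu: "ln (1 + 1 / real n) \<le> 1 / real n" "ln (1 + 1 / real n) \<ge> 0" if "n > 0" for n
    using ln_add_one_self_le_self[of "1 / real n"] that by auto
  have wl: "norm (w n) \<ge> norm s / (real n + 1)" if "n > 0" for n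
  proof -
    have "norm s * (1 / (real n + 1)) \<le> norm s * ln (1 + 1 / real n)"
      by (intro mult_left_mono lnl that) auto
    then show ?thesis using lnu(2)[OF that] by (simp add: w_def norm_mult)
  qed
  have wu: "norm (w n) \<le> 1/2" if "n \<ge> a" for n
  proof -
    have n: "n > 0" using that a2 by simp
    have "norm s * ln (1 + 1 / real n) \<le> norm s * (1 / real n)"
      by (intro mult_left_mono lnu n) auto
    also have "\<dots> \<le> 1/2" using a that n by (simp add: field_simps)
    finally show ?thesis using lnu(2)[OF n] by (simp add: w_def norm_mult)
  qed
  have den: "norm (1 - exp (- w n)) \<ge> norm (w n) / 2" if "n \<ge> a" for n
    using norm_exp_bounds(1)[of "- w n"] wu[OF that] by (simp add: norm_minus_commute)
  have den0: "norm (w n) > 0" if "n > 0" for n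
    using wl[OF that] s1 by (smt (verit) divide_pos_pos of_nat_0_le_iff)
  have den1: "1 - exp (- w n) \<noteq> 0" if "n \<ge> a" for n
  proof -
    have "norm (w n) > 0" using that a2 by (intro den0) simp
    then show ?thesis using den[OF that] by auto
  qed
  have u1: "u (Suc n) = u n * exp (- w n)" if "n > 0" for n
  proof -
    have "ln (real (Suc n)) = ln (real n) + ln (1 + 1 / real n)"
    proof -
      have e: "real (Suc n) = real n * (1 + 1 / real n)" using that by (simp add: field_simps)
      have "1 + 1 / real n > 0" by (simp add: add_pos_nonneg)
      then show ?thesis unfolding e using that by (intro ln_mult_pos) auto
    qed
    then have "- s * of_real (ln (real (Suc n))) = - s * of_real (ln (real n)) + (- w n)"
      by (simp add: w_def algebra_simps)
    moreover have "u m = exp (- s * of_real (ln (real m)))" if "m > 0" for m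
      using that by (simp add: u_def powr_def Ln_of_nat)
    ultimately show ?thesis using that by (simp add: exp_add[symmetric] del: of_nat_Suc)
  qed
  have ur: "u n = r n * (u n - u (Suc n))" if "n \<ge> a" for n
  proof -
    have "u n - u (Suc n) = u n * (1 - exp (- w n))" using u1[of n] that a2 by (simp add: algebra_simps)
    then show ?thesis using den1[OF that] by (simp add: r_def)
  qed
  have rn: "norm (r n) \<le> 2 * (real n + 1) / norm s" if "n \<ge> a" for n
  proof -
    have n: "n > 0" using that a2 by simp
    have "norm (r n) = 1 / norm (1 - exp (- w n))" by (simp add: r_def norm_divide)
    also have "\<dots> \<le> 1 / (norm s / (real n + 1) / 2)"
    proof -
      have p: "norm s / (real n + 1) > 0" using s1 by (intro divide_pos_pos) auto
      moreover have "norm s / (real n + 1) / 2 \<le> norm (1 - exp (- w n))"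
        by (rule order_trans[OF divide_right_mono[OF wl[OF n]] den[OF that]]) simp
      moreover have "norm (1 - exp (- w n)) > 0" using den1[OF that] by simp
      ultimately show ?thesis by (intro divide_left_mono mult_pos_pos half_gt_zero) auto
    qed
    finally show ?thesis by (simp add: algebra_simps)
  qed
  have rd: "norm (r (Suc n) - r n) \<le> 36 / norm s" if "n \<ge> a" for n
  proof -
    have n: "n > 0" using that a2 by simp
    define A B where "A = 1 - exp (- w n)" "B = 1 - exp (- w (Suc n))"
    have AB: "A \<noteq> 0" "B \<noteq> 0" using den1[of n] den1[of "Suc n"] that by (auto simp: A_B_def)
    have "r (Suc n) - r n = (A - B) / (A * B)"
      unfolding r_def A_B_def[symmetric] using AB by (simp add: field_simps)
    also have "A - B = exp (- w n) * (exp (w n - w (Suc n)) - 1)"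
      by (simp add: A_B_def algebra_simps exp_add[symmetric])
    finally have e: "norm (r (Suc n) - r n) = norm (exp (- w n)) * norm (exp (w n - w (Suc n)) - 1) / (norm A * norm B)"
      by (simp add: norm_mult norm_divide)
    have lnd: "ln (1 + 1 / real n) - ln (1 + 1 / real (Suc n)) \<le> 1 / (real n * (real n + 2))"
    proof -
      have "ln (1 + 1 / real n) - ln (1 + 1 / real (Suc n)) = ln ((1 + 1 / real n) / (1 + 1 / real (Suc n)))"
        using n by (intro ln_divide_pos[symmetric]) (auto intro!: add_pos_nonneg)
      also have "(1 + 1 / real n) / (1 + 1 / real (Suc n)) = 1 + 1 / (real n * (real n + 2))"
        using n by (simp add: divide_simps) (simp add: algebra_simps)
      also have "ln \<dots> \<le> 1 / (real n * (real n + 2))"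
        by (rule ln_add_one_self_le_self) simp
      finally show ?thesis .
    qed
    have lnd0: "ln (1 + 1 / real n) - ln (1 + 1 / real (Suc n)) \<ge> 0"
      using n by (subst diff_ge_0_iff_ge, subst ln_le_cancel_iff) (auto intro!: add_pos_nonneg divide_left_mono)
    have wd: "norm (w n - w (Suc n)) \<le> norm s * (1 / (real n * (real n + 2)))"
    proof -
      have "w n - w (Suc n) = s * of_real (ln (1 + 1 / real n) - ln (1 + 1 / real (Suc n)))"
        by (simp add: w_def algebra_simps)
      then have "norm (w n - w (Suc n)) = norm s * (ln (1 + 1 / real n) - ln (1 + 1 / real (Suc n)))"
        using lnd0 by (simp add: norm_mult del: of_real_diff of_nat_Suc)
      also have "\<dots> \<le> norm s * (1 / (real n * (real n + 2)))" by (intro mult_left_mono lnd) auto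
      finally show ?thesis .
    qed
    have wd2: "norm (w n - w (Suc n)) \<le> 1/2"
    proof -
      have "norm s * (1 / (real n * (real n + 2))) \<le> norm s * (1 / real n)"
        using n by (intro mult_left_mono divide_left_mono) auto
      also have "\<dots> \<le> 1/2" using a that n by (simp add: field_simps)
      finally show ?thesis using wd by linarith
    qed
    have e1: "norm (exp (- w n)) \<le> 3"
    proof -
      have "norm (exp (- w n)) \<le> exp (norm (- w n))" by (rule norm_exp)
      also have "\<dots> \<le> exp 1" using wu[OF that] by simp
      also have "\<dots> \<le> 3" by (rule exp_le)
      finally show ?thesis .
    qed
    have e2: "norm (exp (w n - w (Suc n)) - 1) \<le> 3/2 * (norm s * (1 / (real n * (real n + 2))))"
      by (rule order_trans[OF norm_exp_bounds(2)[OF wd2] mult_left_mono[OF wd]]) simp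
    have nA: "norm A \<ge> norm s / (real n + 1) / 2"
      unfolding A_B_def by (rule order_trans[OF divide_right_mono[OF wl[OF n]] den[OF that]]) simp
    have an: "Suc n \<ge> a" using that by simp
    have "norm B \<ge> norm s / (real (Suc n) + 1) / 2"
      unfolding A_B_def by (rule order_trans[OF divide_right_mono[OF wl] den[OF an]]) simp_all
    then have nB: "norm B \<ge> norm s / (real n + 2) / 2" by (simp add: add_ac)
    have pA: "norm s / (real n + 1) / 2 > 0" "norm s / (real n + 2) / 2 > 0" using s1 by (auto intro!: divide_pos_pos)
    have "norm (r (Suc n) - r n) \<le> 3 * (3/2 * (norm s * (1 / (real n * (real n + 2))))) / ((norm s / (real n + 1) / 2) * (norm s / (real n + 2) / 2))"
      unfolding e using pA s1 by (intro frac_le mult_mono e1 e2 nA nB mult_pos_pos) auto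
    also have "\<dots> = 18 * ((real n + 1) / real n) / norm s"
    proof -
      have "3 * (3/2 * (S * (1 / (x * q)))) / ((S / p / 2) * (S / q / 2)) = 18 * (p / x) / S"
        if "S > 0" "x > 0" "p > 0" "q > 0" for S x p q :: real
        using that by (simp add: divide_simps)
      from this[of "norm s" "real n" "real n + 1" "real n + 2"] show ?thesis using n s1 by simp
    qed
    also have "\<dots> \<le> 36 / norm s"
      using n by (intro divide_right_mono) (auto simp: field_simps)
    finally show ?thesis .
  qed
  have nu: "norm (u n) = real n powr (- Re s)" if "n > 0" for n
    using that by (simp add: u_def norm_nat_powr)
  show ?thesis
  proof (cases "N = a")
    case False
    then have N: "N \<ge> a + 1" using a by simp
    have parts: "(\<Sum>n=a+1..M. u n) = r (a+1) * u (a+1) - r M * u (Suc M) + (\<Sum>n=a+1..<M. (r (Suc n) - r n) * u (Suc n))" if "M \<ge> a + 1" for M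
      using that
    proof (induction M rule: dec_induct)
      case base
      then show ?case using ur[of "a+1"] by (simp add: algebra_simps)
    next
      case (step M)
      have "(\<Sum>n=a+1..Suc M. u n) = (\<Sum>n=a+1..M. u n) + r (Suc M) * (u (Suc M) - u (Suc (Suc M)))"
        using step(1) ur[of "Suc M"] by simp
      moreover have "(\<Sum>n=a+1..<Suc M. (r (Suc n) - r n) * u (Suc n)) = (\<Sum>n=a+1..<M. (r (Suc n) - r n) * u (Suc n)) + (r (Suc M) - r M) * u (Suc M)"
        using step(1) by simp
      moreover have "A - r0 * u1 + S + r1 * (u1 - u2) = A - r1 * u2 + (S + (r1 - r0) * u1)" for A r0 r1 u1 u2 S :: complex
        by (simp add: algebra_simps)
      ultimately show ?case unfolding step.IH by (simp only:)
    qed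
    define c where "c = real N powr (1 - Re s) / norm s"
    have p1: "real n * real n powr (- Re s) = real n powr (1 - Re s)" if "n > 0" for n
      using that by (simp add: powr_diff powr_minus field_simps)
    have t1: "norm (r (a+1) * u (a+1)) \<le> 4 * c"
    proof -
      have "norm (r (a+1) * u (a+1)) \<le> (2 * (real (a+1) + 1) / norm s) * real (a+1) powr (- Re s)"
        unfolding norm_mult using rn[of "a+1"] nu[of "a+1"] by (intro mult_mono) auto
      also have "\<dots> \<le> (4 * real (a+1) / norm s) * real (a+1) powr (- Re s)"
        by (intro mult_right_mono divide_right_mono) auto
      also have "\<dots> = 4 * real (a+1) powr (1 - Re s) / norm s"
      proof -
        have "(4 * x / S) * y = 4 * (x * y) / S" for x y S :: real by simp
        moreover have "real (a+1) * real (a+1) powr (- Re s) = real (a+1) powr (1 - Re s)" by (rule p1) simp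
        ultimately show ?thesis by (simp only:)
      qed
      also have "\<dots> \<le> 4 * real N powr (1 - Re s) / norm s"
        using N s by (intro divide_right_mono mult_left_mono powr_mono2) auto
      finally show ?thesis by (simp add: c_def)
    qed
    have t2: "norm (r N * u (Suc N)) \<le> 4 * c"
    proof -
      have "norm (r N * u (Suc N)) \<le> (2 * (real N + 1) / norm s) * real (Suc N) powr (- Re s)"
        unfolding norm_mult using rn[of N] nu[of "Suc N"] a by (intro mult_mono) auto
      also have "\<dots> \<le> (2 * (real N + 1) / norm s) * real N powr (- Re s)"
        using N s by (intro mult_left_mono powr_mono2') auto
      also have "\<dots> \<le> (4 * real N / norm s) * real N powr (- Re s)"
        using N by (intro mult_right_mono divide_right_mono) auto
      also have "\<dots> = 4 * c" using p1[of N] N by (simp add: c_def mult.assoc)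
      finally show ?thesis .
    qed
    have pw: "real (Suc n) powr (- Re s) \<le> 4 * (real (Suc n) powr (1 - Re s) - real n powr (1 - Re s))" for n
    proof (cases "n = 0")
      case False
      have "\<exists>z>real n. z < real n + 1 \<and> (real n + 1) powr (1 - Re s) - real n powr (1 - Re s) = (real n + 1 - real n) * ((1 - Re s) * z powr (1 - Re s - 1))"
        by (rule MVT2) (use False in \<open>auto intro!: derivative_eq_intros\<close>)
      then obtain z where z: "z > real n" "z < real n + 1" "(real n + 1) powr (1 - Re s) - real n powr (1 - Re s) = (1 - Re s) * z powr (- Re s)"
        by auto
      have "(1/4) * (real n + 1) powr (- Re s) \<le> (1 - Re s) * z powr (- Re s)"
        using z s by (intro mult_mono powr_mono2') auto
      then show ?thesis using z(3) by (simp add: add.commute)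
    qed auto
    have sumpw: "(\<Sum>n=1..M. real n powr (- Re s)) \<le> 4 * real M powr (1 - Re s)" for M
    proof (induction M)
      case (Suc M)
      then show ?case using pw[of M] by simp
    qed simp
    have t3: "norm (\<Sum>n=a+1..<N. (r (Suc n) - r n) * u (Suc n)) \<le> 144 * c"
    proof -
      have "norm (\<Sum>n=a+1..<N. (r (Suc n) - r n) * u (Suc n)) \<le> (\<Sum>n=a+1..<N. 36 / norm s * real (Suc n) powr (- Re s))"
      proof (rule sum_norm_le)
        fix n assume "n \<in> {a+1..<N}"
        then show "norm ((r (Suc n) - r n) * u (Suc n)) \<le> 36 / norm s * real (Suc n) powr (- Re s)"
          unfolding norm_mult using rd[of n] nu[of "Suc n"] by (intro mult_mono) auto
      qed
      also have "\<dots> = 36 / norm s * (\<Sum>n=a+1..<N. real (Suc n) powr (- Re s))"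
        by (simp add: sum_distrib_left)
      also have "(\<Sum>n=a+1..<N. real (Suc n) powr (- Re s)) = (\<Sum>n=Suc (a+1)..<Suc N. real n powr (- Re s))"
        by (simp only: sum.shift_bounds_Suc_ivl)
      finally have le: "norm (\<Sum>n=a+1..<N. (r (Suc n) - r n) * u (Suc n)) \<le> 36 / norm s * (\<Sum>n=Suc (a+1)..<Suc N. real n powr (- Re s))" .
      have "(\<Sum>n=Suc (a+1)..<Suc N. real n powr (- Re s)) \<le> (\<Sum>n=1..N. real n powr (- Re s))"
        by (rule sum_mono2) auto
      also have "\<dots> \<le> 4 * real N powr (1 - Re s)" by (rule sumpw)
      finally have "36 / norm s * (\<Sum>n=Suc (a+1)..<Suc N. real n powr (- Re s)) \<le> 36 / norm s * (4 * real N powr (1 - Re s))"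
        by (intro mult_left_mono) auto
      with le show ?thesis by (simp add: c_def)
    qed
    have "norm (\<Sum>n=a+1..N. u n) \<le> norm (r (a+1) * u (a+1) - r N * u (Suc N)) + 144 * c"
      unfolding parts[OF N] by (rule norm_triangle_mono[OF order_refl t3])
    also have "norm (r (a+1) * u (a+1) - r N * u (Suc N)) \<le> 4 * c + 4 * c"
      by (rule order_trans[OF norm_triangle_ineq4]) (use t1 t2 in linarith)
    finally show ?thesis by (simp add: u_def c_def)
  qed simp
qed

text \<open>
  Euler-Maclaurin is accurate only for long sums, N much larger than the ordinate. The block bound allows the sum to be shortened to any length beyond twice the modulus of s, uniformly, which matters since the sieve uses many different lengths.
\<close>
lemma zeta_partial_sum_approx:
  fixes s :: complex
  assumes s: "1/2 \<le> Re s" "Re s \<le> 3/4" and a: "2 * norm s \<le> real a" "a \<le> N" and t: "\<bar>Im s\<bar> \<ge> 1"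
  shows "norm (zeta s - (\<Sum>n=1..a. of_nat n powr (-s))) \<le>
     153 * real N powr (1/2) / \<bar>Im s\<bar> + real N powr (-1/2) + 12 * \<bar>Im s\<bar>\<^sup>2 * real N powr (-3/2)"
proof -
  have n1: "norm s \<ge> \<bar>Im s\<bar>" "norm (s - 1) \<ge> \<bar>Im s\<bar>" using abs_Im_le_cmod[of s] abs_Im_le_cmod[of "s - 1"] by auto
  have N: "N \<ge> 1" using a n1 t by (cases N) auto
  have n2: "norm s \<le> 2 * \<bar>Im s\<bar>" "norm (s + 1) \<le> 3 * \<bar>Im s\<bar>"
    using cmod_le[of s] cmod_le[of "s + 1"] s t by auto
  have s1: "s \<noteq> 1" "s - 1 \<noteq> 0" using t by auto
  have NN: "real N \<ge> 1" using N by simp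
  have p: "real N powr (1 - Re s) \<le> real N powr (1/2)" "real N powr (- Re s) \<le> real N powr (-1/2)"
     "real N powr (- Re s - 1) \<le> real N powr (-3/2)"
    using s NN by (auto intro!: powr_mono)
  have "zeta s - ((\<Sum>n=1..N. of_nat n powr (-s)) + of_nat N powr (1 - s) / (s - 1)) =
      (zpre s - ((s - 1) * (\<Sum>n=1..N. of_nat n powr (-s)) + of_nat N powr (1 - s))) / (s - 1)"
    using zeta_eq_zpre[of s] s s1 by (simp add: diff_divide_distrib add_divide_distrib)
  then have "norm (zeta s - ((\<Sum>n=1..N. of_nat n powr (-s)) + of_nat N powr (1 - s) / (s - 1)))
      = norm (zpre s - ((s - 1) * (\<Sum>n=1..N. of_nat n powr (-s)) + of_nat N powr (1 - s))) / norm (s - 1)"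
    by (simp only: norm_divide)
  also have "\<dots> \<le> (norm (s - 1) * (real N powr (- Re s) / 2 + 2 * norm s * norm (s + 1) * real N powr (- Re s - 1))) / norm (s - 1)"
    using s N by (intro divide_right_mono zpre_approx) auto
  also have "\<dots> = real N powr (- Re s) / 2 + 2 * norm s * norm (s + 1) * real N powr (- Re s - 1)"
    using s1 by simp
  also have "\<dots> \<le> real N powr (-1/2) + 2 * (2 * \<bar>Im s\<bar>) * (3 * \<bar>Im s\<bar>) * real N powr (-3/2)"
  proof (intro add_mono)
    show "real N powr (- Re s) / 2 \<le> real N powr (-1/2)" using p(2) powr_ge_zero[of "real N" "-1/2"] by linarith
    show "2 * norm s * norm (s + 1) * real N powr (- Re s - 1) \<le> 2 * (2 * \<bar>Im s\<bar>) * (3 * \<bar>Im s\<bar>) * real N powr (-3/2)"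
      using p n2 t by (intro mult_mono) auto
  qed
  finally have 1: "norm (zeta s - ((\<Sum>n=1..N. of_nat n powr (-s)) + of_nat N powr (1 - s) / (s - 1)))
      \<le> real N powr (-1/2) + 12 * \<bar>Im s\<bar>\<^sup>2 * real N powr (-3/2)" by (simp add: power2_eq_square)
  have 2: "norm (of_nat N powr (1 - s) / (s - 1)) \<le> real N powr (1/2) / \<bar>Im s\<bar>"
    unfolding norm_divide using N p n1 t norm_nat_powr[of N "1 - s"] by (intro frac_le) auto
  have 3: "norm (\<Sum>n=a+1..N. of_nat n powr (-s)) \<le> 152 * real N powr (1/2) / \<bar>Im s\<bar>"
  proof -
    have "norm (\<Sum>n=a+1..N. of_nat n powr (-s)) \<le> 152 * real N powr (1 - Re s) / norm s"
      by (rule dirichlet_block_bound) (use s a n1 t in auto)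
    also have "\<dots> \<le> 152 * real N powr (1/2) / \<bar>Im s\<bar>"
      using p n1 t by (intro frac_le) auto
    finally show ?thesis .
  qed
  have "(\<Sum>n=1..N. (of_nat n :: complex) powr (-s)) = (\<Sum>n=1..a. of_nat n powr (-s)) + (\<Sum>n=a+1..N. of_nat n powr (-s))"
    using a(2) sum.ub_add_nat[of 1 a "\<lambda>n. (of_nat n :: complex) powr (-s)" "N - a"] by simp
  then have eq: "zeta s - (\<Sum>n=1..a. of_nat n powr (-s)) = 
     (zeta s - ((\<Sum>n=1..N. of_nat n powr (-s)) + of_nat N powr (1 - s) / (s - 1)))
     + ((\<Sum>n=a+1..N. of_nat n powr (-s)) + of_nat N powr (1 - s) / (s - 1))" by simp
  have "norm (zeta s - (\<Sum>n=1..a. of_nat n powr (-s))) \<le> (real N powr (-1/2) + 12 * \<bar>Im s\<bar>\<^sup>2 * real N powr (-3/2))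
      + (152 * real N powr (1/2) / \<bar>Im s\<bar> + real N powr (1/2) / \<bar>Im s\<bar>)"
    unfolding eq by (intro norm_triangle_mono 1 2 3)
  then show ?thesis by (simp add: add_divide_distrib)
qed

section \<open>Mean values of Dirichlet polynomials\<close>

lemma norm_integral_cis_le:
  assumes "\<theta> \<noteq> 0" "A \<le> B"
  shows "norm (integral {A..B} (\<lambda>t. cis (\<theta> * t))) \<le> 2 / \<bar>\<theta>\<bar>"
proof -
  have "((\<lambda>t. cis (\<theta> * t)) has_integral (cis (\<theta> * B) / (\<i> * \<theta>) - cis (\<theta> * A) / (\<i> * \<theta>))) {A..B}"
  proof (rule fundamental_theorem_of_calculus)
    fix t
    have "((\<lambda>t. cis (\<theta> * t)) has_vector_derivative (\<theta> *\<^sub>R (\<i> * cis (\<theta> * t)))) (at t within {A..B})"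
      using exp_scaleR_has_vector_derivative_right[of "\<i> * complex_of_real \<theta>" t "{A..B}"]
      unfolding cis_conv_exp by (simp add: scaleR_conv_of_real mult_ac)
    then have "((\<lambda>t. cis (\<theta> * t) / (\<i> * \<theta>)) has_vector_derivative (\<theta> *\<^sub>R (\<i> * cis (\<theta> * t))) / (\<i> * \<theta>)) (at t within {A..B})"
      by (rule has_vector_derivative_divide)
    then show "((\<lambda>t. cis (\<theta> * t) / (\<i> * \<theta>)) has_vector_derivative cis (\<theta> * t)) (at t within {A..B})"
      using assms by (simp add: scaleR_conv_of_real)
  qed (use assms in auto)
  then have "integral {A..B} (\<lambda>t. cis (\<theta> * t)) = (cis (\<theta> * B) - cis (\<theta> * A)) / (\<i> * \<theta>)"
    by (simp add: integral_unique diff_divide_distrib)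
  also have "norm \<dots> \<le> (norm (cis (\<theta> * B)) + norm (cis (\<theta> * A))) / \<bar>\<theta>\<bar>"
    unfolding norm_divide norm_mult by (intro frac_le norm_triangle_ineq4) (use assms in auto)
  finally show ?thesis by simp
qed

text \<open>
  The derivative of the logarithm is at least 1/K up to K.
\<close>
lemma abs_ln_diff_ge:
  assumes "0 < k" "0 < l" "k \<le> K" "l \<le> (K::nat)"
  shows "\<bar>ln (real k) - ln (real l)\<bar> \<ge> \<bar>real k - real l\<bar> / real K"
proof -
  have *: "ln (real b) - ln (real a) \<ge> (real b - real a) / real K" if "0 < a" "a \<le> b" "b \<le> K" for a b
  proof -
    have "ln (real a / real b) \<le> real a / real b - 1" using that by (intro ln_le_minus_one) auto
    moreover have "ln (real a / real b) = ln (real a) - ln (real b)" using that by (intro ln_divide_pos) auto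
    moreover have "1 - real a / real b = (real b - real a) / real b" using that by (simp add: field_simps)
    moreover have "(real b - real a) / real b \<ge> (real b - real a) / real K"
      using that by (intro divide_left_mono) auto
    ultimately show ?thesis by linarith
  qed
  show ?thesis
    using *[of k l] *[of l k] assms by (cases "k \<le> l") (auto simp: abs_if split: if_splits)
qed

lemma harm_le_ln: "K > 0 \<Longrightarrow> (harm K :: real) \<le> 1 + ln (real K)"
proof -
  assume "K > 0"
  then obtain n where n: "K = Suc n" by (cases K) auto
  have "harm (Suc n) - ln (real (Suc n)) \<le> harm (Suc 0) - ln (real (Suc 0))"
    using decseqD[OF decseq_harm_diff_ln, of 0 n] by simp
  then show ?thesis unfolding n by (simp add: harm_def)
qed

lemma sum_inverse_dist_le:
  assumes k: "0 < k" "k \<le> K"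
  shows "(\<Sum>l\<in>{1..K} - {k}. 1 / \<bar>real k - real l\<bar>) \<le> 2 * (1 + ln (real K))"
proof -
  have e: "{1..K} - {k} = {1..<k} \<union> {k<..K}" using k by auto
  have "(\<Sum>l\<in>{1..K} - {k}. 1 / \<bar>real k - real l\<bar>) = (\<Sum>l\<in>{1..<k}. 1 / \<bar>real k - real l\<bar>) + (\<Sum>l\<in>{k<..K}. 1 / \<bar>real k - real l\<bar>)"
    unfolding e by (rule sum.union_disjoint) auto
  also have "(\<Sum>l\<in>{1..<k}. 1 / \<bar>real k - real l\<bar>) = (\<Sum>m\<in>{1..<k}. 1 / real m)"
    by (rule sum.reindex_bij_witness[of _ "\<lambda>m. k - m" "\<lambda>l. k - l"]) auto
  also have "(\<Sum>l\<in>{k<..K}. 1 / \<bar>real k - real l\<bar>) = (\<Sum>m\<in>{1..K-k}. 1 / real m)"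
    by (rule sum.reindex_bij_witness[of _ "\<lambda>m. k + m" "\<lambda>l. l - k"]) auto
  also have "(\<Sum>m\<in>{1..<k}. 1 / real m) \<le> harm K"
    unfolding harm_def inverse_eq_divide using k by (intro sum_mono2) auto
  also have "(\<Sum>m\<in>{1..K-k}. 1 / real m) \<le> harm K"
    unfolding harm_def inverse_eq_divide using k by (intro sum_mono2) auto
  finally show ?thesis using harm_le_ln[of K] k by simp
qed

text \<open>
  Expanding the square, the off-diagonal terms are bounded by the reciprocal of the distance of the logarithms, hence of the integers; the product of two coefficients is split by the inequality between the arithmetic and the geometric mean, so that a harmonic sum remains. Index set and frequencies are separate because the application has frequencies that are products.
\<close>
lemma dirichlet_polynomial_mean_value:
  fixes b :: "'i \<Rightarrow> complex" and k :: "'i \<Rightarrow> nat"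
  assumes fin: "finite I" and inj: "inj_on k I" and k: "\<And>i. i \<in> I \<Longrightarrow> 0 < k i \<and> k i \<le> K" and T: "T \<ge> 0"
  shows "integral {A..A+T} (\<lambda>t. (norm (\<Sum>i\<in>I. b i * cis (- t * ln (real (k i)))))\<^sup>2)
     \<le> (T + 4 * real K * (1 + ln (real K))) * (\<Sum>i\<in>I. (norm (b i))\<^sup>2)"
proof -
  define \<theta> where "\<theta> = (\<lambda>i j. ln (real (k j)) - ln (real (k i)))"
  have pw: "(norm (\<Sum>i\<in>I. b i * cis (- t * ln (real (k i)))))\<^sup>2 = (\<Sum>i\<in>I. \<Sum>j\<in>I. Re (b i * cnj (b j) * cis (\<theta> i j * t)))" for t
  proof -
    have "complex_of_real ((norm (\<Sum>i\<in>I. b i * cis (- t * ln (real (k i)))))\<^sup>2)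
       = (\<Sum>i\<in>I. b i * cis (- t * ln (real (k i)))) * cnj (\<Sum>i\<in>I. b i * cis (- t * ln (real (k i))))"
      by (simp add: complex_norm_square flip: of_real_power)
    also have "\<dots> = (\<Sum>i\<in>I. \<Sum>j\<in>I. (b i * cis (- t * ln (real (k i)))) * (cnj (b j) * cis (t * ln (real (k j)))))"
      by (simp add: sum_product cis_cnj)
    also have "\<dots> = (\<Sum>i\<in>I. \<Sum>j\<in>I. b i * cnj (b j) * cis (\<theta> i j * t))"
      by (intro sum.cong refl) (simp add: \<theta>_def cis_mult[symmetric] algebra_simps cis_mult)
    finally have "Re (complex_of_real ((norm (\<Sum>i\<in>I. b i * cis (- t * ln (real (k i)))))\<^sup>2)) = Re \<dots>" by (rule arg_cong)
    then show ?thesis by simp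
  qed
  have cc: "continuous_on {A..A+T} (\<lambda>t. Re (b i * cnj (b j) * cis (\<theta> i j * t)))" for i j
    unfolding cis_conv_exp by (intro continuous_intros)
  have io: "(\<lambda>t. Re (b i * cnj (b j) * cis (\<theta> i j * t))) integrable_on {A..A+T}" for i j
    by (rule integrable_continuous_real[OF cc])
  have "integral {A..A+T} (\<lambda>t. (norm (\<Sum>i\<in>I. b i * cis (- t * ln (real (k i)))))\<^sup>2)
     = (\<Sum>i\<in>I. \<Sum>j\<in>I. integral {A..A+T} (\<lambda>t. Re (b i * cnj (b j) * cis (\<theta> i j * t))))"
    unfolding pw using fin io by (simp add: integral_sum integrable_sum)
  also have "\<dots> \<le> (\<Sum>i\<in>I. \<Sum>j\<in>I. (if i = j then T * (norm (b i))\<^sup>2 else ((norm (b i))\<^sup>2 + (norm (b j))\<^sup>2) * (real K / \<bar>real (k i) - real (k j)\<bar>)))"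
  proof (intro sum_mono)
    fix i j assume ij: "i \<in> I" "j \<in> I"
    show "integral {A..A+T} (\<lambda>t. Re (b i * cnj (b j) * cis (\<theta> i j * t))) \<le>
      (if i = j then T * (norm (b i))\<^sup>2 else ((norm (b i))\<^sup>2 + (norm (b j))\<^sup>2) * (real K / \<bar>real (k i) - real (k j)\<bar>))"
    proof (cases "i = j")
      case True
      then show ?thesis using T by (simp add: \<theta>_def complex_norm_square[symmetric] flip: of_real_power)
    next
      case False
      have kk: "k i \<noteq> k j" using inj ij False by (auto simp: inj_on_def)
      have kp: "0 < k i" "k i \<le> K" "0 < k j" "k j \<le> K" using k ij by auto
      have "ln (real (k i)) \<noteq> ln (real (k j))" using kk kp by simp
      then have th: "\<theta> i j \<noteq> 0" by (simp add: \<theta>_def)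
      have ig: "(\<lambda>t. cis (\<theta> i j * t)) integrable_on {A..A+T}"
        unfolding cis_conv_exp by (intro integrable_continuous_real continuous_intros)
      have "integral {A..A+T} (\<lambda>t. Re (b i * cnj (b j) * cis (\<theta> i j * t))) = Re (integral {A..A+T} (\<lambda>t. b i * cnj (b j) * cis (\<theta> i j * t)))"
        by (rule integral_linear[OF _ bounded_linear_Re, unfolded o_def]) (use ig in \<open>simp add: integrable_on_mult_right mult.assoc\<close>)
      also have "\<dots> = Re (b i * cnj (b j) * integral {A..A+T} (\<lambda>t. cis (\<theta> i j * t)))"
        by simp
      also have "\<dots> \<le> norm (b i) * norm (b j) * norm (integral {A..A+T} (\<lambda>t. cis (\<theta> i j * t)))"
        using complex_Re_le_cmod[of "b i * cnj (b j) * integral {A..A+T} (\<lambda>t. cis (\<theta> i j * t))"] by (simp add: norm_mult)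
      also have "\<dots> \<le> norm (b i) * norm (b j) * (2 / \<bar>\<theta> i j\<bar>)"
        using norm_integral_cis_le[OF th, of A "A+T"] T by (intro mult_left_mono) auto
      also have "\<dots> \<le> norm (b i) * norm (b j) * (2 * (real K / \<bar>real (k i) - real (k j)\<bar>))"
      proof (intro mult_left_mono)
        have "\<bar>\<theta> i j\<bar> \<ge> \<bar>real (k j) - real (k i)\<bar> / real K"
          unfolding \<theta>_def by (rule abs_ln_diff_ge) (use kp in auto)
        moreover have "\<bar>real (k j) - real (k i)\<bar> / real K > 0" using kk kp by auto
        ultimately have "2 / \<bar>\<theta> i j\<bar> \<le> 2 / (\<bar>real (k j) - real (k i)\<bar> / real K)"
          by (intro divide_left_mono mult_pos_pos) linarith+
        then show "2 / \<bar>\<theta> i j\<bar> \<le> 2 * (real K / \<bar>real (k i) - real (k j)\<bar>)"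
          by (simp add: abs_minus_commute)
      qed auto
      also have "\<dots> = (2 * norm (b i) * norm (b j)) * (real K / \<bar>real (k i) - real (k j)\<bar>)" by simp
      also have "\<dots> \<le> ((norm (b i))\<^sup>2 + (norm (b j))\<^sup>2) * (real K / \<bar>real (k i) - real (k j)\<bar>)"
        by (intro mult_right_mono sum_squares_bound) auto
      finally show ?thesis using False by simp
    qed
  qed
  also have "\<dots> = (\<Sum>i\<in>I. T * (norm (b i))\<^sup>2 + (\<Sum>j\<in>I - {i}. ((norm (b i))\<^sup>2 + (norm (b j))\<^sup>2) * (real K / \<bar>real (k i) - real (k j)\<bar>)))"
  proof (intro sum.cong refl)
    fix i assume i: "i \<in> I"
    show "(\<Sum>j\<in>I. (if i = j then T * (norm (b i))\<^sup>2 else ((norm (b i))\<^sup>2 + (norm (b j))\<^sup>2) * (real K / \<bar>real (k i) - real (k j)\<bar>)))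
       = T * (norm (b i))\<^sup>2 + (\<Sum>j\<in>I - {i}. ((norm (b i))\<^sup>2 + (norm (b j))\<^sup>2) * (real K / \<bar>real (k i) - real (k j)\<bar>))"
      unfolding sum.remove[OF fin i] by (intro arg_cong2[where f = "(+)"] sum.cong) auto
  qed
  also have "\<dots> = T * (\<Sum>i\<in>I. (norm (b i))\<^sup>2)
     + ((\<Sum>i\<in>I. \<Sum>j\<in>I - {i}. (norm (b i))\<^sup>2 * (real K / \<bar>real (k i) - real (k j)\<bar>))
       + (\<Sum>i\<in>I. \<Sum>j\<in>I - {i}. (norm (b j))\<^sup>2 * (real K / \<bar>real (k i) - real (k j)\<bar>)))"
    by (simp add: sum.distrib sum_distrib_left distrib_right add_divide_distrib)
  also have "(\<Sum>i\<in>I. \<Sum>j\<in>I - {i}. (norm (b j))\<^sup>2 * (real K / \<bar>real (k i) - real (k j)\<bar>))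
     = (\<Sum>i\<in>I. \<Sum>j\<in>I - {i}. (norm (b i))\<^sup>2 * (real K / \<bar>real (k i) - real (k j)\<bar>))"
  proof -
    have e: "(\<Sum>j\<in>I - {i}. g i j) = (\<Sum>j\<in>I. if i = j then 0 else g i j)" if "i \<in> I" for g :: "'i \<Rightarrow> 'i \<Rightarrow> real" and i
      by (rule sum.mono_neutral_cong_left) (use fin in auto)
    have "(\<Sum>i\<in>I. \<Sum>j\<in>I - {i}. (norm (b j))\<^sup>2 * (real K / \<bar>real (k i) - real (k j)\<bar>))
       = (\<Sum>i\<in>I. \<Sum>j\<in>I. if i = j then 0 else (norm (b j))\<^sup>2 * (real K / \<bar>real (k i) - real (k j)\<bar>))"
      by (intro sum.cong refl e)
    also have "\<dots> = (\<Sum>j\<in>I. \<Sum>i\<in>I. if i = j then 0 else (norm (b j))\<^sup>2 * (real K / \<bar>real (k i) - real (k j)\<bar>))"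
      by (rule sum.swap)
    also have "\<dots> = (\<Sum>i\<in>I. \<Sum>j\<in>I. if i = j then 0 else (norm (b i))\<^sup>2 * (real K / \<bar>real (k i) - real (k j)\<bar>))"
      by (intro sum.cong refl) (auto simp: abs_minus_commute)
    also have "\<dots> = (\<Sum>i\<in>I. \<Sum>j\<in>I - {i}. (norm (b i))\<^sup>2 * (real K / \<bar>real (k i) - real (k j)\<bar>))"
      by (intro sum.cong refl e[symmetric])
    finally show ?thesis .
  qed
  also have "(\<Sum>i\<in>I. \<Sum>j\<in>I - {i}. (norm (b i))\<^sup>2 * (real K / \<bar>real (k i) - real (k j)\<bar>)) \<le> (\<Sum>i\<in>I. (norm (b i))\<^sup>2 * (real K * (2 * (1 + ln (real K)))))"
  proof (intro sum_mono)
    fix i assume i: "i \<in> I"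
    have kp: "0 < k i" "k i \<le> K" using k i by auto
    have "(\<Sum>j\<in>I - {i}. 1 / \<bar>real (k i) - real (k j)\<bar>) = (\<Sum>l\<in>k ` (I - {i}). 1 / \<bar>real (k i) - real l\<bar>)"
      by (subst sum.reindex) (auto intro: inj_on_subset[OF inj])
    also have "\<dots> \<le> (\<Sum>l\<in>{1..K} - {k i}. 1 / \<bar>real (k i) - real l\<bar>)"
    proof (rule sum_mono2)
      show "k ` (I - {i}) \<subseteq> {1..K} - {k i}"
        using k inj i by (force simp: inj_on_def Suc_le_eq)
    qed auto
    also have "\<dots> \<le> 2 * (1 + ln (real K))" by (rule sum_inverse_dist_le[OF kp])
    finally have "(\<Sum>j\<in>I - {i}. 1 / \<bar>real (k i) - real (k j)\<bar>) \<le> 2 * (1 + ln (real K))" .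
    then have "(norm (b i))\<^sup>2 * (real K * (\<Sum>j\<in>I - {i}. 1 / \<bar>real (k i) - real (k j)\<bar>)) \<le> (norm (b i))\<^sup>2 * (real K * (2 * (1 + ln (real K))))"
      by (intro mult_left_mono) auto
    then show "(\<Sum>j\<in>I - {i}. (norm (b i))\<^sup>2 * (real K / \<bar>real (k i) - real (k j)\<bar>)) \<le> (norm (b i))\<^sup>2 * (real K * (2 * (1 + ln (real K))))"
      by (simp add: sum_distrib_left)
  qed
  also have "T * (\<Sum>i\<in>I. (norm (b i))\<^sup>2) + ((\<Sum>i\<in>I. (norm (b i))\<^sup>2 * (real K * (2 * (1 + ln (real K))))) + (\<Sum>i\<in>I. (norm (b i))\<^sup>2 * (real K * (2 * (1 + ln (real K))))))
     = (T + 4 * real K * (1 + ln (real K))) * (\<Sum>i\<in>I. (norm (b i))\<^sup>2)"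
    unfolding sum_distrib_right[symmetric] by (simp add: algebra_simps)
  finally show ?thesis by simp
qed

section \<open>Cauchy estimates in mean square\<close>

lemma integral_power2_le:
  fixes f :: "real \<Rightarrow> real"
  assumes ab: "a < b" and f: "continuous_on {a..b} f"
  shows "(integral {a..b} f)\<^sup>2 \<le> (b - a) * integral {a..b} (\<lambda>x. (f x)\<^sup>2)"
proof -
  define c where "c = integral {a..b} f / (b - a)"
  have i1: "f integrable_on {a..b}" "(\<lambda>x. (f x)\<^sup>2) integrable_on {a..b}"
    by (intro integrable_continuous_real continuous_intros f)+
  have "0 \<le> integral {a..b} (\<lambda>x. (f x - c)\<^sup>2)"
    by (intro integral_nonneg integrable_continuous_real continuous_intros f) auto
  also have "(\<lambda>x. (f x - c)\<^sup>2) = (\<lambda>x. (f x)\<^sup>2 - 2 * c * f x + c\<^sup>2)"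
    by (simp add: power2_eq_square algebra_simps fun_eq_iff)
  also have "integral {a..b} \<dots> = integral {a..b} (\<lambda>x. (f x)\<^sup>2) - 2 * c * integral {a..b} f + c\<^sup>2 * (b - a)"
  proof (rule integral_unique)
    have "((\<lambda>x. (f x)\<^sup>2 - 2 * c * f x + c\<^sup>2) has_integral
        (integral {a..b} (\<lambda>x. (f x)\<^sup>2) - 2 * c * integral {a..b} f + (b - a) *\<^sub>R c\<^sup>2)) {a..b}"
      using has_integral_const_real[of "c\<^sup>2" a b] ab
      by (intro has_integral_add has_integral_diff has_integral_mult_right integrable_integral i1) simp
    then show "((\<lambda>x. (f x)\<^sup>2 - 2 * c * f x + c\<^sup>2) has_integral
        (integral {a..b} (\<lambda>x. (f x)\<^sup>2) - 2 * c * integral {a..b} f + c\<^sup>2 * (b - a))) {a..b}"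
      by (simp add: mult.commute)
  qed
  also have "integral {a..b} f = c * (b - a)" using ab by (simp add: c_def)
  finally have "c\<^sup>2 * (b - a) \<le> integral {a..b} (\<lambda>x. (f x)\<^sup>2)" by (simp add: power2_eq_square algebra_simps)
  then have "(b - a) * (c\<^sup>2 * (b - a)) \<le> (b - a) * integral {a..b} (\<lambda>x. (f x)\<^sup>2)"
    using ab by (intro mult_left_mono) auto
  moreover have "(integral {a..b} f)\<^sup>2 = (b - a) * (c\<^sup>2 * (b - a))"
    using ab by (simp add: c_def power2_eq_square)
  ultimately show ?thesis by simp
qed

lemma power2_sum3_le: "(x + y + z)\<^sup>2 \<le> 3 * (x\<^sup>2 + y\<^sup>2 + (z::real)\<^sup>2)"
proof -
  have "3 * (x\<^sup>2 + y\<^sup>2 + z\<^sup>2) - (x + y + z)\<^sup>2 = (x - y)\<^sup>2 + (y - z)\<^sup>2 + (x - z)\<^sup>2"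
    by (simp add: power2_eq_square algebra_simps)
  then show ?thesis by (smt (verit) zero_le_power2)
qed

text \<open>
  Cauchy's formula for g times Z to the power (z - s) times the exponential of the square of z - s. The power of Z balances the two vertical sides against each other when g is much larger on one of them, and the Gaussian makes the horizontal sides negligible. The Cauchy-Schwarz inequality turns the vertical integrals into mean squares.
\<close>
lemma cauchy_rectangle_bound:
  fixes g :: "complex \<Rightarrow> complex"
  assumes S: "g holomorphic_on S" and ab: "a < \<sigma>" "\<sigma> < b" "b - a \<le> 2" and U: "U > 0" and Z: "Z \<ge> 1"
    and box: "cbox (Complex a (\<tau> - U)) (Complex b (\<tau> + U)) \<subseteq> S"
    and G: "\<And>x. a \<le> x \<Longrightarrow> x \<le> b \<Longrightarrow> norm (g (Complex x (\<tau> - U))) \<le> G \<and> norm (g (Complex x (\<tau> + U))) \<le> G"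
  shows "(norm (g (Complex \<sigma> \<tau>)))\<^sup>2 \<le> 3 * ((Z powr (b - \<sigma>) * exp 4 / (b - \<sigma>))\<^sup>2 * (2 * U) * integral {\<tau>-U..\<tau>+U} (\<lambda>y. (norm (g (Complex b y)))\<^sup>2)
      + (Z powr (a - \<sigma>) * exp 4 / (\<sigma> - a))\<^sup>2 * (2 * U) * integral {\<tau>-U..\<tau>+U} (\<lambda>y. (norm (g (Complex a y)))\<^sup>2)
      + (4 * G * Z powr 2 * exp (4 - U\<^sup>2) / U)\<^sup>2)"
proof -
  define s where "s = Complex \<sigma> \<tau>"
  define R where "R = cbox (Complex a (\<tau> - U)) (Complex b (\<tau> + U))"
  define h where "h = (\<lambda>w. g w * exp ((w - s)\<^sup>2) * of_real Z powr (w - s))"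
  define q where "q = (\<lambda>w. h w / (w - s))"
  have inR: "w \<in> R \<longleftrightarrow> a \<le> Re w \<and> Re w \<le> b \<and> \<tau> - U \<le> Im w \<and> Im w \<le> \<tau> + U" for w
    by (simp add: R_def in_cbox_complex_iff)
  have gR: "g holomorphic_on R" using S box unfolding R_def by (rule holomorphic_on_subset)
  have hR: "h holomorphic_on R" unfolding h_def using gR Z by (intro holomorphic_intros) auto
  define p1 p2 p3 p4 where "p1 = Complex a (\<tau> - U)" "p2 = Complex b (\<tau> - U)" "p3 = Complex b (\<tau> + U)" "p4 = Complex a (\<tau> + U)"
  have ci: "((\<lambda>w. h w / (w - s)) has_contour_integral (2 * pi * \<i> * winding_number (rectpath p1 p3) s * h s)) (rectpath p1 p3)"
  proof (rule Cauchy_integral_formula_convex_simple)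
    show "convex R" by (simp add: R_def)
    show "s \<in> interior R" unfolding R_def interior_cbox using ab U by (simp add: s_def in_box_complex_iff)
    show "path_image (rectpath p1 p3) \<subseteq> R - {s}"
    proof -
      have "path_image (rectpath p1 p3) = cbox p1 p3 - box p1 p3"
        using ab U by (intro path_image_rectpath_cbox_minus_box) (auto simp: p1_p2_p3_p4_def)
      moreover have "s \<in> box p1 p3" using ab U by (simp add: s_def p1_p2_p3_p4_def in_box_complex_iff)
      ultimately show ?thesis by (auto simp: R_def p1_p2_p3_p4_def)
    qed
  qed (auto intro: hR)
  have "winding_number (rectpath p1 p3) s = 1"
    by (rule winding_number_rectpath) (use ab U in \<open>simp add: s_def p1_p2_p3_p4_def in_box_complex_iff\<close>)
  moreover have "h s = g s" using Z by (simp add: h_def)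
  ultimately have CI: "contour_integral (rectpath p1 p3) q = 2 * pi * \<i> * g s"
    using contour_integral_unique[OF ci] by (simp add: q_def)
  have seg: "closed_segment p1 p2 \<subseteq> R - {s}" "closed_segment p2 p3 \<subseteq> R - {s}" "closed_segment p3 p4 \<subseteq> R - {s}" "closed_segment p4 p1 \<subseteq> R - {s}"
  proof -
    have "path_image (rectpath p1 p3) = closed_segment p1 p2 \<union> closed_segment p2 p3 \<union> closed_segment p3 p4 \<union> closed_segment p4 p1"
      by (simp add: rectpath_def Let_def path_image_join p1_p2_p3_p4_def Un_assoc)
    moreover have "path_image (rectpath p1 p3) \<subseteq> R - {s}"
    proof -
      have "path_image (rectpath p1 p3) = cbox p1 p3 - box p1 p3"
        using ab U by (intro path_image_rectpath_cbox_minus_box) (auto simp: p1_p2_p3_p4_def)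
      moreover have "s \<in> box p1 p3" using ab U by (simp add: s_def p1_p2_p3_p4_def in_box_complex_iff)
      ultimately show ?thesis by (auto simp: R_def p1_p2_p3_p4_def)
    qed
    ultimately show "closed_segment p1 p2 \<subseteq> R - {s}" "closed_segment p2 p3 \<subseteq> R - {s}" "closed_segment p3 p4 \<subseteq> R - {s}" "closed_segment p4 p1 \<subseteq> R - {s}"
      by blast+
  qed
  have qc: "continuous_on (R - {s}) q"
    unfolding q_def by (intro continuous_intros holomorphic_on_imp_continuous_on holomorphic_on_subset[OF hR]) auto
  have qi: "q contour_integrable_on (linepath p1 p2)" "q contour_integrable_on (linepath p2 p3)"
    "q contour_integrable_on (linepath p3 p4)" "q contour_integrable_on (linepath p4 p1)"
    by (intro contour_integrable_continuous_linepath continuous_on_subset[OF qc] seg)+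
  have CI4: "contour_integral (rectpath p1 p3) q = contour_integral (linepath p1 p2) q + contour_integral (linepath p2 p3) q
     + contour_integral (linepath p3 p4) q + contour_integral (linepath p4 p1) q"
  proof -
    have "rectpath p1 p3 = linepath p1 p2 +++ linepath p2 p3 +++ linepath p3 p4 +++ linepath p4 p1"
      by (simp add: rectpath_def Let_def p1_p2_p3_p4_def)
    then show ?thesis using qi by (simp add: contour_integral_join contour_integrable_joinI valid_path_join add.assoc)
  qed
  have nq: "norm (q (Complex x y)) = norm (g (Complex x y)) * exp ((x - \<sigma>)\<^sup>2 - (y - \<tau>)\<^sup>2) * Z powr (x - \<sigma>) / norm (Complex x y - s)" for x y
  proof -
    have "norm (exp ((Complex x y - s)\<^sup>2)) = exp ((x - \<sigma>)\<^sup>2 - (y - \<tau>)\<^sup>2)"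
      by (simp add: s_def power2_eq_square)
    moreover have "norm (of_real Z powr (Complex x y - s)) = Z powr (x - \<sigma>)"
      using norm_real_powr[of Z "Complex x y - s"] Z by (simp add: s_def)
    ultimately show ?thesis by (simp add: q_def h_def norm_mult norm_divide)
  qed
  have vert: "(norm (integral {\<tau>-U..\<tau>+U} (\<lambda>y. q (Complex x y))))\<^sup>2 \<le>
     (Z powr (x - \<sigma>) * exp 4 / \<bar>x - \<sigma>\<bar>)\<^sup>2 * (2 * U) * integral {\<tau>-U..\<tau>+U} (\<lambda>y. (norm (g (Complex x y)))\<^sup>2)"
    if x: "x = a \<or> x = b" for x
  proof -
    have xx: "a \<le> x" "x \<le> b" "x \<noteq> \<sigma>" "\<bar>x - \<sigma>\<bar> \<le> 2" using x ab by auto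
    have sub: "(\<lambda>y. Complex x y) ` {\<tau>-U..\<tau>+U} \<subseteq> R - {s}" using xx by (auto simp: inR s_def)
    have cC: "continuous_on {\<tau>-U..\<tau>+U} (\<lambda>y. Complex x y)"
      unfolding Complex_eq by (intro continuous_intros)
    have cq: "continuous_on {\<tau>-U..\<tau>+U} (\<lambda>y. q (Complex x y))"
      by (rule continuous_on_compose2[OF qc cC sub])
    have cg: "continuous_on {\<tau>-U..\<tau>+U} (\<lambda>y. g (Complex x y))"
      by (rule continuous_on_compose2[OF holomorphic_on_imp_continuous_on[OF gR] cC]) (use sub in auto)
    define M where "M = Z powr (x - \<sigma>) * exp 4 / \<bar>x - \<sigma>\<bar>"
    have M0: "M \<ge> 0" by (simp add: M_def)
    have "norm (integral {\<tau>-U..\<tau>+U} (\<lambda>y. q (Complex x y))) \<le> integral {\<tau>-U..\<tau>+U} (\<lambda>y. M * norm (g (Complex x y)))"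
    proof (rule integral_norm_bound_integral)
      fix y assume "y \<in> {\<tau>-U..\<tau>+U}"
      have "\<bar>x - \<sigma>\<bar> \<le> norm (Complex x y - s)" using abs_Re_le_cmod[of "Complex x y - s"] by (simp add: s_def)
      moreover have "exp ((x - \<sigma>)\<^sup>2 - (y - \<tau>)\<^sup>2) \<le> exp 4"
      proof -
        have "(x - \<sigma>)\<^sup>2 \<le> 2\<^sup>2" using xx(4) power_mono[of "\<bar>x - \<sigma>\<bar>" 2 2] by simp
        moreover have "(x - \<sigma>)\<^sup>2 - (y - \<tau>)\<^sup>2 \<le> (x - \<sigma>)\<^sup>2" by simp
        ultimately have "(x - \<sigma>)\<^sup>2 - (y - \<tau>)\<^sup>2 \<le> 2\<^sup>2" by (rule order_trans[rotated])
        then show ?thesis by simp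
      qed
      ultimately have "norm (q (Complex x y)) \<le> norm (g (Complex x y)) * exp 4 * Z powr (x - \<sigma>) / \<bar>x - \<sigma>\<bar>"
        unfolding nq using xx by (intro frac_le mult_right_mono mult_left_mono) auto
      then show "norm (q (Complex x y)) \<le> M * norm (g (Complex x y))" by (simp add: M_def mult_ac)
    qed (intro integrable_continuous_real continuous_intros cq cg)+
    then have "(norm (integral {\<tau>-U..\<tau>+U} (\<lambda>y. q (Complex x y))))\<^sup>2 \<le> (M * integral {\<tau>-U..\<tau>+U} (\<lambda>y. norm (g (Complex x y))))\<^sup>2"
      by (intro power_mono) auto
    also have "\<dots> = M\<^sup>2 * (integral {\<tau>-U..\<tau>+U} (\<lambda>y. norm (g (Complex x y))))\<^sup>2" by (simp add: power_mult_distrib)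
    also have "\<dots> \<le> M\<^sup>2 * ((\<tau> + U - (\<tau> - U)) * integral {\<tau>-U..\<tau>+U} (\<lambda>y. (norm (g (Complex x y)))\<^sup>2))"
      using U by (intro mult_left_mono integral_power2_le continuous_intros cg) auto
    finally show ?thesis by (simp add: M_def mult_ac)
  qed
  define V where "V = (\<lambda>x. norm (integral {\<tau>-U..\<tau>+U} (\<lambda>y. q (Complex x y))))"
  have v23: "norm (contour_integral (linepath p2 p3) q) = V b"
    by (subst contour_integral_linepath_same_Re[of _ b _ "\<tau>-U" "\<tau>+U"]) (use U in \<open>auto simp: p1_p2_p3_p4_def V_def norm_mult\<close>)
  have v41: "norm (contour_integral (linepath p4 p1) q) = V a"
  proof -
    have "contour_integral (linepath p4 p1) q = - contour_integral (linepath p1 p4) q"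
      using seg(4) by (intro contour_integral_reverse_linepath continuous_on_subset[OF qc]) (auto simp: closed_segment_commute)
    then show ?thesis
      by (simp, subst contour_integral_linepath_same_Re[of _ a _ "\<tau>-U" "\<tau>+U"]) (use U in \<open>auto simp: p1_p2_p3_p4_def V_def norm_mult\<close>)
  qed
  define H where "H = G * Z powr 2 * exp (4 - U\<^sup>2) / U"
  have G0: "G \<ge> 0" using G[of a] ab by (smt (verit) norm_ge_zero)
  have H0: "H \<ge> 0" using G0 U by (simp add: H_def)
  have hor: "norm (q (Complex x y)) \<le> H" if "a \<le> x" "x \<le> b" "y = \<tau> - U \<or> y = \<tau> + U" for x y
  proof -
    have "norm (g (Complex x y)) \<le> G" using G that by auto
    moreover have "exp ((x - \<sigma>)\<^sup>2 - (y - \<tau>)\<^sup>2) \<le> exp (4 - U\<^sup>2)"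
    proof -
      have "\<bar>x - \<sigma>\<bar> \<le> 2" using that ab by auto
      then have "(x - \<sigma>)\<^sup>2 \<le> 2\<^sup>2" using power_mono[of "\<bar>x - \<sigma>\<bar>" 2 2] by simp
      moreover have "(y - \<tau>)\<^sup>2 = U\<^sup>2" using that by auto
      ultimately show ?thesis by (subst exp_le_cancel_iff) simp
    qed
    moreover have "Z powr (x - \<sigma>) \<le> Z powr 2" using Z that ab by (intro powr_mono) auto
    moreover have "U \<le> norm (Complex x y - s)" using abs_Im_le_cmod[of "Complex x y - s"] that U by (auto simp: s_def)
    ultimately have "norm (q (Complex x y)) \<le> G * exp (4 - U\<^sup>2) * Z powr 2 / U" unfolding nq using U G0
      by (intro frac_le mult_mono) auto
    then show ?thesis by (simp add: H_def mult_ac)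
  qed
  have segx: "\<exists>x. a \<le> x \<and> x \<le> b \<and> w = Complex x y" if "w \<in> closed_segment (Complex a y) (Complex b y)" for w y
  proof -
    have "Im w = y" "Re w \<in> {a..b}"
      using that ab by (auto simp: closed_segment_same_Im closed_segment_eq_real_ivl)
    then show ?thesis by (intro exI[of _ "Re w"]) (auto simp: complex_eq_iff)
  qed
  have h12: "norm (contour_integral (linepath p1 p2) q) \<le> H * 2"
  proof -
    have "norm (contour_integral (linepath p1 p2) q) \<le> H * norm (p2 - p1)"
    proof (rule contour_integral_bound_linepath[OF qi(1) H0])
      fix w assume "w \<in> closed_segment p1 p2"
      then show "norm (q w) \<le> H" using segx[of w "\<tau>-U"] hor by (auto simp: p1_p2_p3_p4_def)
    qed
    also have "norm (p2 - p1) \<le> 2" using ab cmod_le[of "p2 - p1"] by (simp add: p1_p2_p3_p4_def)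
    finally show ?thesis using H0 by (simp add: mult_left_mono)
  qed
  have h34: "norm (contour_integral (linepath p3 p4) q) \<le> H * 2"
  proof -
    have "norm (contour_integral (linepath p3 p4) q) \<le> H * norm (p4 - p3)"
    proof (rule contour_integral_bound_linepath[OF qi(3) H0])
      fix w assume "w \<in> closed_segment p3 p4"
      then have "w \<in> closed_segment p4 p3" by (simp add: closed_segment_commute)
      then show "norm (q w) \<le> H" using segx[of w "\<tau>+U"] hor by (auto simp: p1_p2_p3_p4_def)
    qed
    also have "norm (p4 - p3) \<le> 2" using ab cmod_le[of "p4 - p3"] by (simp add: p1_p2_p3_p4_def)
    finally show ?thesis using H0 by (simp add: mult_left_mono)
  qed
  have "2 * pi * norm (g s) = norm (contour_integral (rectpath p1 p3) q)"
    unfolding CI by (simp add: norm_mult)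
  also have "\<dots> \<le> H * 2 + V b + H * 2 + V a"
    unfolding CI4 v23[symmetric] v41[symmetric]
    by (intro norm_triangle_mono h12 h34 order_refl)
  finally have "2 * pi * norm (g s) \<le> V b + V a + 4 * H" by simp
  moreover have "norm (g s) \<le> 2 * pi * norm (g s)" using pi_gt3 by (simp add: mult_le_cancel_right1)
  ultimately have "norm (g s) \<le> V b + V a + 4 * H" by linarith
  then have "(norm (g s))\<^sup>2 \<le> (V b + V a + 4 * H)\<^sup>2" by (intro power_mono) auto
  also have "\<dots> \<le> 3 * ((V b)\<^sup>2 + (V a)\<^sup>2 + (4 * H)\<^sup>2)" by (rule power2_sum3_le)
  also have "\<dots> \<le> 3 * ((Z powr (b - \<sigma>) * exp 4 / \<bar>b - \<sigma>\<bar>)\<^sup>2 * (2 * U) * integral {\<tau>-U..\<tau>+U} (\<lambda>y. (norm (g (Complex b y)))\<^sup>2)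
      + (Z powr (a - \<sigma>) * exp 4 / \<bar>a - \<sigma>\<bar>)\<^sup>2 * (2 * U) * integral {\<tau>-U..\<tau>+U} (\<lambda>y. (norm (g (Complex a y)))\<^sup>2) + (4 * H)\<^sup>2)"
    unfolding V_def by (intro mult_left_mono add_mono vert order_refl) auto
  finally show ?thesis using ab by (simp add: s_def H_def mult.assoc)
qed

section \<open>Interpolation by Blaschke products\<close>

text \<open>
  The factor of the disc of radius R that vanishes at v and has modulus 1 on the boundary circle.
\<close>
definition blaschke :: "real \<Rightarrow> complex \<Rightarrow> complex \<Rightarrow> complex" where
  "blaschke R w z = of_real R * (z - w) / (of_real (R\<^sup>2) - cnj w * z)"

lemma blaschke_identity:
  "(norm (of_real (R\<^sup>2) - cnj w * z))\<^sup>2 = R\<^sup>2 * (norm (z - w))\<^sup>2 + (R\<^sup>2 - (norm z)\<^sup>2) * (R\<^sup>2 - (norm w)\<^sup>2)"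
proof -
  have "complex_of_real ((norm (of_real (R\<^sup>2) - cnj w * z))\<^sup>2) =
     of_real (R\<^sup>2 * (norm (z - w))\<^sup>2 + (R\<^sup>2 - (norm z)\<^sup>2) * (R\<^sup>2 - (norm w)\<^sup>2))"
    unfolding of_real_add of_real_mult of_real_diff complex_norm_square by (simp add: algebra_simps)
  then show ?thesis by (simp only: of_real_eq_iff)
qed

lemma blaschke_denominator:
  assumes "norm w < R" "norm z \<le> R"
  shows "of_real (R\<^sup>2) - cnj w * z \<noteq> 0"
proof
  assume "of_real (R\<^sup>2) - cnj w * z = 0"
  then have "norm (complex_of_real (R\<^sup>2)) = norm (cnj w * z)" by simp
  then have "R\<^sup>2 = norm w * norm z" by (simp add: norm_mult norm_power)
  moreover have "norm w * norm z < R * R"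
  proof -
    have "norm w * norm z \<le> norm w * R" using assms by (intro mult_left_mono) auto
    also have "\<dots> < R * R" using assms norm_ge_zero[of w] by (intro mult_strict_right_mono) linarith+
    finally show ?thesis .
  qed
  ultimately show False by (simp add: power2_eq_square)
qed

lemma norm_blaschke_power2:
  assumes "norm w < R" "norm z \<le> R" "z \<noteq> w"
  shows "1 / (norm (blaschke R w z))\<^sup>2 = 1 + (R\<^sup>2 - (norm z)\<^sup>2) * (R\<^sup>2 - (norm w)\<^sup>2) / (R\<^sup>2 * (norm (z - w))\<^sup>2)"
proof -
  have "R > 0" using assms(1) norm_ge_zero[of w] by linarith
  then have "R\<^sup>2 * (norm (z - w))\<^sup>2 \<noteq> 0" using assms by simp
  moreover have "1 / (norm (blaschke R w z))\<^sup>2 = (norm (of_real (R\<^sup>2) - cnj w * z))\<^sup>2 / (R\<^sup>2 * (norm (z - w))\<^sup>2)"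
    by (simp add: blaschke_def norm_mult norm_divide power_mult_distrib power_divide)
  ultimately show ?thesis unfolding blaschke_identity by (simp add: add_divide_distrib)
qed

lemma norm_blaschke_le_1:
  assumes "norm w < R" "norm z \<le> R"
  shows "norm (blaschke R w z) \<le> 1"
proof (cases "z = w")
  case False
  have "R > 0" using assms(1) norm_ge_zero[of w] by linarith
  have "(R\<^sup>2 - (norm z)\<^sup>2) * (R\<^sup>2 - (norm w)\<^sup>2) \<ge> 0"
    using assms by (intro mult_nonneg_nonneg) (auto intro!: power_mono)
  then have "1 / (norm (blaschke R w z))\<^sup>2 \<ge> 1"
    unfolding norm_blaschke_power2[OF assms False] by simp
  then have "(norm (blaschke R w z))\<^sup>2 \<le> 1\<^sup>2"
    by (cases "blaschke R w z = 0") (auto simp: divide_simps split: if_splits)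
  then show ?thesis by (rule power2_le_imp_le) simp
qed (simp add: blaschke_def)

lemma norm_blaschke_sphere:
  assumes "norm w < R" "norm z = R"
  shows "norm (blaschke R w z) = 1"
proof -
  have "z \<noteq> w" using assms by auto
  then have "1 / (norm (blaschke R w z))\<^sup>2 = 1" using norm_blaschke_power2[of w R z] assms by simp
  then have "(norm (blaschke R w z))\<^sup>2 = 1\<^sup>2" by simp
  then show ?thesis by (subst (asm) power2_eq_iff_nonneg) auto
qed

lemma max_modulus_ball:
  assumes "f holomorphic_on ball 0 R'" "0 < R" "R < R'" and "\<And>z. norm z = R \<Longrightarrow> norm (f z) \<le> M" and "norm z \<le> R"
  shows "norm (f z) \<le> M"
proof (rule maximum_modulus_frontier[of f "cball 0 R"])
  show "f holomorphic_on interior (cball 0 R)" using assms by (auto intro: holomorphic_on_subset)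
  show "continuous_on (closure (cball 0 R)) f"
    using assms by (auto intro!: holomorphic_on_imp_continuous_on[OF holomorphic_on_subset[OF assms(1)]])
qed (use assms in auto)

text \<open>
  Divide by the Blaschke factors one zero at a time; the maximum principle preserves the bound because the factors are unimodular on the boundary.
\<close>
lemma schwarz_blaschke:
  fixes N :: "complex \<Rightarrow> complex" and z :: complex
  assumes "finite W"
  shows "\<lbrakk>N holomorphic_on ball 0 R'; R < R'; \<And>w. w \<in> W \<Longrightarrow> norm w < R \<and> N w = 0; R > 0;
     \<And>z. norm z = R \<Longrightarrow> norm (N z) \<le> M; norm z \<le> R\<rbrakk> \<Longrightarrow> norm (N z) \<le> M * (\<Prod>w\<in>W. norm (blaschke R w z))"
  using assms
proof (induction W arbitrary: N R' rule: finite_induct)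
  case empty
  then show ?case using max_modulus_ball[of N R' R M z] by simp
next
  case (insert w W)
  have w: "norm w < R" "N w = 0" using insert.prems(3) by auto
  define N1 where "N1 = (\<lambda>z. if z = w then deriv N w else (N z - N w) / (z - w))"
  define N2 where "N2 = (\<lambda>z. N1 z * ((of_real (R\<^sup>2) - cnj w * z) / of_real R))"
  have h1: "N1 holomorphic_on ball 0 R'" unfolding N1_def by (rule pole_lemma_open[OF insert.prems(1)]) simp
  have h2: "N2 holomorphic_on ball 0 R'" unfolding N2_def using insert.prems(4) by (intro holomorphic_intros h1) auto
  have N1: "N z = (z - w) * N1 z" for z using w by (simp add: N1_def)
  have N: "N z = blaschke R w z * N2 z" if "norm z \<le> R" for z
    unfolding N1 N2_def blaschke_def using blaschke_denominator[OF w(1) that] insert.prems(4) by simp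
  have "norm (N2 z) \<le> M * (\<Prod>w\<in>W. norm (blaschke R w z))"
  proof (rule insert.IH[OF h2 insert.prems(2) _ insert.prems(4) _ insert.prems(6)])
    fix v assume v: "v \<in> W"
    then have v1: "norm v < R" "N v = 0" "v \<noteq> w" using insert.prems(3) insert.hyps by auto
    have "blaschke R w v \<noteq> 0" unfolding blaschke_def using blaschke_denominator[OF w(1), of v] v1 insert.prems(4) by simp
    then show "norm v < R \<and> N2 v = 0" using N[of v] v1 by simp
  next
    fix z :: complex assume z: "norm z = R"
    have "norm (N z) = norm (N2 z)" using N[of z] z norm_blaschke_sphere[OF w(1) z] by (simp add: norm_mult)
    then show "norm (N2 z) \<le> M" using insert.prems(5)[OF z] by simp
  qed
  then have "norm (blaschke R w z) * norm (N2 z) \<le> norm (blaschke R w z) * (M * (\<Prod>w\<in>W. norm (blaschke R w z)))"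
    by (intro mult_left_mono) auto
  then show ?case using N[OF insert.prems(6)] insert.hyps by (simp add: norm_mult mult_ac)
qed

text \<open>
  Subtract from F the combination of Blaschke products that interpolates F on W. The difference vanishes on W, so it is small by the Schwarz lemma, and the combination is small because the values on W are.
\<close>
lemma blaschke_interpolation:
  fixes F :: "complex \<Rightarrow> complex"
  assumes F: "F holomorphic_on ball 0 R'" "0 < R" "R < R'" and W: "finite W" "\<And>w. w \<in> W \<Longrightarrow> norm w < R"
    and E: "\<And>z. norm z \<le> R \<Longrightarrow> norm (F z) \<le> E" and \<kappa>: "\<And>w. w \<in> W \<Longrightarrow> norm (F w) \<le> \<kappa>"
    and D: "\<And>w. w \<in> W \<Longrightarrow> (\<Prod>v\<in>W-{w}. 1 / norm (blaschke R v w)) \<le> D"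
    and z: "norm z \<le> R" and q: "(\<Prod>w\<in>W. norm (blaschke R w z)) \<le> q" "q \<le> 1"
  shows "norm (F z) \<le> q * E + 4 * real (card W) * D * \<kappa>"
proof (cases "W = {}")
  case True
  then have "q \<ge> 1" using q by simp
  then have "q = 1" using q by simp
  then show ?thesis using E[OF z] True by simp
next
  case False
  then obtain w0 where w0: "w0 \<in> W" by auto
  have \<kappa>0: "\<kappa> \<ge> 0" using \<kappa>[OF w0] norm_ge_zero[of "F w0"] by linarith
  have D0: "D \<ge> 0" using D[OF w0] by (rule order_trans[rotated]) (intro prod_nonneg, auto)
  have "norm (F 0) \<le> E" using E[of 0] F(2) by simp
  then have E0: "E \<ge> 0" using norm_ge_zero[of "F 0"] by linarith
  define R1 where "R1 = min R' (Min ((\<lambda>w. R\<^sup>2 / (norm w + (R - norm w) / 2)) ` W))"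
  have aux: "R < R\<^sup>2 / (norm w + (R - norm w) / 2)" if "w \<in> W" for w
  proof -
    have p: "norm w + (R - norm w) / 2 > 0" "norm w + (R - norm w) / 2 < R" using W(2)[OF that] F(2) by (auto simp: field_simps add_pos_nonneg)
    then have "R * (norm w + (R - norm w) / 2) < R * R" using F(2) by (intro mult_strict_left_mono) auto
    then show ?thesis using p by (simp add: pos_less_divide_eq power2_eq_square)
  qed
  have R1: "R < R1" "R1 \<le> R'" using aux F W False by (auto simp: R1_def)
  have den: "of_real (R\<^sup>2) - cnj w * z \<noteq> 0" if "w \<in> W" "norm z < R1" for w z
  proof
    assume "of_real (R\<^sup>2) - cnj w * z = 0"
    then have "norm (complex_of_real (R\<^sup>2)) = norm (cnj w * z)" by simp
    then have e: "R\<^sup>2 = norm w * norm z" by (simp add: norm_mult norm_power)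
    have "R1 \<le> R\<^sup>2 / (norm w + (R - norm w) / 2)" unfolding R1_def using W that by (auto intro!: min.coboundedI2 Min_le)
    then have "norm z < R\<^sup>2 / (norm w + (R - norm w) / 2)" using that by linarith
    moreover have p: "norm w + (R - norm w) / 2 > 0" "norm w \<le> norm w + (R - norm w) / 2" using W(2)[OF that(1)] F(2) by (auto simp: field_simps add_pos_nonneg)
    ultimately have "norm z * (norm w + (R - norm w) / 2) < R\<^sup>2" by (simp add: pos_less_divide_eq)
    moreover have "norm z * norm w \<le> norm z * (norm w + (R - norm w) / 2)" using p by (intro mult_left_mono) auto
    ultimately show False using e by (simp add: mult.commute)
  qed
  have bh: "blaschke R w holomorphic_on ball 0 R1" if "w \<in> W" for w
    unfolding blaschke_def using den[OF that] by (intro holomorphic_intros) auto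
  define l where "l = (\<lambda>w z. (\<Prod>v\<in>W-{w}. blaschke R v z / blaschke R v w) * (of_real (R\<^sup>2 - (norm w)\<^sup>2) / (of_real (R\<^sup>2) - cnj w * z)))"
  have lh: "l w holomorphic_on ball 0 R1" if "w \<in> W" for w
  proof -
    have "(\<lambda>z. blaschke R v z / blaschke R v w) holomorphic_on ball 0 R1" if "v \<in> W - {w}" for v
      unfolding divide_inverse using that by (intro holomorphic_on_mult bh holomorphic_on_const) auto
    then have "(\<lambda>z. \<Prod>v\<in>W-{w}. blaschke R v z / blaschke R v w) holomorphic_on ball 0 R1"
      by (rule holomorphic_on_prod)
    moreover have "(\<lambda>z. of_real (R\<^sup>2 - (norm w)\<^sup>2) / (of_real (R\<^sup>2) - cnj w * z)) holomorphic_on ball 0 R1"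
      using den[OF that] by (intro holomorphic_intros) auto
    ultimately show ?thesis unfolding l_def by (rule holomorphic_on_mult)
  qed
  have bnz: "blaschke R v w \<noteq> 0" if "w \<in> W" "v \<in> W" "v \<noteq> w" for v w
    unfolding blaschke_def using den[of v w] W(2)[OF that(1)] R1 that F by simp
  have lw: "l w w = 1" if "w \<in> W" for w
  proof -
    have "(\<Prod>v\<in>W-{w}. blaschke R v w / blaschke R v w) = 1" using bnz[OF that] by (intro prod.neutral) auto
    moreover have "of_real (R\<^sup>2 - (norm w)\<^sup>2) = of_real (R\<^sup>2) - cnj w * w"
      unfolding of_real_diff complex_norm_square by (simp add: mult.commute)
    ultimately show ?thesis using den[OF that, of w] W(2)[OF that] R1 by (simp add: l_def)
  qed
  have lv: "l w v = 0" if "w \<in> W" "v \<in> W" "v \<noteq> w" for w v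
  proof -
    have "(\<Prod>u\<in>W-{w}. blaschke R u v / blaschke R u w) = 0" using W that
      by (intro prod_zero bexI[of _ v]) (auto simp: blaschke_def)
    then show ?thesis by (simp add: l_def)
  qed
  have lb: "norm (l w z) \<le> 2 * D" if "w \<in> W" "norm z \<le> R" for w z
  proof -
    have "norm (\<Prod>v\<in>W-{w}. blaschke R v z / blaschke R v w) \<le> (\<Prod>v\<in>W-{w}. 1 / norm (blaschke R v w))"
      unfolding prod_norm[symmetric] norm_divide using W that
      by (intro prod_mono conjI divide_right_mono norm_blaschke_le_1) auto
    also have "\<dots> \<le> D" by (rule D[OF that(1)])
    finally have 1: "norm (\<Prod>v\<in>W-{w}. blaschke R v z / blaschke R v w) \<le> D" .
    have 2: "norm (of_real (R\<^sup>2 - (norm w)\<^sup>2) / (of_real (R\<^sup>2) - cnj w * z)) \<le> 2"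
    proof -
      have wR: "norm w < R" using W that by auto
      have "norm (of_real (R\<^sup>2) - cnj w * z) \<ge> norm (complex_of_real (R\<^sup>2)) - norm (cnj w * z)" by (rule norm_triangle_ineq2)
      moreover have "norm (cnj w * z) \<le> norm w * R" using that by (simp add: norm_mult mult_left_mono)
      ultimately have ge: "norm (of_real (R\<^sup>2) - cnj w * z) \<ge> R * (R - norm w)"
        by (simp add: power2_eq_square algebra_simps norm_mult)
      have pos: "R * (R - norm w) > 0" using wR F(2) by simp
      have "norm (complex_of_real (R\<^sup>2 - (norm w)\<^sup>2)) = (R + norm w) * (R - norm w)"
      proof -
        have "R\<^sup>2 - (norm w)\<^sup>2 = (R + norm w) * (R - norm w)" by (simp add: power2_eq_square algebra_simps)
        moreover have "(R + norm w) * (R - norm w) \<ge> 0" using wR F(2) by (intro mult_nonneg_nonneg) auto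
        ultimately show ?thesis by (metis abs_of_nonneg norm_of_real)
      qed
      also have "\<dots> \<le> (2 * R) * (R - norm w)" using wR by (intro mult_right_mono) auto
      finally have "norm (of_real (R\<^sup>2 - (norm w)\<^sup>2) / (of_real (R\<^sup>2) - cnj w * z)) \<le> ((2 * R) * (R - norm w)) / (R * (R - norm w))"
        unfolding norm_divide using ge pos by (intro frac_le) auto
      also have "\<dots> = 2" using wR F(2) by simp
      finally show ?thesis .
    qed
    show ?thesis unfolding l_def norm_mult using mult_mono[OF 1 2] D0 by (simp add: mult.commute)
  qed
  define T where "T = (\<lambda>z. \<Sum>w\<in>W. F w * l w z)"
  have Tb: "norm (T z) \<le> 2 * real (card W) * D * \<kappa>" if "norm z \<le> R" for z
  proof -
    have "norm (T z) \<le> (\<Sum>w\<in>W. \<kappa> * (2 * D))"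
      unfolding T_def
    proof (rule sum_norm_le)
      fix w assume "w \<in> W"
      then show "norm (F w * l w z) \<le> \<kappa> * (2 * D)"
        unfolding norm_mult using \<kappa> lb that \<kappa>0 by (intro mult_mono) auto
    qed
    then show ?thesis by (simp add: mult_ac)
  qed
  define N where "N = (\<lambda>z. F z - T z)"
  have Nh: "N holomorphic_on ball 0 R1"
  proof -
    have "F holomorphic_on ball 0 R1" by (rule holomorphic_on_subset[OF F(1)]) (use R1 in auto)
    moreover have "T holomorphic_on ball 0 R1" unfolding T_def
      by (intro holomorphic_on_sum holomorphic_on_mult holomorphic_on_const lh)
    ultimately show ?thesis unfolding N_def by (rule holomorphic_on_diff)
  qed
  have N0: "norm w < R \<and> N w = 0" if "w \<in> W" for w
  proof -
    have "T w = (\<Sum>v\<in>W. if v = w then F w else 0)" unfolding T_def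
      using that lw lv by (intro sum.cong) auto
    then show ?thesis using W that by (simp add: N_def)
  qed
  have Nb: "norm (N z) \<le> E + 2 * real (card W) * D * \<kappa>" if "norm z = R" for z
    unfolding N_def using norm_triangle_ineq4[of "F z" "T z"] E[of z] Tb[of z] that by simp
  have "norm (N z) \<le> (E + 2 * real (card W) * D * \<kappa>) * (\<Prod>w\<in>W. norm (blaschke R w z))"
    by (rule schwarz_blaschke[OF W(1) Nh R1(1) N0 F(2) Nb z])
  also have "\<dots> \<le> (E + 2 * real (card W) * D * \<kappa>) * q"
    using q E0 D0 \<kappa>0 by (intro mult_left_mono) auto
  finally have "norm (N z) \<le> (E + 2 * real (card W) * D * \<kappa>) * q" .
  moreover have "norm (F z) \<le> norm (N z) + norm (T z)" unfolding N_def using norm_triangle_sub by (metis add.commute)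
  moreover have "2 * real (card W) * D * \<kappa> * q \<le> 2 * real (card W) * D * \<kappa> * 1"
    using q D0 \<kappa>0 by (intro mult_left_mono) auto
  ultimately show ?thesis using Tb[OF z] by (simp add: algebra_simps)
qed

text \<open>
  The infinite product is sinh(pi b)/(pi b), by the product formula for the sine at an imaginary argument.
\<close>
lemma prod_one_plus_squares_le:
  assumes b: "b \<ge> 1"
  shows "(\<Prod>k=1..n. 1 + b\<^sup>2 / (real k)\<^sup>2) \<le> exp (pi * b)"
proof -
  define P where "P = (\<lambda>n. \<Prod>k=1..n. 1 + b\<^sup>2 / (real k)\<^sup>2)"
  have P0: "P n \<ge> 0" for n unfolding P_def by (intro prod_nonneg) auto
  have "incseq P"
  proof (rule incseq_SucI)
    fix n show "P n \<le> P (Suc n)"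
      using P0[of n] mult_left_mono[of 1 "1 + b\<^sup>2 / (real (Suc n))\<^sup>2" "P n"] by (simp add: P_def)
  qed
  have "(\<lambda>n. norm (of_real pi * (\<i> * of_real b) * (\<Prod>k=1..n. 1 - (\<i> * of_real b)\<^sup>2 / (of_nat k)\<^sup>2))) \<longlonglongrightarrow> norm (sin (of_real pi * (\<i> * of_real b)))"
    by (intro tendsto_norm sin_product_formula_complex)
  also have "(\<lambda>n. norm (of_real pi * (\<i> * of_real b) * (\<Prod>k=1..n. 1 - (\<i> * of_real b)\<^sup>2 / (of_nat k)\<^sup>2))) = (\<lambda>n. pi * b * P n)"
  proof
    fix n
    have "1 - (\<i> * of_real b)\<^sup>2 / (of_nat k)\<^sup>2 = complex_of_real (1 + b\<^sup>2 / (real k)\<^sup>2)" for k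
      by (simp add: power_mult_distrib)
    then have "(\<Prod>k=1..n. 1 - (\<i> * of_real b)\<^sup>2 / (of_nat k)\<^sup>2) = complex_of_real (P n)"
      unfolding P_def of_real_prod by (simp only:)
    then show "norm (of_real pi * (\<i> * of_real b) * (\<Prod>k=1..n. 1 - (\<i> * of_real b)\<^sup>2 / (of_nat k)\<^sup>2)) = pi * b * P n"
      using b P0[of n] by (simp add: norm_mult)
  qed
  finally have lim: "(\<lambda>n. pi * b * P n) \<longlonglongrightarrow> norm (sin (of_real pi * (\<i> * of_real b)))" .
  have "incseq (\<lambda>n. pi * b * P n)"
    using \<open>incseq P\<close> b by (auto simp: incseq_def intro!: mult_left_mono)
  then have "pi * b * P n \<le> norm (sin (of_real pi * (\<i> * of_real b)))"
    using lim by (rule incseq_le)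
  also have "\<dots> \<le> exp (pi * b)"
  proof (rule power2_le_imp_le)
    have "(norm (sin (of_real pi * (\<i> * of_real b))))\<^sup>2 = (exp (2 * (pi * b)) + inverse (exp (2 * (pi * b))) - 2) / 4"
      unfolding norm_sin_squared by simp
    also have "\<dots> \<le> exp (2 * (pi * b))"
    proof -
      have "inverse (exp (2 * (pi * b))) \<le> 1" unfolding exp_minus[symmetric] using b by simp
      moreover have "exp (2 * (pi * b)) > 0" by simp
      moreover have "(x + y - 2) / 4 \<le> x" if "y \<le> 1" "x > 0" for x y :: real using that by simp
      ultimately show ?thesis by blast
    qed
    also have "\<dots> = (exp (pi * b))\<^sup>2" by (simp add: exp_double)
    finally show "(norm (sin (of_real pi * (\<i> * of_real b))))\<^sup>2 \<le> (exp (pi * b))\<^sup>2" .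
  qed simp
  finally have 1: "pi * b * P n \<le> exp (pi * b)" .
  have "1 * P n \<le> (pi * b) * P n"
  proof (intro mult_right_mono P0)
    have "1 * 1 \<le> pi * b" using b pi_gt3 by (intro mult_mono) auto
    then show "1 \<le> pi * b" by simp
  qed
  with 1 show ?thesis by (simp add: P_def)
qed

text \<open>
  Take equally spaced points, one on each of the segments at spacing a / J. They are confined to a strip of width 2 a next to the boundary of a disc of radius 1 / a, so their pairwise pseudohyperbolic distances are bounded below in terms of the index differences alone, although the horizontal positions are unknown. Each point still contributes a factor 1 - a / 20 or so at the point of real part 2, and there are about len * J / a of them.
\<close>
lemma small_on_segments_imp_small:
  fixes f :: "complex \<Rightarrow> complex"
  assumes a: "0 < a" "a \<le> 1/10" and \<alpha>: "\<bar>\<alpha> - 1/2\<bar> \<le> 1/10" and l: "0 < len" "len \<le> 1/2" and J: "J \<ge> (1::nat)"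
    and f: "f holomorphic_on ball (Complex (\<alpha> + 1/a) t0) (1/a + 1)"
    and E: "\<And>s. Re s \<ge> \<alpha> \<Longrightarrow> \<bar>Im s - t0\<bar> \<le> 1/a \<Longrightarrow> norm (f s) \<le> E"
    and small: "\<And>t. t0 \<le> t \<Longrightarrow> t \<le> t0 + len \<Longrightarrow> \<exists>\<sigma>. \<alpha> + a \<le> \<sigma> \<and> \<sigma> \<le> \<alpha> + 3 * a \<and> norm (f (Complex \<sigma> t)) \<le> \<kappa>"
  shows "norm (f (Complex 2 t0)) \<le> 3 * exp (- (len * real J / 20)) * E + 4 * (len * real J / a) * exp (6 * pi * real J) * \<kappa>"
proof -
  define R where "R = 1 / a"
  have R10: "R \<ge> 10" using a by (simp add: R_def field_simps)
  have aR: "a * R = 1" using a by (simp add: R_def)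
  define c where "c = Complex (\<alpha> + R) t0"
  define F where "F = (\<lambda>z. f (c + z))"
  define \<delta> where "\<delta> = a / real J"
  have \<delta>: "\<delta> > 0" using a J by (simp add: \<delta>_def)
  define n where "n = nat \<lfloor>len / \<delta>\<rfloor>"
  have n1: "real n \<le> len / \<delta>" "real n \<ge> len / \<delta> - 1"
    using l \<delta> by (auto simp: n_def of_nat_nat)
  have jl: "real j * \<delta> \<le> len" if "j \<le> n" for j
  proof -
    have "real j \<le> len / \<delta>" using n1 that by linarith
    then show ?thesis using \<delta> by (simp add: field_simps)
  qed
  have "\<exists>\<sigma>. \<forall>j\<in>{1..n}. \<alpha> + a \<le> \<sigma> j \<and> \<sigma> j \<le> \<alpha> + 3 * a \<and> norm (f (Complex (\<sigma> j) (t0 + real j * \<delta>))) \<le> \<kappa>"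
    using small jl \<delta> by (intro bchoice) auto
  then obtain \<sigma> where \<sigma>: "\<And>j. j \<in> {1..n} \<Longrightarrow> \<alpha> + a \<le> \<sigma> j \<and> \<sigma> j \<le> \<alpha> + 3 * a \<and> norm (f (Complex (\<sigma> j) (t0 + real j * \<delta>))) \<le> \<kappa>"
    by blast
  define w where "w = (\<lambda>j. Complex (\<sigma> j - \<alpha> - R) (real j * \<delta>))"
  have cw: "c + w j = Complex (\<sigma> j) (t0 + real j * \<delta>)" for j by (simp add: c_def w_def complex_eq_iff)
  have inj: "inj_on w {1..n}" using \<delta> by (auto simp: inj_on_def w_def)
  have nw: "1 \<le> R\<^sup>2 - (norm (w j))\<^sup>2" "R\<^sup>2 - (norm (w j))\<^sup>2 \<le> 6" "norm (w j) < R" if j: "j \<in> {1..n}" for j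
  proof -
    define x where "x = \<sigma> j - \<alpha>"
    have x: "a \<le> x" "x \<le> 3 * a" using \<sigma>[OF j] by (auto simp: x_def)
    define v where "v = real j * \<delta>"
    have v: "0 \<le> v" "v \<le> 1/2" using jl[of j] j l \<delta> by (auto simp: v_def)
    have e: "R\<^sup>2 - (norm (w j))\<^sup>2 = 2 * R * x - x\<^sup>2 - v\<^sup>2"
      unfolding w_def cmod_power2 by (simp add: x_def v_def power2_eq_square algebra_simps)
    have v2: "v\<^sup>2 \<le> 1/4" using power_mono[of v "1/2" 2] v by (simp add: power2_eq_square)
    have x2: "x\<^sup>2 \<le> 9/100"
    proof -
      have "x\<^sup>2 \<le> (3/10)\<^sup>2" using x a by (intro power_mono) auto
      then show ?thesis by (simp add: power2_eq_square)
    qed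
    have "R * a \<le> R * x" "R * x \<le> R * (3 * a)" using x R10 by (auto intro!: mult_left_mono)
    then have "1 \<le> R * x" "R * x \<le> 3" using aR by (auto simp: mult.commute)
    then show "1 \<le> R\<^sup>2 - (norm (w j))\<^sup>2" "R\<^sup>2 - (norm (w j))\<^sup>2 \<le> 6"
    proof -
      assume Rx: "1 \<le> R * x" "R * x \<le> 3"
      have "2 * R * x = 2 * (R * x)" by simp
      then show "1 \<le> R\<^sup>2 - (norm (w j))\<^sup>2" "R\<^sup>2 - (norm (w j))\<^sup>2 \<le> 6"
        unfolding e using v2 x2 Rx zero_le_power2[of x] zero_le_power2[of v] by linarith+
    qed
    then have "(norm (w j))\<^sup>2 < R\<^sup>2" by linarith
    then show "norm (w j) < R" by (rule power2_less_imp_less) (use R10 in simp)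
  qed
  define W where "W = w ` {1..n}"
  define z0 where "z0 = Complex (2 - \<alpha> - R) 0"
  define D where "D = exp (6 * pi * real J)"
  define q where "q = exp (- (real n * a / 20))"
  have inD: "norm (f s) \<le> E" if "norm (s - c) \<le> R" for s
  proof (rule E)
    have "\<bar>Re s - (\<alpha> + R)\<bar> \<le> R" using abs_Re_le_cmod[of "s - c"] that by (simp add: c_def)
    then show "Re s \<ge> \<alpha>" by (auto simp: abs_if split: if_splits)
    show "\<bar>Im s - t0\<bar> \<le> 1/a" using abs_Im_le_cmod[of "s - c"] that by (simp add: c_def R_def)
  qed
  have rz: "norm z0 \<le> R" "R\<^sup>2 - (norm z0)\<^sup>2 \<ge> R"
  proof -
    define x where "x = 2 - \<alpha>"
    have x: "7/5 \<le> x" "x \<le> 8/5" using \<alpha> by (auto simp: x_def abs_if split: if_splits)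
    have e: "R\<^sup>2 - (norm z0)\<^sup>2 = 2 * R * x - x\<^sup>2"
      unfolding z0_def cmod_power2 by (simp add: x_def power2_eq_square algebra_simps)
    have "x\<^sup>2 \<le> (8/5)\<^sup>2" using x by (intro power_mono) auto
    then have x2: "x\<^sup>2 \<le> 4" by (simp add: power2_eq_square)
    have Rx: "2 * R * (7/5) \<le> 2 * R * x" using x R10 by (intro mult_left_mono) auto
    show "R\<^sup>2 - (norm z0)\<^sup>2 \<ge> R" unfolding e using R10 x2 Rx by linarith
    then have "(norm z0)\<^sup>2 \<le> R\<^sup>2" using R10 by linarith
    then show "norm z0 \<le> R" by (rule power2_le_imp_le) (use R10 in simp)
  qed
  have "norm (F z0) \<le> q * E + 4 * real (card W) * D * \<kappa>"
  proof (rule blaschke_interpolation[where F = F and z = z0 and R' = "R + 1" and R = R])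
    show "F holomorphic_on ball 0 (R + 1)"
    proof -
      have "(f \<circ> (\<lambda>z. c + z)) holomorphic_on ball 0 (R + 1)"
        by (rule holomorphic_on_compose_gen[OF _ f]) (auto intro!: holomorphic_intros simp: c_def R_def dist_norm)
      then show ?thesis by (simp add: F_def o_def)
    qed
    show "0 < R" "R < R + 1" using R10 by auto
    show "finite W" by (simp add: W_def)
    show "norm v < R" if "v \<in> W" for v using that nw by (auto simp: W_def)
    show "norm (F z) \<le> E" if "norm z \<le> R" for z unfolding F_def using that by (intro inD) simp
    show "norm (F v) \<le> \<kappa>" if "v \<in> W" for v using that \<sigma> by (auto simp: W_def F_def cw)
    show "norm z0 \<le> R" by (rule rz)
    show "q \<le> 1" using a by (simp add: q_def)
    show "(\<Prod>v\<in>W-{u}. 1 / norm (blaschke R v u)) \<le> D" if "u \<in> W" for u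
    proof -
      from that obtain i where i: "i \<in> {1..n}" "u = w i" unfolding W_def by blast
      define P where "P = (\<Prod>k=1..n. 1 + (6 * real J)\<^sup>2 / (real k)\<^sup>2)"
      have tm: "(1 / norm (blaschke R (w j) (w i)))\<^sup>2 \<le> 1 + (6 * real J)\<^sup>2 / (real i - real j)\<^sup>2" if j: "j \<in> {1..n}" "j \<noteq> i" for j
      proof -
        have ne: "w i \<noteq> w j" using inj_onD[OF inj, of i j] i j by blast
        have pos: "0 \<le> R\<^sup>2 - (norm (w i))\<^sup>2" "0 \<le> R\<^sup>2 - (norm (w j))\<^sup>2"
          using nw(1)[OF i(1)] nw(1)[OF j(1)] by linarith+
        have "(1 / norm (blaschke R (w j) (w i)))\<^sup>2 = 1 + (R\<^sup>2 - (norm (w i))\<^sup>2) * (R\<^sup>2 - (norm (w j))\<^sup>2) / (R\<^sup>2 * (norm (w i - w j))\<^sup>2)"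
          unfolding power_one_over by (rule norm_blaschke_power2) (use nw i j ne in \<open>auto intro: less_imp_le\<close>)
        also have "\<dots> \<le> 1 + 6 * 6 / (R\<^sup>2 * ((real i - real j) * \<delta>)\<^sup>2)"
        proof (intro add_left_mono frac_le mult_mono mult_left_mono)
          have "\<bar>(real i - real j) * \<delta>\<bar> \<le> norm (w i - w j)"
            using abs_Im_le_cmod[of "w i - w j"] by (simp add: w_def algebra_simps)
          then show "((real i - real j) * \<delta>)\<^sup>2 \<le> (norm (w i - w j))\<^sup>2"
            using power_mono[of "\<bar>(real i - real j) * \<delta>\<bar>" "norm (w i - w j)" 2] by simp
          show "0 < R\<^sup>2 * ((real i - real j) * \<delta>)\<^sup>2" using R10 j \<delta> by simp
        qed (use nw[OF i(1)] nw[OF j(1)] pos in auto)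
        also have "6 * 6 / (R\<^sup>2 * ((real i - real j) * \<delta>)\<^sup>2) = (6 * real J)\<^sup>2 / (real i - real j)\<^sup>2"
        proof -
          have "R * \<delta> = 1 / real J" using aR by (simp add: \<delta>_def mult.commute)
          then have "R\<^sup>2 * ((real i - real j) * \<delta>)\<^sup>2 = (real i - real j)\<^sup>2 / (real J)\<^sup>2"
            by (metis (no_types, opaque_lifting) mult.left_commute power_mult_distrib power_divide times_divide_eq_right mult.right_neutral power_one)
          then show ?thesis using J by (simp add: power2_eq_square)
        qed
        finally show ?thesis .
      qed
      have "(\<Prod>v\<in>W-{u}. 1 / norm (blaschke R v u)) = (\<Prod>j\<in>{1..n}-{i}. 1 / norm (blaschke R (w j) (w i)))"
      proof -
        have "W - {u} = w ` ({1..n} - {i})" unfolding W_def i(2) using inj i(1) by (auto dest: inj_onD)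
        moreover have "inj_on w ({1..n} - {i})" using inj by (rule inj_on_subset) auto
        ultimately show ?thesis using i by (simp add: prod.reindex)
      qed
      moreover have "(\<Prod>j\<in>{1..n}-{i}. 1 / norm (blaschke R (w j) (w i)))\<^sup>2 \<le> P\<^sup>2"
      proof -
        have se: "{1..n} - {i} = {1..<i} \<union> {i<..n}" using i by auto
        have low: "(\<Prod>j\<in>{1..<i}. 1 + (6 * real J)\<^sup>2 / (real i - real j)\<^sup>2) = (\<Prod>k\<in>{1..<i}. 1 + (6 * real J)\<^sup>2 / (real k)\<^sup>2)"
          by (rule prod.reindex_bij_witness[of _ "\<lambda>k. i - k" "\<lambda>j. i - j"]) (auto simp: of_nat_diff)
        have high: "(\<Prod>j\<in>{i<..n}. 1 + (6 * real J)\<^sup>2 / (real i - real j)\<^sup>2) = (\<Prod>k\<in>{1..n-i}. 1 + (6 * real J)\<^sup>2 / (real k)\<^sup>2)"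
          by (rule prod.reindex_bij_witness[of _ "\<lambda>k. i + k" "\<lambda>j. j - i"]) (auto simp: of_nat_diff power2_commute)
        have "(\<Prod>j\<in>{1..n}-{i}. 1 / norm (blaschke R (w j) (w i)))\<^sup>2 = (\<Prod>j\<in>{1..n}-{i}. (1 / norm (blaschke R (w j) (w i)))\<^sup>2)"
          by (rule prod_power_distrib)
        also have "\<dots> \<le> (\<Prod>j\<in>{1..n}-{i}. 1 + (6 * real J)\<^sup>2 / (real i - real j)\<^sup>2)"
          using tm by (intro prod_mono) auto
        also have "(\<Prod>j\<in>{1..n}-{i}. 1 + (6 * real J)\<^sup>2 / (real i - real j)\<^sup>2) =
           (\<Prod>j\<in>{1..<i}. 1 + (6 * real J)\<^sup>2 / (real i - real j)\<^sup>2) * (\<Prod>j\<in>{i<..n}. 1 + (6 * real J)\<^sup>2 / (real i - real j)\<^sup>2)"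
          unfolding se by (rule prod.union_disjoint) auto
        also have "\<dots> = (\<Prod>k\<in>{1..<i}. 1 + (6 * real J)\<^sup>2 / (real k)\<^sup>2) * (\<Prod>k\<in>{1..n-i}. 1 + (6 * real J)\<^sup>2 / (real k)\<^sup>2)"
          unfolding low high ..
        also have "\<dots> \<le> P * P"
          unfolding P_def using i by (intro mult_mono prod_mono2 prod_nonneg) auto
        finally show ?thesis by (simp add: power2_eq_square)
      qed
      moreover have "P \<ge> 0" unfolding P_def by (intro prod_nonneg) auto
      ultimately have "(\<Prod>v\<in>W-{u}. 1 / norm (blaschke R v u)) \<le> P" by (metis power2_le_imp_le)
      also have "P \<le> exp (pi * (6 * real J))" unfolding P_def using J by (intro prod_one_plus_squares_le) auto
      finally show ?thesis by (simp add: D_def mult_ac)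
    qed
    show "(\<Prod>v\<in>W. norm (blaschke R v z0)) \<le> q"
    proof -
      have tm: "norm (blaschke R v z0) \<le> exp (- (a / 20))" if "v \<in> W" for v
      proof (cases "z0 = v")
        case True
        then show ?thesis by (simp add: blaschke_def)
      next
        case False
        from that obtain j where j: "j \<in> {1..n}" "v = w j" unfolding W_def by blast
        have "(norm (z0 - v))\<^sup>2 \<le> 5"
        proof -
          have "(norm (z0 - v))\<^sup>2 = (2 - \<sigma> j)\<^sup>2 + (real j * \<delta>)\<^sup>2" unfolding j(2) by (simp add: z0_def w_def cmod_power2)
          moreover have "(2 - \<sigma> j)\<^sup>2 \<le> 2\<^sup>2" using \<sigma>[OF j(1)] \<alpha> a by (intro power_mono) (auto simp: abs_if split: if_splits)
          moreover have "(real j * \<delta>)\<^sup>2 \<le> 1\<^sup>2" using jl[of j] j l \<delta> by (intro power_mono) auto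
          ultimately show ?thesis by simp
        qed
        moreover have "norm (z0 - v) > 0" using False by simp
        ultimately have "1 + R * 1 / (R\<^sup>2 * 5) \<le> 1 + (R\<^sup>2 - (norm z0)\<^sup>2) * (R\<^sup>2 - (norm v)\<^sup>2) / (R\<^sup>2 * (norm (z0 - v))\<^sup>2)"
          using rz nw[OF j(1)] R10 j(2) by (intro add_left_mono frac_le mult_mono mult_left_mono mult_nonneg_nonneg) auto
        also have "\<dots> = 1 / (norm (blaschke R v z0))\<^sup>2"
          by (rule norm_blaschke_power2[symmetric]) (use rz nw[OF j(1)] j False in auto)
        also have "1 + R * 1 / (R\<^sup>2 * 5) = 1 + a / 5" using a by (simp add: R_def power2_eq_square)
        finally have ge: "1 + a / 5 \<le> 1 / (norm (blaschke R v z0))\<^sup>2" .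
        have "exp (a / 10) \<le> 1 + a / 5"
        proof -
          have "exp (a / 10) \<le> 1 + a / 10 + (a / 10)\<^sup>2" using a by (intro exp_bound) auto
          also have "(a / 10)\<^sup>2 \<le> a / 10" using a by (simp add: power2_eq_square mult_le_one)
          finally show ?thesis by simp
        qed
        with ge have "exp (a / 10) \<le> 1 / (norm (blaschke R v z0))\<^sup>2" by linarith
        then have "(norm (blaschke R v z0))\<^sup>2 \<le> 1 / exp (a / 10)"
          by (cases "blaschke R v z0 = 0") (auto simp: field_simps)
        also have "\<dots> = (exp (- (a / 20)))\<^sup>2" by (simp add: exp_minus inverse_eq_divide power_divide exp_double[symmetric])
        finally show ?thesis by (rule power2_le_imp_le) simp
      qed
      have "(\<Prod>v\<in>W. norm (blaschke R v z0)) \<le> (\<Prod>v\<in>W. exp (- (a / 20)))"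
        using tm by (intro prod_mono) auto
      also have "\<dots> = q" using inj by (simp add: W_def q_def card_image exp_of_nat_mult[symmetric])
      finally show ?thesis .
    qed
  qed
  moreover have "F z0 = f (Complex 2 t0)" proof -
    have "c + z0 = Complex 2 t0" by (simp add: c_def z0_def complex_eq_iff)
    then show ?thesis by (simp add: F_def)
  qed
  moreover have "card W = n" using inj by (simp add: W_def card_image)
  moreover have "q \<le> 3 * exp (- (len * real J / 20))"
  proof -
    have "real n * a \<ge> (len / \<delta> - 1) * a" using n1 a by (intro mult_right_mono) auto
    also have "(len / \<delta> - 1) * a = len * real J - a" using a by (simp add: \<delta>_def left_diff_distrib)
    finally have "- (real n * a / 20) \<le> 1 + - (len * real J / 20)" using a by simp
    then have "q \<le> exp (1 + - (len * real J / 20))" unfolding q_def by (subst exp_le_cancel_iff)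
    also have "\<dots> = exp 1 * exp (- (len * real J / 20))" by (rule exp_add)
    also have "\<dots> \<le> 3 * exp (- (len * real J / 20))" by (intro mult_right_mono exp_le) auto
    finally show ?thesis .
  qed
  moreover have "E \<ge> 0" using inD[of c] R10 norm_ge_zero[of "f c"] by (simp, linarith)
  moreover have "real n \<le> len * real J / a" using n1 by (simp add: \<delta>_def)
  moreover have "\<kappa> \<ge> 0" using small[of t0] l norm_ge_zero order_trans by (metis add.right_neutral add_le_cancel_left less_imp_le order_refl)
  ultimately have "norm (f (Complex 2 t0)) \<le> q * E + 4 * real n * D * \<kappa>" "q * E \<le> 3 * exp (- (len * real J / 20)) * E"
     "4 * real n * D * \<kappa> \<le> 4 * (len * real J / a) * D * \<kappa>"
    by (simp, simp add: mult_right_mono,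
        intro mult_right_mono mult_left_mono) (auto simp: D_def)
  then have "norm (f (Complex 2 t0)) \<le> 3 * exp (- (len * real J / 20)) * E + 4 * (len * real J / a) * D * \<kappa>"
    by linarith
  then show ?thesis by (simp add: D_def)
qed

section \<open>Primes in dyadic blocks\<close>

text \<open>
  An integer without prime factors above q is determined by the set of primes in its squarefree part, a subset of {1..q}, and by its square part, which is at most the root of x.
\<close>
lemma squarefree_smooth_count:
  fixes q x :: nat
  shows "real (card {n\<in>{1..x}. \<forall>p. prime p \<longrightarrow> p dvd n \<longrightarrow> p \<le> q}) \<le> 2 ^ q * sqrt (real x)"
proof -
  define A where "A = {n\<in>{1..x}. \<forall>p. prime p \<longrightarrow> p dvd n \<longrightarrow> p \<le> q}"
  define g where "g n = (prime_factors (squarefree_part n), square_part n)" for n :: nat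
  define r where "r = nat \<lfloor>sqrt (real x)\<rfloor>"
  have "inj_on g A"
  proof
    fix m n assume mn: "m \<in> A" "n \<in> A" "g m = g n"
    then have nz: "m \<noteq> 0" "n \<noteq> 0" by (auto simp: A_def)
    have eq: "square_part m = square_part n" "prime_factors (squarefree_part m) = prime_factors (squarefree_part n)"
      using mn(3) by (auto simp: g_def)
    have "squarefree_part m = squarefree_part n"
    proof (rule multiplicity_eq_nat)
      fix p :: nat assume p: "prime p"
      have "multiplicity p (squarefree_part m) \<le> 1" "multiplicity p (squarefree_part n) \<le> 1"
        using prime_multiplicity_squarefree_part_le_Suc_0[OF p] by simp_all
      moreover have "multiplicity p (squarefree_part m) > 0 \<longleftrightarrow> multiplicity p (squarefree_part n) > 0"
        using eq(2) p unfolding prime_factors_multiplicity by blast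
      ultimately show "multiplicity p (squarefree_part m) = multiplicity p (squarefree_part n)" by linarith
    qed (use squarefree_part_nonzero in \<open>auto intro!: Nat.gr0I\<close>)
    with eq(1) show "m = n" using squarefree_decompose[of m] squarefree_decompose[of n] by metis
  qed
  moreover have "g ` A \<subseteq> Pow {1..q} \<times> {1..r}"
  proof (rule image_subsetI)
    fix n assume n: "n \<in> A"
    then have nz: "n \<noteq> 0" by (auto simp: A_def)
    have d: "n = squarefree_part n * square_part n ^ 2" by (rule squarefree_decompose)
    have "prime_factors (squarefree_part n) \<subseteq> {1..q}"
    proof
      fix p assume p: "p \<in> prime_factors (squarefree_part n)"
      then have "prime p" "p dvd squarefree_part n" by auto
      then have "p dvd n" by (metis d dvd_mult2)
      with \<open>prime p\<close> n have "p \<le> q" by (auto simp: A_def)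
      then show "p \<in> {1..q}" using \<open>prime p\<close> prime_ge_1_nat by auto
    qed
    moreover have "square_part n \<in> {1..r}"
    proof -
      have "square_part n \<noteq> 0" "squarefree_part n \<noteq> 0" using d nz by (metis mult_zero_right power_zero_numeral, metis mult_zero_left)
      then have "1 * square_part n ^ 2 \<le> squarefree_part n * square_part n ^ 2" by (intro mult_right_mono) linarith+
      then have "square_part n ^ 2 \<le> n" unfolding d[symmetric] by simp
      also have "n \<le> x" using n by (auto simp: A_def)
      finally have "real (square_part n) ^ 2 \<le> real x" by (metis of_nat_le_iff of_nat_power)
      then have "real (square_part n) \<le> sqrt (real x)" by (intro real_le_rsqrt)
      then have "square_part n \<le> r" unfolding r_def by (simp add: le_nat_floor)
      moreover have "1 \<le> square_part n" using \<open>square_part n \<noteq> 0\<close> by linarith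
      ultimately show ?thesis by simp
    qed
    ultimately show "g n \<in> Pow {1..q} \<times> {1..r}" by (auto simp: g_def)
  qed
  ultimately have "card A \<le> card (Pow {1..q} \<times> {1..r})" by (intro card_inj_on_le) auto
  also have "\<dots> = 2 ^ q * r" by (simp add: card_cartesian_product card_Pow)
  finally have "real (card A) \<le> 2 ^ q * real r" 
    by (simp only: of_nat_le_iff[where 'a = real, symmetric] of_nat_mult of_nat_numeral of_nat_power)
  also have "real r \<le> sqrt (real x)" unfolding r_def by (intro of_nat_floor) simp
  finally show ?thesis unfolding A_def by simp
qed

lemma card_multiples: 
  assumes "p > 0" shows "real (card {n\<in>{1..x}. p dvd n}) \<le> real x / real p"
proof -
  have "{n\<in>{1..x}. p dvd n} = (\<lambda>k. p * k) ` {1..x div p}"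
  proof (intro set_eqI iffI)
    fix n assume n: "n \<in> {n\<in>{1..x}. p dvd n}"
    then obtain k where k: "n = p * k" by (auto elim: dvdE)
    with n assms have "k \<in> {1..x div p}"
      by (cases k) (simp_all add: less_eq_div_iff_mult_less_eq mult.commute)
    with k show "n \<in> (\<lambda>k. p * k) ` {1..x div p}" by blast
  next
    fix n assume "n \<in> (\<lambda>k. p * k) ` {1..x div p}"
    then obtain k where "n = p * k" "k \<in> {1..x div p}" by blast
    then have k: "n = p * k" "1 \<le> k" "k \<le> x div p" by simp_all
    then have "n \<le> x" using assms by (simp add: less_eq_div_iff_mult_less_eq mult.commute)
    moreover have "1 \<le> n" using k assms by (simp add: Suc_le_eq)
    ultimately show "n \<in> {n\<in>{1..x}. p dvd n}" using k by simp
  qed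
  then have "card {n\<in>{1..x}. p dvd n} = x div p" using assms by (simp add: card_image inj_on_def)
  moreover have "real (x div p) * real p \<le> real x" 
    unfolding of_nat_mult[symmetric] of_nat_le_iff by (rule div_times_less_eq_dividend)
  ultimately show ?thesis using assms by (simp add: field_simps)
qed

text \<open>
  Erdos's argument. If all blocks beyond some point had fewer than the 3/4-th power of their length many primes, the reciprocals of these primes would sum to less than 1/2 from some point on. Then a positive proportion of the integers up to x would be composed of boundedly many primes, against the square root bound for their number.
\<close>
lemma many_primes_in_dyadic_block:
  "\<exists>k\<ge>K. real (card {p. prime p \<and> 2 ^ k < p \<and> p \<le> (2::nat) ^ (k + 1)}) \<ge> (2 ^ k) powr (3/4)"
proof (rule ccontr)
  assume neg: "\<not> ?thesis"
  define S where "S k = {p. prime p \<and> 2 ^ k < p \<and> p \<le> (2::nat) ^ (k + 1)}" for k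
  \<comment> \<open>From 20 on the geometric series with ratio 2 to the power -1/4 has sum at most 1/4.\<close>
  define k1 where "k1 = max K 20"
  define q where "q = (2::nat) ^ k1"
  \<comment> \<open>The number x, which is 2 to the power m, has a root larger than 8/3 times the bound 2 to the power q for the number of subsets.\<close>
  define m where "m = 2 * q + 3"
  define x where "x = (2::nat) ^ m"
  have m: "m \<ge> k1" 
  proof -
    have "k1 < q" unfolding q_def by (rule less_exp)
    then show ?thesis by (simp add: m_def)
  qed
  have S: "real (card (S k)) < (2 ^ k) powr (3/4)" if "k \<ge> k1" for k
  proof -
    have "K \<le> k" using that by (simp add: k1_def)
    with neg show ?thesis unfolding S_def not_ex de_Morgan_conj by (meson not_le)
  qed
  have fS: "finite (S k)" for k
    by (rule finite_subset[OF _ finite_atMost[of "2^(k+1)"]]) (unfold S_def subset_iff atMost_iff mem_Collect_eq, blast)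
  define A where "A = {n\<in>{1..x}. \<forall>p. prime p \<longrightarrow> p dvd n \<longrightarrow> p \<le> q}"
  have "{1..x} \<subseteq> A \<union> (\<Union>k\<in>{k1..<m}. \<Union>p\<in>S k. {n\<in>{1..x}. p dvd n})"
  proof
    fix n assume n: "n \<in> {1..x}"
    show "n \<in> A \<union> (\<Union>k\<in>{k1..<m}. \<Union>p\<in>S k. {n\<in>{1..x}. p dvd n})"
    proof (cases "n \<in> A")
      case False
      then obtain p where p: "prime p" "p dvd n" "\<not> p \<le> q" using n unfolding A_def mem_Collect_eq by blast
      have "p \<le> x" using dvd_imp_le[OF p(2)] n by simp
      define k where "k = (LEAST k. p \<le> 2 ^ (k + 1))"
      have ex: "p \<le> 2 ^ (p + 1)"
      proof -
        have "p + 1 < 2 ^ (p + 1)" by (rule less_exp)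
        then show ?thesis by linarith
      qed
      have k: "p \<le> 2 ^ (k + 1)" unfolding k_def by (rule LeastI[of "\<lambda>k. p \<le> 2 ^ (k + 1)", OF ex])
      have "m - 1 + 1 = m" by (simp add: m_def)
      then have "p \<le> 2 ^ (m - 1 + 1)" using \<open>p \<le> x\<close> unfolding x_def by simp
      then have "k \<le> m - 1" unfolding k_def by (rule Least_le)
      then have km: "k < m" by (simp add: m_def)
      have "k \<ge> k1"
      proof (rule ccontr)
        assume "\<not> k1 \<le> k"
        then have "(2::nat) ^ (k + 1) \<le> 2 ^ k1" by (intro power_increasing) auto
        then show False using k p(3) unfolding q_def using order_trans by blast
      qed
      moreover have "2 ^ k < p"
      proof (cases k)
        case 0 then show ?thesis using prime_gt_1_nat[OF p(1)] by simp
      next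
        case (Suc j)
        then have "\<not> p \<le> 2 ^ (j + 1)" using not_less_Least[of j "\<lambda>k. p \<le> 2 ^ (k + 1)"] unfolding k_def by auto
        then show ?thesis using Suc by simp
      qed
      ultimately show ?thesis using p n k km unfolding S_def by auto
    qed auto
  qed
  then have "card {1..x} \<le> card (A \<union> (\<Union>k\<in>{k1..<m}. \<Union>p\<in>S k. {n\<in>{1..x}. p dvd n}))"
    using fS by (intro card_mono) (auto simp: A_def)
  also have "\<dots> \<le> card A + card (\<Union>k\<in>{k1..<m}. \<Union>p\<in>S k. {n\<in>{1..x}. p dvd n})" by (rule card_Un_le)
  also have "card (\<Union>k\<in>{k1..<m}. \<Union>p\<in>S k. {n\<in>{1..x}. p dvd n}) \<le> (\<Sum>k\<in>{k1..<m}. card (\<Union>p\<in>S k. {n\<in>{1..x}. p dvd n}))"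
    by (rule card_UN_le) simp
  also have "\<dots> \<le> (\<Sum>k\<in>{k1..<m}. \<Sum>p\<in>S k. card {n\<in>{1..x}. p dvd n})"
    by (intro sum_mono card_UN_le fS)
  finally have "x \<le> card A + (\<Sum>k\<in>{k1..<m}. \<Sum>p\<in>S k. card {n\<in>{1..x}. p dvd n})" by simp
  then have "real x \<le> real (card A + (\<Sum>k\<in>{k1..<m}. \<Sum>p\<in>S k. card {n\<in>{1..x}. p dvd n}))" by (rule of_nat_mono)
  also have "\<dots> = real (card A) + (\<Sum>k\<in>{k1..<m}. \<Sum>p\<in>S k. real (card {n\<in>{1..x}. p dvd n}))"
    unfolding of_nat_add of_nat_sum ..
  finally have x1: "real x \<le> real (card A) + (\<Sum>k\<in>{k1..<m}. \<Sum>p\<in>S k. real (card {n\<in>{1..x}. p dvd n}))" .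
  have x2: "(\<Sum>k\<in>{k1..<m}. \<Sum>p\<in>S k. real (card {n\<in>{1..x}. p dvd n})) \<le> (\<Sum>k\<in>{k1..<m}. real x * (2 powr (-1/4)) ^ k)"
  proof (intro sum_mono)
    fix k assume k: "k \<in> {k1..<m}"
    have "(\<Sum>p\<in>S k. real (card {n\<in>{1..x}. p dvd n})) \<le> (\<Sum>p\<in>S k. real x / 2 ^ k)"
    proof (intro sum_mono)
      fix p assume p: "p \<in> S k"
      then have "real (2 ^ k) \<le> real p" "p > 0" unfolding S_def mem_Collect_eq of_nat_le_iff by (auto simp: prime_gt_0_nat)
      then have "real x / real p \<le> real x / 2 ^ k" by (intro divide_left_mono) auto
      with card_multiples[OF \<open>p > 0\<close>, of x] show "real (card {n\<in>{1..x}. p dvd n}) \<le> real x / 2 ^ k" by linarith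
    qed
    also have "\<dots> = real (card (S k)) * (real x / 2 ^ k)" by simp
    also have "\<dots> \<le> (2 ^ k) powr (3/4) * (real x / 2 ^ k)" using S[of k] k by (intro mult_right_mono) auto
    also have "\<dots> = real x * ((2 ^ k) powr (3/4) / (2 ^ k) powr 1)" by simp
    also have "(2 ^ k) powr (3/4) / (2 ^ k) powr 1 = ((2::real) ^ k) powr (-1/4)" by (subst powr_diff[symmetric]) simp
    also have "\<dots> = (2 powr (-1/4)) ^ k" 
    proof -
      have "((2::real) ^ k) powr (-1/4) = (2 powr real k) powr (-1/4)" by (simp only: powr_realpow zero_less_numeral)
      also have "\<dots> = (2 powr (-1/4)) powr real k" unfolding powr_powr by (simp only: mult.commute)
      also have "\<dots> = (2 powr (-1/4)) ^ k" by (rule powr_realpow) simp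
      finally show ?thesis .
    qed
    finally show "(\<Sum>p\<in>S k. real (card {n\<in>{1..x}. p dvd n})) \<le> real x * (2 powr (-1/4)) ^ k" .
  qed
  have x3: "(\<Sum>k\<in>{k1..<m}. real x * (2 powr (-1/4)) ^ k) = real x * (\<Sum>k\<in>{k1..<m}. (2 powr (-1/4)) ^ k)"
    by (simp add: sum_distrib_left)
  have "(\<Sum>k\<in>{k1..<m}. (2 powr (-1/4)) ^ k) \<le> (1/4::real)"
  proof -
    define \<rho> where "\<rho> = (2::real) powr (-1/4)"
    have r4: "\<rho> ^ 4 = 1/2"
    proof -
      have "\<rho> ^ 4 = \<rho> powr real 4" using powr_realpow[of \<rho> 4] by (simp add: \<rho>_def)
      also have "\<dots> = 2 powr - 1" unfolding \<rho>_def powr_powr by simp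
      finally show ?thesis by (simp only: powr_minus_divide powr_one)
    qed
    have "\<rho> > 0" by (simp add: \<rho>_def)
    have rl: "\<rho> \<le> 7/8"
    proof (rule power_le_imp_le_base[of _ 3])
      show "\<rho> ^ Suc 3 \<le> (7/8) ^ Suc 3" using r4 by (simp add: power_divide eval_nat_numeral)
    qed simp
    have "(\<Sum>k\<in>{k1..<m}. \<rho> ^ k) = (\<rho> ^ k1 - \<rho> ^ m) / (1 - \<rho>)"
    proof -
      have "(\<Sum>k\<in>{k1..<m}. \<rho> ^ k) = (\<Sum>k<m. \<rho> ^ k) - (\<Sum>k<k1. \<rho> ^ k)"
        using sum.atLeastLessThan_concat[of 0 k1 m "\<lambda>k. \<rho> ^ k"] m by (simp add: atLeast0LessThan)
      then show ?thesis unfolding sum_gp_strict using rl by (simp add: diff_divide_distrib)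
    qed
    also have "\<dots> \<le> \<rho> ^ 20 / (1/8)"
    proof (rule frac_le)
      have "\<rho> ^ k1 \<le> \<rho> ^ 20" using rl \<open>\<rho> > 0\<close> by (intro power_decreasing) (auto simp: k1_def)
      moreover have "0 \<le> \<rho>" using \<open>\<rho> > 0\<close> by simp
      ultimately show "\<rho> ^ k1 - \<rho> ^ m \<le> \<rho> ^ 20" using zero_le_power[of \<rho> m] by linarith
    qed (use rl \<open>\<rho> > 0\<close> in auto)
    also have "\<rho> ^ 20 = (\<rho> ^ 4) ^ 5" by (simp flip: power_mult)
    finally have "(\<Sum>k\<in>{k1..<m}. \<rho> ^ k) \<le> 1/4" unfolding r4 by (simp add: power_divide)
    then show ?thesis unfolding \<rho>_def .
  qed
  then have "real x * (\<Sum>k\<in>{k1..<m}. (2 powr (-1/4)) ^ k) \<le> real x * (1/4)" by (rule mult_left_mono) simp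
  then have c1: "real x \<le> real (card A) + real x * (1/4)" using x1 x2 x3 by linarith
  define u where "u = sqrt (real x)"
  have c2: "real (card A) \<le> 2 ^ q * u" unfolding A_def u_def by (rule squarefree_smooth_count)
  have c3: "u > 0" by (simp add: u_def x_def)
  have c4: "real x = u * u" by (simp add: u_def)
  from c1 c2 have "(3/4 * u) * u \<le> 2 ^ q * u" unfolding c4 by linarith
  then have c5: "3/4 * u \<le> 2 ^ q" using c3 by (rule mult_right_le_imp_le)
  have "2 * 2 ^ q \<le> u" unfolding u_def
  proof (rule real_le_rsqrt)
    have "(2 * 2 ^ q)\<^sup>2 = (2::real) ^ (q * 2 + 2)" unfolding power_mult_distrib power_mult power_add by simp
    also have "\<dots> \<le> 2 ^ m" by (rule power_increasing) (unfold m_def, linarith+)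
    finally show "(2 * 2 ^ q)\<^sup>2 \<le> real x" unfolding x_def by simp
  qed
  moreover have "(2::real) ^ q > 0" by simp
  ultimately show False using c5 by linarith
qed

section \<open>The sieved zeta function and the resonator\<close>

text \<open>
  The lower bound 17 ensures that the reciprocal root of each prime is below 1/4.
\<close>
locale prime_set =
  fixes PP :: "nat set"
  assumes finite_PP: "finite PP" and prime_PP: "p \<in> PP \<Longrightarrow> prime p" and PP_ge: "p \<in> PP \<Longrightarrow> 17 \<le> p"
begin

definition euler :: "complex \<Rightarrow> complex" where
  "euler s = (\<Prod>p\<in>PP. 1 - of_nat p powr (- s))"

text \<open>
  The Euler factors at the primes of PP are removed: only integers coprime to all of them remain in the Dirichlet series. Thereby this function and the resonator involve disjoint sets of primes.
\<close>
definition rough_zeta :: "complex \<Rightarrow> complex" where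
  "rough_zeta s = zeta s * euler s"

text \<open>
  The square of its modulus is the weight. For kappa = 1 it concentrates on those t for which the cosines of t ln p are positive, for kappa = -1 on those for which they are negative.
\<close>
definition resonator :: "real \<Rightarrow> real \<Rightarrow> complex" where
  "resonator \<kappa> t = (\<Prod>p\<in>PP. 1 + of_real \<kappa> * cis (- t * ln (real p)))"

definition rough_upto :: "nat \<Rightarrow> nat set" where
  "rough_upto N = {m\<in>{1..N}. coprime m (\<Prod>PP)}"

definition rough_sum :: "nat \<Rightarrow> complex \<Rightarrow> complex" where
  "rough_sum N s = (\<Sum>m\<in>rough_upto N. of_nat m powr (- s))"

lemma finite_rough_upto [simp]: "finite (rough_upto N)" by (simp add: rough_upto_def)

lemma PP_pos: "p \<in> PP \<Longrightarrow> 0 < p" using PP_ge[of p] by linarith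

lemma finite_sub: "S \<subseteq> PP \<Longrightarrow> finite S" using finite_PP by (rule rev_finite_subset)

lemma prod_pos: "S \<subseteq> PP \<Longrightarrow> 0 < \<Prod>S" using PP_pos by (intro prod_pos) auto

lemma prod_le: "S \<subseteq> PP \<Longrightarrow> \<Prod>S \<le> \<Prod>PP"
  using prod_pos[of PP] by (intro dvd_imp_le prod_dvd_prod_subset finite_PP) auto

lemma prime_dvd_prod_PP:
  assumes S: "S \<subseteq> PP" and p: "p \<in> PP"
  shows "p dvd \<Prod>S \<longleftrightarrow> p \<in> S"
proof
  assume "p dvd \<Prod>S"
  then have "\<exists>q\<in>S. p dvd q" using prime_dvd_prod_iff[OF finite_sub[OF S] prime_PP[OF p], of "\<lambda>x. x"] by simp
  then obtain q where "q \<in> S" "p dvd q" by blast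
  then have "p = q" using S prime_PP[OF p] prime_PP[of q] primes_dvd_imp_eq by blast
  then show "p \<in> S" using \<open>q \<in> S\<close> by simp
next
  assume "p \<in> S" then show "p dvd \<Prod>S" by (rule dvd_prodI[OF finite_sub[OF S]])
qed

lemma coprime_PP_iff: "coprime m (\<Prod>PP) \<longleftrightarrow> (\<forall>p\<in>PP. \<not> p dvd m)"
proof
  assume c: "coprime m (\<Prod>PP)"
  show "\<forall>p\<in>PP. \<not> p dvd m"
  proof
    fix p assume p: "p \<in> PP"
    then have "p dvd \<Prod>PP" using prime_dvd_prod_PP[of PP p] by simp
    then show "\<not> p dvd m" using c prime_PP[OF p] not_prime_unit coprime_common_divisor by blast
  qed
next
  assume "\<forall>p\<in>PP. \<not> p dvd m"
  then have "coprime p m" if "p \<in> PP" for p using prime_imp_coprime[of p m] prime_PP[OF that] that by blast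
  then show "coprime m (\<Prod>PP)" by (intro prod_coprime_right) (simp add: coprime_commute)
qed

text \<open>
  The primes of PP that divide m * prod S are exactly those of S, so S and then m can be recovered from the product.
\<close>
lemma rough_times_prod_inj: "inj_on (\<lambda>(m, S). m * \<Prod>S) ({m. coprime m (\<Prod>PP)} \<times> Pow PP)"
proof (rule inj_onI, clarify)
  fix m m' S S' assume c: "coprime m (\<Prod>PP)" "coprime m' (\<Prod>PP)" and S: "S \<subseteq> PP" "S' \<subseteq> PP" and eq: "m * \<Prod>S = m' * \<Prod>S'"
  have d: "p dvd m * \<Prod>S \<longleftrightarrow> p \<in> S" "p dvd m' * \<Prod>S' \<longleftrightarrow> p \<in> S'" if p: "p \<in> PP" for p
    using prime_dvd_mult_iff[OF prime_PP[OF p]] c[unfolded coprime_PP_iff] p prime_dvd_prod_PP[OF S(1) p] prime_dvd_prod_PP[OF S(2) p] by blast+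
  have "S = S'" using d S unfolding eq by blast
  then show "m = m' \<and> S = S'" using eq prod_pos[OF S(2)] by simp
qed

lemma prod_inj: "inj_on (\<lambda>S. \<Prod>S) (Pow PP)"
  using prime_dvd_prod_PP by (intro inj_onI set_eqI) (metis PowD subsetD)

lemma card_Pow_PP: "card (Pow PP) = 2 ^ card PP" by (rule card_Pow[OF finite_PP])

lemma two_power_card_le: "(2::real) ^ card PP \<le> real (\<Prod>PP)"
proof -
  have "(2::real) ^ card PP = (\<Prod>p\<in>PP. 2)" by simp
  also have "\<dots> \<le> (\<Prod>p\<in>PP. real p)" using PP_ge by (intro prod_mono) force
  finally show ?thesis by simp
qed

lemma prod_one_plus_expand:
  fixes g :: "nat \<Rightarrow> complex"
  assumes "finite A"
  shows "(\<Prod>p\<in>A. 1 + c * g p) = (\<Sum>S\<in>Pow A. c ^ card S * (\<Prod>p\<in>S. g p))"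
proof -
  have "(\<Prod>p\<in>A. 1 + c * g p) = (\<Prod>p\<in>A. c * g p + 1)" by (simp add: add.commute)
  also have "\<dots> = (\<Sum>S\<in>Pow A. (\<Prod>p\<in>S. c * g p) * (\<Prod>p\<in>A-S. 1))" by (rule prod_add[OF assms])
  finally show ?thesis by (simp add: prod.distrib)
qed

lemma prod_cis_ln: "S \<subseteq> PP \<Longrightarrow> (\<Prod>p\<in>S. cis (- t * ln (real p))) = cis (- t * ln (real (\<Prod>S)))"
proof -
  assume S: "S \<subseteq> PP"
  have "(\<Prod>p\<in>S. cis (- t * ln (real p))) = cis (\<Sum>p\<in>S. - t * ln (real p))"
    using finite_sub[OF S] by (induction rule: finite_induct) (auto simp: cis_mult)
  also have "(\<Sum>p\<in>S. - t * ln (real p)) = - t * (\<Sum>p\<in>S. ln (real p))" by (rule sum_distrib_left[symmetric])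
  also have "(\<Sum>p\<in>S. ln (real p)) = ln (\<Prod>p\<in>S. real p)" using S PP_pos finite_sub[OF S] by (intro ln_prod[symmetric]) force+
  finally show ?thesis by simp
qed

lemma resonator_expand: "resonator \<kappa> t = (\<Sum>S\<in>Pow PP. of_real \<kappa> ^ card S * cis (- t * ln (real (\<Prod>S))))"
  unfolding resonator_def prod_one_plus_expand[OF finite_PP] using prod_cis_ln by (intro sum.cong) auto

lemma prod_powr: "S \<subseteq> PP \<Longrightarrow> (\<Prod>p\<in>S. of_nat p powr s) = (of_nat (\<Prod>S) powr s :: complex)"
proof -
  assume S: "S \<subseteq> PP"
  show ?thesis using finite_sub[OF S] S
  proof (induction S rule: finite_induct)
    case (insert p S)
    have "of_nat (p * \<Prod>S) powr s = (of_nat p powr s * of_nat (\<Prod>S) powr s :: complex)"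
      using powr_times_real[of "of_nat p" "of_nat (\<Prod>S)" s] unfolding of_nat_mult by (simp del: of_nat_prod)
    then show ?case using insert by simp
  qed simp
qed

lemma euler_expand: "euler s = (\<Sum>S\<in>Pow PP. (-1) ^ card S * of_nat (\<Prod>S) powr (- s))"
  using prod_one_plus_expand[OF finite_PP, of "-1" "\<lambda>p. of_nat p powr (- s)"] prod_powr
  unfolding euler_def by (auto intro!: sum.cong)

lemma continuous_resonator: "continuous_on A (resonator \<kappa>)"
  unfolding resonator_def[abs_def] by (intro continuous_intros continuous_on_cis)

text \<open>
  By unique factorization the frequencies of the product are still distinct integers. Hence the mean value is the product of the mean values up to the longer length: multiplication by the resonator costs nothing.
\<close>
lemma twisted_mean_value:
  assumes I: "I \<subseteq> rough_upto N" and kappa: "\<bar>\<kappa>\<bar> = 1" and T: "T \<ge> 0"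
  shows "integral {A..A+T} (\<lambda>t. (norm (\<Sum>m\<in>I. c m * cis (- t * ln (real m))))\<^sup>2 * (norm (resonator \<kappa> t))\<^sup>2)
     \<le> (T + 4 * real (N * \<Prod>PP) * (1 + ln (real (N * \<Prod>PP)))) * (2 ^ card PP * (\<Sum>m\<in>I. (norm (c m))\<^sup>2))"
proof -
  have finI: "finite I" using I finite_rough_upto finite_subset by blast
  define b where "b = (\<lambda>(m::nat, S::nat set). c m * complex_of_real \<kappa> ^ card S :: complex) "
  define k where "k = (\<lambda>(m::nat, S::nat set). m * \<Prod>S)"
  have gen: "u * x * (y * z) = u * y * (x * z)" for u x y z :: complex by (simp add: mult_ac)
  have eq: "(norm (\<Sum>m\<in>I. c m * cis (- t * ln (real m))))\<^sup>2 * (norm (resonator \<kappa> t))\<^sup>2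
     = (norm (\<Sum>x\<in>I\<times>Pow PP. b x * cis (- t * ln (real (k x)))))\<^sup>2" for t
  proof -
    have "(\<Sum>m\<in>I. c m * cis (- t * ln (real m))) * resonator \<kappa> t
       = (\<Sum>(m,S)\<in>I\<times>Pow PP. (c m * cis (- t * ln (real m))) * (of_real \<kappa> ^ card S * cis (- t * ln (real (\<Prod>S)))))"
      unfolding resonator_expand sum_product sum.cartesian_product ..
    also have "\<dots> = (\<Sum>x\<in>I\<times>Pow PP. b x * cis (- t * ln (real (k x))))"
    proof (intro sum.cong refl, clarify)
      fix m S assume mS: "m \<in> I" "S \<subseteq> PP"
      then have "real m > 0" "real (\<Prod>S) > 0" using I prod_pos[OF mS(2)] by (auto simp: rough_upto_def simp del: of_nat_prod)
      then have "ln (real (m * \<Prod>S)) = ln (real m) + ln (real (\<Prod>S))" unfolding of_nat_mult by (rule ln_mult_pos)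
      then have "- t * ln (real m) + - t * ln (real (\<Prod>S)) = - t * ln (real (m * \<Prod>S))" by (simp add: algebra_simps)
      then have "cis (- t * ln (real m)) * cis (- t * ln (real (\<Prod>S))) = cis (- t * ln (real (m * \<Prod>S)))"
        unfolding cis_mult by (rule arg_cong)
      then show "c m * cis (- t * ln (real m)) * (of_real \<kappa> ^ card S * cis (- t * ln (real (\<Prod>S)))) = b (m, S) * cis (- t * ln (real (k (m, S))))"
        unfolding b_def k_def prod.case gen by (rule arg_cong)
    qed
    finally show ?thesis by (simp only: power_mult_distrib[symmetric] norm_mult[symmetric])
  qed
  have "integral {A..A+T} (\<lambda>t. (norm (\<Sum>x\<in>I\<times>Pow PP. b x * cis (- t * ln (real (k x)))))\<^sup>2)
     \<le> (T + 4 * real (N * \<Prod>PP) * (1 + ln (real (N * \<Prod>PP)))) * (\<Sum>x\<in>I\<times>Pow PP. (norm (b x))\<^sup>2)"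
  proof (rule dirichlet_polynomial_mean_value[OF _ _ _ T])
    show "finite (I \<times> Pow PP)" using finI finite_PP by simp
    show "inj_on k (I \<times> Pow PP)" unfolding k_def
      by (rule inj_on_subset[OF rough_times_prod_inj]) (use I in \<open>auto simp: rough_upto_def\<close>)
    show "0 < k x \<and> k x \<le> N * \<Prod>PP" if "x \<in> I \<times> Pow PP" for x
    proof -
      obtain m S where x: "x = (m, S)" "m \<in> I" "S \<subseteq> PP" using \<open>x \<in> I \<times> Pow PP\<close> by blast
      then have "m \<in> rough_upto N" using I by blast
      then show ?thesis unfolding x k_def prod.case using prod_pos[OF x(3)] prod_le[OF x(3)]
        by (intro conjI mult_le_mono) (auto simp: rough_upto_def simp del: prod_pos_nat_iff)
    qed
  qed
  also have "(\<Sum>x\<in>I\<times>Pow PP. (norm (b x))\<^sup>2) = (\<Sum>m\<in>I. \<Sum>S\<in>Pow PP. (norm (c m))\<^sup>2)"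
    unfolding sum.cartesian_product b_def using kappa by (intro sum.cong) (auto simp: norm_mult norm_power)
  also have "\<dots> = 2 ^ card PP * (\<Sum>m\<in>I. (norm (c m))\<^sup>2)"
    by (simp add: card_Pow_PP sum_distrib_left)
  finally show ?thesis unfolding eq .
qed

lemma resonator_mean_square:
  assumes "\<bar>\<kappa>\<bar> = 1" "T \<ge> 0"
  shows "integral {A..A+T} (\<lambda>t. (norm (resonator \<kappa> t))\<^sup>2) \<le> (T + 4 * real (\<Prod>PP) * (1 + ln (real (\<Prod>PP)))) * 2 ^ card PP"
  using twisted_mean_value[of "{1}" 1 \<kappa> T A "\<lambda>_. 1"] assms by (simp add: rough_upto_def)

end

text \<open>
  Only pairs with equal frequency contribute to the main term; distinct integers up to K have logarithms at distance at least 1/K.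
\<close>
lemma integral_cis_bilinear:
  fixes b :: "'i \<Rightarrow> complex" and c :: "'j \<Rightarrow> complex" and k :: "'i \<Rightarrow> nat" and l :: "'j \<Rightarrow> nat"
  assumes fin: "finite I" "finite J" and k: "\<And>i. i \<in> I \<Longrightarrow> 0 < k i \<and> k i \<le> K" and l: "\<And>j. j \<in> J \<Longrightarrow> 0 < l j \<and> l j \<le> K"
    and b: "\<And>i. i \<in> I \<Longrightarrow> norm (b i) \<le> 1" and c: "\<And>j. j \<in> J \<Longrightarrow> norm (c j) \<le> 1" and T: "T \<ge> 0"
  shows "norm (integral {A..A+T} (\<lambda>t. (\<Sum>i\<in>I. b i * cis (- t * ln (real (k i)))) * cnj (\<Sum>j\<in>J. c j * cis (- t * ln (real (l j)))))
      - of_real T * (\<Sum>i\<in>I. \<Sum>j\<in>J. if k i = l j then b i * cnj (c j) else 0)) \<le> 2 * real K * (real (card I) * real (card J))"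
proof -
  define e where "e i j = (\<lambda>t. cis ((ln (real (l j)) - ln (real (k i))) * t))" for i j
  have cont: "e i j integrable_on {A..A+T}" for i j
    unfolding e_def by (intro integrable_continuous_real continuous_intros continuous_on_cis)
  have "(\<Sum>i\<in>I. b i * cis (- t * ln (real (k i)))) * cnj (\<Sum>j\<in>J. c j * cis (- t * ln (real (l j))))
     = (\<Sum>i\<in>I. \<Sum>j\<in>J. (b i * cnj (c j)) * e i j t)" for t
  proof -
    have "cis (- t * ln (real (k i))) * cnj (cis (- t * ln (real (l j)))) = e i j t" for i j
      unfolding e_def cis_cnj cis_mult by (rule arg_cong[of _ _ cis]) (simp add: algebra_simps)
    then show ?thesis unfolding cnj_sum complex_cnj_mult sum_product
      by (intro sum.cong refl) (metis (no_types, opaque_lifting) mult.assoc mult.left_commute)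
  qed
  then have "integral {A..A+T} (\<lambda>t. (\<Sum>i\<in>I. b i * cis (- t * ln (real (k i)))) * cnj (\<Sum>j\<in>J. c j * cis (- t * ln (real (l j)))))
     = integral {A..A+T} (\<lambda>t. \<Sum>i\<in>I. \<Sum>j\<in>J. (b i * cnj (c j)) * e i j t)" by simp
  also have "\<dots> = (\<Sum>i\<in>I. \<Sum>j\<in>J. (b i * cnj (c j)) * integral {A..A+T} (e i j))"
    using fin cont by (simp add: integral_sum integrable_sum integrable_on_mult_right)
  finally have eq: "integral {A..A+T} (\<lambda>t. (\<Sum>i\<in>I. b i * cis (- t * ln (real (k i)))) * cnj (\<Sum>j\<in>J. c j * cis (- t * ln (real (l j)))))
      - of_real T * (\<Sum>i\<in>I. \<Sum>j\<in>J. if k i = l j then b i * cnj (c j) else 0)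
     = (\<Sum>i\<in>I. \<Sum>j\<in>J. (b i * cnj (c j)) * (integral {A..A+T} (e i j) - (if k i = l j then of_real T else 0)))"
    by (simp add: sum_distrib_left sum_subtractf[symmetric] right_diff_distrib if_distrib mult.commute cong: if_cong)
  have "norm ((b i * cnj (c j)) * (integral {A..A+T} (e i j) - (if k i = l j then of_real T else 0))) \<le> 2 * real K"
    if ij: "i \<in> I" "j \<in> J" for i j
  proof -
    have n: "norm (integral {A..A+T} (e i j) - (if k i = l j then of_real T else 0)) \<le> 2 * real K"
    proof (cases "k i = l j")
      case True
      then have "e i j = (\<lambda>t. 1)" by (simp add: e_def)
      then show ?thesis using True T by (simp add: scaleR_conv_of_real)
    next
      case False
      have K: "real K > 0" using k[OF ij(1)] by linarith
      have "\<bar>real (l j) - real (k i)\<bar> \<ge> 1" using False by linarith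
      then have "1 / real K \<le> \<bar>real (l j) - real (k i)\<bar> / real K" using K by (intro divide_right_mono) auto
      also have "\<dots> \<le> \<bar>ln (real (l j)) - ln (real (k i))\<bar>" using k[OF ij(1)] l[OF ij(2)] by (intro abs_ln_diff_ge) auto
      finally have th: "1 / real K \<le> \<bar>ln (real (l j)) - ln (real (k i))\<bar>" .
      then have nz: "ln (real (l j)) - ln (real (k i)) \<noteq> 0" using K by auto
      have "norm (integral {A..A+T} (e i j)) \<le> 2 / \<bar>ln (real (l j)) - ln (real (k i))\<bar>"
        unfolding e_def using T by (intro norm_integral_cis_le nz) auto
      also have "\<dots> \<le> 2 / (1 / real K)" using th K by (intro divide_left_mono mult_pos_pos) auto
      finally show ?thesis using False by simp
    qed
    have "norm (b i * cnj (c j)) \<le> 1 * 1" unfolding norm_mult complex_mod_cnj using b[OF ij(1)] c[OF ij(2)] by (intro mult_mono) auto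
    then have "norm (b i * cnj (c j)) * norm (integral {A..A+T} (e i j) - (if k i = l j then of_real T else 0)) \<le> 1 * (2 * real K)"
      using n by (intro mult_mono) auto
    then show ?thesis unfolding norm_mult by simp
  qed
  then have "norm (\<Sum>i\<in>I. \<Sum>j\<in>J. (b i * cnj (c j)) * (integral {A..A+T} (e i j) - (if k i = l j then of_real T else 0))) \<le> (\<Sum>i\<in>I. \<Sum>j\<in>J. 2 * real K)"
    by (intro order_trans[OF norm_sum] sum_mono) auto
  then show ?thesis unfolding eq by (simp add: mult_ac)
qed

context prime_set begin

lemma prod_eq_times_prime_iff:
  assumes p: "p \<in> PP" and S: "S \<subseteq> PP" "S' \<subseteq> PP"
  shows "\<Prod>S = p * \<Prod>S' \<longleftrightarrow> p \<notin> S' \<and> S = insert p S'"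
proof
  assume eq: "\<Prod>S = p * \<Prod>S'"
  then have pS: "p \<in> S" using prime_dvd_prod_PP[OF S(1) p] by simp
  have "\<Prod>S = p * \<Prod>(S - {p})" using prod.remove[OF finite_sub[OF S(1)] pS, of "\<lambda>x. x"] by simp
  then have "\<Prod>(S - {p}) = \<Prod>S'" using eq PP_pos[OF p] by simp
  then have "S - {p} = S'" using inj_onD[OF prod_inj, of "S - {p}" S'] S by blast
  then show "p \<notin> S' \<and> S = insert p S'" using pS by blast
next
  assume "p \<notin> S' \<and> S = insert p S'"
  then show "\<Prod>S = p * \<Prod>S'" using finite_sub[OF S(2)] by simp
qed

text \<open>
  Multiplication of the resonator by p to the power -it permutes part of its frequencies. The pairs (S, insert p S) with p outside S are half of all subsets, each contributing kappa, and the final factor kappa makes the total positive.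
\<close>
lemma resonator_bias:
  assumes p: "p \<in> PP" and kappa: "\<bar>\<kappa>\<bar> = 1" and T: "T \<ge> 0"
  shows "integral {A..A+T} (\<lambda>t. (norm (resonator \<kappa> t))\<^sup>2 * (\<kappa> * cos (t * ln (real p))))
     \<ge> T * 2 ^ card PP / 2 - 2 * real (p * \<Prod>PP) * 4 ^ card PP"
proof -
  define b where "b S = complex_of_real \<kappa> ^ card S" for S :: "nat set"
  define F where "F = (\<lambda>t. (\<Sum>S\<in>Pow PP. b S * cis (- t * ln (real (\<Prod>S)))) * cnj (\<Sum>S\<in>Pow PP. b S * cis (- t * ln (real (p * \<Prod>S)))))"
  have nb: "norm (b S) = 1" for S using kappa by (simp add: b_def norm_power)
  have p0: "real p > 0" using PP_pos[OF p] by simp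
  have F: "F t = of_real ((norm (resonator \<kappa> t))\<^sup>2) * cis (t * ln (real p))" for t
  proof -
    have "(\<Sum>S\<in>Pow PP. b S * cis (- t * ln (real (p * \<Prod>S)))) = cis (- t * ln (real p)) * resonator \<kappa> t"
      unfolding resonator_expand sum_distrib_left
    proof (intro sum.cong refl)
      fix S assume "S \<in> Pow PP"
      then have "real (\<Prod>S) > 0" using prod_pos[of S] by (simp del: of_nat_prod prod_pos_nat_iff)
      then have "ln (real (p * \<Prod>S)) = ln (real p) + ln (real (\<Prod>S))" unfolding of_nat_mult using p0 by (intro ln_mult_pos)
      then have "- t * ln (real p) + - t * ln (real (\<Prod>S)) = - t * ln (real (p * \<Prod>S))" by (simp add: algebra_simps)
      then have "cis (- t * ln (real p)) * cis (- t * ln (real (\<Prod>S))) = cis (- t * ln (real (p * \<Prod>S)))"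
        unfolding cis_mult by (rule arg_cong)
      then show "b S * cis (- t * ln (real (p * \<Prod>S))) = cis (- t * ln (real p)) * (of_real \<kappa> ^ card S * cis (- t * ln (real (\<Prod>S))))"
        unfolding b_def by (metis mult.left_commute)
    qed
    then have "F t = resonator \<kappa> t * cnj (resonator \<kappa> t) * cnj (cis (- t * ln (real p)))"
      unfolding F_def b_def resonator_expand[symmetric] by (simp add: mult_ac)
    then show ?thesis by (simp add: complex_norm_square[symmetric] cis_cnj)
  qed
  have Fi: "F integrable_on {A..A+T}" unfolding F_def
    by (intro integrable_continuous_real continuous_intros continuous_on_cis)
  define D where "D = (\<Sum>S\<in>Pow PP. \<Sum>S'\<in>Pow PP. if \<Prod>S = p * \<Prod>S' then b S * cnj (b S') else 0)"
  have D: "D = of_real \<kappa> * 2 ^ card PP / 2"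
  proof -
    have "D = (\<Sum>S'\<in>Pow PP. \<Sum>S\<in>Pow PP. if \<Prod>S = p * \<Prod>S' then b S * cnj (b S') else 0)" unfolding D_def by (rule sum.swap)
    also have "\<dots> = (\<Sum>S'\<in>Pow PP. if p \<notin> S' then of_real \<kappa> else 0)"
    proof (intro sum.cong refl)
      fix S' assume S': "S' \<in> Pow PP"
      have "(\<Sum>S\<in>Pow PP. if \<Prod>S = p * \<Prod>S' then b S * cnj (b S') else 0)
         = (\<Sum>S\<in>Pow PP. if S = insert p S' then (if p \<notin> S' then b S * cnj (b S') else 0) else 0)"
        using prod_eq_times_prime_iff[OF p] S' by (intro sum.cong refl) auto
      also have "\<dots> = (if p \<notin> S' then b (insert p S') * cnj (b S') else 0)" using p S' finite_PP by (simp add: sum.delta)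
      also have "\<dots> = (if p \<notin> S' then of_real \<kappa> else 0)"
      proof (cases "p \<in> S'")
        case False
        then have "b (insert p S') * cnj (b S') = of_real \<kappa> * (b S' * cnj (b S'))"
          using finite_sub[of S'] S' by (simp add: b_def)
        also have "b S' * cnj (b S') = 1" using complex_norm_square[of "b S'"] nb[of S'] by simp
        finally show ?thesis using False by simp
      qed simp
      finally show "(\<Sum>S\<in>Pow PP. if \<Prod>S = p * \<Prod>S' then b S * cnj (b S') else 0) = (if p \<notin> S' then of_real \<kappa> else 0)" .
    qed
    also have "\<dots> = of_real \<kappa> * of_nat (card {S'\<in>Pow PP. p \<notin> S'})"
      using finite_PP by (simp add: sum.If_cases Int_def mult.commute)
    also have "{S'\<in>Pow PP. p \<notin> S'} = Pow (PP - {p})" by blast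
    also have "card (Pow (PP - {p})) = 2 ^ (card PP - 1)" using finite_PP p by (simp add: card_Pow)
    also have "complex_of_nat (2 ^ (card PP - 1)) = 2 ^ card PP / 2"
      using finite_PP p card_gt_0_iff[of PP] by (cases "card PP") auto
    finally show ?thesis by simp
  qed
  have "norm (integral {A..A+T} F - of_real T * D) \<le> 2 * real (p * \<Prod>PP) * (real (card (Pow PP)) * real (card (Pow PP)))"
    unfolding F_def D_def
  proof (rule integral_cis_bilinear)
    fix S assume "S \<in> Pow PP"
    then have S: "0 < \<Prod>S" "\<Prod>S \<le> \<Prod>PP" using prod_pos prod_le by blast+
    show "0 < \<Prod>S \<and> \<Prod>S \<le> p * \<Prod>PP" using S PP_pos[OF p] order_trans[OF S(2), of "p * \<Prod>PP"] by simp
    show "0 < p * \<Prod>S \<and> p * \<Prod>S \<le> p * \<Prod>PP" using S PP_pos[OF p] by simp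
  qed (use nb finite_PP T in auto)
  then have n: "norm (integral {A..A+T} F - of_real T * D) \<le> 2 * real (p * \<Prod>PP) * 4 ^ card PP"
    unfolding card_Pow_PP by (simp add: power_mult_distrib[symmetric])
  have "\<kappa> * \<kappa> = 1" using kappa by (auto simp: abs_if split: if_splits)
  have "of_real \<kappa> * (integral {A..A+T} F - of_real T * D) = of_real \<kappa> * integral {A..A+T} F - of_real (T * 2 ^ card PP / 2)"
  proof -
    have "of_real \<kappa> * (of_real T * D) = of_real (\<kappa> * \<kappa> * (T * 2 ^ card PP / 2))" unfolding D by simp
    then show ?thesis unfolding \<open>\<kappa> * \<kappa> = 1\<close> by (simp add: right_diff_distrib)
  qed
  moreover have "norm (of_real \<kappa> * (integral {A..A+T} F - of_real T * D)) \<le> 2 * real (p * \<Prod>PP) * 4 ^ card PP"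
    unfolding norm_mult using n kappa by simp
  ultimately have "\<bar>Re (of_real \<kappa> * integral {A..A+T} F - of_real (T * 2 ^ card PP / 2))\<bar> \<le> 2 * real (p * \<Prod>PP) * 4 ^ card PP"
    using abs_Re_le_cmod order_trans by metis
  then have "Re (of_real \<kappa> * integral {A..A+T} F) \<ge> T * 2 ^ card PP / 2 - 2 * real (p * \<Prod>PP) * 4 ^ card PP" by simp
  moreover have "Re (of_real \<kappa> * integral {A..A+T} F) = integral {A..A+T} (\<lambda>t. (norm (resonator \<kappa> t))\<^sup>2 * (\<kappa> * cos (t * ln (real p))))"
  proof -
    have "Re (integral {A..A+T} F) = integral {A..A+T} (\<lambda>t. Re (F t))"
      using integral_linear[OF Fi bounded_linear_Re] by (simp add: o_def)
    also have "(\<lambda>t. Re (F t)) = (\<lambda>t. (norm (resonator \<kappa> t))\<^sup>2 * cos (t * ln (real p)))" unfolding F by simp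
    finally have "Re (of_real \<kappa> * integral {A..A+T} F) = \<kappa> * integral {A..A+T} (\<lambda>t. (norm (resonator \<kappa> t))\<^sup>2 * cos (t * ln (real p)))" by simp
    also have "\<dots> = integral {A..A+T} (\<lambda>t. \<kappa> * ((norm (resonator \<kappa> t))\<^sup>2 * cos (t * ln (real p))))" by simp
    also have "\<dots> = integral {A..A+T} (\<lambda>t. (norm (resonator \<kappa> t))\<^sup>2 * (\<kappa> * cos (t * ln (real p))))" by (simp add: mult.left_commute)
    finally show ?thesis .
  qed
  ultimately show ?thesis by linarith
qed

end

context prime_set begin

lemma prod_dvd_iff: "S \<subseteq> PP \<Longrightarrow> \<Prod>S dvd k \<longleftrightarrow> (\<forall>p\<in>S. p dvd k)"
proof -
  assume S: "S \<subseteq> PP"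
  show ?thesis using finite_sub[OF S] S
  proof (induction S rule: finite_induct)
    case (insert p S)
    then have "\<not> p dvd \<Prod>S" using prime_dvd_prod_PP[of S p] by blast
    then have "coprime p (\<Prod>S)" using prime_imp_coprime[of p "\<Prod>S"] prime_PP[of p] insert.prems by simp
    then have "p * \<Prod>S dvd k \<longleftrightarrow> p dvd k \<and> \<Prod>S dvd k" using divides_mult[of p k "\<Prod>S"] dvd_mult_left[of p "\<Prod>S" k] dvd_mult_right[of p "\<Prod>S" k] by blast
    then show ?case using insert by simp
  qed simp
qed

lemma sum_over_multiples:
  fixes g :: "nat \<Rightarrow> complex"
  assumes d: "d > 0"
  shows "(\<Sum>n=1..N div d. g (d * n)) = (\<Sum>k\<in>{1..N}. if d dvd k then g k else 0)"
proof -
  have "(\<Sum>k\<in>{1..N}. if d dvd k then g k else 0) = (\<Sum>k\<in>{k\<in>{1..N}. d dvd k}. g k)"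
    by (rule sum.inter_filter[symmetric]) simp
  also have "\<dots> = (\<Sum>n=1..N div d. g (d * n))"
  proof (rule sum.reindex_bij_witness[of _ "\<lambda>n. d * n" "\<lambda>k. k div d"])
    fix k assume k: "k \<in> {k\<in>{1..N}. d dvd k}"
    then show "d * (k div d) = k" by simp
    show "k div d \<in> {1..N div d}" using k d by (auto simp: div_le_mono Suc_le_eq div_greater_zero_iff dvd_imp_le)
  next
    fix n assume n: "n \<in> {1..N div d}"
    then have "d * n \<le> N" using d by (simp add: less_eq_div_iff_mult_less_eq mult.commute)
    then show "d * n \<in> {k\<in>{1..N}. d dvd k}" using n d by (simp add: Suc_le_eq)
    show "d * n div d = n" using d by simp
  qed auto
  finally show ?thesis by simp
qed

text \<open>
  Inclusion-exclusion over the subsets of PP. Truncating the sum for S at N div prod S makes the identity exact for finite sums.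
\<close>
lemma sieve_identity:
  fixes g :: "nat \<Rightarrow> complex"
  assumes mult: "\<And>m n. m > 0 \<Longrightarrow> n > 0 \<Longrightarrow> g (m * n) = g m * g n"
  shows "(\<Sum>S\<in>Pow PP. (-1) ^ card S * g (\<Prod>S) * (\<Sum>n=1..N div \<Prod>S. g n)) = (\<Sum>k\<in>rough_upto N. g k)"
proof -
  have "(\<Sum>S\<in>Pow PP. (-1) ^ card S * g (\<Prod>S) * (\<Sum>n=1..N div \<Prod>S. g n))
     = (\<Sum>S\<in>Pow PP. \<Sum>k\<in>{1..N}. g k * ((-1) ^ card S * (\<Prod>p\<in>S. of_bool (p dvd k))))"
  proof (intro sum.cong refl)
    fix S assume "S \<in> Pow PP"
    then have S: "S \<subseteq> PP" by simp
    have "g (\<Prod>S) * (\<Sum>n=1..N div \<Prod>S. g n) = (\<Sum>n=1..N div \<Prod>S. g (\<Prod>S * n))"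
      unfolding sum_distrib_left using prod_pos[OF S] by (intro sum.cong refl mult[symmetric]) auto
    also have "\<dots> = (\<Sum>k\<in>{1..N}. if \<Prod>S dvd k then g k else 0)" using prod_pos[OF S] by (rule sum_over_multiples)
    also have "\<dots> = (\<Sum>k\<in>{1..N}. g k * (\<Prod>p\<in>S. of_bool (p dvd k)))"
      unfolding prod_dvd_iff[OF S] using finite_sub[OF S] by (intro sum.cong refl) (auto simp: prod.neutral prod_zero_iff)
    finally have e: "g (\<Prod>S) * (\<Sum>n=1..N div \<Prod>S. g n) = (\<Sum>k\<in>{1..N}. g k * (\<Prod>p\<in>S. of_bool (p dvd k)))" .
    show "(-1) ^ card S * g (\<Prod>S) * (\<Sum>n=1..N div \<Prod>S. g n) = (\<Sum>k\<in>{1..N}. g k * ((-1) ^ card S * (\<Prod>p\<in>S. of_bool (p dvd k))))"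
      unfolding mult.assoc e unfolding sum_distrib_left by (intro sum.cong refl mult.left_commute)
  qed
  also have "\<dots> = (\<Sum>k\<in>{1..N}. g k * (\<Sum>S\<in>Pow PP. (-1) ^ card S * (\<Prod>p\<in>S. of_bool (p dvd k))))"
    unfolding sum_distrib_left by (rule sum.swap)
  also have "\<dots> = (\<Sum>k\<in>{1..N}. g k * (\<Prod>p\<in>PP. 1 + (-1) * of_bool (p dvd k)))"
    unfolding prod_one_plus_expand[OF finite_PP] ..
  also have "\<dots> = (\<Sum>k\<in>{1..N}. if coprime k (\<Prod>PP) then g k else 0)"
    unfolding coprime_PP_iff using finite_PP by (intro sum.cong refl) (auto simp: prod.neutral prod_zero_iff)
  also have "\<dots> = (\<Sum>k\<in>rough_upto N. g k)" unfolding rough_upto_def by (rule sum.inter_filter[symmetric]) simp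
  finally show ?thesis .
qed

text \<open>
  Approximate zeta in every term of the expanded Euler product by the partial sum which the sieve identity prescribes. All these lengths lie between N0 and N1, so one error bound serves for all subsets.
\<close>
lemma rough_zeta_approx:
  fixes s :: complex
  assumes s: "1/2 \<le> Re s" "Re s \<le> 3/4" "\<bar>Im s\<bar> \<ge> 1" and N: "2 * norm s \<le> real N0" "\<Prod>PP * N0 \<le> N1"
  shows "norm (rough_zeta s - rough_sum (\<Prod>PP * N0) s)
     \<le> 2 ^ card PP * (153 * real N1 powr (1/2) / \<bar>Im s\<bar> + real N1 powr (-1/2) + 12 * \<bar>Im s\<bar>\<^sup>2 * real N1 powr (-3/2))"
proof -
  define N where "N = \<Prod>PP * N0"
  define E where "E = 153 * real N1 powr (1/2) / \<bar>Im s\<bar> + real N1 powr (-1/2) + 12 * \<bar>Im s\<bar>\<^sup>2 * real N1 powr (-3/2)"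
  have mult: "of_nat (m * n) powr (-s) = (of_nat m powr (-s) * of_nat n powr (-s) :: complex)" for m n
    using powr_times_real[of "of_nat m" "of_nat n" "-s"] by simp
  have "rough_sum N s = (\<Sum>S\<in>Pow PP. (-1) ^ card S * of_nat (\<Prod>S) powr (-s) * (\<Sum>n=1..N div \<Prod>S. of_nat n powr (-s)))"
    unfolding rough_sum_def using sieve_identity[of "\<lambda>n. of_nat n powr (-s)" N] mult by simp
  moreover have "rough_zeta s = (\<Sum>S\<in>Pow PP. (-1) ^ card S * of_nat (\<Prod>S) powr (-s) * zeta s)"
    unfolding rough_zeta_def euler_expand sum_distrib_left by (simp add: mult.commute)
  ultimately have "rough_zeta s - rough_sum N s = (\<Sum>S\<in>Pow PP. (-1) ^ card S * of_nat (\<Prod>S) powr (-s) * (zeta s - (\<Sum>n=1..N div \<Prod>S. of_nat n powr (-s))))"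
    by (simp add: sum_subtractf[symmetric] right_diff_distrib del: of_nat_prod)
  also have "norm \<dots> \<le> (\<Sum>S\<in>Pow PP. 1 * E)"
  proof (intro order_trans[OF norm_sum] sum_mono)
    fix S assume "S \<in> Pow PP"
    then have S: "S \<subseteq> PP" by simp
    have "norm (of_nat (\<Prod>S) powr (-s) :: complex) = real (\<Prod>S) powr (- Re s)" using norm_nat_powr[OF prod_pos[OF S]] by simp
    also have "\<dots> \<le> real (\<Prod>S) powr 0" using prod_pos[OF S] s by (intro powr_mono) (simp_all add: Suc_le_eq del: of_nat_prod)
    also have "\<dots> = 1" using prod_pos[OF S] by (simp del: of_nat_prod)
    finally have n1: "norm ((-1) ^ card S * of_nat (\<Prod>S) powr (-s) :: complex) \<le> 1" by (simp add: norm_mult norm_power del: of_nat_prod)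
    have "N0 * \<Prod>S \<le> N" unfolding N_def using prod_le[OF S] by (simp add: mult.commute)
    then have "N0 \<le> N div \<Prod>S" using prod_pos[OF S] by (simp add: less_eq_div_iff_mult_less_eq)
    then have "2 * norm s \<le> real (N div \<Prod>S)" using N(1) by linarith
    moreover have "N div \<Prod>S \<le> N1" using N(2) div_le_dividend[of N "\<Prod>S"] unfolding N_def by linarith
    ultimately have "norm (zeta s - (\<Sum>n=1..N div \<Prod>S. of_nat n powr (-s))) \<le> E"
      unfolding E_def using s by (intro zeta_partial_sum_approx) auto
    with n1 show "norm ((-1) ^ card S * of_nat (\<Prod>S) powr (-s) * (zeta s - (\<Sum>n=1..N div \<Prod>S. of_nat n powr (-s)))) \<le> 1 * E"
      unfolding norm_mult[of "(-1) ^ card S * of_nat (\<Prod>S) powr (-s)"] by (intro mult_mono) auto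
  qed
  finally show ?thesis by (simp add: N_def E_def card_Pow_PP)
qed

lemma rough_mean_square:
  assumes I: "I \<subseteq> rough_upto N" and kappa: "\<bar>\<kappa>\<bar> = 1" and T: "T \<ge> 0" and N: "N > 0"
    and B: "\<And>m. m \<in> I \<Longrightarrow> real m powr (1 - 2 * \<sigma>) \<le> B" "B \<ge> 0"
  shows "integral {A..A+T} (\<lambda>t. (norm (\<Sum>m\<in>I. of_nat m powr (- Complex \<sigma> (t + v))))\<^sup>2 * (norm (resonator \<kappa> t))\<^sup>2)
     \<le> (T + 4 * real (N * \<Prod>PP) * (1 + ln (real (N * \<Prod>PP)))) * (2 ^ card PP * (B * (1 + ln (real N))))"
proof -
  have m0: "m > 0" if "m \<in> I" for m using that I by (auto simp: rough_upto_def)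
  have eq: "(\<Sum>m\<in>I. of_nat m powr (- Complex \<sigma> (t + v))) = (\<Sum>m\<in>I. of_nat m powr (- Complex \<sigma> v) * cis (- t * ln (real m)))" for t
  proof (intro sum.cong refl)
    fix m assume m: "m \<in> I"
    have "- Complex \<sigma> (t + v) = - Complex \<sigma> v + - \<i> * of_real t" by (simp add: complex_eq_iff)
    then have "of_nat m powr (- Complex \<sigma> (t + v)) = (of_nat m powr (- Complex \<sigma> v) * of_nat m powr (- \<i> * of_real t) :: complex)"
      by (simp only: powr_add)
    also have "of_nat m powr (- \<i> * of_real t) = cis (- t * ln (real m))"
      using m0[OF m] by (simp add: powr_def cis_conv_exp mult_ac)
    finally show "of_nat m powr (- Complex \<sigma> (t + v)) = of_nat m powr (- Complex \<sigma> v) * cis (- t * ln (real m))" .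
  qed
  have "(\<Sum>m\<in>I. (norm (of_nat m powr (- Complex \<sigma> v) :: complex))\<^sup>2) \<le> (\<Sum>m\<in>I. B * (1 / real m))"
  proof (intro sum_mono)
    fix m assume m: "m \<in> I"
    have "(norm (of_nat m powr (- Complex \<sigma> v) :: complex))\<^sup>2 = real m powr (1 - 2 * \<sigma> + -1)"
      unfolding norm_nat_powr[OF m0[OF m]] by (simp add: power2_eq_square powr_add[symmetric])
    also have "\<dots> = real m powr (1 - 2 * \<sigma>) * (1 / real m)" unfolding powr_add using m0[OF m] by (simp add: powr_minus_divide)
    also have "\<dots> \<le> B * (1 / real m)" using B(1)[OF m] by (intro mult_right_mono) auto
    finally show "(norm (of_nat m powr (- Complex \<sigma> v) :: complex))\<^sup>2 \<le> B * (1 / real m)" .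
  qed
  also have "\<dots> \<le> (\<Sum>m=1..N. B * (1 / real m))" using I B(2) by (intro sum_mono2) (auto simp: rough_upto_def)
  also have "\<dots> = B * harm N" by (simp add: harm_def sum_distrib_left divide_inverse)
  also have "\<dots> \<le> B * (1 + ln (real N))" using harm_le_ln[OF N] B(2) by (rule mult_left_mono)
  finally have le: "(\<Sum>m\<in>I. (norm (of_nat m powr (- Complex \<sigma> v) :: complex))\<^sup>2) \<le> B * (1 + ln (real N))" .
  have "ln (real (N * \<Prod>PP)) \<ge> 0" using N prod_pos[of PP] by (intro ln_ge_zero) (simp add: Suc_le_eq del: of_nat_mult)
  then have nn: "T + 4 * real (N * \<Prod>PP) * (1 + ln (real (N * \<Prod>PP))) \<ge> 0" using T by (intro add_nonneg_nonneg mult_nonneg_nonneg) (simp_all del: of_nat_mult of_nat_prod)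
  show ?thesis unfolding eq
    by (rule order_trans[OF twisted_mean_value[OF I kappa T]]) (intro mult_left_mono le nn, simp)
qed

end

text \<open>
  The scale is T = exp L. The logarithm lam of the product of the primes is small against the root of L, and w is the width of the window in units of 1 / L.
\<close>
locale resonance = prime_set +
  fixes L w \<kappa> :: real
  assumes w: "1 \<le> w" "exp w \<le> L" and lam4: "4 \<le> ln (real (\<Prod>PP))"
    and lamL: "100 * (ln (real (\<Prod>PP)))\<^sup>2 \<le> L" and lamw: "8 * ln (real (\<Prod>PP)) * w \<le> L"
    and L_ge: "1000000000000 \<le> L" and kappa: "\<bar>\<kappa>\<bar> = 1"
begin

text \<open>
  Here eta is the distance from the critical line at which the approximation by a sum of length sqrt T gains a factor exp (- eta * L) while the Euler factors still change by a bounded amount. The half-width a of the window is much smaller. D is the sum of length sqrt T, Q the weight, and W the total mass of the weight on an interval of length T.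
\<close>
definition "T = exp L"
definition "lam = ln (real (\<Prod>PP))"
definition "\<eta> = 1 / lam"
definition "a = w / L"
definition "Q t = (norm (resonator \<kappa> t))\<^sup>2"
definition "D = rough_sum (nat \<lfloor>exp (L / 2)\<rfloor>)"
definition "W = T * 2 ^ card PP"

lemma lam: "lam \<ge> 4" "100 * lam\<^sup>2 \<le> L" "8 * lam * w \<le> L" "400 * lam \<le> L"
proof -
  show l: "lam \<ge> 4" "100 * lam\<^sup>2 \<le> L" "8 * lam * w \<le> L" using lam4 lamL lamw by (simp_all add: lam_def)
  have "4 * lam \<le> lam\<^sup>2" using l(1) by (simp add: power2_eq_square)
  then show "400 * lam \<le> L" using l(2) by linarith
qed

lemma eta: "0 < \<eta>" "\<eta> \<le> 1/4" "\<eta> * lam = 1" "\<eta> * L \<ge> 100 * lam" "\<eta> * L \<le> L / 4"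
proof -
  show e: "0 < \<eta>" "\<eta> \<le> 1/4" "\<eta> * lam = 1" using lam by (auto simp: \<eta>_def field_simps)
  have "\<eta> * (100 * lam\<^sup>2) \<le> \<eta> * L" using lam e by (intro mult_left_mono) auto
  moreover have "\<eta> * (100 * lam\<^sup>2) = 100 * lam" using e(3) by (simp add: power2_eq_square mult_ac)
  ultimately show "\<eta> * L \<ge> 100 * lam" by simp
  have "\<eta> * L \<le> 1/4 * L" using e L_ge by (intro mult_right_mono) auto
  then show "\<eta> * L \<le> L / 4" by simp
qed

lemma exp_lam: "exp lam = real (\<Prod>PP)"
  unfolding lam_def using prod_pos[of PP] by (simp del: of_nat_prod)

lemma Lpos: "L > 0" using L_ge by linarith

lemma exp_linear: "x \<ge> L / 8 \<Longrightarrow> 4 * (1 + L) \<le> exp x"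
proof -
  assume x: "x \<ge> L / 8"
  have "4 * (1 + L) \<le> (L / 8)\<^sup>2 / 2"
  proof -
    have "1000000000000 * L \<le> L * L" using L_ge Lpos by (intro mult_right_mono) auto
    then have "512 + 512 * L \<le> L * L" using L_ge by linarith
    then show ?thesis by (simp add: power2_eq_square)
  qed
  also have "\<dots> \<le> exp (L / 8)" using exp_lower_Taylor_quadratic[of "L / 8"] Lpos by linarith
  also have "\<dots> \<le> exp x" using x by simp
  finally show ?thesis .
qed

text \<open>
  Sums of length up to the 3/4-th power of T, multiplied by the resonator, are short enough for the off-diagonal part of the mean value to be at most T.
\<close>
lemma mean_value_factor:
  assumes "0 < K" "K \<le> exp (3 * L / 4 + lam)"
  shows "4 * K * (1 + ln K) \<le> T"
proof -
  have "ln K \<le> 3 * L / 4 + lam" using ln_mono[OF assms(2,1)] by simp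
  then have "ln K \<le> L" using lam Lpos by linarith
  then have "4 * K * (1 + ln K) \<le> K * (4 * (1 + L))" using assms by simp
  also have "\<dots> \<le> exp (3 * L / 4 + lam) * exp (L / 4 - lam)"
    using assms Lpos lam by (intro mult_mono exp_linear) auto
  also have "\<dots> = T" unfolding T_def exp_add[symmetric] by (rule arg_cong[of _ _ exp]) simp
  finally show ?thesis .
qed

lemma Tpos: "T > 0" by (simp add: T_def)
lemma Wpos: "W > 0" by (simp add: W_def Tpos)
lemma Q_nonneg: "Q t \<ge> 0" by (simp add: Q_def)
lemma continuous_Q: "continuous_on A Q"
  unfolding Q_def[abs_def] by (intro continuous_intros continuous_resonator)

lemma integral_Q: "integral {T..2*T} Q \<le> 2 * W"
proof -
  have "4 * real (\<Prod>PP) * (1 + ln (real (\<Prod>PP))) \<le> T"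
    unfolding exp_lam[symmetric] using Lpos by (intro mean_value_factor) simp_all
  then have "(T + 4 * real (\<Prod>PP) * (1 + ln (real (\<Prod>PP)))) * 2 ^ card PP \<le> (2 * T) * 2 ^ card PP" by (intro mult_right_mono) auto
  from order_trans[OF resonator_mean_square[OF kappa less_imp_le[OF Tpos], of T] this]
  show ?thesis unfolding Q_def[abs_def] W_def mult_2[of T] by (simp add: algebra_simps)
qed

lemma floor_exp: 
  assumes "x \<ge> 0" shows "0 < nat \<lfloor>exp x\<rfloor>" "real (nat \<lfloor>exp x\<rfloor>) \<le> exp (x::real)"
proof -
  have "exp x \<ge> 1" using assms by simp
  then show "0 < nat \<lfloor>exp x\<rfloor>" by simp
  show "real (nat \<lfloor>exp x\<rfloor>) \<le> exp x" by (intro of_nat_floor) simp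
qed

lemma block_mean_square:
  assumes I: "I \<subseteq> rough_upto N" and N: "N > 0" "real N \<le> exp (3 * L / 4)"
    and B: "\<And>m. m \<in> I \<Longrightarrow> real m powr (1 - 2 * \<sigma>) \<le> B" "B \<ge> 0"
  shows "integral {T..2*T} (\<lambda>t. (norm (\<Sum>m\<in>I. of_nat m powr (- Complex \<sigma> (t + v))))\<^sup>2 * Q t) \<le> 2 * L * B * W"
proof -
  have "real (N * \<Prod>PP) \<le> exp (3 * L / 4 + lam)"
    unfolding of_nat_mult exp_add exp_lam[symmetric] using N by (intro mult_mono) auto
  then have f: "4 * real (N * \<Prod>PP) * (1 + ln (real (N * \<Prod>PP))) \<le> T"
    using N prod_pos[of PP] by (intro mean_value_factor) (simp_all del: of_nat_mult)
  have "ln (real N) \<le> 3 * L / 4" using ln_mono[of "real N" "exp (3 * L / 4)"] N by simp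
  then have l: "1 + ln (real N) \<le> L" using L_ge by linarith
  have "(T + 4 * real (N * \<Prod>PP) * (1 + ln (real (N * \<Prod>PP)))) * (2 ^ card PP * (B * (1 + ln (real N)))) \<le> (2 * T) * (2 ^ card PP * (B * L))"
    using f l B N Tpos by (intro mult_mono mult_left_mono mult_nonneg_nonneg) auto
  also have "\<dots> = 2 * L * B * W" by (simp add: W_def mult_ac)
  finally show ?thesis
    using rough_mean_square[OF I kappa less_imp_le[OF Tpos] N(1) B, of T v] unfolding Q_def[abs_def] by simp
qed

text \<open>
  To the left of the critical line at distance delta the square sum grows at most by (sqrt T) to the power 2 delta.
\<close>
lemma D_mean_square:
  assumes "1/2 \<le> \<sigma> + \<delta>" "\<delta> \<ge> 0"
  shows "integral {T..2*T} (\<lambda>t. (norm (D (Complex \<sigma> (t + v))))\<^sup>2 * Q t) \<le> 2 * L * exp (\<delta> * L) * W"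
  unfolding D_def rough_sum_def
proof (rule block_mean_square[OF order_refl])
  have X: "0 < nat \<lfloor>exp (L / 2)\<rfloor>" "real (nat \<lfloor>exp (L / 2)\<rfloor>) \<le> exp (L / 2)" using floor_exp[of "L / 2"] Lpos by auto
  show "0 < nat \<lfloor>exp (L / 2)\<rfloor>" by (rule X)
  show "real (nat \<lfloor>exp (L / 2)\<rfloor>) \<le> exp (3 * L / 4)" by (rule order_trans[OF X(2)]) (use Lpos in simp)
  fix m assume "m \<in> rough_upto (nat \<lfloor>exp (L / 2)\<rfloor>)"
  then have "1 \<le> m" "m \<le> nat \<lfloor>exp (L / 2)\<rfloor>" by (simp_all add: rough_upto_def)
  then have m: "real m \<ge> 1" "real m \<le> exp (L / 2)" using X(2) by linarith+
  have "real m powr (1 - 2 * \<sigma>) \<le> real m powr (2 * \<delta>)" using m assms by (intro powr_mono) auto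
  also have "\<dots> \<le> exp (L / 2) powr (2 * \<delta>)" using m assms by (intro powr_mono2) auto
  also have "\<dots> = exp (\<delta> * L)" by (simp add: powr_def mult_ac)
  finally show "real m powr (1 - 2 * \<sigma>) \<le> exp (\<delta> * L)" .
qed simp

end

section \<open>Elementary bounds for zeta and for the Euler factors\<close>

lemma norm_zeta_crude:
  assumes s: "Re s > 0" "\<bar>Im s\<bar> \<ge> 1"
  shows "norm (zeta s) \<le> 3 * (1 + norm s)\<^sup>2"
proof -
  have s1: "s \<noteq> 1" "norm (s - 1) \<ge> 1" using s(2) abs_Im_le_cmod[of "s - 1"] by auto
  define x where "x = norm s"
  have x0: "x \<ge> 0" by (simp add: x_def)
  have nx: "norm (s + 1) \<le> x + 1" unfolding x_def using norm_triangle_ineq[of s 1] by simp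
  have "norm (zpre s - s) \<le> norm (s - 1) * (1 / 2 + 2 * x * norm (s + 1))"
    using zpre_approx[OF s(1), of 1] by (simp add: x_def)
  also have "\<dots> \<le> norm (s - 1) * (1 / 2 + 2 * x * (x + 1))"
    using nx x0 by (intro mult_left_mono add_left_mono) auto
  finally have "norm (zpre s) \<le> x + norm (s - 1) * (1 / 2 + 2 * x * (x + 1))"
    using norm_triangle_ineq2[of "zpre s" s] unfolding x_def by linarith
  moreover have "1 * x \<le> norm (s - 1) * x" using s1 x0 by (intro mult_right_mono)
  moreover have "norm (s - 1) * (x + 1 / 2 + 2 * x * (x + 1)) = norm (s - 1) * x + norm (s - 1) * (1 / 2 + 2 * x * (x + 1))"
    by (simp add: algebra_simps)
  ultimately have "norm (zpre s) \<le> norm (s - 1) * (x + 1 / 2 + 2 * x * (x + 1))" by linarith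
  also have "\<dots> \<le> norm (s - 1) * (3 * (1 + x)\<^sup>2)"
    using x0 by (intro mult_left_mono) (auto simp: power2_eq_square algebra_simps)
  finally have "norm (zpre s) / norm (s - 1) \<le> 3 * (1 + x)\<^sup>2" using s1 by (simp add: divide_le_eq mult.commute)
  moreover have "zeta s = zpre s / (s - 1)" using zeta_eq_zpre[of s] s s1 by simp
  ultimately show ?thesis by (simp add: norm_divide x_def)
qed

text \<open>
  Comparison of the inverse squares with the telescoping sum over 1/(m - 1/2) - 1/(m + 1/2).
\<close>
lemma norm_zeta_minus_1:
  assumes s: "Re s \<ge> 2"
  shows "norm (zeta s - 1) \<le> 2 / 3"
proof -
  define g where "g n = 1 / (real n + 3/2)" for n
  have tel: "(\<lambda>n. g n - g (Suc n)) sums (g 0 - 0)"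
    by (rule telescope_sums') (unfold g_def, real_asymp)
  have "(\<lambda>n. 1 / of_nat (Suc n) powr s) sums zeta s" using s by (intro zeta_dirichlet) auto
  then have z: "(\<lambda>n. 1 / of_nat (Suc (Suc n)) powr s) sums (zeta s - 1)"
    using sums_Suc_iff[of "\<lambda>n. 1 / of_nat (Suc n) powr s" "zeta s - 1"] by simp
  have le: "norm (1 / of_nat (Suc (Suc n)) powr s) \<le> g n - g (Suc n)" for n
  proof -
    define m where "m = real n + 2"
    have m: "m \<ge> 2" "real (Suc (Suc n)) = m" by (simp_all add: m_def)
    have "norm (1 / of_nat (Suc (Suc n)) powr s) = 1 / m powr Re s"
      unfolding norm_divide norm_nat_powr[OF zero_less_Suc] m by simp
    also have "\<dots> \<le> 1 / m powr 2" using m s by (intro divide_left_mono powr_mono mult_pos_pos) auto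
    also have "\<dots> = 1 / (m * m)" using m by (simp add: power2_eq_square)
    also have "\<dots> \<le> 1 / (m * m - 1/4)" using m mult_mono[of 2 m 2 m] by (intro divide_left_mono mult_pos_pos) auto
    also have "\<dots> = 1 / (m - 1/2) - 1 / (m + 1/2)" using m mult_mono[of 2 m 2 m] by (simp add: field_simps)
    also have "\<dots> = g n - g (Suc n)" by (simp add: g_def m_def algebra_simps)
    finally show ?thesis .
  qed
  have "norm (\<Sum>n. 1 / of_nat (Suc (Suc n)) powr s) \<le> (\<Sum>n. g n - g (Suc n))"
    using le by (intro norm_suminf_le) (use tel in \<open>auto simp: sums_iff\<close>)
  then show ?thesis using z tel by (simp add: sums_iff g_def)
qed

lemma prod_one_minus_inverse_squares:
  "N \<ge> 2 \<Longrightarrow> (\<Prod>m=2..N. 1 - 1 / (real m)\<^sup>2) \<ge> 1/2"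
proof -
  assume N: "N \<ge> 2"
  have "(\<Prod>m=2..N. 1 - 1 / (real m)\<^sup>2) = (1 + 1 / real N) / 2" using N
  proof (induction rule: dec_induct)
    case (step N)
    have "(1 + 1 / real N) / 2 * (1 - 1 / (real (Suc N))\<^sup>2) = (1 + 1 / real (Suc N)) / 2"
      using step(1) by (simp add: divide_simps power2_eq_square) (simp add: algebra_simps)
    moreover have "(\<Prod>m=2..Suc N. 1 - 1 / (real m)\<^sup>2) = (\<Prod>m=2..N. 1 - 1 / (real m)\<^sup>2) * (1 - 1 / (real (Suc N))\<^sup>2)"
      using step(1) by (simp add: prod.nat_ivl_Suc' mult.commute)
    ultimately show ?case unfolding step(3) by (rule trans[rotated])
  qed simp
  then show ?thesis by simp
qed

lemma cont_line:
  assumes "g holomorphic_on A" "\<And>t. t \<in> I \<Longrightarrow> Complex \<sigma> (t + v) \<in> A"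
  shows "continuous_on I (\<lambda>t. g (Complex \<sigma> (t + v)))"
proof (rule continuous_on_compose2[OF holomorphic_on_imp_continuous_on[OF assms(1)]])
  show "continuous_on I (\<lambda>t. Complex \<sigma> (t + v))" unfolding Complex_eq by (intro continuous_intros)
qed (use assms in auto)

context prime_set begin

lemma euler_holomorphic: "euler holomorphic_on A"
  unfolding euler_def[abs_def] using PP_pos by (intro holomorphic_intros) auto

lemma rough_zeta_holomorphic: "rough_zeta holomorphic_on - {1}"
  unfolding rough_zeta_def[abs_def] by (intro holomorphic_intros zeta_holomorphic euler_holomorphic)

lemma rough_sum_holomorphic: "rough_sum N holomorphic_on A"
  unfolding rough_sum_def[abs_def] by (intro holomorphic_intros) (auto simp: rough_upto_def)

lemma norm_prime_powr_le:
  assumes "p \<in> PP" "Re s \<ge> \<sigma>" shows "norm (of_nat p powr (- s) :: complex) \<le> real p powr (- \<sigma>)"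
  unfolding norm_nat_powr[OF PP_pos[OF assms(1)]] using assms PP_pos[OF assms(1)] by (intro powr_mono) auto

lemma euler_nonzero: "Re s > 0 \<Longrightarrow> euler s \<noteq> 0"
proof -
  assume s: "Re s > 0"
  have "of_nat p powr (- s) \<noteq> (1::complex)" if p: "p \<in> PP" for p
  proof -
    have "norm (of_nat p powr (- s) :: complex) = real p powr (- Re s)" using norm_nat_powr[OF PP_pos[OF p]] by simp
    also have "\<dots> < real p powr 0" using PP_ge[OF p] s by (intro powr_less_mono) auto
    finally show ?thesis using PP_pos[OF p] by auto
  qed
  then show ?thesis unfolding euler_def using finite_PP by (auto simp: prod_zero_iff)
qed

lemma norm_euler_le: "Re s \<ge> 0 \<Longrightarrow> norm (euler s) \<le> 2 ^ card PP"
proof -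
  assume s: "Re s \<ge> 0"
  have "norm (euler s) \<le> (\<Prod>p\<in>PP. 2)" unfolding euler_def prod_norm[symmetric]
  proof (intro prod_mono conjI)
    fix p assume p: "p \<in> PP"
    show "norm (1 - of_nat p powr (- s) :: complex) \<le> 2"
      using norm_triangle_ineq4[of 1 "of_nat p powr (- s) :: complex"] norm_prime_powr_le[OF p s] PP_pos[OF p] by simp
  qed simp
  then show ?thesis by simp
qed

lemma norm_euler_2:
  assumes s: "Re s \<ge> 2" shows "norm (euler s) \<ge> 1/2" "norm (euler s) \<le> 2"
proof -
  define G where "G = (\<Prod>p\<in>PP. 1 - 1 / (real p)\<^sup>2)"
  have p1: "0 < 1 - 1 / (real p)\<^sup>2" "1 - 1 / (real p)\<^sup>2 \<le> 1" if "p \<ge> 2" for p :: nat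
  proof -
    have "(1::real) < (real p)\<^sup>2" using that by (simp add: one_less_power)
    then have "1 / (real p)\<^sup>2 < 1 / 1" using that by (intro divide_strict_left_mono) auto
    then show "0 < 1 - 1 / (real p)\<^sup>2" by simp
  qed simp
  have pn: "norm (of_nat p powr (- s) :: complex) \<le> 1 / (real p)\<^sup>2" if "p \<in> PP" for p
    using norm_prime_powr_le[OF that s] PP_pos[OF that] by (simp add: powr_minus_divide)
  define N where "N = Max (insert 2 PP)"
  have N: "N \<ge> 2" "PP \<subseteq> {2..N}" using finite_PP PP_ge by (force simp: N_def intro: Max_ge)+
  have "1/2 \<le> (\<Prod>m=2..N. 1 - 1 / (real m)\<^sup>2)" by (rule prod_one_minus_inverse_squares[OF N(1)])
  also have "\<dots> = G * (\<Prod>m\<in>{2..N}-PP. 1 - 1 / (real m)\<^sup>2)" unfolding G_def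
    using prod.subset_diff[OF N(2), of "\<lambda>m. 1 - 1 / (real m)\<^sup>2"] by (simp add: mult.commute)
  also have "\<dots> \<le> G * 1"
  proof (rule mult_left_mono)
    show "(\<Prod>m\<in>{2..N}-PP. 1 - 1 / (real m)\<^sup>2) \<le> 1" using p1 by (intro prod_le_1) (auto intro: less_imp_le)
    show "0 \<le> G" unfolding G_def using p1 PP_ge by (intro prod_nonneg) (force intro: less_imp_le)
  qed
  finally have G: "1/2 \<le> G" by simp
  have "G \<le> norm (euler s)" unfolding G_def euler_def prod_norm[symmetric]
  proof (intro prod_mono conjI)
    fix p assume p: "p \<in> PP"
    show "0 \<le> 1 - 1 / (real p)\<^sup>2" using p1[of p] PP_ge[OF p] by linarith
    show "1 - 1 / (real p)\<^sup>2 \<le> norm (1 - of_nat p powr (- s) :: complex)"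
      using norm_triangle_ineq2[of 1 "of_nat p powr (- s) :: complex"] pn[OF p] by simp
  qed
  with G show "norm (euler s) \<ge> 1/2" by linarith
  have "norm (euler s) \<le> (\<Prod>p\<in>PP. 1 / (1 - 1 / (real p)\<^sup>2))" unfolding euler_def prod_norm[symmetric]
  proof (intro prod_mono conjI)
    fix p assume p: "p \<in> PP"
    define u where "u = 1 / (real p)\<^sup>2"
    have u: "0 \<le> u" "u < 1" using p1[of p] PP_ge[OF p] by (auto simp: u_def)
    have "(1 + u) * (1 - u) \<le> 1" by (simp add: algebra_simps)
    then have "1 + u \<le> 1 / (1 - u)" using u by (simp add: le_divide_eq)
    moreover have "norm (1 - of_nat p powr (- s) :: complex) \<le> 1 + u"
      using norm_triangle_ineq4[of 1 "of_nat p powr (- s) :: complex"] pn[OF p] by (simp add: u_def)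
    ultimately show "norm (1 - of_nat p powr (- s) :: complex) \<le> 1 / (1 - 1 / (real p)\<^sup>2)" by (simp add: u_def)
  qed simp
  also have "\<dots> = 1 / G" unfolding G_def by (simp add: prod_dividef)
  also have "\<dots> \<le> 1 / (1/2)" using G by (intro divide_left_mono) auto
  finally show "norm (euler s) \<le> 2" by simp
qed

lemma norm_rough_zeta_2:
  assumes s: "Re s \<ge> 2" shows "norm (rough_zeta s) \<ge> 1/6" "norm (rough_zeta s) \<le> 4"
proof -
  have z: "norm (zeta s) \<ge> 1/3" "norm (zeta s) \<le> 2"
    using norm_zeta_minus_1[OF s] norm_triangle_ineq2[of 1 "1 - zeta s"] norm_triangle_ineq[of 1 "zeta s - 1"] by (simp_all add: norm_minus_commute)
  show "norm (rough_zeta s) \<ge> 1/6" using mult_mono[OF z(1) norm_euler_2(1)[OF s]] by (simp add: rough_zeta_def norm_mult)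
  show "norm (rough_zeta s) \<le> 4" using mult_mono[OF z(2) norm_euler_2(2)[OF s]] by (simp add: rough_zeta_def norm_mult)
qed

text \<open>
  Each factor changes relatively by at most a constant times |x| ln p when its exponent is reflected, so the product changes by at most the exponential of a constant times |x| times the sum of the ln p.
\<close>
lemma euler_ratio:
  assumes x: "\<And>p. p \<in> PP \<Longrightarrow> \<bar>x\<bar> * ln (real p) \<le> 1"
  shows "norm (euler (Complex (1/2 + x) y)) \<le> exp (3 * \<bar>x\<bar> * ln (real (\<Prod>PP))) * norm (euler (Complex (1/2 - x) y))"
proof -
  have "norm (euler (Complex (1/2 + x) y)) \<le> (\<Prod>p\<in>PP. exp (3 * \<bar>x\<bar> * ln (real p)) * norm (1 - of_nat p powr (- Complex (1/2 - x) y) :: complex))"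
    unfolding euler_def prod_norm[symmetric]
  proof (intro prod_mono conjI)
    fix p assume p: "p \<in> PP"
    define z where "z = (of_nat p powr (- Complex (1/2) y) :: complex)"
    define u where "u = x * ln (real p)"
    have p0: "real p > 0" "ln (real p) \<ge> 0" using PP_ge[OF p] by auto
    have u1: "\<bar>u\<bar> \<le> 1" "\<bar>x\<bar> * ln (real p) = \<bar>u\<bar>" using x[OF p] p0 by (simp_all add: u_def abs_mult)
    have pz: "of_nat p powr (- Complex (1/2 + r) y) = z * of_real (exp (- r * ln (real p)))" for r
    proof -
      have "- Complex (1/2 + r) y = - Complex (1/2) y + of_real (- r)" by (simp add: complex_eq_iff)
      then have "of_nat p powr (- Complex (1/2 + r) y) = z * of_nat p powr (of_real (- r))" unfolding z_def by (simp only: powr_add)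
      also have "of_nat p powr (of_real (- r)) = (of_real (exp (- r * ln (real p))) :: complex)"
        using powr_of_real[of "real p" "-r"] p0 by (simp add: powr_def)
      finally show ?thesis .
    qed
    have nz: "norm z \<le> 1/4"
    proof -
      have "norm z = real p powr (- (1/2))" unfolding z_def norm_nat_powr[OF PP_pos[OF p]] by simp
      also have "\<dots> \<le> 16 powr (- (1/2))" using PP_ge[OF p] by (intro powr_mono2') auto
      also have "(16::real) powr (- (1/2)) = 1 / sqrt 16" by (simp only: powr_minus_divide powr_half_sqrt zero_le_numeral)
      also have "sqrt 16 = sqrt (4\<^sup>2)" by (rule arg_cong[of _ _ sqrt]) simp
      also have "\<dots> = 4" by (rule real_sqrt_abs[THEN trans]) simp
      finally show ?thesis .
    qed
    have diff: "\<bar>exp u - exp (- u)\<bar> \<le> 3 * \<bar>u\<bar>"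
    proof -
      have pos: "exp v - exp (- v) \<le> 3 * v" if "0 \<le> v" "v \<le> 1" for v :: real
      proof -
        have "exp v \<le> 1 + v + v\<^sup>2" using that by (intro exp_bound) auto
        moreover have "v\<^sup>2 \<le> v" using that by (simp add: power2_eq_square mult_le_one mult_left_le)
        moreover have "1 + - v \<le> exp (- v)" by (rule exp_ge_add_one_self)
        ultimately show ?thesis by linarith
      qed
      show ?thesis
      proof (cases "u \<ge> 0")
        case True
        then have "exp (- u) \<le> exp u" by simp
        then show ?thesis using pos[of u] True u1 by simp
      next
        case False
        then have "exp u \<le> exp (- u)" by simp
        then show ?thesis using pos[of "-u"] False u1 by simp
      qed
    qed
    define M1 where "M1 = norm (1 - z * of_real (exp u))"
    have "exp u \<le> exp 1" using u1 by simp
    then have "exp u \<le> 3" using exp_le by linarith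
    then have "norm z * exp u \<le> 1/4 * 3" using nz by (intro mult_mono) auto
    then have M1: "M1 \<ge> 1/4" unfolding M1_def using norm_triangle_ineq2[of 1 "z * of_real (exp u)"] by (simp add: norm_mult)
    have "norm (1 - z * of_real (exp (- u))) \<le> M1 + norm (z * of_real (exp u - exp (- u)))"
      unfolding M1_def using norm_triangle_ineq[of "1 - z * of_real (exp u)" "z * of_real (exp u - exp (- u))"] by (simp add: algebra_simps)
    also have "norm (z * of_real (exp u - exp (- u))) \<le> 1/4 * (3 * \<bar>u\<bar>)"
      unfolding norm_mult norm_of_real using nz diff by (intro mult_mono) auto
    also have "1/4 * (3 * \<bar>u\<bar>) \<le> M1 * (3 * \<bar>u\<bar>)" using M1 by (intro mult_right_mono) auto
    also have "M1 + M1 * (3 * \<bar>u\<bar>) = (1 + 3 * \<bar>u\<bar>) * M1" by (simp add: algebra_simps)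
    also have "\<dots> \<le> exp (3 * \<bar>u\<bar>) * M1" using exp_ge_add_one_self[of "3 * \<bar>u\<bar>"] M1 by (intro mult_right_mono) auto
    finally have "norm (1 - z * of_real (exp (- u))) \<le> exp (3 * (\<bar>x\<bar> * ln (real p))) * M1" unfolding u1(2) by simp
    then show "norm (1 - of_nat p powr (- Complex (1/2 + x) y) :: complex) \<le> exp (3 * \<bar>x\<bar> * ln (real p)) * norm (1 - of_nat p powr (- Complex (1/2 - x) y) :: complex)"
      using pz[of x] pz[of "-x"] unfolding M1_def u_def by (simp add: mult.assoc)
  qed simp
  also have "\<dots> = exp (\<Sum>p\<in>PP. 3 * \<bar>x\<bar> * ln (real p)) * norm (\<Prod>p\<in>PP. 1 - of_nat p powr (- Complex (1/2 - x) y) :: complex)"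
    by (simp add: prod.distrib exp_sum[OF finite_PP] prod_norm)
  also have "(\<Sum>p\<in>PP. 3 * \<bar>x\<bar> * ln (real p)) = 3 * \<bar>x\<bar> * (\<Sum>p\<in>PP. ln (real p))" by (rule sum_distrib_left[symmetric])
  also have "(\<Sum>p\<in>PP. ln (real p)) = ln (real (\<Prod>PP))" unfolding of_nat_prod using PP_pos finite_PP by (intro ln_prod[symmetric]) force+
  finally show ?thesis unfolding euler_def .
qed

lemma rough_sum_cnj: "rough_sum N (cnj s) = cnj (rough_sum N s)"
  unfolding rough_sum_def by (simp add: cnj_powr)

lemma euler_cnj: "euler (cnj s) = cnj (euler s)"
  unfolding euler_def by (simp add: cnj_powr)

lemma rough_zeta_cnj: "Re s > -1 \<Longrightarrow> s \<noteq> 1 \<Longrightarrow> rough_zeta (cnj s) = cnj (rough_zeta s)"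
  unfolding rough_zeta_def euler_cnj by (simp add: zeta_cnj)

text \<open>
  The factor in the functional equation of the sieved function. The quotient of Euler factors is bounded within distance eta of the critical line.
\<close>
definition rough_chi :: "complex \<Rightarrow> complex" where
  "rough_chi s = chi s * (euler s / euler (1 - s))"

lemma rough_zeta_functional:
  assumes "0 < Re s" "Re s < 1"
  shows "rough_zeta s = rough_chi s * rough_zeta (1 - s)"
  using zeta_functional[OF assms] euler_nonzero[of "1 - s"] assms by (simp add: rough_zeta_def rough_chi_def)

lemma rough_chi_holomorphic: "rough_chi holomorphic_on {s. Re s < 1}"
proof -
  have "(euler \<circ> (\<lambda>s. 1 - s)) holomorphic_on {s. Re s < 1}"
    by (intro holomorphic_on_compose_gen[OF _ euler_holomorphic[of UNIV]] holomorphic_intros) auto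
  then show ?thesis unfolding rough_chi_def[abs_def]
    by (intro holomorphic_intros chi_holomorphic euler_holomorphic) (auto simp: o_def euler_nonzero)
qed

end

context resonance begin

lemma a_bounds: "0 < a" "a \<le> \<eta> / 8" "a * L = w" "a \<le> 1/32"
proof -
  show "0 < a" using w Lpos by (simp add: a_def)
  show a8: "a \<le> \<eta> / 8" using lam Lpos by (simp add: a_def \<eta>_def divide_simps mult_ac)
  show "a * L = w" using Lpos by (simp add: a_def)
  show "a \<le> 1/32" using a8 eta by linarith
qed

lemma norm_rough_chi_le:
  assumes x: "\<bar>x\<bar> \<le> \<eta>" and y: "T / 4 \<le> y" "y \<le> 4 * T"
  shows "norm (rough_chi (Complex (1/2 + x) y)) \<le> 4000 * exp (- x * L)"
proof -
  have x4: "\<bar>x\<bar> \<le> 1/4" using x eta by linarith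
  have T4: "T \<ge> 4" unfolding T_def using exp_ge_add_one_self[of L] L_ge by linarith
  then have y0: "y > 0" "y \<ge> 1" using y by linarith+
  have rat: "norm (euler (Complex (1/2 + x) y)) \<le> 27 * norm (euler (1 - Complex (1/2 + x) y))"
  proof -
    have "\<bar>x\<bar> * ln (real p) \<le> 1" if p: "p \<in> PP" for p
    proof -
      have "p \<le> \<Prod>PP" using prod_le[of "{p}"] p by simp
      then have "ln (real p) \<le> lam" unfolding lam_def using PP_pos[OF p] by (intro ln_mono) (simp_all del: of_nat_prod)
      moreover have "ln (real p) \<ge> 0" using PP_ge[OF p] by simp
      ultimately have "\<bar>x\<bar> * ln (real p) \<le> \<eta> * lam" using x eta by (intro mult_mono) auto
      then show ?thesis using eta by simp
    qed
    from euler_ratio[OF this, where y = y]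
    have "norm (euler (Complex (1/2 + x) y)) \<le> exp (3 * \<bar>x\<bar> * lam) * norm (euler (Complex (1/2 - x) y))" by (simp add: lam_def)
    also have "exp (3 * \<bar>x\<bar> * lam) \<le> exp (3 * 1)"
    proof -
      have "\<bar>x\<bar> * lam \<le> \<eta> * lam" using x lam by (intro mult_right_mono) auto
      then show ?thesis using eta by simp
    qed
    also have "exp (3 * 1) = (exp (1::real)) ^ 3" by (metis exp_of_nat_mult of_nat_numeral)
    also have "\<dots> \<le> 3 ^ 3" by (intro power_mono exp_le) auto
    finally have "norm (euler (Complex (1/2 + x) y)) \<le> 27 * norm (euler (Complex (1/2 - x) y))" by (simp add: mult_right_mono)
    moreover have "1 - Complex (1/2 + x) y = cnj (Complex (1/2 - x) y)" by (simp add: complex_eq_iff)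
    ultimately show ?thesis by (simp add: euler_cnj)
  qed
  have "norm (chi (Complex (1/2 + x) y)) \<le> 72 * y powr (- x)"
    using norm_chi_le[of "Complex (1/2 + x) y"] x4 y0 by (simp add: abs_le_iff)
  also have "y powr (- x) \<le> 2 * exp (- x * L)"
  proof -
    have "\<bar>ln y - L\<bar> \<le> ln 4"
      using ln_mono[of "T/4" y] ln_mono[of y "4 * T"] y y0 T4 by (simp add: ln_div ln_mult T_def abs_le_iff)
    then have "\<bar>x\<bar> * \<bar>ln y - L\<bar> \<le> 1/4 * ln 4" using x4 by (intro mult_mono) auto
    moreover have "ln (4::real) \<le> 4 * ln 2" using ln_realpow[of 2 2] by simp
    ultimately have "\<bar>x * (ln y - L)\<bar> \<le> ln 2" unfolding abs_mult by linarith
    then have "- x * ln y \<le> ln 2 + - x * L" by (simp add: algebra_simps abs_le_iff)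
    then have "exp (- x * ln y) \<le> exp (ln 2 + - x * L)" by simp
    also have "\<dots> = 2 * exp (- x * L)" unfolding exp_add by simp
    finally show ?thesis using y0 by (simp add: powr_def)
  qed
  finally have c: "norm (chi (Complex (1/2 + x) y)) \<le> 144 * exp (- x * L)" by simp
  have "euler (1 - Complex (1/2 + x) y) \<noteq> 0" using x4 by (intro euler_nonzero) auto
  then have "norm (euler (Complex (1/2 + x) y) / euler (1 - Complex (1/2 + x) y)) \<le> 27"
    using rat by (simp add: norm_divide divide_le_eq)
  then have "norm (rough_chi (Complex (1/2 + x) y)) \<le> (144 * exp (- x * L)) * 27"
    unfolding rough_chi_def norm_mult using c by (intro mult_mono) auto
  then show ?thesis using exp_gt_zero[of "- x * L"] by linarith
qed

end

lemma three_sum_bound: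
  fixes A c e s1 s2 :: real
  assumes "A \<le> 3 * (e + s1 + s2)" "e \<le> c"
  shows "A \<le> 3 * c + 3 * s1 + 3 * s2"
  using assms unfolding distrib_left by linarith

context resonance begin

section \<open>Mean squares to the right of the critical line\<close>

lemma T_large: "T \<ge> 1000000000000"
  unfolding T_def using exp_ge_add_one_self[of L] L_ge by linarith

lemma norm_powr_bounds:
  assumes N: "exp (3 * L / 2) \<le> N" "N \<le> 2 * exp (3 * L / 2)"
  shows "N powr (1/2) \<le> 2 * exp (3 * L / 4)" "N powr (-1/2) \<le> exp (- 3 * L / 4)" "N powr (-3/2) \<le> exp (- 9 * L / 4)"
proof -
  have pw: "exp (3 * L / 2) powr r = exp (r * (3 * L / 2))" for r by (simp add: powr_def)
  have "N powr (1/2) \<le> (4 * exp (3 * L / 2)) powr (1/2)" using N order_trans[OF exp_ge_zero N(1)] by (intro powr_mono2) auto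
  also have "\<dots> = 4 powr (1/2) * exp (3 * L / 2) powr (1/2)" by (rule powr_mult)
  also have "(4::real) powr (1/2) = 2" using powr_half_sqrt[of 4] real_sqrt_abs[of 2] by simp
  also have "exp (3 * L / 2) powr (1/2) = exp (3 * L / 4)" unfolding pw by simp
  finally show "N powr (1/2) \<le> 2 * exp (3 * L / 4)" .
  have "N powr (-1/2) \<le> exp (3 * L / 2) powr (-1/2)" using N by (intro powr_mono2') auto
  then show "N powr (-1/2) \<le> exp (- 3 * L / 4)" unfolding pw by simp
  have "N powr (-3/2) \<le> exp (3 * L / 2) powr (-3/2)" using N by (intro powr_mono2') auto
  then show "N powr (-3/2) \<le> exp (- 9 * L / 4)" unfolding pw by simp
qed

lemma rough_zeta_error:
  assumes y: "T / 2 \<le> y" "y \<le> 3 * T"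
  shows "norm (rough_zeta (Complex (1/2 + \<eta>) y) - rough_sum (\<Prod>PP * nat \<lceil>8 * T\<rceil>) (Complex (1/2 + \<eta>) y)) \<le> 2 ^ card PP * (1000 * exp (- L / 4))"
proof -
  define s where "s = Complex (1/2 + \<eta>) y"
  \<comment> \<open>At length T to the power 3/2 the two competing error terms of Euler-Maclaurin are both of order T to the power -1/4.\<close>
  define N1 where "N1 = nat \<lceil>exp (3 * L / 2)\<rceil>"
  have N0: "8 * T \<le> real (nat \<lceil>8 * T\<rceil>)" "real (nat \<lceil>8 * T\<rceil>) \<le> 9 * T" using T_large by linarith+
  have e1: "exp (3 * L / 2) \<ge> 1" using Lpos by simp
  have N1: "exp (3 * L / 2) \<le> real N1" "real N1 \<le> 2 * exp (3 * L / 2)" unfolding N1_def using e1 by linarith+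
  have "norm s \<le> \<bar>1/2 + \<eta>\<bar> + \<bar>y\<bar>" using cmod_le[of s] by (simp add: s_def)
  then have ns: "2 * norm s \<le> real (nat \<lceil>8 * T\<rceil>)" using y eta T_large N0 by linarith
  have "real (\<Prod>PP * nat \<lceil>8 * T\<rceil>) \<le> exp lam * (9 * T)" unfolding of_nat_mult exp_lam[symmetric] using N0 by (intro mult_left_mono) auto
  also have "\<dots> \<le> exp lam * (exp (L / 4) * exp L)"
    using exp_linear[of "L / 4"] Lpos L_ge unfolding T_def by (intro mult_left_mono mult_right_mono) auto
  also have "\<dots> = exp (lam + L / 4 + L)" unfolding exp_add by simp
  also have "\<dots> \<le> exp (3 * L / 2)" unfolding exp_le_cancel_iff using lam Lpos by linarith
  also note N1(1)
  finally have NN: "\<Prod>PP * nat \<lceil>8 * T\<rceil> \<le> N1" by (simp only: of_nat_le_iff)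
  have y0: "y > 0" "y \<ge> 1" using y T_large by linarith+
  have "norm (rough_zeta s - rough_sum (\<Prod>PP * nat \<lceil>8 * T\<rceil>) s)
     \<le> 2 ^ card PP * (153 * real N1 powr (1/2) / \<bar>Im s\<bar> + real N1 powr (-1/2) + 12 * \<bar>Im s\<bar>\<^sup>2 * real N1 powr (-3/2))"
    by (rule rough_zeta_approx[OF _ _ _ ns NN]) (use eta y0 in \<open>auto simp: s_def\<close>)
  also have "\<dots> \<le> 2 ^ card PP * (1000 * exp (- L / 4))"
  proof (rule mult_left_mono)
    have "153 * real N1 powr (1/2) / \<bar>Im s\<bar> \<le> 153 * (2 * exp (3 * L / 4)) / (T / 2)"
      using norm_powr_bounds[OF N1] y T_large by (intro frac_le mult_left_mono) (auto simp: s_def)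
    also have "\<dots> = 612 * (exp (3 * L / 4) / exp L)" by (simp add: T_def)
    also have "exp (3 * L / 4) / exp L = exp (- L / 4)" unfolding exp_diff[symmetric] by (rule arg_cong[of _ _ exp]) simp
    finally have p1: "153 * real N1 powr (1/2) / \<bar>Im s\<bar> \<le> 612 * exp (- L / 4)" .
    have "real N1 powr (-1/2) \<le> exp (- 3 * L / 4)" by (rule norm_powr_bounds[OF N1])
    also have "\<dots> \<le> exp (- L / 4)" using Lpos by simp
    finally have p2: "real N1 powr (-1/2) \<le> exp (- L / 4)" .
    have "\<bar>Im s\<bar>\<^sup>2 \<le> (3 * T)\<^sup>2" using y y0 by (intro power_mono) (auto simp: s_def)
    then have "12 * \<bar>Im s\<bar>\<^sup>2 * real N1 powr (-3/2) \<le> 12 * (3 * T)\<^sup>2 * exp (- 9 * L / 4)"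
      using norm_powr_bounds(3)[OF N1] by (intro mult_mono) auto
    also have "\<dots> = 108 * (exp L * exp L * exp (- 9 * L / 4))" by (simp add: T_def power2_eq_square)
    also have "exp L * exp L * exp (- 9 * L / 4) = exp (- L / 4)" unfolding exp_add[symmetric] by (rule arg_cong[of _ _ exp]) simp
    finally have p3: "12 * \<bar>Im s\<bar>\<^sup>2 * real N1 powr (-3/2) \<le> 108 * exp (- L / 4)" .
    from p1 p2 p3 show "153 * real N1 powr (1/2) / \<bar>Im s\<bar> + real N1 powr (-1/2) + 12 * \<bar>Im s\<bar>\<^sup>2 * real N1 powr (-3/2) \<le> 1000 * exp (- L / 4)"
      using exp_ge_zero[of "- L / 4"] by linarith
  qed simp
  finally show ?thesis unfolding s_def .
qed

lemma powr_tail: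
  assumes "exp r < real m" "r \<ge> 0"
  shows "real m powr (1 - 2 * (1/2 + \<eta>)) \<le> exp (- (2 * \<eta> * r))"
proof -
  have "real m powr (1 - 2 * (1/2 + \<eta>)) \<le> exp r powr (1 - 2 * (1/2 + \<eta>))" using assms eta by (intro powr_mono2') auto
  also have "\<dots> = exp (- (2 * \<eta> * r))" by (simp add: powr_def)
  finally show ?thesis .
qed

text \<open>
  Here the off-diagonal part of the mean value loses a power of the product of the primes. The terms beyond the 3/4-th power of T gain exp (- eta * L / 2) more than needed, and this outweighs the loss.
\<close>
lemma far_tail_mean_square:
  assumes N: "N = \<Prod>PP * nat \<lceil>8 * T\<rceil>" and I: "I \<subseteq> rough_upto N" "\<And>m. m \<in> I \<Longrightarrow> exp (3 * L / 4) < real m"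
  shows "integral {T..2*T} (\<lambda>t. (norm (\<Sum>m\<in>I. of_nat m powr (- Complex (1/2 + \<eta>) (t + v))))\<^sup>2 * Q t) \<le> 400 * L\<^sup>2 * exp (- (\<eta> * L)) * W"
proof -
  have N0: "8 * T \<le> real (nat \<lceil>8 * T\<rceil>)" "real (nat \<lceil>8 * T\<rceil>) \<le> 9 * T" using T_large by linarith+
  have N1: "N > 0" unfolding N using N0 T_large prod_pos[of PP] by simp
  have e2: "real (N * \<Prod>PP) \<le> 9 * exp (L + 2 * lam)"
  proof -
    have "real (N * \<Prod>PP) \<le> exp lam * (9 * T) * exp lam" unfolding N of_nat_mult exp_lam[symmetric] using N0 by (intro mult_left_mono mult_right_mono) auto
    then show ?thesis unfolding T_def exp_add mult_2 by (simp add: mult_ac)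
  qed
  have pos: "real (N * \<Prod>PP) > 0" using N1 prod_pos[of PP] by (simp del: of_nat_mult)
  have "ln (real (N * \<Prod>PP)) \<le> ln (9 * exp (L + 2 * lam))" using e2 pos by (intro ln_mono)
  also have "\<dots> = ln 9 + (L + 2 * lam)" using ln_mult_pos[of 9 "exp (L + 2 * lam)"] by simp
  also have "ln (9::real) \<le> 8" using ln_le_minus_one[of 9] by simp
  finally have l: "1 + ln (real (N * \<Prod>PP)) \<le> 2 * L" using lam L_ge by simp
  have "real N \<le> real (N * \<Prod>PP)" using prod_pos[of PP] by (intro of_nat_mono) (simp add: Suc_le_eq)
  then have "ln (real N) \<le> ln (real (N * \<Prod>PP))" using N1 by (intro ln_mono) auto
  then have lN: "1 + ln (real N) \<le> 2 * L" "0 \<le> 1 + ln (real N)" using l N1 ln_ge_zero[of "real N"] by linarith+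
  have "4 * real (N * \<Prod>PP) * (1 + ln (real (N * \<Prod>PP))) \<le> 4 * (9 * exp (L + 2 * lam)) * (2 * L)"
    using e2 l pos Lpos lN by (intro mult_mono') (auto intro!: add_nonneg_nonneg ln_ge_zero simp: Suc_le_eq N1 prod_pos simp del: of_nat_mult of_nat_prod)
  also have "\<dots> = 72 * L * exp (2 * lam) * T" unfolding exp_add T_def by simp
  finally have k: "T + 4 * real (N * \<Prod>PP) * (1 + ln (real (N * \<Prod>PP))) \<le> T + 72 * L * exp (2 * lam) * T" by simp
  have "1 * 1 \<le> L * exp (2 * lam)" using L_ge lam by (intro mult_mono) auto
  then have "1 * T \<le> L * exp (2 * lam) * T" using Tpos by (intro mult_right_mono) auto
  with k have k': "T + 4 * real (N * \<Prod>PP) * (1 + ln (real (N * \<Prod>PP))) \<le> 100 * L * exp (2 * lam) * T" using Tpos by linarith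
  have pt: "real m powr (1 - 2 * (1/2 + \<eta>)) \<le> exp (- (2 * \<eta> * (3 * L / 4)))" if "m \<in> I" for m
    by (rule powr_tail[OF I(2)[OF that]]) (use Lpos in simp)
  have "integral {T..T+T} (\<lambda>t. (norm (\<Sum>m\<in>I. of_nat m powr (- Complex (1/2 + \<eta>) (t + v))))\<^sup>2 * (norm (resonator \<kappa> t))\<^sup>2)
     \<le> (T + 4 * real (N * \<Prod>PP) * (1 + ln (real (N * \<Prod>PP)))) * (2 ^ card PP * (exp (- (2 * \<eta> * (3 * L / 4))) * (1 + ln (real N))))"
    by (rule rough_mean_square[OF I(1) kappa _ N1 pt]) (use Tpos in auto)
  also have "\<dots> \<le> (100 * L * exp (2 * lam) * T) * (2 ^ card PP * (exp (- (2 * \<eta> * (3 * L / 4))) * (2 * L)))"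
    using k' lN Lpos Tpos by (intro mult_mono mult_left_mono) auto
  also have "\<dots> = 200 * L\<^sup>2 * (exp (2 * lam) * exp (- (2 * \<eta> * (3 * L / 4)))) * W" by (simp add: W_def power2_eq_square mult_ac)
  also have "exp (2 * lam) * exp (- (2 * \<eta> * (3 * L / 4))) = exp (2 * lam - 3 / 2 * (\<eta> * L))" unfolding exp_add[symmetric] by (rule arg_cong[of _ _ exp]) simp
  also have "200 * L\<^sup>2 * exp (2 * lam - 3 / 2 * (\<eta> * L)) * W \<le> 400 * L\<^sup>2 * exp (- (\<eta> * L)) * W"
  proof (intro mult_right_mono mult_mono)
    show "exp (2 * lam - 3 / 2 * (\<eta> * L)) \<le> exp (- (\<eta> * L))" using eta(4) lam(1) by simp
  qed (use Wpos in auto)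
  finally show ?thesis unfolding Q_def[abs_def] mult_2 .
qed

text \<open>
  The terms between sqrt T and the 3/4-th power of T are short enough for a sharp mean value, the later terms gain an additional power of T, and the error of the approximation by the whole sum is negligible.
\<close>
lemma tail_mean_square:
  assumes v: "\<bar>v\<bar> \<le> T / 2"
  shows "integral {T..2*T} (\<lambda>t. (norm (rough_zeta (Complex (1/2 + \<eta>) (t + v)) - D (Complex (1/2 + \<eta>) (t + v))))\<^sup>2 * Q t) \<le> L ^ 3 * exp (- (\<eta> * L)) * W"
proof -
  define N where "N = \<Prod>PP * nat \<lceil>8 * T\<rceil>"
  define X where "X = nat \<lfloor>exp (L / 2)\<rfloor>"
  define Y where "Y = nat \<lfloor>exp (3 * L / 4)\<rfloor>"
  define I1 where "I1 = rough_upto Y - rough_upto X"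
  define I2 where "I2 = rough_upto N - rough_upto Y"
  have e: "exp (L / 2) \<ge> 1" "exp (3 * L / 4) \<ge> 1" "exp (L / 2) \<le> exp (3 * L / 4)" "exp (3 * L / 4) \<le> T" using Lpos by (auto simp: T_def)
  have XY: "X \<le> Y" unfolding X_def Y_def using e by (intro nat_mono floor_mono)
  have "real Y \<le> T" unfolding Y_def using e by linarith
  moreover have "1 * nat \<lceil>8 * T\<rceil> \<le> N" unfolding N_def using prod_pos[OF order_refl] by (intro mult_le_mono1) linarith
  moreover have "8 * T \<le> real (nat \<lceil>8 * T\<rceil>)" by linarith
  ultimately have YN: "Y \<le> N" using Tpos by linarith
  have sub: "rough_upto X \<subseteq> rough_upto Y" "rough_upto Y \<subseteq> rough_upto N" using XY YN by (auto simp: rough_upto_def)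
  define b where "b = 1/2 + \<eta>"
  define E where "E = (\<lambda>t. rough_zeta (Complex b (t + v)) - rough_sum N (Complex b (t + v)))"
  define S1 where "S1 = (\<lambda>t. \<Sum>m\<in>I1. of_nat m powr (- Complex b (t + v)) :: complex)"
  define S2 where "S2 = (\<lambda>t. \<Sum>m\<in>I2. of_nat m powr (- Complex b (t + v)) :: complex)"
  have S1: "S1 t = rough_sum Y (Complex b (t + v)) - D (Complex b (t + v))" for t
    unfolding S1_def I1_def D_def rough_sum_def X_def[symmetric] by (rule sum_diff[OF finite_rough_upto sub(1)])
  have S2: "S2 t = rough_sum N (Complex b (t + v)) - rough_sum Y (Complex b (t + v))" for t
    unfolding S2_def I2_def rough_sum_def by (rule sum_diff[OF finite_rough_upto sub(2)])
  have ne: "Complex b (t + v) \<in> - {1}" if "t \<in> {T..2*T}" for t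
    using that v T_large by (auto simp: complex_eq_iff)
  have Dh: "D holomorphic_on UNIV" unfolding D_def by (rule rough_sum_holomorphic)
  have cz: "continuous_on {T..2*T} (\<lambda>t. rough_zeta (Complex b (t + v)))" using ne by (intro cont_line[OF rough_zeta_holomorphic]) auto
  have cs: "continuous_on {T..2*T} (\<lambda>t. rough_sum M (Complex b (t + v)))" for M by (intro cont_line[OF rough_sum_holomorphic[of _ UNIV]]) auto
  have cd: "continuous_on {T..2*T} (\<lambda>t. D (Complex b (t + v)))" by (intro cont_line[OF Dh]) auto
  have cS1: "continuous_on {T..2*T} S1" unfolding S1[abs_def] by (intro continuous_intros cs cd)
  have cS2: "continuous_on {T..2*T} S2" unfolding S2[abs_def] by (intro continuous_intros cs)
  have i1: "(\<lambda>t. (norm (S1 t))\<^sup>2 * Q t) integrable_on {T..2*T}" by (intro integrable_continuous_real continuous_intros cS1 continuous_Q)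
  have i2: "(\<lambda>t. (norm (S2 t))\<^sup>2 * Q t) integrable_on {T..2*T}" by (intro integrable_continuous_real continuous_intros cS2 continuous_Q)
  have i3: "Q integrable_on {T..2*T}" by (intro integrable_continuous_real continuous_Q)
  have i4: "(\<lambda>t. (norm (rough_zeta (Complex b (t + v)) - D (Complex b (t + v))))\<^sup>2 * Q t) integrable_on {T..2*T}"
    by (intro integrable_continuous_real continuous_intros cz cd continuous_Q)
  define c where "c = 1000000 * exp (- (\<eta> * L))"
  have Eb: "(norm (E t))\<^sup>2 \<le> c" if t: "t \<in> {T..2*T}" for t
  proof -
    have "norm (E t) \<le> 2 ^ card PP * (1000 * exp (- L / 4))" unfolding E_def b_def N_def
      by (rule rough_zeta_error) (use t v in \<open>auto simp: abs_le_iff\<close>)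
    also have "\<dots> \<le> exp lam * (1000 * exp (- L / 4))" using two_power_card_le unfolding exp_lam by (intro mult_right_mono) auto
    finally have "(norm (E t))\<^sup>2 \<le> (exp lam * (1000 * exp (- L / 4)))\<^sup>2" by (intro power_mono) auto
    also have "\<dots> = 1000000 * (exp lam * exp lam * exp (- L / 4) * exp (- L / 4))" by (simp add: power2_eq_square)
    also have "exp lam * exp lam * exp (- L / 4) * exp (- L / 4) = exp (2 * lam - L / 2)" unfolding exp_add[symmetric] by (rule arg_cong[of _ _ exp]) simp
    also have "1000000 * exp (2 * lam - L / 2) \<le> c" unfolding c_def
    proof (intro mult_left_mono)
      have "2 * lam - L / 2 \<le> - (\<eta> * L)" using eta(5) lam(4) Lpos by linarith
      then show "exp (2 * lam - L / 2) \<le> exp (- (\<eta> * L))" by simp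
    qed simp
    finally show ?thesis .
  qed
  have "integral {T..2*T} (\<lambda>t. (norm (rough_zeta (Complex b (t + v)) - D (Complex b (t + v))))\<^sup>2 * Q t)
     \<le> integral {T..2*T} (\<lambda>t. 3 * c * Q t + (3 * ((norm (S1 t))\<^sup>2 * Q t) + 3 * ((norm (S2 t))\<^sup>2 * Q t)))"
  proof (rule integral_le[OF i4])
    show "(\<lambda>t. 3 * c * Q t + (3 * ((norm (S1 t))\<^sup>2 * Q t) + 3 * ((norm (S2 t))\<^sup>2 * Q t))) integrable_on {T..2*T}"
      by (intro integrable_add integrable_on_mult_right i1 i2 i3)
    fix t assume t: "t \<in> {T..2*T}"
    have "rough_zeta (Complex b (t + v)) - D (Complex b (t + v)) = E t + S1 t + S2 t" unfolding E_def S1 S2 by simp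
    then have "norm (rough_zeta (Complex b (t + v)) - D (Complex b (t + v))) \<le> norm (E t) + norm (S1 t) + norm (S2 t)"
      using norm_triangle_ineq[of "E t + S1 t" "S2 t"] norm_triangle_ineq[of "E t" "S1 t"] by simp
    then have "(norm (rough_zeta (Complex b (t + v)) - D (Complex b (t + v))))\<^sup>2 \<le> (norm (E t) + norm (S1 t) + norm (S2 t))\<^sup>2" by (intro power_mono) auto
    also have "\<dots> \<le> 3 * ((norm (E t))\<^sup>2 + (norm (S1 t))\<^sup>2 + (norm (S2 t))\<^sup>2)" by (rule power2_sum3_le)
    finally have "(norm (rough_zeta (Complex b (t + v)) - D (Complex b (t + v))))\<^sup>2 \<le> 3 * c + 3 * (norm (S1 t))\<^sup>2 + 3 * (norm (S2 t))\<^sup>2"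
      by (rule three_sum_bound[OF _ Eb[OF t]])
    from mult_right_mono[OF this Q_nonneg[of t]]
    show "(norm (rough_zeta (Complex b (t + v)) - D (Complex b (t + v))))\<^sup>2 * Q t \<le> 3 * c * Q t + (3 * ((norm (S1 t))\<^sup>2 * Q t) + 3 * ((norm (S2 t))\<^sup>2 * Q t))"
      by (simp add: algebra_simps)
  qed
  also have "\<dots> = 3 * c * integral {T..2*T} Q + (3 * integral {T..2*T} (\<lambda>t. (norm (S1 t))\<^sup>2 * Q t) + 3 * integral {T..2*T} (\<lambda>t. (norm (S2 t))\<^sup>2 * Q t))"
    using i1 i2 i3 by (simp add: integral_add integrable_add integrable_on_mult_right)
  also have "\<dots> \<le> 3 * c * (2 * W) + (3 * (2 * L * exp (- (\<eta> * L)) * W) + 3 * (400 * L\<^sup>2 * exp (- (\<eta> * L)) * W))"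
  proof (intro add_mono mult_left_mono)
    show "integral {T..2*T} Q \<le> 2 * W" by (rule integral_Q)
    show "integral {T..2*T} (\<lambda>t. (norm (S1 t))\<^sup>2 * Q t) \<le> 2 * L * exp (- (\<eta> * L)) * W" unfolding S1_def
    proof (rule block_mean_square[of _ Y])
      show "I1 \<subseteq> rough_upto Y" by (auto simp: I1_def)
      show "0 < Y" "real Y \<le> exp (3 * L / 4)" unfolding Y_def using floor_exp[of "3 * L / 4"] Lpos by auto
      fix m assume "m \<in> I1"
      then have "m > X" by (auto simp: I1_def rough_upto_def)
      then have "exp (L / 2) < real m" unfolding X_def by linarith
      then show "real m powr (1 - 2 * b) \<le> exp (- (\<eta> * L))" unfolding b_def using powr_tail[of "L / 2" m] Lpos by simp
    qed simp
    show "integral {T..2*T} (\<lambda>t. (norm (S2 t))\<^sup>2 * Q t) \<le> 400 * L\<^sup>2 * exp (- (\<eta> * L)) * W" unfolding S2_def b_def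
    proof (rule far_tail_mean_square[OF N_def])
      show "I2 \<subseteq> rough_upto N" by (auto simp: I2_def)
      fix m assume "m \<in> I2"
      then have "m > Y" by (auto simp: I2_def rough_upto_def)
      then show "exp (3 * L / 4) < real m" unfolding Y_def by linarith
    qed
  qed (auto simp: c_def)
  also have "\<dots> = (6000000 + 6 * L + 1200 * L\<^sup>2) * (exp (- (\<eta> * L)) * W)" by (simp add: c_def algebra_simps)
  also have "\<dots> \<le> L ^ 3 * (exp (- (\<eta> * L)) * W)"
  proof (intro mult_right_mono)
    have "L * 1000000000000 \<le> L * L" using L_ge Lpos by (intro mult_left_mono) auto
    moreover have "1000000000000 * L\<^sup>2 \<le> L * L\<^sup>2" using L_ge by (intro mult_right_mono) auto
    ultimately have "6000000 + 6 * L + 1200 * L\<^sup>2 \<le> L * L\<^sup>2" using L_ge unfolding power2_eq_square[of L] by linarith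
    then show "6000000 + 6 * L + 1200 * L\<^sup>2 \<le> L ^ 3" by (simp add: power2_eq_square power3_eq_cube mult_ac)
  qed (use Wpos in auto)
  finally show ?thesis unfolding b_def by (simp add: mult.assoc)
qed

end

context resonance begin

section \<open>A biased point with controlled mean squares\<close>

text \<open>
  The mean squares which control the function pointwise, normalized so that each of them has mean value bounded by a power of L against the weight.
\<close>
definition "lineweight y = exp (\<eta> * L) * (norm (rough_zeta (Complex (1/2 + \<eta>) y) - D (Complex (1/2 + \<eta>) y)))\<^sup>2
   + exp (- (\<eta> * L)) * (norm (D (Complex (1/2 - \<eta>) y)))\<^sup>2
   + (norm (D (Complex (1/2 + 4 * a) y)))\<^sup>2 + (norm (D (Complex (1/2 - 4 * a) y)))\<^sup>2"

text \<open>
  The range covers the window of radius 1/a, at most L, and two applications of Cauchy's formula with rectangles of half-height 2 L.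
\<close>
definition "\<Phi> t = integral {-(5*L)..5*L} (\<lambda>v. lineweight (t + v))"
definition "V t = (\<Sum>p\<in>PP. real p powr (-1/2) * cos (t * ln (real p)))"
definition "\<Sigma> = (\<Sum>p\<in>PP. real p powr (-1/2))"

lemma D_holomorphic: "D holomorphic_on A"
  unfolding D_def by (rule rough_sum_holomorphic)

lemma lineweight_nonneg: "lineweight y \<ge> 0" by (simp add: lineweight_def)

lemma continuous_lineweight_shift:
  assumes "\<And>t. t \<in> I \<Longrightarrow> t + v > 0"
  shows "continuous_on I (\<lambda>t. lineweight (t + v))"
proof -
  have "continuous_on I (\<lambda>t. rough_zeta (Complex (1/2 + \<eta>) (t + v)))"
    using assms by (intro cont_line[OF rough_zeta_holomorphic]) (force simp: complex_eq_iff)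
  moreover have "continuous_on I (\<lambda>t. D (Complex \<sigma> (t + v)))" for \<sigma> by (intro cont_line[OF D_holomorphic[of UNIV]]) auto
  ultimately show ?thesis unfolding lineweight_def by (intro continuous_intros)
qed

lemma continuous_lineweight: "continuous_on {0<..} lineweight"
  using continuous_lineweight_shift[of "{0<..}" 0] by simp

lemma L_powers: "1000000000000 * L ^ k \<le> L ^ Suc k" "0 < L ^ k"
  using L_ge Lpos by (auto intro: mult_right_mono)

lemma exp_ge_linear: "x \<ge> L / 8 \<Longrightarrow> 4 + 4 * L \<le> exp x"
  using exp_linear[of x] by (simp add: distrib_left)

lemma five_L: "5 * L \<le> T / 100"
proof -
  have e: "4 + 4 * L \<le> exp (L / 2)" using Lpos by (intro exp_ge_linear) simp
  then have "1000 \<le> exp (L / 2)" "L \<le> exp (L / 2)" using L_ge by linarith+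
  then have "1000 * L \<le> exp (L / 2) * exp (L / 2)" using Lpos by (intro mult_mono) auto
  also have "\<dots> = T" by (simp add: T_def exp_add[symmetric])
  finally show ?thesis using Lpos by linarith
qed

lemma exp_aL: "exp (4 * a * L) \<le> L ^ 4" "exp (3 * a * L) \<le> L ^ 3"
proof -
  have "exp (4 * a * L) = exp w ^ 4" using a_bounds(3) by (simp add: exp_of_nat_mult[symmetric] mult.assoc)
  also have "\<dots> \<le> L ^ 4" using w by (intro power_mono) auto
  finally show "exp (4 * a * L) \<le> L ^ 4" .
  have "exp (3 * a * L) = exp w ^ 3" using a_bounds(3) by (simp add: exp_of_nat_mult[symmetric] mult.assoc)
  also have "\<dots> \<le> L ^ 3" using w by (intro power_mono) auto
  finally show "exp (3 * a * L) \<le> L ^ 3" .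
qed

lemma lineweight_mean:
  assumes v: "\<bar>v\<bar> \<le> T / 2"
  shows "integral {T..2*T} (\<lambda>t. lineweight (t + v) * Q t) \<le> L ^ 6 * W"
proof -
  define A where "A = (\<lambda>t. (norm (rough_zeta (Complex (1/2 + \<eta>) (t + v)) - D (Complex (1/2 + \<eta>) (t + v))))\<^sup>2 * Q t)"
  define B where "B \<sigma> = (\<lambda>t. (norm (D (Complex \<sigma> (t + v))))\<^sup>2 * Q t)" for \<sigma>
  have "continuous_on {T..2*T} (\<lambda>t. rough_zeta (Complex (1/2 + \<eta>) (t + v)))"
    using v T_large by (intro cont_line[OF rough_zeta_holomorphic]) (auto simp: complex_eq_iff)
  moreover have cD: "continuous_on {T..2*T} (\<lambda>t. D (Complex \<sigma> (t + v)))" for \<sigma> by (intro cont_line[OF D_holomorphic[of UNIV]]) auto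
  ultimately have iA: "A integrable_on {T..2*T}" unfolding A_def by (intro integrable_continuous_real continuous_intros continuous_Q)
  have iB: "B \<sigma> integrable_on {T..2*T}" for \<sigma> unfolding B_def by (intro integrable_continuous_real continuous_intros continuous_Q cD)
  have "(\<lambda>t. lineweight (t + v) * Q t) = (\<lambda>t. exp (\<eta> * L) * A t + exp (- (\<eta> * L)) * B (1/2 - \<eta>) t + B (1/2 + 4 * a) t + B (1/2 - 4 * a) t)"
    unfolding lineweight_def A_def B_def by (simp add: algebra_simps)
  then have "integral {T..2*T} (\<lambda>t. lineweight (t + v) * Q t)
     = exp (\<eta> * L) * integral {T..2*T} A + exp (- (\<eta> * L)) * integral {T..2*T} (B (1/2 - \<eta>)) + integral {T..2*T} (B (1/2 + 4 * a)) + integral {T..2*T} (B (1/2 - 4 * a))"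
    using iA iB by (simp add: integral_add integrable_add integrable_on_mult_right)
  also have "\<dots> \<le> exp (\<eta> * L) * (L ^ 3 * exp (- (\<eta> * L)) * W) + exp (- (\<eta> * L)) * (2 * L * exp (\<eta> * L) * W) + 2 * L * exp (0 * L) * W + 2 * L * exp (4 * a * L) * W"
    unfolding A_def B_def using a_bounds eta
    by (intro add_mono mult_left_mono tail_mean_square[OF v] D_mean_square) auto
  also have "\<dots> = (exp (\<eta> * L) * exp (- (\<eta> * L))) * (L ^ 3 + 2 * L) * W + 2 * L * W + 2 * L * exp (4 * a * L) * W" by (simp add: algebra_simps)
  also have "exp (\<eta> * L) * exp (- (\<eta> * L)) = 1" unfolding exp_add[symmetric] by simp
  also have "1 * (L ^ 3 + 2 * L) * W + 2 * L * W + 2 * L * exp (4 * a * L) * W = (L ^ 3 + 4 * L + 2 * L * exp (4 * a * L)) * W" by (simp add: algebra_simps)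
  also have "\<dots> \<le> L ^ 6 * W"
  proof (rule mult_right_mono)
    have "2 * L * exp (4 * a * L) \<le> 2 * L * L ^ 4" using exp_aL Lpos by (intro mult_left_mono) auto
    then have "2 * L * exp (4 * a * L) \<le> 2 * L ^ 5" by (simp add: eval_nat_numeral)
    then show "L ^ 3 + 4 * L + 2 * L * exp (4 * a * L) \<le> L ^ 6"
      using L_powers[of 5] L_powers[of 4] L_powers[of 3] L_powers[of 2] L_powers[of 1] by (simp add: eval_nat_numeral del: power_Suc)
  qed (use Wpos in simp)
  finally show ?thesis .
qed

lemma continuous_two_lineweight: "continuous_on ({T..2*T} \<times> {-(5*L)..5*L}) (\<lambda>(t, v). lineweight (t + v))"
  unfolding case_prod_beta
  by (rule continuous_on_compose2[OF continuous_lineweight]) (use five_L T_large in \<open>auto intro!: continuous_intros\<close>)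

lemma continuous_Phi: "continuous_on {T..2*T} \<Phi>"
  unfolding \<Phi>_def[abs_def]
  using integral_continuous_on_param[of "{T..2*T}" "-(5*L)" "5*L" "\<lambda>t v. lineweight (t + v)"] continuous_two_lineweight by (simp add: cbox_interval)

lemma Phi_mean: "integral {T..2*T} (\<lambda>t. \<Phi> t * Q t) \<le> L ^ 8 * W"
proof -
  have p1: "continuous_on ({T..2*T} \<times> {-(5*L)..5*L}) (\<lambda>x. lineweight (fst x + snd x))" using continuous_two_lineweight by (simp add: case_prod_beta)
  have p2: "continuous_on ({T..2*T} \<times> {-(5*L)..5*L}) (\<lambda>x. Q (fst x))"
    by (rule continuous_on_compose2[OF continuous_Q[of UNIV]]) (auto intro!: continuous_intros)
  have c: "continuous_on (cbox (T, -(5*L)) (2*T, 5*L)) (\<lambda>(t, v). lineweight (t + v) * Q t)"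
    unfolding cbox_Pair_eq box_real case_prod_beta by (rule continuous_on_mult[OF p1 p2])
  have "integral {T..2*T} (\<lambda>t. \<Phi> t * Q t) = integral {T..2*T} (\<lambda>t. integral {-(5*L)..5*L} (\<lambda>v. lineweight (t + v) * Q t))"
    unfolding \<Phi>_def by simp
  also have "\<dots> = integral {-(5*L)..5*L} (\<lambda>v. integral {T..2*T} (\<lambda>t. lineweight (t + v) * Q t))"
    using integral_swap_continuous[OF c] by (simp add: cbox_interval)
  also have "\<dots> \<le> integral {-(5*L)..5*L} (\<lambda>v. L ^ 6 * W)"
  proof -
    have "continuous_on ((\<lambda>x. (snd x, fst x)) ` (cbox (-(5*L)) (5*L) \<times> cbox T (2*T))) (\<lambda>(t, v). lineweight (t + v) * Q t)"
      by (rule continuous_on_subset[OF c]) (auto simp: cbox_Pair_eq)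
    from continuous_on_compose2[OF this, of "cbox (-(5*L)) (5*L) \<times> cbox T (2*T)" "\<lambda>x. (snd x, fst x)"]
    have "continuous_on (cbox (-(5*L)) (5*L) \<times> cbox T (2*T)) (\<lambda>(v, t). lineweight (t + v) * Q t)"
      by (simp add: case_prod_beta continuous_on_Pair continuous_on_snd continuous_on_fst continuous_on_id)
    from integral_continuous_on_param[OF this]
    have i: "(\<lambda>v. integral {T..2*T} (\<lambda>t. lineweight (t + v) * Q t)) integrable_on {-(5*L)..5*L}"
      by (intro integrable_continuous_real) (simp add: cbox_interval)
    have "integral {T..2*T} (\<lambda>t. lineweight (t + v) * Q t) \<le> L ^ 6 * W" if "v \<in> {-(5*L)..5*L}" for v
      using that five_L T_large by (intro lineweight_mean) auto
    then show ?thesis by (intro integral_le[OF i]) auto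
  qed
  also have "\<dots> = 10 * L ^ 7 * W" using Lpos by (simp add: eval_nat_numeral)
  also have "\<dots> \<le> L ^ 8 * W" using L_powers[of 7] Wpos by (intro mult_right_mono) (auto simp: eval_nat_numeral simp del: power_Suc)
  finally show ?thesis .
qed

text \<open>
  Without the weight the mean of V is negligible; the bias of the resonator at each prime shifts it to a fixed proportion of its maximum.
\<close>
lemma V_mean: "integral {T..2*T} (\<lambda>t. Q t * (\<kappa> * V t)) \<ge> 2 / 5 * \<Sigma> * W"
proof -
  define F where "F p = (\<lambda>t. Q t * (\<kappa> * cos (t * ln (real p))))" for p :: nat
  have iF: "F p integrable_on {T..2*T}" for p unfolding F_def by (intro integrable_continuous_real continuous_intros continuous_Q)
  have one: "integral {T..2*T} (F p) \<ge> 2 / 5 * W" if p: "p \<in> PP" for p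
  proof -
    have "integral {T..T+T} (F p) \<ge> T * 2 ^ card PP / 2 - 2 * real (p * \<Prod>PP) * 4 ^ card PP"
      unfolding F_def Q_def using Tpos by (intro resonator_bias[OF p kappa]) simp
    moreover have "2 * real (p * \<Prod>PP) * 4 ^ card PP \<le> 1 / 10 * W"
    proof -
      have "real p \<le> exp lam" unfolding exp_lam of_nat_le_iff using prod_le[of "{p}"] p by simp
      have four: "(4::real) ^ card PP = 2 ^ card PP * 2 ^ card PP" by (simp add: power_mult_distrib[symmetric])
      have A: "real p * exp lam \<le> exp lam * exp lam" using \<open>real p \<le> exp lam\<close> by (rule mult_right_mono) simp
      have B: "2 ^ card PP * 2 ^ card PP \<le> exp lam * 2 ^ card PP" using two_power_card_le unfolding exp_lam[symmetric] by (rule mult_right_mono) simp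
      have "2 * real (p * \<Prod>PP) * 4 ^ card PP = 2 * ((real p * exp lam) * (2 ^ card PP * 2 ^ card PP))"
        by (simp only: of_nat_mult exp_lam four mult.assoc)
      also have "\<dots> \<le> 2 * ((exp lam * exp lam) * (exp lam * 2 ^ card PP))"
        by (intro mult_left_mono mult_mono[OF A B]) auto
      also have "\<dots> = 2 * (exp lam * exp lam * exp lam) * 2 ^ card PP" by (simp only: mult.assoc)
      also have "exp lam * exp lam * exp lam = exp (3 * lam)" unfolding exp_add[symmetric] by (rule arg_cong[of _ _ exp]) simp
      also have "2 * exp (3 * lam) * 2 ^ card PP \<le> 2 * exp (L / 2) * 2 ^ card PP" using lam(4) Lpos by (intro mult_right_mono mult_left_mono) auto
      also have "\<dots> \<le> 1 / 10 * (exp (L / 2) * exp (L / 2)) * 2 ^ card PP"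
      proof -
        have "20 \<le> exp (L / 2)" using exp_ge_linear[of "L / 2"] L_ge Lpos by linarith
        then have "20 * exp (L / 2) \<le> exp (L / 2) * exp (L / 2)" by (intro mult_right_mono) auto
        then show ?thesis by (intro mult_right_mono) auto
      qed
      also have "\<dots> = 1 / 10 * W" unfolding exp_add[symmetric] by (simp add: W_def T_def)
      finally show ?thesis .
    qed
    moreover have "T + T = 2 * T" by simp
    ultimately have "integral {T..2*T} (F p) \<ge> W / 2 - 1 / 10 * W" unfolding W_def by simp
    then show ?thesis by simp
  qed
  have "(\<lambda>t. Q t * (\<kappa> * V t)) = (\<lambda>t. \<Sum>p\<in>PP. real p powr (-1/2) * F p t)"
    unfolding V_def F_def by (simp add: sum_distrib_left mult_ac)
  then have "integral {T..2*T} (\<lambda>t. Q t * (\<kappa> * V t)) = (\<Sum>p\<in>PP. real p powr (-1/2) * integral {T..2*T} (F p))"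
    using finite_PP iF by (simp add: integral_sum integrable_on_mult_right)
  also have "\<dots> \<ge> (\<Sum>p\<in>PP. real p powr (-1/2) * (2 / 5 * W))" using one by (intro sum_mono mult_left_mono) auto
  finally show ?thesis unfolding \<Sigma>_def by (simp add: sum_distrib_left sum_distrib_right mult_ac)
qed

lemma V_le: "\<bar>V t\<bar> \<le> \<Sigma>"
  unfolding V_def \<Sigma>_def by (rule order_trans[OF sum_abs]) (auto intro!: sum_mono simp: abs_mult mult_left_le)

text \<open>
  If the mean squares were large wherever V is biased, the pointwise bound for V by the sum of a small constant and a multiple of the mean squares would, averaged against the weight, contradict the mean value of V.
\<close>
lemma exists_biased_point:
  assumes "PP \<noteq> {}"
  shows "\<exists>t0\<in>{T..2*T}. \<kappa> * V t0 \<ge> \<Sigma> / 8 \<and> \<Phi> t0 \<le> L ^ 9"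
proof (rule ccontr)
  assume neg: "\<not> ?thesis"
  have Sp: "\<Sigma> > 0" unfolding \<Sigma>_def using assms finite_PP PP_pos by (intro sum_pos) force+
  have Phi0: "\<Phi> t \<ge> 0" if "t \<in> {T..2*T}" for t unfolding \<Phi>_def using lineweight_nonneg that five_L T_large
    by (intro integral_nonneg integrable_continuous_real continuous_on_compose2[OF continuous_lineweight]) (auto intro!: continuous_intros)
  have pw: "\<kappa> * V t \<le> \<Sigma> / 8 + \<Sigma> / L ^ 9 * \<Phi> t" if t: "t \<in> {T..2*T}" for t
  proof (cases "\<kappa> * V t \<ge> \<Sigma> / 8")
    case True
    then have "\<Phi> t > L ^ 9" using neg t by force
    then have "1 \<le> \<Phi> t / L ^ 9" using L_powers(2)[of 9] by (simp add: le_divide_eq)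
    then have "\<Sigma> * 1 \<le> \<Sigma> * (\<Phi> t / L ^ 9)" using Sp by (intro mult_left_mono) auto
    moreover have "\<kappa> * V t \<le> \<Sigma>" using V_le[of t] kappa abs_ge_self[of "\<kappa> * V t"] unfolding abs_mult by simp
    ultimately show ?thesis using Sp by simp
  next
    case False
    moreover have "\<Sigma> / L ^ 9 * \<Phi> t \<ge> 0" using Sp Phi0[OF t] L_powers(2)[of 9] by (intro mult_nonneg_nonneg divide_nonneg_nonneg) auto
    ultimately show ?thesis by linarith
  qed
  have cV: "continuous_on A V" for A unfolding V_def[abs_def] by (intro continuous_intros)
  have i1: "Q integrable_on {T..2*T}" by (intro integrable_continuous_real continuous_Q)
  have i2: "(\<lambda>t. \<Phi> t * Q t) integrable_on {T..2*T}" by (intro integrable_continuous_real continuous_intros continuous_Q continuous_Phi)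
  have "integral {T..2*T} (\<lambda>t. Q t * (\<kappa> * V t)) \<le> integral {T..2*T} (\<lambda>t. \<Sigma> / 8 * Q t + \<Sigma> / L ^ 9 * (\<Phi> t * Q t))"
  proof (rule integral_le)
    show "(\<lambda>t. Q t * (\<kappa> * V t)) integrable_on {T..2*T}" by (intro integrable_continuous_real continuous_intros continuous_Q cV)
    show "(\<lambda>t. \<Sigma> / 8 * Q t + \<Sigma> / L ^ 9 * (\<Phi> t * Q t)) integrable_on {T..2*T}" by (intro integrable_add integrable_on_mult_right i1 i2)
    show "Q t * (\<kappa> * V t) \<le> \<Sigma> / 8 * Q t + \<Sigma> / L ^ 9 * (\<Phi> t * Q t)" if "t \<in> {T..2*T}" for t
      using mult_left_mono[OF pw[OF that] Q_nonneg[of t]] by (simp add: algebra_simps)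
  qed
  also have "\<dots> = \<Sigma> / 8 * integral {T..2*T} Q + \<Sigma> / L ^ 9 * integral {T..2*T} (\<lambda>t. \<Phi> t * Q t)"
    using i1 i2 by (simp only: integral_add integrable_on_mult_right integral_mult_right)
  also have "\<dots> \<le> \<Sigma> / 8 * (2 * W) + \<Sigma> / L ^ 9 * (L ^ 8 * W)"
    using Sp integral_Q Phi_mean L_powers(2)[of 9] by (intro add_mono mult_left_mono) auto
  also have "\<Sigma> / L ^ 9 * (L ^ 8 * W) = \<Sigma> * W * (1 / L)" using Lpos by (simp add: eval_nat_numeral)
  also have "\<dots> \<le> \<Sigma> * W * (1 / 10)" using L_ge Lpos Sp Wpos by (intro mult_left_mono divide_left_mono) auto
  finally have "2 / 5 * (\<Sigma> * W) \<le> 7 / 20 * (\<Sigma> * W)" using V_mean by simp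
  then show False using mult_pos_pos[OF Sp Wpos] by linarith
qed

end

context resonance begin

section \<open>Pointwise bounds near the biased point\<close>

lemma exp_8_le: "(exp 4)\<^sup>2 \<le> (6561::real)"
proof -
  have "(exp 4)\<^sup>2 = (exp (1::real)) ^ 8" by (simp add: exp_of_nat_mult[symmetric] power_mult[symmetric])
  also have "\<dots> \<le> 3 ^ 8" by (intro power_mono exp_le) auto
  finally show ?thesis by simp
qed

lemma horizontal_negligible:
  assumes "0 \<le> G" "G \<le> exp (4 * L)" "0 \<le> z" "z \<le> exp L"
  shows "(4 * G * z * exp (4 - (2 * L)\<^sup>2) / (2 * L))\<^sup>2 \<le> 1"
proof -
  have "1000000000000 * L \<le> L * L" using L_ge Lpos by (intro mult_right_mono) auto
  then have "5 * L + 4 \<le> 4 * (L * L)" using L_ge by linarith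
  then have le: "4 * L + L + (4 - (2 * L)\<^sup>2) \<le> 0" by (simp add: power2_eq_square)
  have "4 * G * z * exp (4 - (2 * L)\<^sup>2) \<le> 4 * exp (4 * L) * exp L * exp (4 - (2 * L)\<^sup>2)"
    using assms by (intro mult_mono) auto
  also have "\<dots> = 4 * exp (4 * L + L + (4 - (2 * L)\<^sup>2))" unfolding exp_add by simp
  also have "\<dots> \<le> 4 * 1" using le by simp
  finally have "4 * G * z * exp (4 - (2 * L)\<^sup>2) / (2 * L) \<le> 1" using L_ge Lpos by (simp add: divide_le_eq)
  moreover have "0 \<le> 4 * G * z * exp (4 - (2 * L)\<^sup>2) / (2 * L)" using assms Lpos by simp
  ultimately show ?thesis by (simp add: power_le_one)
qed

lemma norm_D_crude: "Re s \<ge> 0 \<Longrightarrow> norm (D s) \<le> exp (L / 2)"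
proof -
  assume s: "Re s \<ge> 0"
  define X where "X = nat \<lfloor>exp (L / 2)\<rfloor>"
  have "norm (D s) \<le> (\<Sum>m\<in>rough_upto X. 1)" unfolding D_def rough_sum_def X_def[symmetric]
  proof (intro order_trans[OF norm_sum] sum_mono)
    fix m assume "m \<in> rough_upto X"
    then have m: "m \<ge> 1" "0 < m" by (auto simp: rough_upto_def)
    have "norm (of_nat m powr (- s) :: complex) = real m powr (- Re s)" using norm_nat_powr[OF m(2)] by simp
    also have "\<dots> \<le> real m powr 0" using m s by (intro powr_mono) auto
    finally show "norm (of_nat m powr (- s) :: complex) \<le> 1" using m by simp
  qed
  also have "\<dots> = real (card (rough_upto X))" by simp
  also have "\<dots> \<le> real (card {1..X})" by (intro of_nat_mono card_mono) (auto simp: rough_upto_def)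
  also have "\<dots> \<le> exp (L / 2)" unfolding X_def by simp
  finally show ?thesis .
qed

lemma norm_rough_zeta_crude:
  assumes s: "1/4 \<le> Re s" "Re s \<le> 3" "T / 4 \<le> Im s" "Im s \<le> 4 * T"
  shows "norm (rough_zeta s) \<le> exp (3 * L)"
proof -
  have "norm s \<le> \<bar>Re s\<bar> + \<bar>Im s\<bar>" by (rule cmod_le)
  then have n: "1 + norm s \<le> 5 * T" using s T_large by simp
  have "norm (zeta s) \<le> 3 * (1 + norm s)\<^sup>2" using s T_large by (intro norm_zeta_crude) auto
  also have "\<dots> \<le> 3 * (5 * T)\<^sup>2" using n by (intro mult_left_mono power_mono) (auto intro: add_nonneg_nonneg)
  finally have z: "norm (zeta s) \<le> 75 * (T * T)" by (simp add: power2_eq_square)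
  have "norm (euler s) \<le> exp lam" using norm_euler_le[of s] two_power_card_le s unfolding exp_lam by simp
  then have "norm (rough_zeta s) \<le> (75 * (T * T)) * exp lam" unfolding rough_zeta_def norm_mult using z by (intro mult_mono) auto
  also have "\<dots> \<le> (exp (L / 4) * (T * T)) * exp lam"
    using exp_ge_linear[of "L / 4"] L_ge Lpos by (intro mult_right_mono) auto
  also have "\<dots> = exp (L / 4 + (L + L) + lam)" unfolding exp_add T_def ..
  also have "\<dots> \<le> exp (3 * L)" unfolding exp_le_cancel_iff using lam Lpos by linarith
  finally show ?thesis .
qed

lemma integral_line_le_Phi:
  assumes t0: "t0 \<in> {T..2*T}" and y: "\<bar>y - t0\<bar> \<le> 3 * L" and c: "c \<ge> 0"
    and g: "continuous_on {y - 2*L..y + 2*L} g" "\<And>u. u \<in> {y - 2*L..y + 2*L} \<Longrightarrow> g u \<le> c * lineweight u"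
  shows "integral {y - 2*L..y + 2*L} g \<le> c * \<Phi> t0"
proof -
  have cl: "continuous_on {t0 - 5*L..t0 + 5*L} lineweight"
    by (rule continuous_on_subset[OF continuous_lineweight]) (use t0 five_L T_large in auto)
  have sub: "{y - 2*L..y + 2*L} \<subseteq> {t0 - 5*L..t0 + 5*L}" using y by (auto simp: abs_le_iff)
  have "integral {y - 2*L..y + 2*L} g \<le> integral {y - 2*L..y + 2*L} (\<lambda>u. c * lineweight u)"
    using g sub by (intro integral_le integrable_continuous_real continuous_intros continuous_on_subset[OF cl]) auto
  also have "\<dots> = c * integral {y - 2*L..y + 2*L} lineweight" by simp
  also have "\<dots> \<le> c * integral {t0 - 5*L..t0 + 5*L} lineweight"
    using c lineweight_nonneg sub by (intro mult_left_mono integral_subset_le integrable_continuous_real continuous_on_subset[OF cl]) auto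
  also have "integral {t0 - 5*L..t0 + 5*L} lineweight = \<Phi> t0"
    unfolding \<Phi>_def using integral_shift[where f = lineweight and a = "-(5*L)" and b = "5*L" and c = t0] cl by (simp add: o_def add.commute)
  finally show ?thesis .
qed

lemma cbox_Complex: "s \<in> cbox (Complex p q) (Complex r t) \<longleftrightarrow> p \<le> Re s \<and> Re s \<le> r \<and> q \<le> Im s \<and> Im s \<le> t"
  by (auto simp: in_cbox_complex_iff)

lemma inverse_a_le: "1 / a \<le> L"
  using w Lpos by (simp add: a_def divide_le_eq)

lemma square_quotient_le:
  fixes d e r z :: real
  assumes "0 < d" "d \<le> e" "1 / d \<le> r"
  shows "(z * exp 4 / e)\<^sup>2 \<le> z\<^sup>2 * 6561 * r\<^sup>2"
proof -
  have e: "1 / e \<le> r" using assms order_trans[OF divide_left_mono[of d e 1]] by simp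
  have "(z * exp 4 / e)\<^sup>2 = z\<^sup>2 * (exp 4)\<^sup>2 * (1 / e)\<^sup>2" by (simp add: power_mult_distrib power_divide)
  also have "\<dots> \<le> z\<^sup>2 * 6561 * r\<^sup>2" using exp_8_le e assms by (intro mult_mono[OF mult_left_mono] power_mono) auto
  finally show ?thesis .
qed

lemma D_pointwise:
  assumes t0: "t0 \<in> {T..2*T}" "\<Phi> t0 \<le> L ^ 9" and x: "\<bar>x\<bar> \<le> 3 * a" and y: "\<bar>y - t0\<bar> \<le> 3 * L"
  shows "norm (D (Complex (1/2 + x) y)) \<le> L ^ 7"
proof -
  have cD: "continuous_on {y - 2*L..y + 2*L} (\<lambda>u. (norm (D (Complex \<sigma> u)))\<^sup>2)" for \<sigma>
    using cont_line[OF D_holomorphic[of UNIV], of "{y - 2*L..y + 2*L}" \<sigma> 0] by (intro continuous_intros) simp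
  have "(norm (D (Complex (1/2 + x) y)))\<^sup>2 \<le> 3 * ((1 powr (1/2 + 4 * a - (1/2 + x)) * exp 4 / (1/2 + 4 * a - (1/2 + x)))\<^sup>2 * (2 * (2 * L)) * integral {y-2*L..y+2*L} (\<lambda>u. (norm (D (Complex (1/2 + 4 * a) u)))\<^sup>2)
      + (1 powr (1/2 - 4 * a - (1/2 + x)) * exp 4 / (1/2 + x - (1/2 - 4 * a)))\<^sup>2 * (2 * (2 * L)) * integral {y-2*L..y+2*L} (\<lambda>u. (norm (D (Complex (1/2 - 4 * a) u)))\<^sup>2)
      + (4 * exp (L / 2) * 1 powr 2 * exp (4 - (2 * L)\<^sup>2) / (2 * L))\<^sup>2)"
    by (rule cauchy_rectangle_bound[OF D_holomorphic[of UNIV]]) (use x a_bounds Lpos in \<open>auto intro!: norm_D_crude simp: abs_le_iff\<close>)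
  also have "\<dots> \<le> 3 * ((1\<^sup>2 * 6561 * L\<^sup>2) * (2 * (2 * L)) * (1 * \<Phi> t0) + (1\<^sup>2 * 6561 * L\<^sup>2) * (2 * (2 * L)) * (1 * \<Phi> t0) + 1)"
  proof (intro mult_left_mono add_mono mult_mono)
    show "(1 powr (1/2 + 4 * a - (1/2 + x)) * exp 4 / (1/2 + 4 * a - (1/2 + x)))\<^sup>2 \<le> 1\<^sup>2 * 6561 * L\<^sup>2"
      unfolding powr_one_eq_one by (rule square_quotient_le[of a]) (use x a_bounds inverse_a_le in \<open>auto simp: abs_le_iff\<close>)
    show "(1 powr (1/2 - 4 * a - (1/2 + x)) * exp 4 / (1/2 + x - (1/2 - 4 * a)))\<^sup>2 \<le> 1\<^sup>2 * 6561 * L\<^sup>2"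
      unfolding powr_one_eq_one by (rule square_quotient_le[of a]) (use x a_bounds inverse_a_le in \<open>auto simp: abs_le_iff\<close>)
    show "integral {y-2*L..y+2*L} (\<lambda>u. (norm (D (Complex (1/2 + 4 * a) u)))\<^sup>2) \<le> 1 * \<Phi> t0"
      by (rule integral_line_le_Phi[OF t0(1) y _ cD]) (auto simp: lineweight_def)
    show "integral {y-2*L..y+2*L} (\<lambda>u. (norm (D (Complex (1/2 - 4 * a) u)))\<^sup>2) \<le> 1 * \<Phi> t0"
      by (rule integral_line_le_Phi[OF t0(1) y _ cD]) (auto simp: lineweight_def)
    show "(4 * exp (L / 2) * 1 powr 2 * exp (4 - (2 * L)\<^sup>2) / (2 * L))\<^sup>2 \<le> 1"
      by (rule horizontal_negligible) (use Lpos in auto)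
  qed (use Lpos cD in \<open>auto intro!: integral_nonneg integrable_continuous_real\<close>)
  also have "\<dots> = 157464 * L ^ 3 * \<Phi> t0 + 3" by (simp add: power2_eq_square power3_eq_cube)
  also have "\<dots> \<le> 157464 * L ^ 3 * L ^ 9 + 3" using t0(2) Lpos by (intro add_right_mono mult_left_mono) auto
  also have "\<dots> = 157464 * L ^ 12 + 3" by (simp add: power_add[symmetric])
  also have "\<dots> \<le> L ^ 14"
  proof -
    have "1 \<le> L ^ 12" using L_ge by (intro one_le_power) linarith
    moreover have "1000000000000 * L ^ 12 \<le> L ^ 13" "1000000000000 * L ^ 13 \<le> L ^ 14" using L_powers[of 12] L_powers[of 13] by (simp_all add: eval_nat_numeral del: power_Suc)
    ultimately show ?thesis by linarith
  qed
  also have "\<dots> = (L ^ 7)\<^sup>2" by (simp add: power_mult[symmetric])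
  finally show ?thesis by (rule power2_le_imp_le) (use Lpos in simp)
qed

text \<open>
  The remainder in a symmetric approximate functional equation with both sums of length sqrt T. It is small in mean on both lines at distance eta, relative to the size exp (- eta * L) and exp (eta * L) of the natural bounds there.
\<close>
definition "defect s = rough_zeta s - D s - rough_chi s * D (1 - s)"

lemma norm_D_reflect: "norm (D (1 - Complex \<sigma> y)) = norm (D (Complex (1 - \<sigma>) y))"
proof -
  have "1 - Complex \<sigma> y = cnj (Complex (1 - \<sigma>) y)" by (simp add: complex_eq_iff)
  then show ?thesis unfolding D_def by (simp add: rough_sum_cnj)
qed

text \<open>
  On the right line both parts are small by themselves. On the left line the functional equation exchanges the roles of the two sums, and conjugation brings the argument back to the right line.
\<close>
lemma defect_lines:
  assumes y: "T / 4 \<le> y" "y \<le> 4 * T"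
  shows "exp (\<eta> * L) * (norm (defect (Complex (1/2 + \<eta>) y)))\<^sup>2 \<le> 40000000 * lineweight y"
    and "exp (- (\<eta> * L)) * (norm (defect (Complex (1/2 - \<eta>) y)))\<^sup>2 \<le> 40000000 * lineweight y"
proof -
  define R where "R = norm (rough_zeta (Complex (1/2 + \<eta>) y) - D (Complex (1/2 + \<eta>) y))"
  define S where "S = norm (D (Complex (1/2 - \<eta>) y))"
  define E where "E = exp (\<eta> * L)"
  have E: "E > 0" "exp (- (\<eta> * L)) = 1 / E" by (simp_all add: E_def exp_minus inverse_eq_divide)
  have lw: "E * R\<^sup>2 + 1 / E * S\<^sup>2 \<le> lineweight y" unfolding lineweight_def R_def S_def E_def E(2)[unfolded E_def] by simp
  have nn: "0 \<le> R" "0 \<le> S" by (simp_all add: R_def S_def)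
  have sq: "(p + q)\<^sup>2 \<le> 2 * p\<^sup>2 + 2 * q\<^sup>2" for p q :: real
    using sum_squares_bound[of p q] by (simp add: power2_sum)
  have fin: "E * p\<^sup>2 \<le> 40000000 * lineweight y" if p: "0 \<le> p" "p \<le> R + 4000 * (1 / E) * S" for p
  proof -
    have "p\<^sup>2 \<le> (R + 4000 * (1 / E) * S)\<^sup>2" using p by (intro power_mono) auto
    also have "\<dots> \<le> 2 * R\<^sup>2 + 2 * (4000 * (1 / E) * S)\<^sup>2" by (rule sq)
    finally have "E * p\<^sup>2 \<le> E * (2 * R\<^sup>2 + 2 * (4000 * (1 / E) * S)\<^sup>2)" using E by (intro mult_left_mono) auto
    also have "\<dots> = 2 * (E * R\<^sup>2) + 32000000 * (1 / E * S\<^sup>2)" using E by (simp add: field_simps power2_eq_square)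
    also have "\<dots> \<le> 40000000 * (E * R\<^sup>2) + 40000000 * (1 / E * S\<^sup>2)" using E nn by (intro add_mono mult_right_mono) auto
    also have "\<dots> \<le> 40000000 * lineweight y" using lw by (simp only: distrib_left[symmetric] mult_left_mono zero_le_numeral)
    finally show ?thesis .
  qed
  have "norm (defect (Complex (1/2 + \<eta>) y)) \<le> R + norm (rough_chi (Complex (1/2 + \<eta>) y)) * S"
    unfolding defect_def R_def S_def using norm_triangle_ineq4[of "rough_zeta (Complex (1/2 + \<eta>) y) - D (Complex (1/2 + \<eta>) y)" "rough_chi (Complex (1/2 + \<eta>) y) * D (1 - Complex (1/2 + \<eta>) y)"]
    by (simp add: norm_mult norm_D_reflect)
  also have "\<dots> \<le> R + 4000 * (1 / E) * S"
    using norm_rough_chi_le[of \<eta> y] y eta nn E(2) by (intro add_left_mono mult_right_mono) auto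
  finally show "exp (\<eta> * L) * (norm (defect (Complex (1/2 + \<eta>) y)))\<^sup>2 \<le> 40000000 * lineweight y"
    using fin unfolding E_def[symmetric] by simp
  define s where "s = Complex (1/2 - \<eta>) y"
  have rs: "1 - s = cnj (Complex (1/2 + \<eta>) y)" by (simp add: s_def complex_eq_iff)
  have "rough_zeta s = rough_chi s * rough_zeta (1 - s)" using eta by (intro rough_zeta_functional) (auto simp: s_def)
  then have "defect s = rough_chi s * (rough_zeta (1 - s) - D (1 - s)) - D s" unfolding defect_def by (simp add: algebra_simps)
  moreover have "norm (rough_zeta (1 - s) - D (1 - s)) = R"
  proof -
    have "Complex (1/2 + \<eta>) y \<noteq> 1" using y T_large by (auto simp: complex_eq_iff)
    then have "rough_zeta (1 - s) - D (1 - s) = cnj (rough_zeta (Complex (1/2 + \<eta>) y) - D (Complex (1/2 + \<eta>) y))"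
      unfolding rs using eta by (simp add: rough_zeta_cnj D_def rough_sum_cnj)
    then show ?thesis by (simp only: complex_mod_cnj R_def)
  qed
  ultimately have "norm (defect s) \<le> norm (rough_chi s) * R + S"
    using norm_triangle_ineq4[of "rough_chi s * (rough_zeta (1 - s) - D (1 - s))" "D s"] by (simp add: norm_mult S_def s_def)
  also have "\<dots> \<le> 4000 * E * R + S"
    using norm_rough_chi_le[of "-\<eta>" y] y eta nn unfolding s_def E_def by (intro add_right_mono mult_right_mono) auto
  finally have d: "norm (defect s) \<le> 4000 * E * R + S" .
  have "1 / E * (norm (defect s))\<^sup>2 \<le> 1 / E * (2 * (4000 * E * R)\<^sup>2 + 2 * S\<^sup>2)"
    using E power_mono[OF d, of 2] sq[of "4000 * E * R" S] by (intro mult_left_mono) auto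
  also have "\<dots> = 32000000 * (E * R\<^sup>2) + 2 * (1 / E * S\<^sup>2)" using E by (simp add: field_simps power2_eq_square)
  also have "\<dots> \<le> 40000000 * (E * R\<^sup>2) + 40000000 * (1 / E * S\<^sup>2)" using E nn by (intro add_mono mult_right_mono) auto
  also have "\<dots> \<le> 40000000 * lineweight y" using lw by (simp only: distrib_left[symmetric] mult_left_mono zero_le_numeral)
  finally show "exp (- (\<eta> * L)) * (norm (defect (Complex (1/2 - \<eta>) y)))\<^sup>2 \<le> 40000000 * lineweight y"
    unfolding s_def E(2) .
qed

lemma defect_holomorphic: "defect holomorphic_on {s. Re s < 1}"
proof -
  have z: "rough_zeta holomorphic_on {s. Re s < 1}" by (rule holomorphic_on_subset[OF rough_zeta_holomorphic]) auto
  have "(D \<circ> (\<lambda>s. 1 - s)) holomorphic_on {s. Re s < 1}"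
    by (rule holomorphic_on_compose_gen[OF _ D_holomorphic[of UNIV]]) (auto intro!: holomorphic_intros)
  then have "(\<lambda>s. D (1 - s)) holomorphic_on {s. Re s < 1}" by (simp add: o_def)
  with z show ?thesis unfolding defect_def[abs_def] by (intro holomorphic_intros rough_chi_holomorphic D_holomorphic)
qed

lemma norm_defect_crude:
  assumes x: "\<bar>x\<bar> \<le> \<eta>" and y: "T / 4 \<le> y" "y \<le> 4 * T"
  shows "norm (defect (Complex (1/2 + x) y)) \<le> exp (4 * L)"
proof -
  have x4: "\<bar>x\<bar> \<le> 1/4" using x eta by linarith
  define s where "s = Complex (1/2 + x) y"
  have z: "norm (rough_zeta s) \<le> exp (3 * L)" using x4 y by (intro norm_rough_zeta_crude) (auto simp: s_def abs_le_iff)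
  have d: "norm (D s) \<le> exp (L / 2)" "norm (D (1 - s)) \<le> exp (L / 2)" using x4 by (intro norm_D_crude; simp add: s_def abs_le_iff)+
  have "- x * L \<le> \<eta> * L" using x Lpos by (intro mult_right_mono) (auto simp: abs_le_iff)
  then have "exp (- x * L) \<le> exp (L / 4)" using eta by simp
  then have "norm (rough_chi s) \<le> 4000 * exp (L / 4)" using norm_rough_chi_le[OF x y] unfolding s_def by linarith
  also have "\<dots> \<le> exp (L / 4) * exp (L / 4)" using exp_ge_linear[of "L / 4"] L_ge Lpos by (intro mult_right_mono) auto
  also have "\<dots> = exp (L / 2)" unfolding exp_add[symmetric] by simp
  finally have c: "norm (rough_chi s) \<le> exp (L / 2)" .
  have "norm (rough_chi s * D (1 - s)) \<le> exp (L / 2) * exp (L / 2)" unfolding norm_mult using c d by (intro mult_mono) auto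
  then have c': "norm (rough_chi s * D (1 - s)) \<le> exp L" unfolding exp_add[symmetric] by simp
  have "norm (defect s) \<le> norm (rough_zeta s) + norm (D s) + norm (rough_chi s * D (1 - s))"
    unfolding defect_def using norm_triangle_ineq4[of "rough_zeta s - D s" "rough_chi s * D (1 - s)"] norm_triangle_ineq4[of "rough_zeta s" "D s"] by linarith
  also have "\<dots> \<le> exp (3 * L) + exp (L / 2) + exp L" using z d c' by linarith
  also have "\<dots> \<le> 3 * exp (3 * L)" using Lpos exp_le_cancel_iff[of "L/2" "3*L"] exp_le_cancel_iff[of L "3*L"] by linarith
  also have "\<dots> \<le> exp L * exp (3 * L)" using exp_ge_linear[of L] L_ge Lpos by (intro mult_right_mono) auto
  also have "\<dots> = exp (4 * L)" unfolding exp_add[symmetric] by simp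
  finally show ?thesis unfolding s_def .
qed

end

context resonance begin

lemma L_ge_1: "1 \<le> L ^ k" using L_ge by (intro one_le_power) linarith

text \<open>
  Cauchy's formula with Z = sqrt T interpolates the defect between the two lines: the unequal sizes on the lines are exactly compensated by the power of Z, up to exp (3 * w).
\<close>
lemma near_bound:
  assumes t0: "t0 \<in> {T..2*T}" "\<Phi> t0 \<le> L ^ 9" and x: "\<bar>x\<bar> \<le> 3 * a" and y: "\<bar>y - t0\<bar> \<le> 3 * L"
  shows "norm (rough_zeta (Complex (1/2 + x) y)) \<le> L ^ 11"
proof -
  define Z where "Z = exp (L / 2)"
  have x2: "\<bar>x\<bar> \<le> \<eta> / 2" "\<bar>x\<bar> < \<eta>" using x a_bounds eta by linarith+
  have yr: "T / 4 \<le> u \<and> u \<le> 4 * T" if "u \<in> {y - 2*L..y + 2*L}" for u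
    using that y t0(1) five_L T_large by (auto simp: abs_le_iff)
  define I where "I \<sigma> = integral {y - 2*L..y + 2*L} (\<lambda>u. (norm (defect (Complex \<sigma> u)))\<^sup>2)" for \<sigma>
  have cd: "continuous_on {y - 2*L..y + 2*L} (\<lambda>u. (norm (defect (Complex \<sigma> u)))\<^sup>2)" if "\<sigma> < 1" for \<sigma>
    using cont_line[OF defect_holomorphic, of "{y - 2*L..y + 2*L}" \<sigma> 0] that by (intro continuous_intros) simp
  have I0: "I \<sigma> \<ge> 0" if "\<sigma> < 1" for \<sigma> unfolding I_def by (intro integral_nonneg integrable_continuous_real cd that) auto
  have IR: "exp (\<eta> * L) * I (1/2 + \<eta>) \<le> 40000000 * \<Phi> t0"
  proof -
    have "exp (\<eta> * L) * I (1/2 + \<eta>) = integral {y - 2*L..y + 2*L} (\<lambda>u. exp (\<eta> * L) * (norm (defect (Complex (1/2 + \<eta>) u)))\<^sup>2)" unfolding I_def by simp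
    also have "\<dots> \<le> 40000000 * \<Phi> t0"
      using yr defect_lines(1) eta by (intro integral_line_le_Phi[OF t0(1) y] continuous_intros cd) auto
    finally show ?thesis .
  qed
  have IL: "exp (- (\<eta> * L)) * I (1/2 - \<eta>) \<le> 40000000 * \<Phi> t0"
  proof -
    have "exp (- (\<eta> * L)) * I (1/2 - \<eta>) = integral {y - 2*L..y + 2*L} (\<lambda>u. exp (- (\<eta> * L)) * (norm (defect (Complex (1/2 - \<eta>) u)))\<^sup>2)" unfolding I_def by simp
    also have "\<dots> \<le> 40000000 * \<Phi> t0"
      using yr defect_lines(2) eta by (intro integral_line_le_Phi[OF t0(1) y] continuous_intros cd) auto
    finally show ?thesis .
  qed
  have ex: "exp (r * L) \<le> L ^ 3" if "\<bar>r\<bar> = \<bar>x\<bar>" for r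
  proof -
    have "r * L \<le> 3 * a * L" using that x Lpos by (intro mult_right_mono) (auto simp: abs_le_iff)
    then show ?thesis using exp_aL(2) order_trans[of "exp (r * L)" "exp (3 * a * L)"] by simp
  qed
  have qt: "(Z powr q * exp 4 / e)\<^sup>2 \<le> exp (2 * q * (L / 2)) * 6561 * L" if e: "\<eta> / 2 \<le> e" for q e
  proof -
    have "(Z powr q * exp 4 / e)\<^sup>2 \<le> (Z powr q)\<^sup>2 * 6561 * (2 * lam)\<^sup>2"
      using e eta by (intro square_quotient_le[of "\<eta> / 2"]) (auto simp: \<eta>_def)
    also have "(Z powr q)\<^sup>2 = exp (2 * q * (L / 2))" by (simp add: Z_def powr_def power2_eq_square exp_add[symmetric])
    also have "exp (2 * q * (L / 2)) * 6561 * (2 * lam)\<^sup>2 \<le> exp (2 * q * (L / 2)) * 6561 * L"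
      using lam(2) Lpos by (intro mult_left_mono) (auto simp: power_mult_distrib)
    finally show ?thesis .
  qed
  have R: "(Z powr (1/2 + \<eta> - (1/2 + x)) * exp 4 / (1/2 + \<eta> - (1/2 + x)))\<^sup>2 \<le> exp (\<eta> * L) * (6561 * L ^ 4)"
  proof -
    have "exp (2 * (1/2 + \<eta> - (1/2 + x)) * (L / 2)) = exp (\<eta> * L) * exp (- x * L)" unfolding exp_add[symmetric] by (rule arg_cong[of _ _ exp]) (simp add: algebra_simps)
    also have "\<dots> \<le> exp (\<eta> * L) * L ^ 3" using ex[of "-x"] by (intro mult_left_mono) auto
    finally have "exp (2 * (1/2 + \<eta> - (1/2 + x)) * (L / 2)) * 6561 * L \<le> exp (\<eta> * L) * L ^ 3 * 6561 * L" using Lpos by (intro mult_right_mono) auto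
    also have "\<dots> = exp (\<eta> * L) * (6561 * L ^ 4)" by (simp add: eval_nat_numeral)
    finally have B: "exp (2 * (1/2 + \<eta> - (1/2 + x)) * (L / 2)) * 6561 * L \<le> exp (\<eta> * L) * (6561 * L ^ 4)" .
    have "\<eta> / 2 \<le> 1/2 + \<eta> - (1/2 + x)" using x2 by linarith
    from order_trans[OF qt[OF this] B] show ?thesis .
  qed
  have Lf: "(Z powr (1/2 - \<eta> - (1/2 + x)) * exp 4 / (1/2 + x - (1/2 - \<eta>)))\<^sup>2 \<le> exp (- (\<eta> * L)) * (6561 * L ^ 4)"
  proof -
    have "exp (2 * (1/2 - \<eta> - (1/2 + x)) * (L / 2)) = exp (- (\<eta> * L)) * exp (- x * L)" unfolding exp_add[symmetric] by (rule arg_cong[of _ _ exp]) (simp add: algebra_simps)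
    also have "\<dots> \<le> exp (- (\<eta> * L)) * L ^ 3" using ex[of "-x"] by (intro mult_left_mono) auto
    finally have "exp (2 * (1/2 - \<eta> - (1/2 + x)) * (L / 2)) * 6561 * L \<le> exp (- (\<eta> * L)) * L ^ 3 * 6561 * L" using Lpos by (intro mult_right_mono) auto
    also have "\<dots> = exp (- (\<eta> * L)) * (6561 * L ^ 4)" by (simp add: eval_nat_numeral)
    finally have B: "exp (2 * (1/2 - \<eta> - (1/2 + x)) * (L / 2)) * 6561 * L \<le> exp (- (\<eta> * L)) * (6561 * L ^ 4)" .
    have "\<eta> / 2 \<le> 1/2 + x - (1/2 - \<eta>)" using x2 by linarith
    from order_trans[OF qt[OF this] B] show ?thesis .
  qed
  have "(norm (defect (Complex (1/2 + x) y)))\<^sup>2 \<le> 3 * ((Z powr (1/2 + \<eta> - (1/2 + x)) * exp 4 / (1/2 + \<eta> - (1/2 + x)))\<^sup>2 * (2 * (2 * L)) * I (1/2 + \<eta>)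
      + (Z powr (1/2 - \<eta> - (1/2 + x)) * exp 4 / (1/2 + x - (1/2 - \<eta>)))\<^sup>2 * (2 * (2 * L)) * I (1/2 - \<eta>)
      + (4 * exp (4 * L) * Z powr 2 * exp (4 - (2 * L)\<^sup>2) / (2 * L))\<^sup>2)"
    unfolding I_def
  proof (rule cauchy_rectangle_bound[OF defect_holomorphic])
    show "cbox (Complex (1/2 - \<eta>) (y - 2 * L)) (Complex (1/2 + \<eta>) (y + 2 * L)) \<subseteq> {s. Re s < 1}" using eta by (auto simp: cbox_Complex)
    fix x' assume "1/2 - \<eta> \<le> x'" "x' \<le> 1/2 + \<eta>"
    then have x': "\<bar>x' - 1/2\<bar> \<le> \<eta>" by (auto simp: abs_le_iff)
    show "norm (defect (Complex x' (y - 2 * L))) \<le> exp (4 * L) \<and> norm (defect (Complex x' (y + 2 * L))) \<le> exp (4 * L)"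
      using norm_defect_crude[OF x', of "y - 2 * L"] norm_defect_crude[OF x', of "y + 2 * L"] yr[of "y - 2 * L"] yr[of "y + 2 * L"] Lpos by simp
  qed (use x2 eta Lpos in \<open>auto simp: Z_def\<close>)
  also have "\<dots> \<le> 3 * ((exp (\<eta> * L) * (6561 * L ^ 4)) * (2 * (2 * L)) * I (1/2 + \<eta>) + (exp (- (\<eta> * L)) * (6561 * L ^ 4)) * (2 * (2 * L)) * I (1/2 - \<eta>) + 1)"
  proof (intro mult_left_mono add_mono mult_right_mono R Lf I0)
    show "(4 * exp (4 * L) * Z powr 2 * exp (4 - (2 * L)\<^sup>2) / (2 * L))\<^sup>2 \<le> 1"
      by (rule horizontal_negligible) (auto simp: Z_def powr_def)
  qed (use eta Lpos in auto)
  also have "\<dots> = 3 * (26244 * L ^ 5 * (exp (\<eta> * L) * I (1/2 + \<eta>)) + 26244 * L ^ 5 * (exp (- (\<eta> * L)) * I (1/2 - \<eta>)) + 1)"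
    by (simp add: eval_nat_numeral)
  also have "\<dots> \<le> 3 * (26244 * L ^ 5 * (40000000 * L ^ 9) + 26244 * L ^ 5 * (40000000 * L ^ 9) + 1)"
    using IR IL t0(2) Lpos by (intro mult_left_mono add_mono) auto
  also have "\<dots> = 6298560000000 * L ^ 14 + 3" by (simp add: power_add[symmetric])
  also have "\<dots> \<le> L ^ 16"
    using L_ge_1[of 14] L_powers[of 14] L_powers[of 15] by (simp add: eval_nat_numeral del: power_Suc)
  also have "\<dots> = (L ^ 8)\<^sup>2" by (simp add: power_mult[symmetric])
  finally have d: "norm (defect (Complex (1/2 + x) y)) \<le> L ^ 8" by (rule power2_le_imp_le) (use Lpos in simp)
  define s where "s = Complex (1/2 + x) y"
  have D1: "norm (D s) \<le> L ^ 7" unfolding s_def by (rule D_pointwise[OF t0 x y])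
  have D2: "norm (D (1 - s)) \<le> L ^ 7" unfolding s_def norm_D_reflect using D_pointwise[OF t0 _ y, of "-x"] x by simp
  have "norm (rough_chi s) \<le> 4000 * exp (- x * L)" unfolding s_def using x2 yr[of y] Lpos by (intro norm_rough_chi_le) auto
  also have "\<dots> \<le> 4000 * L ^ 3" using ex[of "-x"] by simp
  finally have "norm (rough_chi s * D (1 - s)) \<le> 4000 * L ^ 3 * L ^ 7" unfolding norm_mult using D2 Lpos by (intro mult_mono) auto
  also have "4000 * L ^ 3 * L ^ 7 = 4000 * L ^ 10" by (simp add: eval_nat_numeral)
  finally have c: "norm (rough_chi s * D (1 - s)) \<le> 4000 * L ^ 10" .
  have "rough_zeta s = defect s + D s + rough_chi s * D (1 - s)" by (simp add: defect_def)
  then have "norm (rough_zeta s) \<le> norm (defect s) + norm (D s) + norm (rough_chi s * D (1 - s))"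
    using norm_triangle_ineq[of "defect s + D s" "rough_chi s * D (1 - s)"] norm_triangle_ineq[of "defect s" "D s"] by simp
  also have "\<dots> \<le> L ^ 8 + L ^ 7 + 4000 * L ^ 10" using d D1 c unfolding s_def by linarith
  also have "\<dots> \<le> L ^ 11" using L_powers[of 7] L_powers[of 8] L_powers[of 9] L_powers[of 10] by (simp add: eval_nat_numeral del: power_Suc)
  finally show ?thesis unfolding s_def .
qed

text \<open>
  Cauchy's formula between a line just left of the window, where the function is bounded by the previous lemma, and the line of real part 2.2, where the Dirichlet series converges absolutely.
\<close>
lemma wide_bound:
  assumes t0: "t0 \<in> {T..2*T}" "\<Phi> t0 \<le> L ^ 9" and s: "Re s \<ge> 1/2 - 2 * a" "\<bar>Im s - t0\<bar> \<le> L"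
  shows "norm (rough_zeta s) \<le> L ^ 14"
proof (cases "Re s \<ge> 2")
  case True
  then have "norm (rough_zeta s) \<le> 4" by (rule norm_rough_zeta_2)
  also have "\<dots> \<le> L ^ 14" using L_powers[of 13] L_ge_1[of 13] by (simp add: eval_nat_numeral del: power_Suc)
  finally show ?thesis .
next
  case False
  define \<sigma> y where "\<sigma> = Re s" and "y = Im s"
  have sig: "1/2 - 2 * a \<le> \<sigma>" "\<sigma> < 2" using False s by (auto simp: \<sigma>_def)
  have y: "\<bar>y - t0\<bar> \<le> L" using s by (simp add: y_def)
  define I where "I \<tau> = integral {y - 2*L..y + 2*L} (\<lambda>u. (norm (rough_zeta (Complex \<tau> u)))\<^sup>2)" for \<tau>
  have yr: "T / 4 \<le> u \<and> u \<le> 4 * T \<and> 0 < u" if "u \<in> {y - 2*L..y + 2*L}" for u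
    using that y t0(1) five_L T_large by (auto simp: abs_le_iff)
  have Ib: "0 \<le> I \<tau> \<and> I \<tau> \<le> 4 * L * c\<^sup>2" if c: "\<And>u. u \<in> {y - 2*L..y + 2*L} \<Longrightarrow> norm (rough_zeta (Complex \<tau> u)) \<le> c" for \<tau> c
  proof -
    have "continuous_on {y - 2*L..y + 2*L} (\<lambda>u. rough_zeta (Complex \<tau> (u + 0)))"
    proof (rule cont_line[OF rough_zeta_holomorphic])
      fix t assume "t \<in> {y - 2*L..y + 2*L}"
      then show "Complex \<tau> (t + 0) \<in> - {1}" using yr[of t] by (auto simp: complex_eq_iff)
    qed
    then have "continuous_on {y - 2*L..y + 2*L} (\<lambda>u. (norm (rough_zeta (Complex \<tau> u)))\<^sup>2)" by (intro continuous_intros) simp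
    then have int: "(\<lambda>u. (norm (rough_zeta (Complex \<tau> u)))\<^sup>2) integrable_on {y - 2*L..y + 2*L}" by (rule integrable_continuous_real)
    have "I \<tau> \<le> integral {y - 2*L..y + 2*L} (\<lambda>u. c\<^sup>2)" unfolding I_def using c by (intro integral_le int power_mono) auto
    also have "\<dots> = 4 * L * c\<^sup>2" using Lpos by simp
    finally show ?thesis unfolding I_def using int by (auto intro!: integral_nonneg)
  qed
  have IR: "0 \<le> I 2.2 \<and> I 2.2 \<le> 4 * L * 4\<^sup>2" by (rule Ib, rule norm_rough_zeta_2) simp
  have IL: "0 \<le> I (1/2 - 3 * a) \<and> I (1/2 - 3 * a) \<le> 4 * L * (L ^ 11)\<^sup>2"
    using near_bound[OF t0, of "- 3 * a"] a_bounds y by (intro Ib) (auto simp: abs_le_iff)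
  have "(norm (rough_zeta (Complex \<sigma> y)))\<^sup>2 \<le> 3 * ((1 powr (2.2 - \<sigma>) * exp 4 / (2.2 - \<sigma>))\<^sup>2 * (2 * (2 * L)) * I 2.2
      + (1 powr (1/2 - 3 * a - \<sigma>) * exp 4 / (\<sigma> - (1/2 - 3 * a)))\<^sup>2 * (2 * (2 * L)) * I (1/2 - 3 * a)
      + (4 * exp (3 * L) * 1 powr 2 * exp (4 - (2 * L)\<^sup>2) / (2 * L))\<^sup>2)"
    unfolding I_def
  proof (rule cauchy_rectangle_bound[OF rough_zeta_holomorphic])
    show "cbox (Complex (1/2 - 3 * a) (y - 2 * L)) (Complex 2.2 (y + 2 * L)) \<subseteq> - {1}"
      using yr by (force simp: cbox_Complex)
    fix x' assume "1/2 - 3 * a \<le> x'" "x' \<le> 2.2"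
    then show "norm (rough_zeta (Complex x' (y - 2 * L))) \<le> exp (3 * L) \<and> norm (rough_zeta (Complex x' (y + 2 * L))) \<le> exp (3 * L)"
      using a_bounds Lpos yr[of "y - 2 * L"] yr[of "y + 2 * L"] by (intro conjI norm_rough_zeta_crude) auto
  qed (use sig a_bounds Lpos in auto)
  also have "\<dots> \<le> 3 * ((1\<^sup>2 * 6561 * 5\<^sup>2) * (2 * (2 * L)) * (4 * L * 4\<^sup>2) + (1\<^sup>2 * 6561 * L\<^sup>2) * (2 * (2 * L)) * (4 * L * (L ^ 11)\<^sup>2) + 1)"
  proof (intro mult_left_mono add_mono mult_mono)
    show "(1 powr (2.2 - \<sigma>) * exp 4 / (2.2 - \<sigma>))\<^sup>2 \<le> 1\<^sup>2 * 6561 * 5\<^sup>2"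
      unfolding powr_one_eq_one by (rule square_quotient_le[of "1/5"]) (use sig in auto)
    show "(1 powr (1/2 - 3 * a - \<sigma>) * exp 4 / (\<sigma> - (1/2 - 3 * a)))\<^sup>2 \<le> 1\<^sup>2 * 6561 * L\<^sup>2"
      unfolding powr_one_eq_one by (rule square_quotient_le[of a]) (use sig a_bounds inverse_a_le in auto)
    show "(4 * exp (3 * L) * 1 powr 2 * exp (4 - (2 * L)\<^sup>2) / (2 * L))\<^sup>2 \<le> 1"
      by (rule horizontal_negligible) (use Lpos in auto)
  qed (use Lpos IR IL in auto)
  also have "\<dots> = 125971200 * L ^ 2 + 314928 * L ^ 26 + 3" by (simp add: eval_nat_numeral)
  also have "\<dots> \<le> L ^ 28"
  proof -
    have "L ^ 2 \<le> L ^ 26" using L_ge by (intro power_increasing) auto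
    then show ?thesis using L_ge_1[of 26] L_powers[of 26] L_powers[of 27] by (simp add: eval_nat_numeral del: power_Suc)
  qed
  also have "\<dots> = (L ^ 14)\<^sup>2" by (simp add: power_mult[symmetric])
  finally have "norm (rough_zeta (Complex \<sigma> y)) \<le> L ^ 14" by (rule power2_le_imp_le) (use Lpos in simp)
  then show ?thesis by (simp add: \<sigma>_def y_def)
qed

text \<open>
  The logarithm of |1 - z| is - Re z up to a multiple of the square of |z|. The squares sum to a bounded amount because the reciprocals of the primes do, and the shift x changes the real parts by at most 2 a times the sum of the ln p in total.
\<close>
lemma ln_norm_euler:
  assumes p100: "\<And>p. p \<in> PP \<Longrightarrow> 100 \<le> p" and sum1: "(\<Sum>p\<in>PP. 1 / real p) \<le> 1" and x: "\<bar>x\<bar> \<le> a"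
  shows "\<bar>ln (norm (euler (Complex (1/2 + x) t))) + V t\<bar> \<le> 13"
proof -
  have fac: "\<bar>ln (norm (1 - of_nat p powr (- Complex (1/2 + x) t) :: complex)) + real p powr (-1/2) * cos (t * ln (real p))\<bar>
      \<le> 12 * (1 / real p) + 2 * a * ln (real p) \<and> norm (1 - of_nat p powr (- Complex (1/2 + x) t) :: complex) \<noteq> 0" if p: "p \<in> PP" for p
  proof -
    define z where "z = (of_nat p powr (- Complex (1/2 + x) t) :: complex)"
    define r where "r = real p powr (-1/2)"
    define u where "u = - x * ln (real p)"
    have p0: "real p > 0" "ln (real p) \<ge> 0" "real p \<ge> 100" using p100[OF p] by auto
    have "ln (real p) \<le> lam"
    proof -
      have "real p \<le> exp lam" unfolding exp_lam of_nat_le_iff using prod_le[of "{p}"] p by simp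
      then have "ln (real p) \<le> ln (exp lam)" using p0 by (intro ln_mono) auto
      then show ?thesis by simp
    qed
    then have "a * ln (real p) \<le> \<eta> / 8 * lam" using a_bounds eta lam p0 by (intro mult_mono) auto
    then have al: "a * ln (real p) \<le> 1/8" using eta by simp
    have ux: "\<bar>u\<bar> \<le> a * ln (real p)" unfolding u_def using x p0 by (simp add: abs_mult mult_right_mono)
    have eu: "exp u \<le> 1 + 2 * \<bar>u\<bar>" "1 - 2 * \<bar>u\<bar> \<le> exp u"
    proof -
      have "exp \<bar>u\<bar> \<le> 1 + \<bar>u\<bar> + \<bar>u\<bar>\<^sup>2" using ux al by (intro exp_bound) auto
      moreover have "\<bar>u\<bar>\<^sup>2 \<le> \<bar>u\<bar>"
        unfolding power2_eq_square using mult_right_mono[of "\<bar>u\<bar>" 1 "\<bar>u\<bar>"] ux al by linarith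
      moreover have "exp u \<le> exp \<bar>u\<bar>" by simp
      ultimately show "exp u \<le> 1 + 2 * \<bar>u\<bar>" by linarith
      show "1 - 2 * \<bar>u\<bar> \<le> exp u" using exp_ge_add_one_self[of u] by linarith
    qed
    have r: "0 \<le> r" "r \<le> 1/10" "r\<^sup>2 = 1 / real p"
    proof -
      have "r \<le> 100 powr (-1/2)" unfolding r_def using p0 by (intro powr_mono2') auto
      also have "(-1/2::real) = - (1/2)" by simp
      also have "(100::real) powr (- (1/2)) = 1 / sqrt 100" by (simp only: powr_minus_divide powr_half_sqrt zero_le_numeral)
      also have "sqrt 100 = (10::real)" by (rule real_sqrt_unique) auto
      finally show "r \<le> 1/10" by simp
      show "r\<^sup>2 = 1 / real p" unfolding r_def using p0 by (simp add: power2_eq_square powr_add[symmetric] powr_minus_divide)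
    qed (simp add: r_def)
    have z: "z = of_real (r * exp u) * cis (- (t * ln (real p)))"
    proof -
      have "- Complex (1/2 + x) t = of_real (-1/2) + (of_real (- x) + \<i> * of_real (- t))" by (simp add: complex_eq_iff)
      then have "z = of_nat p powr of_real (-1/2) * (of_nat p powr of_real (- x) * of_nat p powr (\<i> * of_real (- t)))"
        unfolding z_def by (simp only: powr_add)
      also have "of_nat p powr of_real (-1/2) = (of_real r :: complex)" using powr_of_real[of "real p" "-1/2"] p0 by (simp add: r_def)
      also have "of_nat p powr of_real (- x) = (of_real (exp u) :: complex)" using powr_of_real[of "real p" "-x"] p0 by (simp add: powr_def u_def)
      also have "of_nat p powr (\<i> * of_real (- t)) = cis (- (t * ln (real p)))" using p0 by (simp add: powr_def cis_conv_exp mult_ac)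
      finally show ?thesis by simp
    qed
    have nz: "norm z = r * exp u" "Re z = r * exp u * cos (t * ln (real p))" unfolding z using r by (simp_all add: norm_mult)
    have e54: "exp u \<le> 5/4" using eu ux al by linarith
    have n5: "norm z \<le> 1/5" using mult_mono[OF r(2) e54] r nz by simp
    have nz2: "(norm z)\<^sup>2 \<le> 2 * (1 / real p)"
    proof -
      have "(norm z)\<^sup>2 = 1 / real p * (exp u)\<^sup>2" unfolding nz power_mult_distrib r(3) ..
      also have "\<dots> \<le> 1 / real p * (5/4)\<^sup>2" using e54 by (intro mult_left_mono power_mono) auto
      also have "\<dots> \<le> 1 / real p * 2" by (rule mult_left_mono) (auto simp: power2_eq_square)
      finally show ?thesis by simp
    qed
    define h where "h = (norm z)\<^sup>2 - 2 * Re z"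
    have n1: "(norm (1 - z))\<^sup>2 = 1 + h" unfolding h_def cmod_power2 by (simp add: power2_eq_square algebra_simps)
    have habs: "\<bar>h\<bar> \<le> 11/5 * norm z"
    proof -
      have "(norm z)\<^sup>2 \<le> 1/5 * norm z" unfolding power2_eq_square using n5 by (intro mult_right_mono) auto
      then show ?thesis unfolding h_def using abs_Re_le_cmod[of z] zero_le_power2[of "norm z"] by linarith
    qed
    then have h2: "\<bar>h\<bar> \<le> 1/2" using n5 by linarith
    have "\<bar>h\<bar>\<^sup>2 \<le> (11/5 * norm z)\<^sup>2" using habs by (intro power_mono) auto
    then have "h\<^sup>2 * 25 \<le> 121 * (norm z)\<^sup>2" by (simp add: power_mult_distrib power_divide)
    then have hs: "h\<^sup>2 \<le> 5 * (norm z)\<^sup>2" using zero_le_power2[of "norm z"] by linarith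
    have pos: "norm (1 - z) > 0" 
    proof -
      have "1 + h > 0" using h2 by (simp add: abs_le_iff)
      then have "(norm (1 - z))\<^sup>2 > 0" unfolding n1 .
      then show ?thesis by simp
    qed
    have "ln (1 + h) = 2 * ln (norm (1 - z))" unfolding n1[symmetric] using pos by (simp add: ln_realpow)
    then have "\<bar>2 * ln (norm (1 - z)) - h\<bar> \<le> 2 * h\<^sup>2" using abs_ln_one_plus_x_minus_x_bound[OF h2] by simp
    then have b1: "\<bar>ln (norm (1 - z)) + Re z\<bar> \<le> 6 * (norm z)\<^sup>2" using hs zero_le_power2[of "norm z"] unfolding h_def by linarith
    have "\<bar>Re z - r * cos (t * ln (real p))\<bar> = r * \<bar>exp u - 1\<bar> * \<bar>cos (t * ln (real p))\<bar>"
    proof -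
      have "Re z - r * cos (t * ln (real p)) = r * (exp u - 1) * cos (t * ln (real p))" unfolding nz by (simp add: algebra_simps)
      then show ?thesis using r by (simp add: abs_mult)
    qed
    also have "\<dots> \<le> 1 * (2 * \<bar>u\<bar>) * 1" using r eu by (intro mult_mono) (auto simp: abs_le_iff)
    also have "\<dots> \<le> 2 * a * ln (real p)" using ux by simp
    finally have b2: "\<bar>Re z - r * cos (t * ln (real p))\<bar> \<le> 2 * a * ln (real p)" .
    have "\<bar>ln (norm (1 - z)) + r * cos (t * ln (real p))\<bar> \<le> 12 * (1 / real p) + 2 * a * ln (real p)" using b1 b2 nz2 by linarith
    then show ?thesis using pos unfolding z_def r_def by simp
  qed
  have "ln (norm (euler (Complex (1/2 + x) t))) = (\<Sum>p\<in>PP. ln (norm (1 - of_nat p powr (- Complex (1/2 + x) t) :: complex)))"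
    unfolding euler_def prod_norm[symmetric] using fac finite_PP by (intro ln_prod) (auto simp: zero_less_norm_iff)
  then have "\<bar>ln (norm (euler (Complex (1/2 + x) t))) + V t\<bar> = \<bar>\<Sum>p\<in>PP. ln (norm (1 - of_nat p powr (- Complex (1/2 + x) t) :: complex)) + real p powr (-1/2) * cos (t * ln (real p))\<bar>"
    by (simp add: V_def sum.distrib)
  also have "\<dots> \<le> (\<Sum>p\<in>PP. 12 * (1 / real p) + 2 * a * ln (real p))" using fac by (intro order_trans[OF sum_abs] sum_mono) blast
  also have "\<dots> = 12 * (\<Sum>p\<in>PP. 1 / real p) + 2 * a * (\<Sum>p\<in>PP. ln (real p))" by (simp add: sum.distrib sum_distrib_left)
  also have "(\<Sum>p\<in>PP. ln (real p)) = lam" unfolding lam_def of_nat_prod using PP_pos finite_PP by (intro ln_prod[symmetric]) force+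
  also have "12 * (\<Sum>p\<in>PP. 1 / real p) + 2 * a * lam \<le> 13"
  proof -
    have "a * lam \<le> \<eta> / 8 * lam" using a_bounds lam by (intro mult_right_mono) auto
    then have "a * lam \<le> 1/8" using eta by simp
    then show ?thesis using sum1 by simp
  qed
  finally show ?thesis .
qed

end

context resonance begin

section \<open>Extreme values on a window around the critical line\<close>

lemma norm_zeta_eq:
  assumes "\<bar>x\<bar> \<le> a"
  shows "norm (zeta (Complex (1/2 + x) t)) = norm (rough_zeta (Complex (1/2 + x) t)) / norm (euler (Complex (1/2 + x) t))"
    "norm (euler (Complex (1/2 + x) t)) > 0"
proof -
  have "euler (Complex (1/2 + x) t) \<noteq> 0" using assms a_bounds by (intro euler_nonzero) auto
  then show "norm (euler (Complex (1/2 + x) t)) > 0"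
    "norm (zeta (Complex (1/2 + x) t)) = norm (rough_zeta (Complex (1/2 + x) t)) / norm (euler (Complex (1/2 + x) t))"
    by (simp_all add: rough_zeta_def norm_mult)
qed

text \<open>
  At the biased point the sieved function is at most a power of L, while the finite product by which zeta was multiplied is exponentially large in the sum of the reciprocal roots.
\<close>
lemma small_value:
  assumes ne: "PP \<noteq> {}" and p100: "\<And>p. p \<in> PP \<Longrightarrow> 100 \<le> p" and sum1: "(\<Sum>p\<in>PP. 1 / real p) \<le> 1" and k: "\<kappa> = -1"
  shows "\<exists>t\<in>{T..2*T}. \<forall>x. \<bar>x\<bar> \<le> a \<longrightarrow> norm (zeta (Complex (1/2 + x) t)) \<le> exp (14 * ln L + 13 - \<Sigma> / 8)"
proof -
  obtain t0 where t0: "t0 \<in> {T..2*T}" "\<kappa> * V t0 \<ge> \<Sigma> / 8" "\<Phi> t0 \<le> L ^ 9" using exists_biased_point[OF ne] by blast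
  have "norm (zeta (Complex (1/2 + x) t0)) \<le> exp (14 * ln L + 13 - \<Sigma> / 8)" if x: "\<bar>x\<bar> \<le> a" for x
  proof -
    define m where "m = norm (euler (Complex (1/2 + x) t0))"
    have m: "m > 0" unfolding m_def by (rule norm_zeta_eq[OF x])
    have "norm (rough_zeta (Complex (1/2 + x) t0)) \<le> L ^ 14"
      using x a_bounds Lpos by (intro wide_bound[OF t0(1,3)]) (auto simp: abs_le_iff)
    also have "L ^ 14 = exp (14 * ln L)" using exp_of_nat_mult[of 14 "ln L"] Lpos by simp
    finally have f: "norm (rough_zeta (Complex (1/2 + x) t0)) \<le> exp (14 * ln L)" .
    have "\<bar>ln m + V t0\<bar> \<le> 13" unfolding m_def by (rule ln_norm_euler[OF p100 sum1 x])
    then have "\<Sigma> / 8 - 13 \<le> ln m" using t0(2) k by simp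
    then have "exp (\<Sigma> / 8 - 13) \<le> m" using m by (simp add: ln_ge_iff)
    then have "norm (rough_zeta (Complex (1/2 + x) t0)) / m \<le> exp (14 * ln L) / exp (\<Sigma> / 8 - 13)" using f by (intro frac_le) auto
    also have "\<dots> = exp (14 * ln L + 13 - \<Sigma> / 8)" unfolding exp_diff[symmetric] by (rule arg_cong[of _ _ exp]) simp
    finally show ?thesis unfolding norm_zeta_eq(1)[OF x] m_def .
  qed
  then show ?thesis using t0 by blast
qed

lemma V_shift:
  assumes ell: "\<And>p. p \<in> PP \<Longrightarrow> ln (real p) \<le> ell"
  shows "\<bar>V t - V t0\<bar> \<le> \<bar>t - t0\<bar> * ell * \<Sigma>"
proof -
  have "\<bar>V t - V t0\<bar> \<le> (\<Sum>p\<in>PP. real p powr (-1/2) * (\<bar>t - t0\<bar> * ell))"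
    unfolding V_def sum_subtractf[symmetric] right_diff_distrib[symmetric]
  proof (rule order_trans[OF sum_abs sum_mono])
    fix p assume p: "p \<in> PP"
    have l0: "0 \<le> ln (real p)" using PP_pos[OF p] by simp
    have lip: "\<bar>cos u - cos v\<bar> \<le> \<bar>u - v\<bar>" for u v :: real
    proof -
      have "cos u - cos v = 2 * sin ((u + v) / 2) * sin ((v - u) / 2)" by (rule cos_diff_cos)
      then have "\<bar>cos u - cos v\<bar> = 2 * \<bar>sin ((u + v) / 2)\<bar> * \<bar>sin ((v - u) / 2)\<bar>" by (simp add: abs_mult)
      also have "\<dots> \<le> 2 * 1 * \<bar>(v - u) / 2\<bar>" by (intro mult_mono abs_sin_le_one abs_sin_x_le_abs_x) auto
      finally show ?thesis by simp
    qed
    have "\<bar>cos (t * ln (real p)) - cos (t0 * ln (real p))\<bar> \<le> \<bar>t * ln (real p) - t0 * ln (real p)\<bar>" by (rule lip)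
    also have "\<dots> = \<bar>t - t0\<bar> * ln (real p)" using l0 by (simp add: left_diff_distrib[symmetric] abs_mult)
    also have "\<dots> \<le> \<bar>t - t0\<bar> * ell" using ell[OF p] by (intro mult_left_mono) auto
    finally show "\<bar>real p powr (-1/2) * (cos (t * ln (real p)) - cos (t0 * ln (real p)))\<bar> \<le> real p powr (-1/2) * (\<bar>t - t0\<bar> * ell)"
      by (simp add: abs_mult mult_left_mono)
  qed
  also have "\<dots> = \<bar>t - t0\<bar> * ell * \<Sigma>" unfolding \<Sigma>_def by (simp add: sum_distrib_left mult_ac)
  finally show ?thesis .
qed

text \<open>
  The sieved function cannot be tiny somewhere on each horizontal segment of the window near the biased point: together with its upper bound this would make it smaller than 1/6 at real part 2. On a good segment its size is at least the exponential of - 28 J, and the finite product by which zeta was multiplied is exponentially small there. The height len is so small that V keeps half of its bias.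
\<close>
lemma large_value:
  assumes ne: "PP \<noteq> {}" and p100: "\<And>p. p \<in> PP \<Longrightarrow> 100 \<le> p" and sum1: "(\<Sum>p\<in>PP. 1 / real p) \<le> 1" and k: "\<kappa> = 1"
    and ell: "ell \<ge> 1" "\<And>p. p \<in> PP \<Longrightarrow> ln (real p) \<le> ell"
  shows "\<exists>t\<in>{T..2*T+1}. \<forall>x. \<bar>x\<bar> \<le> a \<longrightarrow> norm (zeta (Complex (1/2 + x) t)) \<ge> exp (\<Sigma> / 16 - 13 - 140000 * ell * ln L)"
proof -
  obtain t0 where t0: "t0 \<in> {T..2*T}" "\<kappa> * V t0 \<ge> \<Sigma> / 8" "\<Phi> t0 \<le> L ^ 9" using exists_biased_point[OF ne] by blast
  define len where "len = 1 / (16 * ell)"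
  \<comment> \<open>The factor 4800 makes len * J / 20 at least 15 ln L, one power of L more than the upper bound.\<close>
  define J where "J = nat \<lceil>4800 * ell * ln L\<rceil>"
  \<comment> \<open>The growth 6 pi J < 24 J of the interpolation and three further factors at most exp J leave exp (- J).\<close>
  define K where "K = 28 * real J"
  have len: "0 < len" "len \<le> 1/2" using ell(1) by (auto simp: len_def divide_le_eq)
  have lnL: "ln L \<ge> 1" using ln_mono[of "exp 1" L] exp_le L_ge by simp
  have el: "1 * 1 \<le> ell * ln L" using ell(1) lnL by (intro mult_mono) auto
  have J: "4800 * ell * ln L \<le> real J" "real J \<le> 4801 * ell * ln L" using el unfolding J_def by linarith+
  have J1: "J \<ge> 1" "real J \<ge> 4800" using J el by linarith+
  have Sp: "\<Sigma> \<ge> 0" unfolding \<Sigma>_def by (intro sum_nonneg) auto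
  have "\<exists>t. t0 \<le> t \<and> t \<le> t0 + len \<and> (\<forall>x. \<bar>x\<bar> \<le> a \<longrightarrow> exp (- K) < norm (rough_zeta (Complex (1/2 + x) t)))"
  proof (rule ccontr)
    assume neg: "\<not> ?thesis"
    have small: "\<exists>\<sigma>. 1/2 - 2*a + a \<le> \<sigma> \<and> \<sigma> \<le> 1/2 - 2*a + 3 * a \<and> norm (rough_zeta (Complex \<sigma> t)) \<le> exp (- K)" if t: "t0 \<le> t" "t \<le> t0 + len" for t
    proof -
      obtain x where "\<bar>x\<bar> \<le> a" "norm (rough_zeta (Complex (1/2 + x) t)) \<le> exp (- K)" using neg t by (auto simp: not_less)
      then show ?thesis by (intro exI[of _ "1/2 + x"]) (auto simp: abs_le_iff)
    qed
    have "norm (rough_zeta (Complex 2 t0)) \<le> 3 * exp (- (len * real J / 20)) * L ^ 14 + 4 * (len * real J / a) * exp (6 * pi * real J) * exp (- K)"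
    proof (rule small_on_segments_imp_small[where \<alpha> = "1/2 - 2 * a", OF _ _ _ len J1(1) _ _ small])
      show "rough_zeta holomorphic_on ball (Complex (1/2 - 2 * a + 1 / a) t0) (1 / a + 1)"
      proof (rule holomorphic_on_subset[OF rough_zeta_holomorphic], clarify)
        assume "1 \<in> ball (Complex (1/2 - 2 * a + 1 / a) t0) (1 / a + 1)"
        then have "norm (Complex (1/2 - 2 * a + 1 / a) t0 - 1) < 1 / a + 1" by (simp add: dist_norm)
        then have "t0 < L + 1" using abs_Im_le_cmod[of "Complex (1/2 - 2 * a + 1 / a) t0 - 1"] inverse_a_le by simp
        then show False using t0(1) five_L T_large Lpos by auto
      qed
      show "norm (rough_zeta s) \<le> L ^ 14" if "1/2 - 2 * a \<le> Re s" "\<bar>Im s - t0\<bar> \<le> 1 / a" for s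
        using that inverse_a_le by (intro wide_bound[OF t0(1,3)]) auto
    qed (use a_bounds in auto)
    also have "3 * exp (- (len * real J / 20)) * L ^ 14 \<le> 1 / 100"
    proof -
      have "len * real J / 20 \<ge> len * (4800 * ell * ln L) / 20" using J len by (intro divide_right_mono mult_left_mono) auto
      also have "len * (4800 * ell * ln L) / 20 = 15 * ln L" using ell(1) by (simp add: len_def)
      finally have "exp (- (len * real J / 20)) \<le> exp (- (15 * ln L))" by simp
      also have "\<dots> = 1 / L ^ 15" using exp_of_nat_mult[of 15 "ln L"] Lpos by (simp add: exp_minus inverse_eq_divide)
      finally have "exp (- (len * real J / 20)) * L ^ 14 \<le> 1 / L ^ 15 * L ^ 14" using Lpos by (intro mult_right_mono) auto
      also have "\<dots> = 1 / L" using Lpos by (simp add: eval_nat_numeral)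
      also have "\<dots> \<le> 1 / 1000" using L_ge Lpos by (intro divide_left_mono) auto
      finally show ?thesis by simp
    qed
    also have "4 * (len * real J / a) * exp (6 * pi * real J) * exp (- K) \<le> 1 / 100"
    proof -
      define E where "E = exp (real J)"
      have E: "real J \<le> E" "1 + real J \<le> E" unfolding E_def using exp_ge_add_one_self[of "real J"] by linarith+
      have "L = exp (ln L)" using Lpos by simp
      also have "\<dots> \<le> E" unfolding E_def using J el lnL mult_mono[of 1 ell "ln L" "ln L"] ell(1) by (subst exp_le_cancel_iff) linarith
      finally have "L \<le> E" .
      have "len * real J / a = len * real J * (1 / a)" by simp
      also have "\<dots> \<le> 1 * E * E" using len E inverse_a_le a_bounds \<open>L \<le> E\<close> J1 by (intro mult_mono) auto
      finally have A: "4 * (len * real J / a) \<le> E * (E * E)" using E J1 len a_bounds by (intro mult_mono) (auto simp: E_def)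
      have "6 * pi * real J \<le> 24 * real J" using pi_less_4 by (intro mult_right_mono) auto
      then have A2: "exp (6 * pi * real J) \<le> exp (24 * real J)" by simp
      have "4 * (len * real J / a) * exp (6 * pi * real J) * exp (- K) \<le> E * (E * E) * exp (24 * real J) * exp (- K)"
        by (rule mult_right_mono[OF mult_mono[OF A A2]]) (auto simp: E_def)
      also have "\<dots> = exp (real J + (real J + real J) + 24 * real J + - K)" unfolding E_def exp_add ..
      also have "\<dots> = exp (- real J)" by (rule arg_cong[of _ _ exp]) (simp add: K_def)
      also have "\<dots> = 1 / E" by (simp add: E_def exp_minus inverse_eq_divide)
      also have "\<dots> \<le> 1 / 100" using E J1 by (intro divide_left_mono) auto
      finally show ?thesis .
    qed
    finally have "norm (rough_zeta (Complex 2 t0)) \<le> 1 / 100 + 1 / 100" by simp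
    moreover have "norm (rough_zeta (Complex 2 t0)) \<ge> 1/6" by (rule norm_rough_zeta_2) simp
    ultimately show False by simp
  qed
  then obtain t where t: "t0 \<le> t" "t \<le> t0 + len" and f: "\<And>x. \<bar>x\<bar> \<le> a \<Longrightarrow> exp (- K) < norm (rough_zeta (Complex (1/2 + x) t))" by blast
  have "\<bar>V t - V t0\<bar> \<le> \<bar>t - t0\<bar> * ell * \<Sigma>" by (rule V_shift[OF ell(2)])
  also have "\<dots> \<le> len * ell * \<Sigma>" using t ell(1) Sp by (intro mult_right_mono) auto
  also have "\<dots> = \<Sigma> / 16" using ell(1) by (simp add: len_def)
  finally have dV: "\<bar>V t - V t0\<bar> \<le> \<Sigma> / 16" .
  have "V t0 \<ge> \<Sigma> / 8" using t0(2) k by simp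
  with dV have V: "V t \<ge> \<Sigma> / 16" by linarith
  have "exp (\<Sigma> / 16 - 13 - 140000 * ell * ln L) \<le> norm (zeta (Complex (1/2 + x) t))" if x: "\<bar>x\<bar> \<le> a" for x
  proof -
    define m where "m = norm (euler (Complex (1/2 + x) t))"
    have m: "m > 0" unfolding m_def by (rule norm_zeta_eq[OF x])
    have "\<bar>ln m + V t\<bar> \<le> 13" unfolding m_def by (rule ln_norm_euler[OF p100 sum1 x])
    then have "ln m \<le> 13 - \<Sigma> / 16" using V by (simp add: abs_le_iff)
    then have "m \<le> exp (13 - \<Sigma> / 16)" using m by (metis exp_le_cancel_iff exp_ln)
    then have "exp (- K) / exp (13 - \<Sigma> / 16) \<le> norm (rough_zeta (Complex (1/2 + x) t)) / m" using f[OF x] m by (intro frac_le) auto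
    moreover have "exp (\<Sigma> / 16 - 13 - 140000 * ell * ln L) \<le> exp (- K - (13 - \<Sigma> / 16))" using J(2) el by (simp add: K_def)
    ultimately show ?thesis unfolding norm_zeta_eq(1)[OF x] m_def exp_diff by linarith
  qed
  moreover have "t \<in> {T..2*T+1}" using t t0(1) len by auto
  ultimately show ?thesis by blast
qed

end

section \<open>The choice of the parameters\<close>

text \<open>
  With L the exponential of a small power of y, the scale L exceeds every power of y, whereas ln L is negligible against the fourth root of y, which is the order of the bias.
\<close>
lemma eventually_parameters:
  fixes w B :: real
  shows "eventually (\<lambda>y::real. 100 \<le> y \<and> 100 * (y * ln (2 * y))\<^sup>2 \<le> exp (y powr (1/16)) \<and> 8 * (y * ln (2 * y)) * w \<le> exp (y powr (1/16))
     \<and> 1000000000000 \<le> exp (y powr (1/16)) \<and> exp w \<le> exp (y powr (1/16)) \<and> B \<le> exp (y powr (1/16))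
     \<and> B \<le> y powr (3/4) * (2 * y) powr (-1/2) / 8 - 13 - 14 * y powr (1/16)
     \<and> B \<le> y powr (3/4) * (2 * y) powr (-1/2) / 16 - 13 - 140000 * ln (2 * y) * y powr (1/16)) at_top"
proof (intro eventually_conj)
  show "\<forall>\<^sub>F y::real in at_top. 100 \<le> y" by (rule eventually_ge_at_top)
  show "\<forall>\<^sub>F y::real in at_top. 100 * (y * ln (2 * y))\<^sup>2 \<le> exp (y powr (1/16))" by real_asymp
  have e: "filterlim (\<lambda>y::real. exp (y powr (1/16))) at_top at_top" by real_asymp
  have "filterlim (\<lambda>y::real. exp (y powr (1/16)) / (8 * (y * ln (2 * y)))) at_top at_top" by real_asymp
  then have "\<forall>\<^sub>F y::real in at_top. w \<le> exp (y powr (1/16)) / (8 * (y * ln (2 * y)))" by (simp add: filterlim_at_top)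
  moreover have "\<forall>\<^sub>F y::real in at_top. y \<ge> 1" by (rule eventually_ge_at_top)
  ultimately show "\<forall>\<^sub>F y::real in at_top. 8 * (y * ln (2 * y)) * w \<le> exp (y powr (1/16))"
  proof eventually_elim
    case (elim y)
    then have "8 * (y * ln (2 * y)) > 0" by (intro mult_pos_pos ln_gt_zero) auto
    with elim(1) show ?case by (simp add: le_divide_eq mult.commute)
  qed
  show "\<forall>\<^sub>F y::real in at_top. 1000000000000 \<le> exp (y powr (1/16))" "\<forall>\<^sub>F y::real in at_top. exp w \<le> exp (y powr (1/16))"
    "\<forall>\<^sub>F y::real in at_top. B \<le> exp (y powr (1/16))"
    using e unfolding filterlim_at_top by blast+
  have "filterlim (\<lambda>y::real. y powr (3/4) * (2 * y) powr (-1/2) / 8 - 13 - 14 * y powr (1/16)) at_top at_top" by real_asymp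
  then show "\<forall>\<^sub>F y::real in at_top. B \<le> y powr (3/4) * (2 * y) powr (-1/2) / 8 - 13 - 14 * y powr (1/16)" unfolding filterlim_at_top by blast
  have "filterlim (\<lambda>y::real. y powr (3/4) * (2 * y) powr (-1/2) / 16 - 13 - 140000 * ln (2 * y) * y powr (1/16)) at_top at_top" by real_asymp
  then show "\<forall>\<^sub>F y::real in at_top. B \<le> y powr (3/4) * (2 * y) powr (-1/2) / 16 - 13 - 140000 * ln (2 * y) * y powr (1/16)" unfolding filterlim_at_top by blast
qed

text \<open>
  All primes of a dyadic block with many primes form the set PP. Its at most Y elements above Y have reciprocals summing to at most 1, and at least the 3/4-th power of Y many of them give a bias of order the fourth root of Y.
\<close>
lemma extreme_values:
  fixes w B :: real
  assumes w: "w \<ge> 1"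
  shows "\<exists>L t. B \<le> L \<and> 1 \<le> L \<and> exp L \<le> t \<and> (\<forall>x. \<bar>x\<bar> \<le> w / L \<longrightarrow> norm (zeta (Complex (1/2 + x) t)) \<le> exp (- B))"
    and "\<exists>L t. B \<le> L \<and> 1 \<le> L \<and> exp L \<le> t \<and> (\<forall>x. \<bar>x\<bar> \<le> w / L \<longrightarrow> norm (zeta (Complex (1/2 + x) t)) \<ge> exp B)"
proof -
  obtain y0 where y0: "\<And>y. y \<ge> y0 \<Longrightarrow> 100 \<le> y \<and> 100 * (y * ln (2 * y))\<^sup>2 \<le> exp (y powr (1/16)) \<and> 8 * (y * ln (2 * y)) * w \<le> exp (y powr (1/16))
     \<and> 1000000000000 \<le> exp (y powr (1/16)) \<and> exp w \<le> exp (y powr (1/16)) \<and> B \<le> exp (y powr (1/16))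
     \<and> B \<le> y powr (3/4) * (2 * y) powr (-1/2) / 8 - 13 - 14 * y powr (1/16)
     \<and> B \<le> y powr (3/4) * (2 * y) powr (-1/2) / 16 - 13 - 140000 * ln (2 * y) * y powr (1/16)"
    using eventually_parameters[where w = w and B = B] unfolding eventually_at_top_linorder by blast
  obtain k0 :: nat where k0: "y0 < 2 ^ k0" using real_arch_pow[of 2 y0] by auto
  obtain k where k: "k \<ge> k0" "real (card {p. prime p \<and> 2 ^ k < p \<and> p \<le> (2::nat) ^ (k + 1)}) \<ge> (2 ^ k) powr (3/4)"
    using many_primes_in_dyadic_block by blast
  define Y where "Y = (2::nat) ^ k"
  define y where "y = real Y"
  define PP where "PP = {p. prime p \<and> Y < p \<and> p \<le> 2 * Y}"
  define L where "L = exp (y powr (1/16))"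
  define ell where "ell = ln (2 * y)"
  have "(2::real) ^ k0 \<le> 2 ^ k" using k(1) by (intro power_increasing) auto
  with k0 have "y0 \<le> 2 ^ k" by linarith
  then have "y \<ge> y0" by (simp add: y_def Y_def)
  note par = y0[OF this, folded L_def]
  have n: "real (card PP) \<ge> y powr (3/4)" using k(2) by (simp add: PP_def Y_def y_def)
  have fin: "finite PP" unfolding PP_def by (rule finite_subset[of _ "{..2*Y}"]) auto
  have pr: "real p > y" "real p \<le> 2 * y" "p \<ge> 100" if "p \<in> PP" for p
    using that par unfolding PP_def y_def by auto
  have "PP \<subseteq> {Y<..2*Y}" by (auto simp: PP_def)
  then have "card PP \<le> card {Y<..2*Y}" by (intro card_mono) auto
  then have n2: "real (card PP) \<le> y" by (simp add: y_def)
  have y100: "y \<ge> 100" using par by blast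
  have ell1: "ell \<ge> 1" unfolding ell_def using y100 exp_le ln_mono[of "exp 1" "2 * y"] by simp
  have lnp: "ln (real p) \<le> ell" if "p \<in> PP" for p unfolding ell_def using pr[OF that] y100 by (intro ln_mono) auto
  have "0 < y powr (3/4)" using y100 by simp
  then have "card PP \<noteq> 0" using n by linarith
  then have ne: "PP \<noteq> {}" by auto
  have lamsum: "ln (real (\<Prod>PP)) = (\<Sum>p\<in>PP. ln (real p))" unfolding of_nat_prod using fin pr y100 by (intro ln_prod) force+
  have lam2: "ln (real (\<Prod>PP)) \<le> y * ln (2 * y)"
  proof -
    have "ln (real (\<Prod>PP)) \<le> (\<Sum>p\<in>PP. ell)" unfolding lamsum using lnp by (intro sum_mono) auto
    also have "\<dots> = real (card PP) * ell" by simp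
    also have "\<dots> \<le> y * ell" using n2 ell1 by (intro mult_right_mono) auto
    finally show ?thesis by (simp add: ell_def)
  qed
  have lam4: "4 \<le> ln (real (\<Prod>PP))"
  proof -
    obtain q where q: "q \<in> PP" using ne by blast
    have "exp (4::real) = exp 1 ^ 4" by (simp add: exp_of_nat_mult[symmetric])
    also have "\<dots> \<le> 3 ^ 4" by (intro power_mono exp_le) auto
    finally have "exp 4 \<le> real q" using pr(3)[OF q] by simp
    then have "4 \<le> ln (real q)" using ln_mono[of "exp 4" "real q"] by simp
    also have "\<dots> \<le> (\<Sum>p\<in>PP. ln (real p))" using q fin pr by (intro member_le_sum ln_ge_zero) force+
    finally show ?thesis unfolding lamsum .
  qed
  have res: "resonance PP L w \<kappa>" if "\<bar>\<kappa>\<bar> = 1" for \<kappa>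
  proof
    show "finite PP" by (rule fin)
    show "prime p" if "p \<in> PP" for p using that by (simp add: PP_def)
    show "17 \<le> p" if "p \<in> PP" for p using pr(3)[OF that] by linarith
    show "4 \<le> ln (real (\<Prod>PP))" by (rule lam4)
    have "100 * (ln (real (\<Prod>PP)))\<^sup>2 \<le> 100 * (y * ln (2 * y))\<^sup>2" using lam2 lam4 by (intro mult_left_mono power_mono) auto
    then show "100 * (ln (real (\<Prod>PP)))\<^sup>2 \<le> L" using par by linarith
    have "8 * ln (real (\<Prod>PP)) * w \<le> 8 * (y * ln (2 * y)) * w" using lam2 w by (intro mult_right_mono mult_left_mono) auto
    then show "8 * ln (real (\<Prod>PP)) * w \<le> L" using par by linarith
  qed (use par w that in auto)
  have sum1: "(\<Sum>p\<in>PP. 1 / real p) \<le> 1"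
  proof -
    have "1 / real p \<le> 1 / y" if "p \<in> PP" for p using pr(1)[OF that] y100 by (intro frac_le) auto
    then have "(\<Sum>p\<in>PP. 1 / real p) \<le> (\<Sum>p\<in>PP. 1 / y)" by (rule sum_mono)
    also have "\<dots> = real (card PP) / y" by simp
    also have "\<dots> \<le> 1" using n2 y100 by (simp add: divide_le_eq)
    finally show ?thesis .
  qed
  have Sig: "(\<Sum>p\<in>PP. real p powr (-1/2)) \<ge> y powr (3/4) * (2 * y) powr (-1/2)"
  proof -
    have "y powr (3/4) * (2 * y) powr (-1/2) \<le> real (card PP) * (2 * y) powr (-1/2)" using n by (intro mult_right_mono) auto
    also have "\<dots> = (\<Sum>p\<in>PP. (2 * y) powr (-1/2))" by simp
    also have "\<dots> \<le> (\<Sum>p\<in>PP. real p powr (-1/2))" using pr y100 by (intro sum_mono powr_mono2') force+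
    finally show ?thesis .
  qed
  have lnL: "ln L = y powr (1/16)" by (simp add: L_def)
  have BL: "B \<le> L" "1 \<le> L" using par by linarith+
  have p100: "\<And>p. p \<in> PP \<Longrightarrow> 100 \<le> p" using pr(3) by blast
  interpret m: resonance PP L w "-1" by (rule res) simp
  interpret p: resonance PP L w 1 by (rule res) simp
  obtain t where t: "m.T \<le> t" "\<And>x. \<bar>x\<bar> \<le> m.a \<Longrightarrow> norm (zeta (Complex (1/2 + x) t)) \<le> exp (14 * ln L + 13 - m.\<Sigma> / 8)"
    using m.small_value[OF ne p100 sum1 refl] by auto
  have e: "exp (14 * ln L + 13 - m.\<Sigma> / 8) \<le> exp (- B)" using Sig par unfolding m.\<Sigma>_def lnL by simp
  show "\<exists>L t. B \<le> L \<and> 1 \<le> L \<and> exp L \<le> t \<and> (\<forall>x. \<bar>x\<bar> \<le> w / L \<longrightarrow> norm (zeta (Complex (1/2 + x) t)) \<le> exp (- B))"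
  proof (rule exI[of _ L], rule exI[of _ t], intro conjI BL allI impI)
    show "exp L \<le> t" using t(1) unfolding m.T_def .
    fix x assume "\<bar>x\<bar> \<le> w / L"
    then have "\<bar>x\<bar> \<le> m.a" unfolding m.a_def .
    from order_trans[OF t(2)[OF this] e] show "norm (zeta (Complex (1/2 + x) t)) \<le> exp (- B)" .
  qed
  obtain t where t: "p.T \<le> t" "\<And>x. \<bar>x\<bar> \<le> p.a \<Longrightarrow> norm (zeta (Complex (1/2 + x) t)) \<ge> exp (p.\<Sigma> / 16 - 13 - 140000 * ell * ln L)"
    using p.large_value[OF ne p100 sum1 refl ell1 lnp] by auto
  have e: "exp B \<le> exp (p.\<Sigma> / 16 - 13 - 140000 * ell * ln L)" using Sig par unfolding p.\<Sigma>_def lnL ell_def by simp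
  show "\<exists>L t. B \<le> L \<and> 1 \<le> L \<and> exp L \<le> t \<and> (\<forall>x. \<bar>x\<bar> \<le> w / L \<longrightarrow> norm (zeta (Complex (1/2 + x) t)) \<ge> exp B)"
  proof (rule exI[of _ L], rule exI[of _ t], intro conjI BL allI impI)
    show "exp L \<le> t" using t(1) unfolding p.T_def .
    fix x assume "\<bar>x\<bar> \<le> w / L"
    then have "\<bar>x\<bar> \<le> p.a" unfolding p.a_def .
    from order_trans[OF e t(2)[OF this]] show "exp B \<le> norm (zeta (Complex (1/2 + x) t))" .
  qed
qed

theorem corollary5p11:
  fixes c :: real and \<epsilon> :: "real \<Rightarrow> real"
  assumes "c > 0"
    and "\<And>t. t > 1 \<Longrightarrow> \<bar>\<epsilon> t\<bar> \<le> c / ln t"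
  shows "Liminf at_top (\<lambda>t::real. ereal (cmod (zeta (1 / 2 + of_real (\<epsilon> t) + \<i> * of_real t)))) = 0
       \<and> Limsup at_top (\<lambda>t::real. ereal (cmod (zeta (1 / 2 + of_real (\<epsilon> t) + \<i> * of_real t)))) = \<infinity>"
proof -
  define g where "g = (\<lambda>t. cmod (zeta (1 / 2 + of_real (\<epsilon> t) + \<i> * of_real t)))"
  have gc: "g t = norm (zeta (Complex (1/2 + \<epsilon> t) t))" for t
    unfolding g_def by (rule arg_cong[of _ _ "\<lambda>s. norm (zeta s)"]) (simp add: complex_eq_iff)
  \<comment> \<open>A window of width at least 1 / L only enlarges the set of points considered.\<close>
  define w where "w = max c 1"
  have w: "w \<ge> 1" "c \<le> w" by (simp_all add: w_def)
  have win: "\<bar>\<epsilon> t\<bar> \<le> w / L \<and> t \<ge> B" if L: "B \<le> L" "1 \<le> L" "exp L \<le> t" for B L t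
  proof -
    have t1: "t > 1" using L exp_ge_add_one_self[of L] by linarith
    have "L \<le> ln t" using L t1 by (simp add: ln_ge_iff)
    then have "c / ln t \<le> w / L" using w L assms(1) by (intro frac_le) auto
    then show ?thesis using assms(2)[OF t1] L exp_ge_add_one_self[of L] by linarith
  qed
  have freq_small: "\<exists>t\<ge>b. g t \<le> exp (- B)" for b B
  proof -
    define B' where "B' = max b B"
    obtain L t where L: "B' \<le> L" "1 \<le> L" "exp L \<le> t" "\<And>x. \<bar>x\<bar> \<le> w / L \<Longrightarrow> norm (zeta (Complex (1/2 + x) t)) \<le> exp (- B')"
      using extreme_values(1)[OF w(1), of B'] by blast
    have "g t \<le> exp (- B')" unfolding gc using win[OF L(1-3)] by (intro L(4)) simp
    also have "\<dots> \<le> exp (- B)" by (simp add: B'_def)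
    finally show ?thesis using win[OF L(1-3)] by (auto simp: B'_def)
  qed
  have freq_large: "\<exists>t\<ge>b. g t \<ge> B" for b B
  proof -
    define B' where "B' = max b B"
    obtain L t where L: "B' \<le> L" "1 \<le> L" "exp L \<le> t" "\<And>x. \<bar>x\<bar> \<le> w / L \<Longrightarrow> norm (zeta (Complex (1/2 + x) t)) \<ge> exp B'"
      using extreme_values(2)[OF w(1), of B'] by blast
    have "B \<le> B'" by (simp add: B'_def)
    then have "B \<le> exp B'" using exp_ge_add_one_self[of B'] by linarith
    also have "\<dots> \<le> g t" unfolding gc using win[OF L(1-3)] by (intro L(4)) simp
    finally show ?thesis using win[OF L(1-3)] by (auto simp: B'_def)
  qed
  have "Liminf at_top (\<lambda>t. ereal (g t)) = 0"
  proof (rule antisym)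
    show "0 \<le> Liminf at_top (\<lambda>t. ereal (g t))" by (intro Liminf_bounded always_eventually) (simp add: g_def)
    show "Liminf at_top (\<lambda>t. ereal (g t)) \<le> 0"
    proof (rule ccontr)
      assume "\<not> Liminf at_top (\<lambda>t. ereal (g t)) \<le> 0"
      then obtain r where r: "0 < ereal r" "ereal r < Liminf at_top (\<lambda>t. ereal (g t))" using ereal_dense2 by (metis not_le)
      then have "eventually (\<lambda>t. ereal r < ereal (g t)) at_top" using less_LiminfD by blast
      then obtain b where b: "\<And>t. t \<ge> b \<Longrightarrow> r < g t" unfolding eventually_at_top_linorder by auto
      obtain t where "t \<ge> b" "g t \<le> exp (- (- ln r))" using freq_small by blast
      then show False using b[of t] r by simp
    qed
  qed
  moreover have "Limsup at_top (\<lambda>t. ereal (g t)) = \<infinity>"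
  proof (rule ccontr)
    assume "Limsup at_top (\<lambda>t. ereal (g t)) \<noteq> \<infinity>"
    then have "Limsup at_top (\<lambda>t. ereal (g t)) < \<infinity>" by (simp add: less_top[symmetric] top_ereal_def)
    then obtain r where r: "Limsup at_top (\<lambda>t. ereal (g t)) < ereal r" using ereal_dense2 by blast
    then have "eventually (\<lambda>t. ereal (g t) < ereal r) at_top" using Limsup_lessD by blast
    then obtain b where b: "\<And>t. t \<ge> b \<Longrightarrow> g t < r" unfolding eventually_at_top_linorder by auto
    obtain t where "t \<ge> b" "g t \<ge> r" using freq_large by blast
    then show False using b[of t] by simp
  qed
  ultimately show ?thesis unfolding g_def by simp
qed

end
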